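(* Let $S$ be a compact hyperbolic Riemann surface and let $\gamma$ be a simple closed geodesic on $S$ of length $\ell(\gamma)\le \frac12$ separating $S$ into two parts $S_1$, $S_2$. Put $$\mu(\gamma)=\exp\left(-2\pi^2\left(\frac{1}{\ell(\gamma)}-\frac12\right)\right).$$ If $\sigma$ is a non-trivial real harmonic 1-form on $S$ all of whose periods over cycles in $S_2$ vanish, then a) $E_{S_2}(\sigma)\le \mu(\gamma)\,E(\sigma)$; b) $E_{S_2\smallsetminus C(\gamma)}(\sigma)\le \mu(\gamma)^2\,E_{C(\gamma)}(\sigma)$.
   Context: The energy of a real 1-form $\omega$ over a domain $D\subseteq S$ is $E_D(\omega)=\int_D\omega\wedge\star\omega$, where $\star$ is the Hodge star, and $E(\omega)=E_S(\omega)$. The standard collar of a simple closed geodesic $\gamma$ is $C(\gamma)=\{p\in S\mid \operatorname{dist}(p,\gamma)<\operatorname{cl}(\ell(\gamma))\}$ (hyperbolic distance), where $\operatorname{cl}(s)=\operatorname{arcsinh}\left(1/\sinh(s/2)\right)$; by the collar theorem it is an embedded cylinder. *)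

theory Defs
  imports "HOL-Analysis.Analysis"
begin

section \<open>Riemann surfaces\<close>

text \<open>A chart is a pair of its domain \<open>U\<close> and its coordinate map \<open>\<phi>\<close>; only the values of
  \<open>\<phi>\<close> on \<open>U\<close> matter.\<close>

type_synonym 'a chart = "'a set \<times> ('a \<Rightarrow> complex)"

definition chart_range :: "'a chart \<Rightarrow> complex set" where
  "chart_range c = snd c ` fst c"

definition transition :: "'a chart \<Rightarrow> 'a chart \<Rightarrow> complex \<Rightarrow> complex" where
  "transition c d = snd d \<circ> inv_into (fst c) (snd c)"

definition overlap :: "'a chart \<Rightarrow> 'a chart \<Rightarrow> complex set" where
  "overlap c d = snd c ` (fst c \<inter> fst d)"

definition riemann_surface :: "'a::t2_space set \<Rightarrow> 'a chart set \<Rightarrow> bool" where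
  "riemann_surface S A \<longleftrightarrow>
     connected S \<and> S \<noteq> {} \<and> (\<Union>c\<in>A. fst c) = S \<and>
     (\<forall>c\<in>A. openin (top_of_set S) (fst c) \<and> open (chart_range c) \<and>
        (\<exists>g. homeomorphism (fst c) (chart_range c) (snd c) g)) \<and>
     (\<forall>c\<in>A. \<forall>d\<in>A. transition c d holomorphic_on overlap c d)"

section \<open>Hyperbolic structure\<close>

definition upper_half_plane :: "complex set" where
  "upper_half_plane = {z. Im z > 0}"

definition hyp_dist :: "complex \<Rightarrow> complex \<Rightarrow> real" where
  "hyp_dist z w = arcosh (1 + (dist z w)\<^sup>2 / (2 * Im z * Im w))"

text \<open>A Riemann surface is hyperbolic if its universal covering surface is the upper half-plane;
  \<open>\<pi>\<close> is a holomorphic universal covering map. Any two such maps differ by an automorphism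
  of the half-plane, that is, by a hyperbolic isometry, so the metric that \<open>\<pi>\<close> induces on
  \<open>S\<close> does not depend on its choice.\<close>

definition hyperbolic_riemann_surface ::
    "'a::t2_space set \<Rightarrow> 'a chart set \<Rightarrow> (complex \<Rightarrow> 'a) \<Rightarrow> bool" where
  "hyperbolic_riemann_surface S A \<pi> \<longleftrightarrow>
     riemann_surface S A \<and> covering_space upper_half_plane \<pi> S \<and>
     (\<forall>c\<in>A. (snd c \<circ> \<pi>) holomorphic_on (upper_half_plane \<inter> \<pi> -` fst c))"

definition surf_dist :: "(complex \<Rightarrow> 'a) \<Rightarrow> 'a \<Rightarrow> 'a \<Rightarrow> real" where
  "surf_dist \<pi> p q =
     Inf {hyp_dist z w | z w. z \<in> upper_half_plane \<and> w \<in> upper_half_plane \<and> \<pi> z = p \<and> \<pi> w = q}"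

definition surf_setdist :: "(complex \<Rightarrow> 'a) \<Rightarrow> 'a \<Rightarrow> 'a set \<Rightarrow> real" where
  "surf_setdist \<pi> p G = (INF q\<in>G. surf_dist \<pi> p q)"

text \<open>A unit speed geodesic is a curve that is locally distance realizing. A closed geodesic of
  length \<open>L\<close> is parametrized on the whole line, with period \<open>L\<close>; this makes it smooth at its
  base point.\<close>

definition unit_speed_geodesic :: "'a set \<Rightarrow> (complex \<Rightarrow> 'a) \<Rightarrow> (real \<Rightarrow> 'a) \<Rightarrow> bool" where
  "unit_speed_geodesic S \<pi> \<gamma> \<longleftrightarrow>
     range \<gamma> \<subseteq> S \<and>
     (\<forall>t. \<exists>e>0. \<forall>r\<in>{t-e<..<t+e}. \<forall>s\<in>{t-e<..<t+e}. surf_dist \<pi> (\<gamma> r) (\<gamma> s) = \<bar>r - s\<bar>)"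

definition simple_closed_geodesic ::
    "'a set \<Rightarrow> (complex \<Rightarrow> 'a) \<Rightarrow> (real \<Rightarrow> 'a) \<Rightarrow> real \<Rightarrow> bool" where
  "simple_closed_geodesic S \<pi> \<gamma> L \<longleftrightarrow>
     unit_speed_geodesic S \<pi> \<gamma> \<and> L > 0 \<and> (\<forall>t. \<gamma> (t + L) = \<gamma> t) \<and> inj_on \<gamma> {0..<L}"

definition collar_width :: "real \<Rightarrow> real" where
  "collar_width s = arsinh (1 / sinh (s / 2))"

definition standard_collar ::
    "'a set \<Rightarrow> (complex \<Rightarrow> 'a) \<Rightarrow> (real \<Rightarrow> 'a) \<Rightarrow> real \<Rightarrow> 'a set" where
  "standard_collar S \<pi> \<gamma> L = {p \<in> S. surf_setdist \<pi> p (range \<gamma>) < collar_width L}"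

definition separates_into :: "'a::topological_space set \<Rightarrow> 'a set \<Rightarrow> 'a set \<Rightarrow> 'a set \<Rightarrow> bool" where
  "separates_into S G S1 S2 \<longleftrightarrow> components (S - G) = {S1, S2} \<and> S1 \<noteq> S2"

section \<open>Differential forms\<close>

text \<open>A real 1-form is given by its local expressions: \<open>\<omega> c z v\<close> is the value, in the chart \<open>c\<close>
  at the coordinate \<open>z\<close>, on the tangent vector \<open>v\<close>; thus
  \<open>\<omega> c z 1\<close> and \<open>\<omega> c z \<i>\<close> are the coefficients of \<open>dx\<close> and \<open>dy\<close>. Similarly for 2-forms.\<close>

type_synonym 'a form1 = "'a chart \<Rightarrow> complex \<Rightarrow> complex \<Rightarrow> real"
type_synonym 'a form2 = "'a chart \<Rightarrow> complex \<Rightarrow> complex \<Rightarrow> complex \<Rightarrow> real"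

definition one_form :: "'a chart set \<Rightarrow> 'a form1 \<Rightarrow> bool" where
  "one_form A \<omega> \<longleftrightarrow>
     (\<forall>c\<in>A. \<forall>z\<in>chart_range c. linear (\<omega> c z)) \<and>
     (\<forall>c\<in>A. \<forall>d\<in>A. \<forall>z\<in>overlap c d. \<forall>v.
        \<omega> c z v = \<omega> d (transition c d z) (deriv (transition c d) z * v))"

text \<open>In a conformal coordinate the Hodge star sends \<open>dx\<close> to \<open>dy\<close> and \<open>dy\<close> to \<open>-dx\<close>.\<close>

definition hodge_star :: "'a form1 \<Rightarrow> 'a form1" where
  "hodge_star \<omega> c z v = - \<omega> c z (\<i> * v)"

definition wedge :: "'a form1 \<Rightarrow> 'a form1 \<Rightarrow> 'a form2" where
  "wedge \<alpha> \<beta> c z v w = \<alpha> c z v * \<beta> c z w - \<alpha> c z w * \<beta> c z v"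

definition ext_deriv :: "'a form1 \<Rightarrow> 'a form2" where
  "ext_deriv \<omega> c z v w =
     frechet_derivative (\<lambda>x. \<omega> c x w) (at z) v - frechet_derivative (\<lambda>x. \<omega> c x v) (at z) w"

definition closed_form :: "'a chart set \<Rightarrow> 'a form1 \<Rightarrow> bool" where
  "closed_form A \<omega> \<longleftrightarrow>
     (\<forall>c\<in>A. \<forall>z\<in>chart_range c. (\<forall>v. (\<lambda>x. \<omega> c x v) differentiable (at z)) \<and>
        (\<forall>v w. ext_deriv \<omega> c z v w = 0))"

text \<open>If \<open>\<omega> = a dx + b dy\<close> and \<open>\<star>\<omega>\<close> are closed, then \<open>a - i b\<close> satisfies the Cauchy-Riemann
  equations and is holomorphic; hence smoothness need not be demanded separately.\<close>

definition harmonic_form :: "'a chart set \<Rightarrow> 'a form1 \<Rightarrow> bool" where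
  "harmonic_form A \<omega> \<longleftrightarrow> one_form A \<omega> \<and> closed_form A \<omega> \<and> closed_form A (hodge_star \<omega>)"

definition nontrivial_form :: "'a chart set \<Rightarrow> 'a form1 \<Rightarrow> bool" where
  "nontrivial_form A \<omega> \<longleftrightarrow> (\<exists>c\<in>A. \<exists>z\<in>chart_range c. \<exists>v. \<omega> c z v \<noteq> 0)"

section \<open>Integration\<close>

text \<open>The integral of a 2-form over \<open>D\<close> is computed by cutting \<open>D\<close> into finitely many disjoint
  Borel pieces, each lying in a chart domain. By the change of variables formula the result does
  not depend on the pieces.\<close>

definition has_surface_integral :: "'a chart set \<Rightarrow> 'a form2 \<Rightarrow> 'a set \<Rightarrow> real \<Rightarrow> bool" where
  "has_surface_integral A \<eta> D I \<longleftrightarrow>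
     (\<exists>(n::nat) c B.
        disjoint_family_on B {..<n} \<and> (\<Union>i<n. B i) = D \<and>
        (\<forall>i<n. c i \<in> A \<and> B i \<subseteq> fst (c i) \<and> snd (c i) ` B i \<in> sets borel \<and>
           set_integrable lborel (snd (c i) ` B i) (\<lambda>z. \<eta> (c i) z 1 \<i>)) \<and>
        I = (\<Sum>i<n. set_lebesgue_integral lborel (snd (c i) ` B i) (\<lambda>z. \<eta> (c i) z 1 \<i>)))"

definition surface_integral :: "'a chart set \<Rightarrow> 'a form2 \<Rightarrow> 'a set \<Rightarrow> real" where
  "surface_integral A \<eta> D = (THE I. has_surface_integral A \<eta> D I)"

definition energy :: "'a chart set \<Rightarrow> 'a set \<Rightarrow> 'a form1 \<Rightarrow> real" where
  "energy A D \<omega> = surface_integral A (wedge \<omega> (hodge_star \<omega>)) D"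

text \<open>The curve \<open>p\<close> on the unit interval is piecewise continuously differentiable and \<open>I\<close> is the
  integral of \<open>\<omega>\<close> along it; \<open>t\<close> is a subdivision whose \<open>i\<close>-th piece lies in the domain of the
  chart \<open>c i\<close> and has there the continuous velocity \<open>V i\<close>.\<close>

definition has_line_integral :: "'a chart set \<Rightarrow> 'a form1 \<Rightarrow> (real \<Rightarrow> 'a) \<Rightarrow> real \<Rightarrow> bool" where
  "has_line_integral A \<omega> p I \<longleftrightarrow>
     (\<exists>(n::nat) t c V.
        t 0 = 0 \<and> t n = 1 \<and>
        (\<forall>i<n. t i < t (Suc i) \<and> c i \<in> A \<and> p ` {t i..t (Suc i)} \<subseteq> fst (c i) \<and>
           continuous_on {t i..t (Suc i)} (V i) \<and>
           (\<forall>s\<in>{t i..t (Suc i)}.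
              ((snd (c i) \<circ> p) has_vector_derivative V i s) (at s within {t i..t (Suc i)}))) \<and>
        I = (\<Sum>i<n. integral {t i..t (Suc i)} (\<lambda>s. \<omega> (c i) (snd (c i) (p s)) (V i s))))"

text \<open>Every 1-cycle is, up to homology, an integral combination of closed curves, so it suffices
  to consider the latter.\<close>

definition vanishing_periods_in :: "'a chart set \<Rightarrow> 'a form1 \<Rightarrow> 'a set \<Rightarrow> bool" where
  "vanishing_periods_in A \<omega> T \<longleftrightarrow>
     (\<forall>p I. p ` {0..1} \<subseteq> T \<and> p 0 = p 1 \<and> has_line_integral A \<omega> p I \<longrightarrow> I = 0)"

end

theory Submission
  imports Defs "HOL-Complex_Analysis.Complex_Analysis"
begin

text \<open>On the universal cover, normalized so that the geodesic is the image of the imaginary axis,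
  \<open>\<sigma>\<close> is the real part of \<open>f dz\<close> with \<open>f\<close> holomorphic. The logarithm maps the collar conformally
  to the flat cylinder \<open>\<bar>y\<bar> < Y\<close> of circumference \<open>L\<close>, where \<open>Y = arctan (1 / sinh (L / 2))\<close>.
  As the periods over \<open>S2\<close> vanish, \<open>\<sigma>\<close> has a primitive on the union of \<open>S2\<close> and the collar, and by
  Green's formula the energy beyond height \<open>y\<close> is a boundary integral over the circle at height
  \<open>y\<close>. Wirtinger's inequality bounds this integral by \<open>L / (4 * pi)\<close> times the energy density at
  \<open>y\<close>, so the energy beyond height \<open>y\<close> decays at least like \<open>exp (- 4 * pi * y / L)\<close>. Going through
  half of the collar gives the first estimate, going through all of it the second. The constants
  follow from \<open>Y \<ge> pi / 2 - L / 2\<close>.\<close>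

section \<open>Plane integrals\<close>

text \<open>The obstacle is Green's formula on a surface that is given through its universal
  covering. It is used in weak form: for an invariant function \<open>u\<close> on the half-plane,
  the scalar product of its gradient with the conjugate of \<open>f\<close> has integral zero over a
  fundamental set, by a partition of unity. For \<open>u\<close> one takes a cut-off in the collar
  times a function \<open>Q\<close>. \<open>Q = Re P\<close> gives the energy formula.
  \<open>Q = 1\<close> shows that the conjugate form has no period along the geodesic, which the
  hypothesis on \<sigma> does not state; this gives \<open>Im f\<close> mean zero on the circles, so
  that Wirtinger's inequality can bound the boundary integral. That the collar is embedded rests on
  traces: no deck transformation is elliptic, so T g T g^-1 and T g T^-1 g^-1 have trace at least 2
  in absolute value, where T is the translation along the geodesic; this keeps the axis and its
  image under g at least two collar widths apart. In the second estimate the energy of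
  \<open>S2\<close> outside the collar also appears on the right; absorbing it costs a factor 2,
  which the gap between 4 pi and 2 pi^2 pays for.\<close>

definition cplx_of_vec :: "real^2 \<Rightarrow> complex" where
  "cplx_of_vec v = Complex (v$1) (v$2)"

definition vec_of_cplx :: "complex \<Rightarrow> real^2" where
  "vec_of_cplx z = vector [Re z, Im z]"

lemma vec_of_cplx_inverse [simp]: "cplx_of_vec (vec_of_cplx z) = z"
  by (simp add: cplx_of_vec_def vec_of_cplx_def)

lemma cplx_of_vec_inverse [simp]: "vec_of_cplx (cplx_of_vec v) = v"
  by (simp add: cplx_of_vec_def vec_of_cplx_def vec_eq_iff forall_2)

lemma linear_cplx_of_vec: "linear cplx_of_vec"
  by (rule linearI) (simp_all add: cplx_of_vec_def complex_eq_iff)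

lemma linear_vec_of_cplx: "linear vec_of_cplx"
  by (rule linearI) (simp_all add: vec_of_cplx_def vec_eq_iff forall_2)

lemma measurable_cplx_of_vec [measurable]: "cplx_of_vec \<in> borel_measurable borel"
  using linear_continuous_on[OF linear_conv_bounded_linear[THEN iffD1, OF linear_cplx_of_vec]]
  by (rule borel_measurable_continuous_onI)

text \<open>Both measures give a box the product of its side lengths. This carries the change of
  variables formula of \<open>real^2\<close>, with its Jacobian determinant, over to the complex
  plane.\<close>

lemma lborel_cplx_of_vec: "lborel = distr lborel borel cplx_of_vec"
proof (rule lborel_eqI)
  fix l u :: complex
  assume le: "\<And>b. b \<in> Basis \<Longrightarrow> l \<bullet> b \<le> u \<bullet> b"
  have r: "Re l \<le> Re u" "Im l \<le> Im u"
    using le[of 1] le[of \<i>] by (auto simp: Basis_complex_def)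
  have eq: "cplx_of_vec -` box l u = box (vec_of_cplx l) (vec_of_cplx u)"
  proof -
    have 1: "z \<in> box l u \<longleftrightarrow> Re l < Re z \<and> Re z < Re u \<and> Im l < Im z \<and> Im z < Im u" for z
      by (auto simp: box_def Basis_complex_def)
    show ?thesis
      unfolding vimage_def
      by (intro set_eqI) (auto simp: 1 mem_box_cart cplx_of_vec_def vec_of_cplx_def forall_2)
  qed
  have "emeasure (distr lborel borel cplx_of_vec) (box l u) = emeasure lborel (box (vec_of_cplx l) (vec_of_cplx u))"
    by (subst emeasure_distr) (auto simp: eq)
  also have "\<dots> = (\<Prod>b\<in>Basis. (vec_of_cplx u - vec_of_cplx l) \<bullet> b)"
    by (rule emeasure_lborel_box)
      (use r in \<open>auto simp: Basis_vec_def vec_of_cplx_def inner_axis UNIV_2\<close>)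
  also have "(\<Prod>b\<in>Basis. (vec_of_cplx u - vec_of_cplx l) \<bullet> b) = (Re u - Re l) * (Im u - Im l)"
    by (simp add: Basis_vec_def vec_of_cplx_def prod.UNION_disjoint UNIV_2 inner_axis axis_eq_axis)
  also have "\<dots> = (\<Prod>b\<in>Basis. (u - l) \<bullet> b)"
    by (simp add: Basis_complex_def)
  finally show "emeasure (distr lborel borel cplx_of_vec) (box l u) = (\<Prod>b\<in>Basis. (u - l) \<bullet> b)" .
qed simp

text \<open>This makes Fubini's theorem applicable to rectangles in the complex plane; see
  \<open>rect_Fubini\<close>.\<close>

lemma lborel_complex_pair: "lborel = distr (lborel \<Otimes>\<^sub>M lborel) borel (\<lambda>(x, y). Complex x y)"
proof (rule lborel_eqI)
  fix l u :: complex
  assume le: "\<And>b. b \<in> Basis \<Longrightarrow> l \<bullet> b \<le> u \<bullet> b"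
  have r: "Re l \<le> Re u" "Im l \<le> Im u"
    using le[of 1] le[of \<i>] by (auto simp: Basis_complex_def)
  have [measurable]: "(\<lambda>(x, y). Complex x y) \<in> borel_measurable (lborel \<Otimes>\<^sub>M lborel)"
    unfolding Complex_eq by measurable
  have eq: "(\<lambda>(x, y). Complex x y) -` box l u = {Re l<..<Re u} \<times> {Im l<..<Im u}"
    by (auto simp: box_def Basis_complex_def)
  have "emeasure (distr (lborel \<Otimes>\<^sub>M lborel) borel (\<lambda>(x, y). Complex x y)) (box l u)
     = emeasure (lborel \<Otimes>\<^sub>M lborel) ({Re l<..<Re u} \<times> {Im l<..<Im u})"
    by (subst emeasure_distr) (auto simp: eq space_pair_measure)
  also have "\<dots> = ennreal (Re u - Re l) * ennreal (Im u - Im l)"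
    by (subst lborel.emeasure_pair_measure_Times) (auto simp: r)
  also have "\<dots> = (\<Prod>b\<in>Basis. (u - l) \<bullet> b)"
    using r by (simp add: Basis_complex_def ennreal_mult)
  finally show "emeasure (distr (lborel \<Otimes>\<^sub>M lborel) borel (\<lambda>(x, y). Complex x y)) (box l u) = (\<Prod>b\<in>Basis. (u - l) \<bullet> b)" .
qed simp

lemma set_integrable_cplx_of_vec:
  fixes h :: "complex \<Rightarrow> real"
  assumes [measurable]: "(\<lambda>z. indicator X z *\<^sub>R h z) \<in> borel_measurable borel"
  shows "set_integrable lborel X h \<longleftrightarrow> set_integrable lborel (vec_of_cplx ` X) (h \<circ> cplx_of_vec)"
    and "set_lebesgue_integral lborel X h = set_lebesgue_integral lborel (vec_of_cplx ` X) (h \<circ> cplx_of_vec)"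
proof -
  have ind: "indicator X (cplx_of_vec v) = (indicator (vec_of_cplx ` X) v :: real)" for v
    by (force simp: indicator_def image_iff)
  have "set_integrable lborel X h \<longleftrightarrow> integrable (distr lborel borel cplx_of_vec) (\<lambda>z. indicator X z *\<^sub>R h z)"
    unfolding set_integrable_def using lborel_cplx_of_vec by simp
  also have "\<dots> \<longleftrightarrow> integrable lborel (\<lambda>v. indicator X (cplx_of_vec v) *\<^sub>R h (cplx_of_vec v))"
    by (rule integrable_distr_eq) (use assms in auto)
  finally show "set_integrable lborel X h \<longleftrightarrow> set_integrable lborel (vec_of_cplx ` X) (h \<circ> cplx_of_vec)"
    by (simp add: set_integrable_def ind)
  have "set_lebesgue_integral lborel X h = integral\<^sup>L (distr lborel borel cplx_of_vec) (\<lambda>z. indicator X z *\<^sub>R h z)"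
    unfolding set_lebesgue_integral_def using lborel_cplx_of_vec by simp
  also have "\<dots> = integral\<^sup>L lborel (\<lambda>v. indicator X (cplx_of_vec v) *\<^sub>R h (cplx_of_vec v))"
    by (rule integral_distr) (use assms in auto)
  finally show "set_lebesgue_integral lborel X h = set_lebesgue_integral lborel (vec_of_cplx ` X) (h \<circ> cplx_of_vec)"
    by (simp add: set_lebesgue_integral_def ind)
qed

text \<open>By the Cauchy-Riemann equations the Jacobian determinant of \<phi> is
  \<open>(cmod (deriv \<phi> z))\<^sup>2\<close>. Injectivity is asked on \<open>X\<close> alone, so
  that sets of representatives in the half-plane qualify. Continuity of \<open>h\<close> on an open
  set around the image makes every integrand Borel, which allows passing between gauge and Lebesgue
  integrals.\<close>

lemma holomorphic_change_of_variables:
  fixes h :: "complex \<Rightarrow> real"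
  assumes hol: "\<phi> holomorphic_on V" and V: "open V" "X \<subseteq> V"
    and X: "X \<in> sets borel" and inj: "inj_on \<phi> X" and Y: "\<phi> ` X \<in> sets borel"
    and h: "continuous_on Z h" "open Z" "\<phi> ` X \<subseteq> Z"
  shows "set_integrable lborel (\<phi> ` X) h \<longleftrightarrow> set_integrable lborel X (\<lambda>z. (cmod (deriv \<phi> z))\<^sup>2 * h (\<phi> z))"
    and "set_lebesgue_integral lborel (\<phi> ` X) h
       = set_lebesgue_integral lborel X (\<lambda>z. (cmod (deriv \<phi> z))\<^sup>2 * h (\<phi> z))"
proof -
  let ?k = "\<lambda>z. (cmod (deriv \<phi> z))\<^sup>2 * h (\<phi> z)"
  define g where "g = vec_of_cplx \<circ> \<phi> \<circ> cplx_of_vec"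
  define g' where "g' v w = vec_of_cplx (deriv \<phi> (cplx_of_vec v) * cplx_of_vec w)" for v w
  define X' where "X' = vec_of_cplx ` X"
  have ind_meas: "(\<lambda>z. indicator B z *\<^sub>R u z) \<in> borel_measurable borel"
    if "continuous_on W u" "open W" "B \<subseteq> W" "B \<in> sets borel" for B W and u :: "complex \<Rightarrow> real"
    using that borel_measurable_continuous_on_indicator continuous_on_subset by blast
  have "isCont \<phi> z" if "z \<in> V" for z
    using that hol V holomorphic_on_imp_continuous_on continuous_on_eq_continuous_at by blast
  have dd: "(\<phi> has_field_derivative deriv \<phi> z) (at z)" if "z \<in> V" for z
    using holomorphic_derivI[OF hol V(1) that] .
  have contk: "continuous_on (V \<inter> \<phi> -` Z) ?k"
  proof (intro continuous_intros)
    show "continuous_on (V \<inter> \<phi> -` Z) (deriv \<phi>)"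
      using V hol holomorphic_deriv holomorphic_on_imp_continuous_on
      by (meson continuous_on_subset inf_le1)
    show "continuous_on (V \<inter> \<phi> -` Z) (\<lambda>z. h (\<phi> z))"
      by (rule continuous_on_compose2[OF h(1)])
        (use hol holomorphic_on_imp_continuous_on continuous_on_subset in \<open>blast+\<close>)
  qed
  have openk: "open (V \<inter> \<phi> -` Z)"
    using continuous_open_preimage[OF holomorphic_on_imp_continuous_on[OF hol] V(1) h(2)] .
  have mh: "(\<lambda>z. indicator (\<phi> ` X) z *\<^sub>R h z) \<in> borel_measurable borel"
    by (rule ind_meas[OF h Y])
  have mk: "(\<lambda>z. indicator X z *\<^sub>R ?k z) \<in> borel_measurable borel"
    by (rule ind_meas[OF contk openk _ X]) (use V h in auto)
  have X'eq: "X' = cplx_of_vec -` X"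
    by (force simp: X'_def)
  have X'b: "X' \<in> sets borel"
    unfolding X'eq using measurable_sets[OF measurable_cplx_of_vec X] by simp
  then have X'l: "X' \<in> sets lebesgue"
    by (metis sets_completionI_sets sets_lborel)
  have im: "g ` X' = vec_of_cplx ` (\<phi> ` X)"
    by (simp add: g_def X'_def image_comp o_def)
  have "vec_of_cplx ` (\<phi> ` X) = cplx_of_vec -` (\<phi> ` X)"
  proof (intro set_eqI iffI)
    fix v assume "v \<in> cplx_of_vec -` (\<phi> ` X)"
    then show "v \<in> vec_of_cplx ` (\<phi> ` X)"
      by (metis cplx_of_vec_inverse imageI vimageD)
  qed auto
  then have gX'b: "g ` X' \<in> sets borel"
    unfolding im using measurable_sets[OF measurable_cplx_of_vec Y] by simp
  have der: "(g has_derivative g' v) (at v within X')" if "v \<in> X'" for v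
  proof -
    have "cplx_of_vec v \<in> V" using that V by (auto simp: X'_def)
    then have 1: "(\<phi> has_derivative (*) (deriv \<phi> (cplx_of_vec v))) (at (cplx_of_vec v))"
      using dd has_field_derivative_def by blast
    have 2: "(cplx_of_vec has_derivative cplx_of_vec) (at v within X')"
      by (rule linear_imp_has_derivative[OF linear_cplx_of_vec])
    have 3: "(vec_of_cplx has_derivative vec_of_cplx) (at (\<phi> (cplx_of_vec v)))"
      by (rule linear_imp_has_derivative[OF linear_vec_of_cplx])
    show ?thesis
      unfolding g_def g'_def comp_def
      by (rule has_derivative_compose[OF has_derivative_compose[OF 2 1] 3])
  qed
  have injg: "inj_on g X'"
    using inj by (auto simp: inj_on_def X'_def g_def) (metis vec_of_cplx_inverse)
  have det: "\<bar>det (matrix (g' v))\<bar> = (cmod (deriv \<phi> (cplx_of_vec v)))\<^sup>2" for v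
  proof -
    obtain a b where ab: "deriv \<phi> (cplx_of_vec v) = Complex a b" by (cases "deriv \<phi> (cplx_of_vec v)")
    have "g' v = (\<lambda>w. vec_of_cplx (Complex a b * cplx_of_vec w))"
      by (simp add: g'_def ab fun_eq_iff)
    then have "det (matrix (g' v)) = a * a + b * b"
      by (simp add: det_2 matrix_def cplx_of_vec_def vec_of_cplx_def axis_def)
    also have "\<dots> = (cmod (Complex a b))\<^sup>2"
      unfolding cmod_power2 by (simp add: power2_eq_square)
    finally show ?thesis by (simp add: ab)
  qed
  have abs: "((\<lambda>v. ?k (cplx_of_vec v)) absolutely_integrable_on X' \<and> integral X' (\<lambda>v. ?k (cplx_of_vec v)) = b)
     \<longleftrightarrow> ((h \<circ> cplx_of_vec) absolutely_integrable_on (g ` X') \<and> integral (g ` X') (h \<circ> cplx_of_vec) = b)" for b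
  proof -
    \<comment> \<open>The theorem applied below concerns functions with values in some
      \<open>real^n\<close>; the real function \<open>h\<close> is therefore wrapped into
      \<open>real^1\<close>.\<close>
    let ?F = "\<lambda>v. vec ((h \<circ> cplx_of_vec) v) :: real^1"
    have e: "\<bar>det (matrix (g' v))\<bar> *\<^sub>R ?F (g v) = vec (?k (cplx_of_vec v))" for v
      by (simp add: det g_def vec_eq_iff)
    show ?thesis
      using has_absolute_integral_change_of_variables[OF X'l der injg, of ?F "vec b"]
      unfolding e by (simp add: absolutely_integrable_on_1_iff integral_on_1_eq o_def)
  qed
  have leb1: "(u absolutely_integrable_on B \<longleftrightarrow> set_integrable lborel B u)"
     "(u absolutely_integrable_on B \<Longrightarrow> integral B u = set_lebesgue_integral lborel B u)"
    if m: "(\<lambda>z. indicator B z *\<^sub>R u z) \<in> borel_measurable lborel" for B and u :: "real^2 \<Rightarrow> real"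
  proof -
    show "(u absolutely_integrable_on B \<longleftrightarrow> set_integrable lborel B u)"
      unfolding set_integrable_def using integrable_completion[OF m] .
    show "integral B u = set_lebesgue_integral lborel B u" if "u absolutely_integrable_on B"
      using set_lebesgue_integral_eq_integral(2)[OF that] integral_completion[OF m]
      by (simp add: set_lebesgue_integral_def)
  qed
  have m1: "(\<lambda>v. indicator X' v *\<^sub>R ?k (cplx_of_vec v)) \<in> borel_measurable lborel"
    using measurable_compose[OF measurable_cplx_of_vec mk]
    by (simp add: X'eq indicator_def vimage_def)
  have "(\<lambda>v. indicator (g ` X') v *\<^sub>R h (cplx_of_vec v)) = (\<lambda>v. indicator (\<phi> ` X) (cplx_of_vec v) *\<^sub>R h (cplx_of_vec v))"
    using \<open>vec_of_cplx ` (\<phi> ` X) = cplx_of_vec -` (\<phi> ` X)\<close> im by (auto simp: fun_eq_iff indicator_def)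
  then have m2: "(\<lambda>v. indicator (g ` X') v *\<^sub>R (h \<circ> cplx_of_vec) v) \<in> borel_measurable lborel"
    using measurable_compose[OF measurable_cplx_of_vec mh] by simp
  have iff: "(\<lambda>v. ?k (cplx_of_vec v)) absolutely_integrable_on X' \<longleftrightarrow> (h \<circ> cplx_of_vec) absolutely_integrable_on (g ` X')"
    using abs by blast
  show *: "set_integrable lborel (\<phi> ` X) h \<longleftrightarrow> set_integrable lborel X ?k"
    using iff set_integrable_cplx_of_vec(1)[OF mh] set_integrable_cplx_of_vec(1)[OF mk] leb1(1)[OF m1] leb1(1)[OF m2]
    by (simp add: im[symmetric] X'_def[symmetric] o_def)
  show "set_lebesgue_integral lborel (\<phi> ` X) h = set_lebesgue_integral lborel X ?k"
  proof (cases "set_integrable lborel X ?k")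
    case True
    then have "(\<lambda>v. ?k (cplx_of_vec v)) absolutely_integrable_on X'"
      using set_integrable_cplx_of_vec(1)[OF mk] leb1(1)[OF m1] by (simp add: X'_def o_def)
    moreover from this have "integral (g ` X') (h \<circ> cplx_of_vec) = integral X' (\<lambda>v. ?k (cplx_of_vec v))"
      using abs by blast
    ultimately show ?thesis
      using iff set_integrable_cplx_of_vec(2)[OF mh] set_integrable_cplx_of_vec(2)[OF mk] leb1(2)[OF m1] leb1(2)[OF m2]
      by (simp add: im[symmetric] X'_def[symmetric] o_def)
  next
    case False
    \<comment> \<open>Neither side is integrable here, and both integrals have the default value
      0.\<close>
    then show ?thesis using * unfolding set_lebesgue_integral_def set_integrable_def
      by (simp add: not_integrable_integral_eq)
  qed
qed

text \<open>Translation invariance of Lebesgue measure makes the integral of every difference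
  quotient of \<open>p\<close> in direction \<open>e\<close> vanish; dominated convergence passes to
  the derivative.\<close>

lemma integral_directional_derivative_eq_0:
  fixes p :: "complex \<Rightarrow> real" and e :: complex
  assumes der: "\<And>z. (p has_derivative p' z) (at z)"
    and cont: "continuous_on UNIV (\<lambda>z. p' z e)"
    and K: "compact K" "\<And>z. z \<notin> K \<Longrightarrow> p z = 0" "\<And>z. z \<notin> K \<Longrightarrow> p' z e = 0"
  shows "integrable lborel (\<lambda>z. p' z e)" "integral\<^sup>L lborel (\<lambda>z. p' z e) = 0"
proof -
  \<comment> \<open>\<open>K'\<close> contains every point whose segment in direction
    \<open>e\<close>, with parameter up to 1, meets \<open>K\<close>. Outside it all difference
    quotients with step at most 1 vanish, hence a multiple of its indicator dominates them.\<close>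
  define K' where "K' = (\<lambda>(z, t). z - t *\<^sub>R e) ` (K \<times> {0..1})"
  have K': "compact K'"
    unfolding K'_def by (intro compact_continuous_image compact_Times K compact_Icc)
      (auto simp: case_prod_beta intro!: continuous_intros)
  have KK': "K \<subseteq> K'" unfolding K'_def by (force simp: image_iff)
  have contp: "continuous_on UNIV p"
    by (meson der has_derivative_continuous continuous_at_imp_continuous_on)
  have [measurable]: "p \<in> borel_measurable borel" "(\<lambda>z. p' z e) \<in> borel_measurable borel"
    using contp cont borel_measurable_continuous_onI by blast+
  obtain M where M: "\<And>z. z \<in> K \<Longrightarrow> \<bar>p' z e\<bar> \<le> M"
    using compact_imp_bounded[OF compact_continuous_image[OF continuous_on_subset[OF cont subset_UNIV] K(1)]]
    by (auto simp: bounded_iff)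
  define B where "B = max M 0"
  have B: "\<bar>p' z e\<bar> \<le> B" for z
    using M[of z] K(3)[of z] by (cases "z \<in> K") (auto simp: B_def)
  have fin: "emeasure lborel K' < \<infinity>" "emeasure lborel K < \<infinity>"
    using K' K emeasure_bounded_finite compact_imp_bounded by blast+
  have int_ind: "integrable lborel (\<lambda>z. B * indicator K' z)"
    using K' by (intro integrable_mult_right integrable_real_indicator)
      (use fin in \<open>auto simp: compact_imp_closed\<close>)
  show "integrable lborel (\<lambda>z. p' z e)"
    by (rule Bochner_Integration.integrable_bound[OF int_ind])
      (use B KK' K(3) in \<open>auto simp: indicator_def B_def intro!: AE_I2\<close>)
  define t :: "nat \<Rightarrow> real" where "t n = 1 / real (Suc n)" for n
  have t: "0 < t n" "t n \<le> 1" for n by (auto simp: t_def field_simps)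
  have t0: "t \<longlonglongrightarrow> 0" unfolding t_def by (rule LIMSEQ_Suc) (rule lim_1_over_n)
  have pint: "integrable lborel p"
  proof -
    obtain N where N: "\<And>z. z \<in> K \<Longrightarrow> \<bar>p z\<bar> \<le> N"
      using compact_imp_bounded[OF compact_continuous_image[OF continuous_on_subset[OF contp subset_UNIV] K(1)]]
      by (auto simp: bounded_iff)
    have "integrable lborel (\<lambda>z. max N 0 * indicator K z)"
      using K by (intro integrable_mult_right integrable_real_indicator)
        (use fin in \<open>auto simp: compact_imp_closed\<close>)
    then show ?thesis
      by (rule Bochner_Integration.integrable_bound)
        (use N K(2) in \<open>force simp: indicator_def intro!: AE_I2\<close>)+
  qed
  let ?q = "\<lambda>n z. (p (z + t n *\<^sub>R e) - p z) / t n"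
  have shift: "integrable lborel (\<lambda>z. p (z + c)) \<and> integral\<^sup>L lborel (\<lambda>z. p (z + c)) = integral\<^sup>L lborel p" for c
  proof -
    have d: "distr lborel borel (\<lambda>z. c + z) = (lborel :: complex measure)"
      using lborel_distr_plus[of c] by simp
    have "integrable (distr lborel borel (\<lambda>z. c + z)) p" using pint d by simp
    moreover have "integral\<^sup>L (distr lborel borel (\<lambda>z. c + z)) p = integral\<^sup>L lborel p" using d by simp
    ultimately show ?thesis
      by (subst (asm) integrable_distr_eq, simp, simp, subst (asm) integral_distr) (simp_all add: add.commute)
  qed
  have q0: "integral\<^sup>L lborel (?q n) = 0" for n
    using shift[of "t n *\<^sub>R e"] pint by simp
  have dline: "((\<lambda>s. p (z + s *\<^sub>R e)) has_real_derivative p' (z + s *\<^sub>R e) e) (at s)" for z s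
  proof -
    have "((\<lambda>s. z + s *\<^sub>R e) has_derivative (\<lambda>h. h *\<^sub>R e)) (at s)"
      by (auto intro!: derivative_eq_intros)
    from has_derivative_compose[OF this der]
    have "((\<lambda>s. p (z + s *\<^sub>R e)) has_derivative (\<lambda>h. p' (z + s *\<^sub>R e) (h *\<^sub>R e))) (at s)" .
    moreover have "p' (z + s *\<^sub>R e) (h *\<^sub>R e) = p' (z + s *\<^sub>R e) e * h" for h
      using has_derivative_linear[OF der] by (simp add: linear_cmul)
    ultimately show ?thesis by (simp add: has_field_derivative_def)
  qed
  have mvt: "\<exists>s. 0 < s \<and> s < t n \<and> ?q n z = p' (z + s *\<^sub>R e) e" for n z
  proof -
    obtain s where "0 < s" "s < t n" "p (z + t n *\<^sub>R e) - p (z + 0 *\<^sub>R e) = (t n - 0) * p' (z + s *\<^sub>R e) e"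
      using MVT2[OF t(1)[of n] dline] by blast
    then show ?thesis using t(1)[of n] by (intro exI[of _ s]) simp
  qed
  have bound: "\<bar>?q n z\<bar> \<le> B * indicator K' z" for n z
  proof -
    obtain s where s: "0 < s" "s < t n" "?q n z = p' (z + s *\<^sub>R e) e" using mvt by blast
    show ?thesis
    proof (cases "z \<in> K'")
      case True then show ?thesis using B s by simp
    next
      case False
      have "z + s *\<^sub>R e \<notin> K"
      proof
        assume "z + s *\<^sub>R e \<in> K"
        then have "z \<in> K'" unfolding K'_def
          using s t(2)[of n] by (intro image_eqI[of _ _ "(z + s *\<^sub>R e, s)"]) auto
        then show False using False by simp
      qed
      then show ?thesis using False s K(3) by simp
    qed
  qed
  have lim: "(\<lambda>n. ?q n z) \<longlonglongrightarrow> p' z e" for z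
  proof -
    have "(\<lambda>h. (p (z + h *\<^sub>R e) - p z) / h) \<midarrow>0\<rightarrow> p' z e"
      using dline[of z 0] by (simp add: DERIV_def)
    moreover have "filterlim t (at 0) sequentially"
      using t t0 by (intro filterlim_atI) (auto intro!: always_eventually simp: less_imp_neq[THEN not_sym])
    ultimately show ?thesis
      by (rule filterlim_compose)
  qed
  have "(\<lambda>n. integral\<^sup>L lborel (?q n)) \<longlonglongrightarrow> integral\<^sup>L lborel (\<lambda>z. p' z e)"
    by (rule integral_dominated_convergence[OF _ _ int_ind]) (use lim bound in auto)
  then show "integral\<^sup>L lborel (\<lambda>z. p' z e) = 0"
    by (simp only: q0 LIMSEQ_const_iff)
qed

section \<open>Wirtinger's inequality\<close>

text \<open>With \<open>T = tan (k * (x - m))\<close>, centred at the midpoint,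
  \<open>w'^2 - k^2 w^2\<close> plus the derivative of \<open>k w^2 T\<close> is the square of
  \<open>w' + k w T\<close>, and the boundary terms vanish with \<open>w\<close>. For
  \<open>k < pi / (b - a)\<close> the tangent is finite on the closed interval; the sharp constant
  is reached by letting \<open>k\<close> tend to \<open>pi / (b - a)\<close>.\<close>

lemma Wirtinger_zero_ends:
  fixes w :: "real \<Rightarrow> real"
  assumes ab: "a < b"
    and der: "\<And>x. x \<in> {a..b} \<Longrightarrow> (w has_real_derivative w' x) (at x)"
    and cont: "continuous_on {a..b} w'"
    and ends: "w a = 0" "w b = 0"
  shows "integral {a..b} (\<lambda>x. (w x)\<^sup>2) \<le> ((b - a) / pi)\<^sup>2 * integral {a..b} (\<lambda>x. (w' x)\<^sup>2)"
proof -
  let ?I = "integral {a..b} (\<lambda>x. (w x)\<^sup>2)" and ?J = "integral {a..b} (\<lambda>x. (w' x)\<^sup>2)"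
  define k0 where "k0 = pi / (b - a)"
  have k0: "k0 > 0" using ab by (simp add: k0_def)
  have contw: "continuous_on {a..b} w"
    using der by (meson DERIV_isCont continuous_at_imp_continuous_on)
  have int: "(\<lambda>x. (w x)\<^sup>2) integrable_on {a..b}" "(\<lambda>x. (w' x)\<^sup>2) integrable_on {a..b}"
    using contw cont by (auto intro!: integrable_continuous_interval continuous_intros)
  have key: "k\<^sup>2 * ?I \<le> ?J" if k: "0 < k" "k < k0" for k
  proof -
    define m where "m = (a + b) / 2"
    define T where "T x = tan (k * (x - m))" for x
    have cosne: "cos (k * (x - m)) > 0" if "x \<in> {a..b}" for x
    proof -
      have "\<bar>x - m\<bar> \<le> (b - a) / 2" using that by (auto simp: m_def abs_le_iff field_simps)
      then have "k * \<bar>x - m\<bar> \<le> k * ((b - a) / 2)" using k by (intro mult_left_mono) auto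
      also have "\<dots> < k0 * ((b - a) / 2)" using k ab by (intro mult_strict_right_mono) auto
      also have "\<dots> = pi / 2" using ab by (simp add: k0_def)
      finally have "\<bar>k * (x - m)\<bar> < pi / 2" using k by (simp add: abs_mult)
      then show ?thesis by (intro cos_gt_zero_pi) auto
    qed
    have contT: "continuous_on {a..b} T"
      unfolding T_def using cosne by (intro continuous_intros) (auto simp: less_le)
    have dT: "(T has_real_derivative k * (1 + (T x)\<^sup>2)) (at x)" if "x \<in> {a..b}" for x
    proof -
      have c: "cos (k * (x - m)) \<noteq> 0" using cosne[OF that] by simp
      have "(T has_real_derivative inverse ((cos (k * (x - m)))\<^sup>2) * k) (at x)"
        unfolding T_def by (rule DERIV_chain2[where f=tan and g="\<lambda>x. k * (x - m)", OF DERIV_tan[OF c]]) (auto intro!: derivative_eq_intros)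
      then show ?thesis using tan_sec[OF c] by (simp add: T_def power_inverse mult.commute)
    qed
    have "((\<lambda>x. k * (w x)\<^sup>2 * T x) has_real_derivative
        2 * k * w x * w' x * T x + k\<^sup>2 * (w x)\<^sup>2 * (1 + (T x)\<^sup>2)) (at x)" if "x \<in> {a..b}" for x
      using that
      by (auto intro!: derivative_eq_intros der dT simp: power2_eq_square algebra_simps)
    then have "((\<lambda>x. 2 * k * w x * w' x * T x + k\<^sup>2 * (w x)\<^sup>2 * (1 + (T x)\<^sup>2)) has_integral
        (k * (w b)\<^sup>2 * T b - k * (w a)\<^sup>2 * T a)) {a..b}"
      using ab by (intro fundamental_theorem_of_calculus)
        (auto simp: has_real_derivative_iff_has_vector_derivative[symmetric] intro: DERIV_subset has_field_derivative_at_within)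
    then have 1: "((\<lambda>x. 2 * k * w x * w' x * T x + k\<^sup>2 * (w x)\<^sup>2 * (1 + (T x)\<^sup>2)) has_integral 0) {a..b}"
      by (simp add: ends)
    have 2: "((\<lambda>x. (w' x)\<^sup>2 - k\<^sup>2 * (w x)\<^sup>2) has_integral (?J - k\<^sup>2 * ?I)) {a..b}"
      using int by (intro has_integral_diff has_integral_mult_right integrable_integral)
    have "((\<lambda>x. ((w' x)\<^sup>2 - k\<^sup>2 * (w x)\<^sup>2) + (2 * k * w x * w' x * T x + k\<^sup>2 * (w x)\<^sup>2 * (1 + (T x)\<^sup>2))) has_integral ((?J - k\<^sup>2 * ?I) + 0)) {a..b}"
      by (rule has_integral_add[OF 2 1])
    moreover have "0 \<le> ((w' x)\<^sup>2 - k\<^sup>2 * (w x)\<^sup>2) + (2 * k * w x * w' x * T x + k\<^sup>2 * (w x)\<^sup>2 * (1 + (T x)\<^sup>2))" for x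
    proof -
      have "((w' x)\<^sup>2 - k\<^sup>2 * (w x)\<^sup>2) + (2 * k * w x * w' x * T x + k\<^sup>2 * (w x)\<^sup>2 * (1 + (T x)\<^sup>2))
         = (w' x + k * w x * T x)\<^sup>2" by (simp add: power2_eq_square algebra_simps)
      then show ?thesis by simp
    qed
    ultimately have "0 \<le> (?J - k\<^sup>2 * ?I) + 0"
      by (rule has_integral_nonneg)
    then show ?thesis by simp
  qed
  have "((\<lambda>k. k\<^sup>2 * ?I) \<longlongrightarrow> k0\<^sup>2 * ?I) (at_left k0)"
    by (intro tendsto_intros)
  moreover have "eventually (\<lambda>k. k\<^sup>2 * ?I \<le> ?J) (at_left k0)"
    using eventually_at_left_real[OF k0] by eventually_elim (use key in auto)
  ultimately have "k0\<^sup>2 * ?I \<le> ?J"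
    by (rule tendsto_upperbound) simp
  then show ?thesis
    using ab by (simp add: k0_def field_simps)
qed

text \<open>For a primitive \<open>U\<close>, the difference \<open>U (y + L) - U y\<close> has
  derivative zero.\<close>

lemma integral_periodic:
  fixes u :: "real \<Rightarrow> real"
  assumes per: "\<And>x. u (x + L) = u x" and cont: "continuous_on UNIV u" and "L > 0"
  shows "integral {x..x + L} u = integral {0..L} u"
proof -
  define a where "a = min 0 x - 1"
  define b where "b = max 0 x + 1"
  define U where "U y = integral {a..y} u" for y
  have U: "(U has_real_derivative u y) (at y)" if "a < y" "y < b + L" for y
  proof -
    have "((\<lambda>y. integral {a..y} u) has_real_derivative u y) (at y within {a..b + L})"
      using that by (intro integral_has_real_derivative continuous_on_subset[OF cont]) auto
    then show ?thesis using that unfolding U_def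
      by (simp add: at_within_Icc_at)
  qed
  have int: "integral {p..q} u = U q - U p" if "a \<le> p" "p \<le> q" for p q
    using Henstock_Kurzweil_Integration.integral_combine[of a p q u] that
      integrable_continuous_interval[OF continuous_on_subset[OF cont subset_UNIV]]
    by (simp add: U_def)
  have D: "((\<lambda>y. U (y + L) - U y) has_real_derivative 0) (at y)" if "a < y" "y < b" for y
  proof -
    have "((\<lambda>y. U (y + L)) has_real_derivative u (y + L)) (at y)"
      using U[of "y + L"] that \<open>L > 0\<close> by (simp add: DERIV_shift)
    moreover have "(U has_real_derivative u y) (at y)" using U that \<open>L > 0\<close> by simp
    ultimately have "((\<lambda>y. U (y + L) - U y) has_real_derivative u (y + L) - u y) (at y)"
      by (rule DERIV_diff)
    then show ?thesis by (simp add: per)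
  qed
  have "\<exists>c. \<forall>y\<in>{a<..<b}. U (y + L) - U y = c"
    by (rule has_field_derivative_zero_constant[OF convex_real_interval(8)])
      (blast intro: has_field_derivative_at_within[OF D] dest: greaterThanLessThan_iff[THEN iffD1])
  then obtain c where c: "\<And>y. y \<in> {a<..<b} \<Longrightarrow> U (y + L) - U y = c" by blast
  have "U (x + L) - U x = U (0 + L) - U 0"
  proof -
    have "x \<in> {a<..<b}" "0 \<in> {a<..<b}" by (auto simp: a_def b_def)
    from this[THEN c] show ?thesis by simp
  qed
  then show ?thesis using int[of x "x + L"] int[of 0 L] \<open>L > 0\<close> by (simp add: a_def)
qed

text \<open>Instead of the mean value, \<open>c\<close> is a value that \<open>u\<close> takes at
  two points half a period apart, found by the intermediate value theorem. Then \<open>u - c\<close>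
  vanishes at the ends of two intervals of length \<open>L / 2\<close>, and the inequality with zero
  ends on each of them gives the sharp factor \<open>L / (2 * pi)\<close>.\<close>

lemma Wirtinger_periodic:
  fixes u :: "real \<Rightarrow> real"
  assumes L: "L > 0" and per: "\<And>x. u (x + L) = u x"
    and der: "\<And>x. (u has_real_derivative u' x) (at x)" and cont: "continuous_on UNIV u'"
  obtains c where "integral {0..L} (\<lambda>x. (u x - c)\<^sup>2) \<le> (L / (2 * pi))\<^sup>2 * integral {0..L} (\<lambda>x. (u' x)\<^sup>2)"
proof -
  have contu: "continuous_on UNIV u"
    by (meson DERIV_isCont continuous_at_imp_continuous_on der)
  have per': "u' (x + L) = u' x" for x
  proof -
    have "((\<lambda>x. u (x + L)) has_real_derivative u' (x + L)) (at x)"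
      using der[of "x + L"] by (simp add: DERIV_shift)
    then show ?thesis using DERIV_unique der per by (metis (no_types, lifting) ext)
  qed
  define d where "d x = u (x + L / 2) - u x" for x
  have dc: "continuous_on {0..L/2} d"
    unfolding d_def by (intro continuous_intros continuous_on_compose2[OF contu] continuous_on_subset[OF contu]) auto
  have "d (L / 2) = - d 0" using per[of 0] by (simp add: d_def)
  then have "\<exists>x\<ge>0. x \<le> L / 2 \<and> d x = 0"
  proof (cases "d 0 \<le> 0")
    case True
    then show ?thesis using IVT'[of d 0 0 "L/2"] dc L \<open>d (L / 2) = - d 0\<close> by auto
  next
    case False
    then show ?thesis using IVT2'[of d "L/2" 0 0] dc L \<open>d (L / 2) = - d 0\<close> by auto
  qed
  then obtain x0 where x0: "u (x0 + L / 2) = u x0" by (auto simp: d_def)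
  define c where "c = u x0"
  have w: "integral {a..a + L/2} (\<lambda>x. (u x - c)\<^sup>2) \<le> (L / (2 * pi))\<^sup>2 * integral {a..a + L/2} (\<lambda>x. (u' x)\<^sup>2)"
    if "u a = c" "u (a + L / 2) = c" for a
  proof -
    have "((\<lambda>x. u x - c) has_real_derivative u' x) (at x)" for x
      by (auto intro!: derivative_eq_intros der)
    moreover have "continuous_on {a..a + L/2} u'" using cont by (rule continuous_on_subset) simp
    ultimately have "integral {a..a + L/2} (\<lambda>x. (u x - c)\<^sup>2) \<le> ((a + L/2 - a) / pi)\<^sup>2 * integral {a..a + L/2} (\<lambda>x. (u' x)\<^sup>2)"
      using L that by (intro Wirtinger_zero_ends) auto
    then show ?thesis by simp
  qed
  have "u (x0 + L / 2 + L / 2) = c" using per[of x0] by (simp add: c_def add.commute)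
  then have 2: "integral {x0 + L/2..x0 + L} (\<lambda>x. (u x - c)\<^sup>2) \<le> (L / (2 * pi))\<^sup>2 * integral {x0 + L/2..x0 + L} (\<lambda>x. (u' x)\<^sup>2)"
  proof -
    have "x0 + L / 2 + L / 2 = x0 + L" by simp
    then show ?thesis using w[of "x0 + L / 2"] x0 \<open>u (x0 + L / 2 + L / 2) = c\<close> by (simp only: c_def)
  qed
  have 1: "integral {x0..x0 + L/2} (\<lambda>x. (u x - c)\<^sup>2) \<le> (L / (2 * pi))\<^sup>2 * integral {x0..x0 + L/2} (\<lambda>x. (u' x)\<^sup>2)"
    using w[of x0] x0 by (simp add: c_def)
  have i1: "continuous_on UNIV (\<lambda>x. (u x - c)\<^sup>2)" and i2: "continuous_on UNIV (\<lambda>x. (u' x)\<^sup>2)"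
    using contu cont by (auto intro!: continuous_intros)
  have split: "integral {x0..x0 + L} v = integral {x0..x0 + L/2} v + integral {x0 + L/2..x0 + L} v"
    if "continuous_on UNIV v" for v :: "real \<Rightarrow> real"
    using that L by (intro Henstock_Kurzweil_Integration.integral_combine[symmetric] integrable_continuous_interval)
      (auto intro: continuous_on_subset)
  have "integral {0..L} (\<lambda>x. (u x - c)\<^sup>2) = integral {x0..x0 + L} (\<lambda>x. (u x - c)\<^sup>2)"
    by (rule integral_periodic[symmetric]) (use per i1 L in auto)
  also have "\<dots> \<le> (L / (2 * pi))\<^sup>2 * integral {x0..x0 + L} (\<lambda>x. (u' x)\<^sup>2)"
    using 1 2 unfolding split[OF i1] split[OF i2] by (simp add: distrib_left)
  also have "integral {x0..x0 + L} (\<lambda>x. (u' x)\<^sup>2) = integral {0..L} (\<lambda>x. (u' x)\<^sup>2)"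
    by (rule integral_periodic) (use per' i2 L in auto)
  finally show ?thesis by (rule that)
qed

text \<open>The derivative of \<open>arctan (sinh x)\<close> is \<open>1 / cosh x\<close>, at most
  1. With \<open>x = L / 2\<close> this yields the lower bound for \<open>Y\<close> in
  \<open>Y_ge\<close>.\<close>

lemma arctan_sinh_le:
  fixes x :: real
  assumes "0 \<le> x"
  shows "arctan (sinh x) \<le> x"
proof -
  have "(\<lambda>x. x - arctan (sinh x)) 0 \<le> (\<lambda>x. x - arctan (sinh x)) x"
  proof (rule DERIV_nonneg_imp_nondecreasing[OF assms])
    fix y :: real
    have "((\<lambda>x. x - arctan (sinh x)) has_real_derivative (1 - inverse (1 + (sinh y)\<^sup>2) * cosh y)) (at y)"
      by (auto intro!: derivative_eq_intros)
    moreover have "inverse (1 + (sinh y)\<^sup>2) * cosh y \<le> 1"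
    proof -
      have "1 + (sinh y)\<^sup>2 = (cosh y)\<^sup>2" by (simp add: cosh_square_eq)
      then show ?thesis using cosh_real_ge_1[of y] by (simp add: power2_eq_square field_simps)
    qed
    then have "0 \<le> 1 - inverse (1 + (sinh y)\<^sup>2) * cosh y" by simp
    ultimately show "\<exists>D. ((\<lambda>x. x - arctan (sinh x)) has_real_derivative D) (at y) \<and> 0 \<le> D"
      by blast
  qed
  then show ?thesis by simp
qed

section \<open>Energy decay on a flat cylinder\<close>

text \<open>The decay estimate in conformal coordinates: the collar is the annulus
  \<open>{\<bar>y\<bar> < Y}\<close> modulo \<open>x \<mapsto> x + L\<close>, the form is \<open>Re (f d\<zeta>)\<close> with primitive \<open>Re G\<close>,
  and by Green's formula \<open>flux y\<close> is the energy beyond height \<open>y\<close>.\<close>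

locale cylinder =
  fixes L Y :: real and f G :: "complex \<Rightarrow> complex"
  assumes L: "L > 0" and Y: "Y > 0"
    and f_hol: "f holomorphic_on {z. \<bar>Im z\<bar> < Y}"
    and G_deriv: "\<And>z. \<bar>Im z\<bar> < Y \<Longrightarrow> (G has_field_derivative f z) (at z)"
    and G_per: "\<And>z. \<bar>Im z\<bar> < Y \<Longrightarrow> G (z + of_real L) = G z"
begin

definition slice_energy :: "real \<Rightarrow> real" where
  "slice_energy y = integral {0..L} (\<lambda>x. (cmod (f (Complex x y)))\<^sup>2)"

text \<open>With \<open>u = Re G\<close>, whose derivative in \<open>y\<close> is
  \<open>- Im f\<close>, this is minus the integral of \<open>u\<close> times its normal derivative
  over the circle at height \<open>y\<close>.\<close>

definition flux :: "real \<Rightarrow> real" where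
  "flux y = integral {0..L} (\<lambda>x. Re (G (Complex x y)) * Im (f (Complex x y)))"

lemma open_strip: "open {z. \<bar>Im z\<bar> < Y}"
  by (intro open_Collect_less continuous_intros)

lemma f_cont: "continuous_on {z. \<bar>Im z\<bar> < Y} f"
  using f_hol by (rule holomorphic_on_imp_continuous_on)

lemma f_deriv: "\<bar>Im z\<bar> < Y \<Longrightarrow> (f has_field_derivative deriv f z) (at z)"
  using holomorphic_derivI[OF f_hol open_strip] by simp

lemma f_per: assumes "\<bar>Im z\<bar> < Y" shows "f (z + of_real L) = f z"
proof -
  have "((\<lambda>w. G (w + of_real L)) has_field_derivative f (z + of_real L)) (at z)"
    using G_deriv[of "z + of_real L"] assms by (simp add: DERIV_shift)
  moreover have "((\<lambda>w. G (w + of_real L)) has_field_derivative f z) (at z)"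
    by (rule has_field_derivative_transform_within_open[OF G_deriv[OF assms] open_strip])
      (use assms G_per in auto)
  ultimately show ?thesis by (rule DERIV_unique)
qed

lemma G_cont: "continuous_on {z. \<bar>Im z\<bar> < Y} G"
  using G_deriv by (metis DERIV_isCont continuous_at_imp_continuous_on mem_Collect_eq)

lemma deriv_f_cont: "continuous_on {z. \<bar>Im z\<bar> < Y} (deriv f)"
  using holomorphic_deriv[OF f_hol open_strip] by (rule holomorphic_on_imp_continuous_on)

lemma horizontal_cont:
  assumes "continuous_on {z. \<bar>Im z\<bar> < Y} h" "\<bar>y\<bar> < Y"
  shows "continuous_on X (\<lambda>x. h (Complex x y))"
  by (rule continuous_on_compose2[OF assms(1)]) (use assms(2) in \<open>auto simp: Complex_eq intro!: continuous_intros\<close>)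

lemma horizontal_deriv:
  assumes "(h has_field_derivative h') (at (Complex x y))"
  shows "((\<lambda>x. h (Complex x y)) has_vector_derivative h') (at x within X)"
proof -
  have "((\<lambda>x. Complex x y) has_vector_derivative 1) (at x within X)"
    unfolding Complex_eq by (auto intro!: derivative_eq_intros)
  from field_vector_diff_chain_within[OF this has_field_derivative_at_within[OF assms]]
  show ?thesis by (simp add: o_def)
qed

lemma vertical_deriv:
  assumes "(h has_field_derivative h') (at (Complex x y))"
  shows "((\<lambda>y. h (Complex x y)) has_vector_derivative \<i> * h') (at y within X)"
proof -
  have "((\<lambda>y. Complex x y) has_vector_derivative \<i>) (at y within X)"
    unfolding Complex_eq by (auto intro!: derivative_eq_intros)
  from field_vector_diff_chain_within[OF this has_field_derivative_at_within[OF assms]]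
  show ?thesis by (simp add: o_def)
qed

lemma vector_deriv_Re: "(h has_vector_derivative h') F \<Longrightarrow> ((\<lambda>x. Re (h x)) has_vector_derivative Re h') F"
  and vector_deriv_Im: "(h has_vector_derivative h') F \<Longrightarrow> ((\<lambda>x. Im (h x)) has_vector_derivative Im h') F"
  by (rule bounded_linear.has_vector_derivative[OF bounded_linear_Re], assumption)
    (rule bounded_linear.has_vector_derivative[OF bounded_linear_Im], assumption)

lemma rect_cont:
  assumes "continuous_on {z. \<bar>Im z\<bar> < Y} h"
  shows "continuous_on ({-Y<..<Y} \<times> X) (\<lambda>(y, x). h (Complex x y))"
  unfolding case_prod_beta
  by (rule continuous_on_compose2[OF assms]) (auto simp: Complex_eq intro!: continuous_intros)

text \<open>Differentiation under the integral gives
  \<open>u * Re (deriv f) - (Im f)\<^sup>2\<close>. Integration by parts in \<open>x\<close> over a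
  full period, where the boundary terms cancel, replaces the first term by
  \<open>- (Re f)\<^sup>2\<close>.\<close>

lemma flux_deriv:
  assumes y: "\<bar>y\<bar> < Y"
  shows "(flux has_real_derivative - slice_energy y) (at y)"
proof -
  let ?a = "\<lambda>x y. Re (f (Complex x y))" and ?b = "\<lambda>x y. Im (f (Complex x y))"
  let ?u = "\<lambda>x y. Re (G (Complex x y))" and ?a' = "\<lambda>x y. Re (deriv f (Complex x y))"
  let ?D = "\<lambda>y x. ?u x y * ?a' x y - (?b x y)\<^sup>2"
  have cts: "continuous_on {0..L} (\<lambda>x. (?a x y)\<^sup>2)" "continuous_on {0..L} (\<lambda>x. (?b x y)\<^sup>2)"
     "continuous_on {0..L} (\<lambda>x. ?u x y * ?a' x y)"
    using y by (auto intro!: continuous_intros horizontal_cont f_cont G_cont deriv_f_cont)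
  have *: "((\<lambda>y. integral (cbox 0 L) (\<lambda>x. ?u x y * ?b x y)) has_vector_derivative integral (cbox 0 L) (?D y))
      (at y within {-Y<..<Y})"
  proof (rule leibniz_rule_vector_derivative)
    fix z x assume z: "z \<in> {-Y<..<Y}"
    then have z': "\<bar>Im (Complex x z)\<bar> < Y" by auto
    have "((\<lambda>y. ?u x y) has_vector_derivative Re (\<i> * f (Complex x z))) (at z within {-Y<..<Y})"
      by (rule vector_deriv_Re[OF vertical_deriv[OF G_deriv[OF z']]])
    moreover have "((\<lambda>y. ?b x y) has_vector_derivative Im (\<i> * deriv f (Complex x z))) (at z within {-Y<..<Y})"
      by (rule vector_deriv_Im[OF vertical_deriv[OF f_deriv[OF z']]])
    ultimately have "((\<lambda>y. ?u x y * ?b x y) has_vector_derivative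
        (?u x z * Im (\<i> * deriv f (Complex x z)) + Re (\<i> * f (Complex x z)) * ?b x z)) (at z within {-Y<..<Y})"
      by (rule has_vector_derivative_mult)
    then show "((\<lambda>y. ?u x y * ?b x y) has_vector_derivative ?D z x) (at z within {-Y<..<Y})"
      by (simp add: power2_eq_square)
  next
    fix z assume "z \<in> {-Y<..<Y}"
    then show "(\<lambda>x. ?u x z * ?b x z) integrable_on cbox 0 L"
      by (intro integrable_continuous continuous_intros horizontal_cont f_cont G_cont) auto
  next
    show "continuous_on ({-Y<..<Y} \<times> cbox 0 L) (\<lambda>(y, x). ?D y x)"
      by (rule rect_cont[where h="\<lambda>z. Re (G z) * Re (deriv f z) - (Im (f z))\<^sup>2"])
        (intro continuous_intros f_cont G_cont deriv_f_cont)
  qed (use y in auto)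
  have 1: "(flux has_real_derivative integral {0..L} (?D y)) (at y)"
  proof -
    have "y \<in> {-Y<..<Y}" using y by auto
    note at_within_open[OF this open_greaterThanLessThan]
    with * show ?thesis
      by (simp add: flux_def[abs_def] has_real_derivative_iff_has_vector_derivative)
  qed
  have "((\<lambda>x. ?u x y * ?a' x y + ?a x y * ?a x y) has_integral (?u L y * ?a L y - ?u 0 y * ?a 0 y)) {0..L}"
  proof (rule fundamental_theorem_of_calculus)
    fix x assume "x \<in> {0..L}"
    have "((\<lambda>x. ?u x y) has_vector_derivative ?a x y) (at x within {0..L})"
      by (rule vector_deriv_Re[OF horizontal_deriv[OF G_deriv]]) (use y in simp)
    moreover have "((\<lambda>x. ?a x y) has_vector_derivative ?a' x y) (at x within {0..L})"
      by (rule vector_deriv_Re[OF horizontal_deriv[OF f_deriv]]) (use y in simp)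
    ultimately show "((\<lambda>x. ?u x y * ?a x y) has_vector_derivative (?u x y * ?a' x y + ?a x y * ?a x y)) (at x within {0..L})"
      by (rule has_vector_derivative_mult)
  qed (use L in simp)
  moreover have "Complex L y = Complex 0 y + of_real L" by (simp add: complex_eq_iff)
  then have "?u L y * ?a L y = ?u 0 y * ?a 0 y"
    using f_per[of "Complex 0 y"] G_per[of "Complex 0 y"] y by simp
  ultimately have "((\<lambda>x. ?u x y * ?a' x y + (?a x y)\<^sup>2) has_integral 0) {0..L}"
    by (simp add: power2_eq_square)
  from has_integral_diff[OF this has_integral_add[OF integrable_integral[OF integrable_continuous_interval[OF cts(1)]]
        integrable_integral[OF integrable_continuous_interval[OF cts(2)]]]]
  have "((\<lambda>x. ?u x y * ?a' x y + (?a x y)\<^sup>2 - ((?a x y)\<^sup>2 + (?b x y)\<^sup>2)) has_integral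
      (0 - (integral {0..L} (\<lambda>x. (?a x y)\<^sup>2) + integral {0..L} (\<lambda>x. (?b x y)\<^sup>2)))) {0..L}" .
  moreover have "integral {0..L} (\<lambda>x. (?a x y)\<^sup>2) + integral {0..L} (\<lambda>x. (?b x y)\<^sup>2) = slice_energy y"
    unfolding slice_energy_def cmod_power2
    by (rule Henstock_Kurzweil_Integration.integral_add[symmetric]) (intro integrable_continuous_interval cts)+
  ultimately have "(?D y has_integral - slice_energy y) {0..L}"
    by simp
  then show ?thesis using 1 by (simp add: integral_unique)
qed

text \<open>\<open>Im f\<close> has mean zero on the circle because \<open>G\<close> is periodic, so
  \<open>u\<close> may be replaced by \<open>u - c\<close>. Young's inequality with weight
  \<open>k\<close> separates the two factors, and Wirtinger's inequality bounds \<open>u - c\<close>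
  by its derivative \<open>Re f\<close>.\<close>

lemma flux_le:
  assumes y: "\<bar>y\<bar> < Y"
  shows "flux y \<le> L / (4 * pi) * slice_energy y"
proof -
  let ?a = "\<lambda>x. Re (f (Complex x y))" and ?b = "\<lambda>x. Im (f (Complex x y))" and ?u = "\<lambda>x. Re (G (Complex x y))"
  have shift: "Complex (x + L) y = Complex x y + of_real L" for x by (simp add: complex_eq_iff)
  have cts: "continuous_on X ?a" "continuous_on X ?b" "continuous_on X ?u" for X
    using y by (auto intro!: continuous_intros horizontal_cont f_cont G_cont)
  have du: "(?u has_real_derivative ?a x) (at x)" for x
    unfolding has_real_derivative_iff_has_vector_derivative
    by (rule vector_deriv_Re[OF horizontal_deriv[OF G_deriv]]) (use y in simp)
  obtain c where c: "integral {0..L} (\<lambda>x. (?u x - c)\<^sup>2) \<le> (L / (2 * pi))\<^sup>2 * integral {0..L} (\<lambda>x. (?a x)\<^sup>2)"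
    using Wirtinger_periodic[of L ?u ?a] L du cts(1) y G_per by (auto simp: shift)
  have "(?b has_integral (Im (G (Complex L y)) - Im (G (Complex 0 y)))) {0..L}"
    by (rule fundamental_theorem_of_calculus)
      (use L y in \<open>auto intro!: vector_deriv_Im horizontal_deriv G_deriv\<close>)
  then have b0: "(?b has_integral 0) {0..L}"
    using shift[of 0] G_per[of "Complex 0 y"] y by simp
  let ?A = "integral {0..L} (\<lambda>x. (?a x)\<^sup>2)" and ?B = "integral {0..L} (\<lambda>x. (?b x)\<^sup>2)"
    and ?C = "integral {0..L} (\<lambda>x. (?u x - c)\<^sup>2)"
  \<comment> \<open>The lowest frequency of the circle. With this weight both terms of Young's
    inequality become energies divided by \<open>k\<close>, and \<open>1 / (2 * k)\<close> is
    \<open>L / (4 * pi)\<close>.\<close>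
  define k where "k = 2 * pi / L"
  have k: "k > 0" using L by (simp add: k_def)
  have iA: "((\<lambda>x. (?a x)\<^sup>2) has_integral ?A) {0..L}" and iB: "((\<lambda>x. (?b x)\<^sup>2) has_integral ?B) {0..L}"
    and iC: "((\<lambda>x. (?u x - c)\<^sup>2) has_integral ?C) {0..L}"
    and iu: "((\<lambda>x. ?u x * ?b x) has_integral flux y) {0..L}"
    unfolding flux_def
    by (intro integrable_integral integrable_continuous_interval continuous_intros cts)+
  have "((\<lambda>x. ?u x * ?b x - c * ?b x) has_integral (flux y - c * 0)) {0..L}"
    by (intro has_integral_diff iu has_integral_mult_right b0)
  moreover have "((\<lambda>x. (k * (?u x - c)\<^sup>2 + (?b x)\<^sup>2 / k) / 2) has_integral ((k * ?C + ?B / k) / 2)) {0..L}"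
    by (intro has_integral_divide has_integral_add has_integral_mult_right iC iB)
  moreover have "?u x * ?b x - c * ?b x \<le> (k * (?u x - c)\<^sup>2 + (?b x)\<^sup>2 / k) / 2" for x
  proof -
    have "0 \<le> (k * (?u x - c) - ?b x)\<^sup>2 / k" using k by simp
    also have "\<dots> = k * (?u x - c)\<^sup>2 + (?b x)\<^sup>2 / k - 2 * (?u x * ?b x - c * ?b x)"
      using k by (simp add: power2_eq_square field_simps)
    finally show ?thesis by simp
  qed
  ultimately have "flux y - c * 0 \<le> (k * ?C + ?B / k) / 2"
    by (rule has_integral_le)
  also have "k * ?C \<le> ?A / k"
  proof -
    have "?C \<le> (1 / k)\<^sup>2 * ?A" using c by (simp add: k_def)
    then have "k * ?C \<le> k * ((1 / k)\<^sup>2 * ?A)" using k by (intro mult_left_mono) auto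
    also have "\<dots> = ?A / k" using k by (simp add: power2_eq_square)
    finally show ?thesis .
  qed
  also have "(?A / k + ?B / k) / 2 = L / (4 * pi) * (?A + ?B)"
    using L by (simp add: k_def field_simps)
  also have "?A + ?B = slice_energy y"
    unfolding slice_energy_def cmod_power2
    by (rule Henstock_Kurzweil_Integration.integral_add[symmetric]) (intro integrable_continuous_interval continuous_intros cts)+
  finally show ?thesis by simp
qed

text \<open>\<open>flux_deriv\<close> and \<open>flux_le\<close> combine to a differential
  inequality: \<open>flux y * exp (4 * pi / L * y)\<close> is nonincreasing.\<close>

lemma flux_decay:
  assumes ab: "-Y < a" "a \<le> b" "b < Y"
  shows "flux b \<le> exp (- (4 * pi / L) * (b - a)) * flux a"
proof -
  let ?k = "4 * pi / L"
  have "flux b * exp (?k * b) \<le> flux a * exp (?k * a)"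
  proof (rule DERIV_nonpos_imp_nonincreasing[OF ab(2)])
    fix y assume "a \<le> y" "y \<le> b"
    then have y: "\<bar>y\<bar> < Y" using ab by auto
    have "((\<lambda>y. flux y * exp (?k * y)) has_real_derivative
        (- slice_energy y * exp (?k * y) + exp (?k * y) * ?k * flux y)) (at y)"
      by (rule derivative_eq_intros flux_deriv[OF y] refl)+ (simp add: algebra_simps)
    moreover have "?k * flux y \<le> slice_energy y"
      using flux_le[OF y] L by (simp add: field_simps)
    then have "exp (?k * y) * (?k * flux y) \<le> exp (?k * y) * slice_energy y"
      by (intro mult_left_mono) auto
    then have "- slice_energy y * exp (?k * y) + exp (?k * y) * ?k * flux y \<le> 0"
      by (simp add: algebra_simps)
    ultimately show "\<exists>D. ((\<lambda>y. flux y * exp (?k * y)) has_real_derivative D) (at y) \<and> D \<le> 0"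
      by blast
  qed
  then have "flux b * exp (?k * b) * exp (- ?k * b) \<le> flux a * exp (?k * a) * exp (- ?k * b)"
    by (intro mult_right_mono) auto
  also have "flux a * exp (?k * a) * exp (- ?k * b) = exp (- ?k * (b - a)) * flux a"
    by (simp add: mult.assoc exp_add[symmetric] algebra_simps diff_divide_distrib)
  finally show ?thesis by (simp add: mult.assoc exp_add[symmetric])
qed

end

section \<open>Lifting through a covering of a compact surface\<close>

text \<open>The number of functions depends on the surface and cannot index a type such as
  \<open>real^n\<close>. The bounded functions on the naturals form one normed space with room for
  any finite number of coordinates, here along the unit vectors \<delta>.\<close>

lemma finite_separating_family_embedding:
  fixes S :: "'a::topological_space set" and \<F> :: "('a \<Rightarrow> real) set"
  assumes fin: "finite \<F>" and cont: "\<And>u. u \<in> \<F> \<Longrightarrow> continuous_on S u"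
    and sep: "\<And>p q. p \<in> S \<Longrightarrow> q \<in> S \<Longrightarrow> (\<And>u. u \<in> \<F> \<Longrightarrow> u p = u q) \<Longrightarrow> p = q"
  obtains E :: "'a \<Rightarrow> nat \<Rightarrow>\<^sub>C real" where "continuous_on S E" "inj_on E S"
proof -
  obtain F and m :: nat where F: "\<F> = F ` {i. i < m}"
    using fin by (metis finite_imp_nat_seg_image_inj_on)
  define \<delta> :: "nat \<Rightarrow> nat \<Rightarrow>\<^sub>C real" where "\<delta> k = Bcontfun (\<lambda>j. if j = k then 1 else 0)" for k
  have d: "apply_bcontfun (\<delta> k) j = (if j = k then 1 else 0)" for k j
  proof -
    have "(\<lambda>j. if j = k then 1 else 0 :: real) \<in> bcontfun"
      by (rule bcontfun_normI[where b=1]) auto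
    then show ?thesis by (simp add: \<delta>_def Bcontfun_inverse)
  qed
  define E where "E q = (\<Sum>k<m. F k q *\<^sub>R \<delta> k)" for q
  have app_sum: "apply_bcontfun (sum g X) j = (\<Sum>k\<in>X. apply_bcontfun (g k) j)"
    for g :: "nat \<Rightarrow> nat \<Rightarrow>\<^sub>C real" and X j
    by (induction X rule: infinite_finite_induct) auto
  have "apply_bcontfun (E q) j = F j q" if "j < m" for q j
    using that by (simp add: E_def app_sum d if_distrib[where f="\<lambda>x. _ * x"] cong: if_cong)
  then have "inj_on E S"
    by (intro inj_onI sep) (auto simp: F, metis)
  moreover have "continuous_on S E"
    unfolding E_def by (intro continuous_intros cont) (auto simp: F)
  ultimately show ?thesis using that by blast
qed

lemma openin_extend_by_zero:
  fixes u :: "'a::topological_space \<Rightarrow> 'b::real_normed_vector"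
  assumes U: "openin (top_of_set S) U" and K: "closedin (top_of_set S) K" "K \<subseteq> U"
    and u: "continuous_on U u" "\<And>q. q \<in> U - K \<Longrightarrow> u q = 0"
  shows "continuous_on S (\<lambda>q. if q \<in> U then u q else 0)"
proof -
  have eq: "U \<union> (S - K) = S" using K openin_imp_subset[OF U] by auto
  have "continuous_on (U \<union> (S - K)) (\<lambda>q. if q \<in> U then u q else 0)"
    by (rule continuous_on_cases_local_open) (use eq U K u in \<open>auto simp: openin_diff\<close>)
  then show ?thesis by (simp add: eq)
qed

text \<open>A chart map need not extend continuously to \<open>S\<close>, but a bump function
  \<open>b\<close> does, and so does \<open>c\<close>, the product of bump and chart map. Together
  they recover the chart map wherever \<open>b\<close> is positive, and by compactness finitely many
  of these regions cover \<open>S\<close>.\<close>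

lemma compact_locally_planar_embedding:
  fixes S :: "'a::t2_space set"
  assumes S: "compact S"
    and loc: "\<And>p. p \<in> S \<Longrightarrow> \<exists>U V. \<exists>h :: 'a \<Rightarrow> complex. \<exists>g. p \<in> U \<and> openin (top_of_set S) U \<and> open V \<and> homeomorphism U V h g"
  obtains E :: "'a \<Rightarrow> nat \<Rightarrow>\<^sub>C real" where "continuous_on S E" "inj_on E S"
proof -
  have "\<exists>(b :: 'a \<Rightarrow> real) (c :: 'a \<Rightarrow> complex). continuous_on S b \<and> continuous_on S c \<and> b p > 0 \<and>
      (\<forall>q\<in>S. \<forall>q'\<in>S. b q > 0 \<and> b q = b q' \<and> c q = c q' \<longrightarrow> q = q')" if pS: "p \<in> S" for p
  proof -
    obtain U V and h :: "'a \<Rightarrow> complex" and g where U: "p \<in> U" "openin (top_of_set S) U" "open V" "homeomorphism U V h g"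
      using loc[OF pS] by blast
    have hg: "\<And>q. q \<in> U \<Longrightarrow> g (h q) = q" "h ` U = V" "g ` V = U" "continuous_on U h" "continuous_on V g"
      using U(4) by (auto simp: homeomorphism_def)
    obtain r where r: "r > 0" "cball (h p) r \<subseteq> V"
      using U hg open_contains_cball by blast
    define b0 where "b0 q = max 0 (r - dist (h q) (h p))" for q
    define b where "b q = (if q \<in> U then b0 q else 0)" for q
    define c where "c q = (if q \<in> U then b0 q *\<^sub>R h q else 0)" for q
    let ?K = "g ` cball (h p) r"
    have "compact ?K" using r hg by (meson compact_cball compact_continuous_image continuous_on_subset)
    moreover have "?K \<subseteq> U" using r hg by blast
    ultimately have K: "closedin (top_of_set S) ?K" "?K \<subseteq> U"
      using openin_imp_subset[OF U(2)] closed_subset compact_imp_closed by (metis order_trans, metis)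
    have z: "b0 q = 0" if "q \<in> U - ?K" for q
    proof -
      have "h q \<notin> cball (h p) r"
        using that hg(1)[of q] by (metis DiffD1 DiffD2 imageI)
      then show ?thesis by (simp add: b0_def dist_commute)
    qed
    have cb0: "continuous_on U b0" unfolding b0_def by (intro continuous_intros hg)
    have "continuous_on S b"
      unfolding b_def by (rule openin_extend_by_zero[OF U(2) K cb0 z])
    moreover have "continuous_on S c"
      unfolding c_def by (rule openin_extend_by_zero[OF U(2) K]) (use z in \<open>auto intro!: continuous_intros cb0 hg\<close>)
    moreover have "b p > 0" using U r by (simp add: b_def b0_def)
    moreover have "q = q'" if "b q > 0" "b q = b q'" "c q = c q'" for q q'
    proof -
      have U: "q \<in> U" "q' \<in> U" using that(1,2) by (auto simp: b_def split: if_splits)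
      then have "b0 q > 0" "b0 q = b0 q'" "b0 q *\<^sub>R h q = b0 q' *\<^sub>R h q'"
        using that by (simp_all add: b_def c_def)
      then have "h q = h q'" by simp
      then show ?thesis using hg(1) U by metis
    qed
    ultimately show ?thesis by blast
  qed
  then obtain b :: "'a \<Rightarrow> 'a \<Rightarrow> real" and c :: "'a \<Rightarrow> 'a \<Rightarrow> complex" where
    bc: "\<And>p. p \<in> S \<Longrightarrow> continuous_on S (b p)" "\<And>p. p \<in> S \<Longrightarrow> continuous_on S (c p)"
        "\<And>p. p \<in> S \<Longrightarrow> b p p > 0"
        "\<And>p q q'. p \<in> S \<Longrightarrow> q \<in> S \<Longrightarrow> q' \<in> S \<Longrightarrow> b p q > 0 \<Longrightarrow> b p q = b p q' \<Longrightarrow> c p q = c p q' \<Longrightarrow> q = q'"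
    by metis
  have "\<And>p. p \<in> S \<Longrightarrow> \<exists>W. open W \<and> {q \<in> S. b p q > 0} = S \<inter> W"
  proof -
    fix p assume "p \<in> S"
    then have "openin (top_of_set S) (S \<inter> b p -` {0<..})"
      using continuous_openin_preimage_gen[OF bc(1)] open_greaterThan by blast
    then show "\<exists>W. open W \<and> {q \<in> S. b p q > 0} = S \<inter> W"
      by (auto simp: openin_open vimage_def Int_def)
  qed
  then obtain W where W: "\<And>p. p \<in> S \<Longrightarrow> open (W p) \<and> {q \<in> S. b p q > 0} = S \<inter> W p" by metis
  have "S \<subseteq> (\<Union>p\<in>S. W p)" using W bc(3) by blast
  then obtain P where P: "P \<subseteq> S" "finite P" "S \<subseteq> (\<Union>p\<in>P. W p)"
    using compactE_image[OF S, of S W] W by blast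
  let ?F = "(\<Union>p\<in>P. {b p, \<lambda>q. Re (c p q), \<lambda>q. Im (c p q)})"
  show ?thesis
  proof (rule finite_separating_family_embedding[of ?F S])
    show "finite ?F" using P by auto
    show "continuous_on S u" if "u \<in> ?F" for u
      using that P bc(1,2) by (auto intro!: continuous_intros)
    fix q q' assume q: "q \<in> S" "q' \<in> S" and eq: "\<And>u. u \<in> ?F \<Longrightarrow> u q = u q'"
    obtain p where p: "p \<in> P" "q \<in> W p" using P q by blast
    then have "b p q > 0" using W[of p] P q by blast
    moreover have "b p q = b p q'" using eq[of "b p"] p by auto
    moreover have "Re (c p q) = Re (c p q')" using eq[of "\<lambda>q. Re (c p q)"] p by auto
    moreover have "Im (c p q) = Im (c p q')" using eq[of "\<lambda>q. Im (c p q)"] p by auto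
    ultimately show "q = q'" using bc(4) p P q by (metis complex_eqI subsetD)
  qed (use that in blast)
qed

lemma covering_space_compose_homeomorphism:
  assumes cov: "covering_space C p S" and hom: "homeomorphism S S' E E'"
  shows "covering_space C (E \<circ> p) S'"
proof
  have p: "continuous_on C p" "p ` C = S"
    using cov by (auto simp: covering_space_def)
  have E: "continuous_on S E" "E ` S = S'" "E' ` S' = S" "\<And>x. x \<in> S \<Longrightarrow> E' (E x) = x" "\<And>x. x \<in> S' \<Longrightarrow> E (E' x) = x"
    using hom by (auto simp: homeomorphism_def)
  show "continuous_on C (E \<circ> p)" using continuous_on_compose[OF p(1)] E(1) p(2) by simp
  show "(E \<circ> p) ` C = S'" using p E by (metis image_comp)
  fix y assume "y \<in> S'"
  then have "E' y \<in> S" using E by auto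
  have "\<forall>x\<in>S. \<exists>T. x \<in> T \<and> openin (top_of_set S) T \<and> (\<exists>v. \<Union>v = C \<inter> p -` T \<and>
       (\<forall>u\<in>v. openin (top_of_set C) u) \<and> pairwise disjnt v \<and> (\<forall>u\<in>v. \<exists>q. homeomorphism u T p q))"
    using cov unfolding covering_space_def by (elim conjE)
  from bspec[OF this \<open>E' y \<in> S\<close>] obtain T where T0: "E' y \<in> T \<and> openin (top_of_set S) T \<and> (\<exists>v. \<Union>v = C \<inter> p -` T \<and>
       (\<forall>u\<in>v. openin (top_of_set C) u) \<and> pairwise disjnt v \<and> (\<forall>u\<in>v. \<exists>q. homeomorphism u T p q))"
    by (rule exE)
  obtain v where v: "\<Union>v = C \<inter> p -` T \<and>
       (\<forall>u\<in>v. openin (top_of_set C) u) \<and> pairwise disjnt v \<and> (\<forall>u\<in>v. \<exists>q. homeomorphism u T p q)"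
    using T0[THEN conjunct2, THEN conjunct2] by (rule exE)
  note T = T0[THEN conjunct1] T0[THEN conjunct2, THEN conjunct1] v[THEN conjunct1]
    v[THEN conjunct2, THEN conjunct1] v[THEN conjunct2, THEN conjunct2, THEN conjunct1]
    v[THEN conjunct2, THEN conjunct2, THEN conjunct2]
  have TS: "T \<subseteq> S" by (rule openin_imp_subset[OF T(2)])
  have o1: "openin (top_of_set S') (E ` T)"
    using homeomorphism_imp_open_map[OF hom T(2)] .
  have o2: "y \<in> E ` T" using T E \<open>y \<in> S'\<close> by (metis imageI)
  have o3: "\<Union>v = C \<inter> (E \<circ> p) -` (E ` T)"
  proof -
    have "E (p z) \<in> E ` T \<longleftrightarrow> p z \<in> T" if "z \<in> C" for z
    proof
      have pz: "p z \<in> S" using that p(2) by blast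
      assume "E (p z) \<in> E ` T"
      then obtain t where "t \<in> T" "E (p z) = E t" by blast
      then have "p z = t" using E(4)[OF pz] E(4)[of t] TS by auto
      then show "p z \<in> T" using \<open>t \<in> T\<close> by simp
    qed simp
    then show ?thesis by (simp add: T(3) set_eq_iff cong: conj_cong)
  qed
  have o4: "\<exists>q. homeomorphism u (E ` T) (E \<circ> p) q" if uv: "u \<in> v" for u
  proof -
    obtain q where "homeomorphism u T p q" using T uv by blast
    moreover have "homeomorphism T (E ` T) E E'"
      using homeomorphism_of_subsets[OF hom TS, of "{}"] by simp
    ultimately show ?thesis using homeomorphism_compose by blast
  qed
  show "\<exists>T. y \<in> T \<and> openin (top_of_set S') T \<and> (\<exists>v. \<Union>v = C \<inter> (E \<circ> p) -` T \<and>
      (\<forall>u\<in>v. openin (top_of_set C) u) \<and> pairwise disjnt v \<and> (\<forall>u\<in>v. \<exists>q. homeomorphism u T (E \<circ> p) q))"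
    by (intro exI[of _ "E ` T"] exI[of _ v] conjI ballI o1 o2 o3 o4 T(5) bspec[OF T(4)])
qed

text \<open>The lifting theorem of the library requires the base of the covering to lie in a normed
  space; a compact base can be embedded in one.\<close>

lemma compact_covering_space_lift:
  fixes p :: "complex \<Rightarrow> 'a::t2_space" and f :: "'c::real_normed_vector \<Rightarrow> 'a"
  assumes cov: "covering_space C p S" and C: "open C" and S: "compact S"
    and az: "a \<in> C" "z \<in> U"
    and U: "simply_connected U" "locally path_connected U"
    and f: "continuous_on U f" "f \<in> U \<rightarrow> S" "f z = p a"
  obtains g where "continuous_on U g" "g \<in> U \<rightarrow> C" "g z = a" "\<And>y. y \<in> U \<Longrightarrow> p (g y) = f y"
proof -
  have p: "continuous_on C p" "p ` C = S"
    using cov by (auto simp: covering_space_def)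
  have "\<exists>U V. \<exists>h :: 'a \<Rightarrow> complex. \<exists>g. q \<in> U \<and> openin (top_of_set S) U \<and> open V \<and> homeomorphism U V h g" if qS: "q \<in> S" for q
  proof -
    obtain x T U' k where "p x = q" "x \<in> T" "openin (top_of_set C) T" "q \<in> U'" "openin (top_of_set S) U'" "homeomorphism T U' p k"
      using covering_space_local_homeomorphism_alt[OF cov qS] by metis
    then show ?thesis using C homeomorphism_symD openin_open_eq by metis
  qed
  from compact_locally_planar_embedding[OF S this]
  obtain E :: "'a \<Rightarrow> nat \<Rightarrow>\<^sub>C real" where E: "continuous_on S E" "inj_on E S" by metis
  then obtain E' where hom: "homeomorphism S (E ` S) E E'"
    using homeomorphism_compact[OF S] by metis
  have "covering_space C (E \<circ> p) (E ` S)"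
    by (rule covering_space_compose_homeomorphism[OF cov hom])
  moreover have "continuous_on U (E \<circ> f)"
    using continuous_on_compose[OF f(1)] continuous_on_subset[OF E(1)] f(2) image_subset_iff_funcset by blast
  moreover have "(E \<circ> f) \<in> U \<rightarrow> E ` S" using f by auto
  ultimately obtain g where g: "continuous_on U g" "g \<in> U \<rightarrow> C" "g z = a" "\<And>y. y \<in> U \<Longrightarrow> (E \<circ> p) (g y) = (E \<circ> f) y"
    using covering_space_lift_strong[of C "E \<circ> p" "E ` S" a z U "E \<circ> f"] az U f by auto
  moreover have "p (g y) = f y" if "y \<in> U" for y
    using g(4)[OF that] E(2) p g(2) f(2) that by (force dest: inj_onD simp: Pi_iff)
  ultimately show ?thesis using that by blast
qed

section \<open>Deck transformations\<close>

lemma open_upper_half_plane: "open upper_half_plane"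
  unfolding upper_half_plane_def by (intro open_Collect_less continuous_intros)

lemma convex_upper_half_plane: "convex upper_half_plane"
  unfolding upper_half_plane_def by (simp add: convex_halfspace_Im_gt)

text \<open>A self-map over \<open>\<pi>\<close> suffices as definition: \<open>deck_inverse\<close>
  derives bijectivity from the uniqueness of lifts.\<close>

definition deck_transformation :: "(complex \<Rightarrow> 'a) \<Rightarrow> (complex \<Rightarrow> complex) \<Rightarrow> bool" where
  "deck_transformation \<pi> g \<longleftrightarrow> g holomorphic_on upper_half_plane \<and> g \<in> upper_half_plane \<rightarrow> upper_half_plane \<and>
     (\<forall>z\<in>upper_half_plane. \<pi> (g z) = \<pi> z)"

locale compact_hyperbolic_surface =
  fixes S :: "'a::t2_space set" and A :: "'a chart set" and \<pi> :: "complex \<Rightarrow> 'a"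
  assumes hyperbolic: "hyperbolic_riemann_surface S A \<pi>" and compact: "compact S"
begin

abbreviation "H \<equiv> upper_half_plane"

lemma covering: "covering_space H \<pi> S"
  using hyperbolic by (simp add: hyperbolic_riemann_surface_def)

lemma surface: "riemann_surface S A"
  using hyperbolic by (simp add: hyperbolic_riemann_surface_def)

lemma pi_cont: "continuous_on H \<pi>" and pi_image: "\<pi> ` H = S"
  using covering by (auto simp: covering_space_def)

lemma pi_in: "z \<in> H \<Longrightarrow> \<pi> z \<in> S"
  using pi_image by auto

lemma lift_cases: assumes "p \<in> S" obtains z where "z \<in> H" "\<pi> z = p"
  using assms pi_image by auto

lemma local_inj:
  assumes "z \<in> H"
  obtains e where "e > 0" "ball z e \<subseteq> H" "inj_on \<pi> (ball z e)"
proof -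
  obtain T u q where "z \<in> T" "openin (top_of_set H) T" "homeomorphism T u \<pi> q"
    using covering_space_local_homeomorphism[OF covering assms] by metis
  moreover from this have "open T" "T \<subseteq> H" "inj_on \<pi> T"
    using open_upper_half_plane openin_open_eq by (auto simp: homeomorphism_def intro: inj_on_inverseI)
  ultimately show ?thesis using that by (meson inj_on_subset open_contains_ball order_trans)
qed

lemma pi_open_map:
  assumes "open V" "V \<subseteq> H"
  shows "openin (top_of_set S) (\<pi> ` V)"
proof (subst openin_subopen, clarify)
  fix z assume "z \<in> V"
  then obtain T u q where T: "z \<in> T" "openin (top_of_set H) T" "openin (top_of_set S) u" "homeomorphism T u \<pi> q"
    using covering_space_local_homeomorphism[OF covering] assms by (metis subsetD)
  have "openin (top_of_set T) (T \<inter> V)" using assms by (auto simp: openin_open)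
  then have "openin (top_of_set u) (\<pi> ` (T \<inter> V))"
    using homeomorphism_imp_open_map[OF T(4)] by blast
  then have "openin (top_of_set S) (\<pi> ` (T \<inter> V))" using T(3) openin_trans by blast
  then show "\<exists>T. openin (top_of_set S) T \<and> \<pi> z \<in> T \<and> T \<subseteq> \<pi> ` V"
    using \<open>z \<in> V\<close> T by blast
qed

lemma pi_preimage_open:
  assumes "openin (top_of_set S) U"
  shows "open (H \<inter> \<pi> -` U)"
  using continuous_openin_preimage[OF pi_cont _ assms] pi_in open_upper_half_plane
  by (metis (no_types, lifting) Pi_I openin_open_eq)

lemma chart_open: "c \<in> A \<Longrightarrow> openin (top_of_set S) (fst c)"
  and chart_range_open: "c \<in> A \<Longrightarrow> open (chart_range c)"
  and charts_cover: "(\<Union>c\<in>A. fst c) = S"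
  using surface by (auto simp: riemann_surface_def)

lemma chart_homeomorphism:
  assumes "c \<in> A"
  obtains g where "homeomorphism (fst c) (chart_range c) (snd c) g"
  using surface assms unfolding riemann_surface_def by blast

lemma chart_inj:
  assumes "c \<in> A"
  shows "inj_on (snd c) (fst c)"
proof -
  obtain g where "homeomorphism (fst c) (chart_range c) (snd c) g" using chart_homeomorphism[OF assms] .
  then show ?thesis by (intro inj_on_inverseI[where g=g]) (auto simp: homeomorphism_def)
qed

lemma chart_lift_open: "c \<in> A \<Longrightarrow> open (H \<inter> \<pi> -` fst c)"
  using chart_open pi_preimage_open by blast

lemma chart_lift_holomorphic: "c \<in> A \<Longrightarrow> (snd c \<circ> \<pi>) holomorphic_on (H \<inter> \<pi> -` fst c)"
  using hyperbolic by (simp add: hyperbolic_riemann_surface_def)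

text \<open>Locally \<open>g\<close> is a chart composed with \<open>\<pi>\<close>, followed by the
  holomorphic inverse of that same composition near \<open>g z\<close>, where it is injective. A
  continuous lift is therefore automatically holomorphic.\<close>

lemma lift_holomorphic:
  assumes g: "continuous_on U g" "open U" "U \<subseteq> H" "g \<in> U \<rightarrow> H" "\<And>z. z \<in> U \<Longrightarrow> \<pi> (g z) = \<pi> z"
  shows "g holomorphic_on U"
  unfolding holomorphic_on_open[OF g(2)]
proof
  fix z assume z: "z \<in> U"
  then have zH: "z \<in> H" "g z \<in> H" using g by auto
  then obtain c where c: "c \<in> A" "\<pi> z \<in> fst c" using pi_in charts_cover by blast
  let ?O = "H \<inter> \<pi> -` fst c" and ?\<phi> = "snd c \<circ> \<pi>"
  have O: "open ?O" "z \<in> ?O" "g z \<in> ?O" using c zH g z chart_lift_open by auto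
  obtain e where e: "e > 0" "ball (g z) e \<subseteq> H" "inj_on \<pi> (ball (g z) e)"
    using local_inj zH by blast
  define V where "V = ball (g z) e \<inter> ?O"
  have V: "open V" "g z \<in> V" "V \<subseteq> ?O" "inj_on \<pi> V" using O e by (auto simp: V_def intro: inj_on_subset)
  have inj: "inj_on ?\<phi> V"
    using V chart_inj[OF c(1)] by (intro comp_inj_on) (auto intro: inj_on_subset)
  have hol: "?\<phi> holomorphic_on V" using chart_lift_holomorphic[OF c(1)] V holomorphic_on_subset by blast
  obtain k where k: "k holomorphic_on (?\<phi> ` V)" "\<And>z. z \<in> V \<Longrightarrow> k (?\<phi> z) = z"
    using holomorphic_has_inverse[OF hol V(1) inj] by metis
  define W where "W = U \<inter> g -` V \<inter> ?O"
  have W: "open W" "z \<in> W"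
    using continuous_open_preimage[OF g(1,2) V(1)] O V z by (auto simp: W_def open_Int)
  have "g w = (k \<circ> ?\<phi>) w" if "w \<in> W" for w
    using that k(2)[of "g w"] g(5)[of w] by (auto simp: W_def)
  moreover have "(k \<circ> ?\<phi>) holomorphic_on W"
  proof (rule holomorphic_on_compose_gen[OF _ k(1)])
    show "?\<phi> holomorphic_on W" using chart_lift_holomorphic[OF c(1)] by (rule holomorphic_on_subset) (auto simp: W_def)
    show "?\<phi> ` W \<subseteq> ?\<phi> ` V"
    proof (rule image_subsetI)
      fix w assume w: "w \<in> W"
      then have "?\<phi> w = ?\<phi> (g w)" "g w \<in> V" using g(5) by (auto simp: W_def)
      then show "?\<phi> w \<in> ?\<phi> ` V" by blast
    qed
  qed
  ultimately have "g holomorphic_on W" using holomorphic_transform by metis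
  then show "\<exists>f'. (g has_field_derivative f') (at z)"
    using W holomorphic_on_open by blast
qed

lemma deck_holo: "deck_transformation \<pi> g \<Longrightarrow> g holomorphic_on H"
  and deck_in: "deck_transformation \<pi> g \<Longrightarrow> z \<in> H \<Longrightarrow> g z \<in> H"
  and deck_pi: "deck_transformation \<pi> g \<Longrightarrow> z \<in> H \<Longrightarrow> \<pi> (g z) = \<pi> z"
  by (auto simp: deck_transformation_def)

text \<open>The half-plane is simply connected, so \<open>\<pi>\<close> lifts through itself to a
  map that sends \<open>z\<close> to \<open>w\<close>.\<close>

lemma deck_exists:
  assumes "z \<in> H" "w \<in> H" "\<pi> z = \<pi> w"
  obtains g where "deck_transformation \<pi> g" "g z = w"
proof -
  obtain g where g: "continuous_on H g" "g \<in> H \<rightarrow> H" "g z = w" "\<And>y. y \<in> H \<Longrightarrow> \<pi> (g y) = \<pi> y"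
    using compact_covering_space_lift[OF covering open_upper_half_plane compact assms(2,1), of \<pi>]
      convex_imp_simply_connected convex_imp_locally_path_connected convex_upper_half_plane pi_cont pi_in assms(3)
    by (metis Pi_I)
  moreover have "g holomorphic_on H"
    by (rule lift_holomorphic) (use g open_upper_half_plane in auto)
  ultimately show ?thesis by (intro that[of g]) (auto simp: deck_transformation_def)
qed

lemma deck_unique:
  assumes "deck_transformation \<pi> g" "deck_transformation \<pi> h" "a \<in> H" "g a = h a" "z \<in> H"
  shows "g z = h z"
  by (rule covering_space_lift_unique[OF covering, where f=\<pi> and T=H and a=a])
    (use assms pi_cont pi_in deck_holo deck_in deck_pi holomorphic_on_imp_continuous_on convex_connected convex_upper_half_plane in auto)

lemma deck_id: "deck_transformation \<pi> (\<lambda>z. z)"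
  by (auto simp: deck_transformation_def)

lemma deck_compose:
  assumes "deck_transformation \<pi> g" "deck_transformation \<pi> h"
  shows "deck_transformation \<pi> (\<lambda>z. g (h z))"
  using assms holomorphic_on_compose_gen[of h H g H]
  by (auto simp: deck_transformation_def o_def Pi_iff)

lemma deck_inverse:
  assumes g: "deck_transformation \<pi> g"
  obtains h where "deck_transformation \<pi> h" "\<And>z. z \<in> H \<Longrightarrow> h (g z) = z" "\<And>z. z \<in> H \<Longrightarrow> g (h z) = z"
proof -
  have i: "\<i> \<in> H" by (simp add: upper_half_plane_def)
  obtain h where h: "deck_transformation \<pi> h" "h (g \<i>) = \<i>"
    using deck_exists[OF deck_in[OF g i] i] deck_pi[OF g i] by metis
  have "h (g z) = z" if "z \<in> H" for z
    using deck_unique[OF deck_compose[OF h(1) g] deck_id i] h that by simp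
  moreover have "g (h z) = z" if "z \<in> H" for z
    using deck_unique[OF deck_compose[OF g h(1)] deck_id deck_in[OF g i]] h that by simp
  ultimately show ?thesis using that h by blast
qed

lemma deck_fixpoint:
  assumes "deck_transformation \<pi> g" "a \<in> H" "g a = a" "z \<in> H"
  shows "g z = z"
  using deck_unique[OF assms(1) deck_id assms(2)] assms by simp

end

section \<open>Moebius transformations of the upper half-plane\<close>

definition moebius :: "real \<Rightarrow> real \<Rightarrow> real \<Rightarrow> real \<Rightarrow> complex \<Rightarrow> complex" where
  "moebius a b c d z = (of_real a * z + of_real b) / (of_real c * z + of_real d)"

lemma in_upper_half_plane [simp]: "z \<in> upper_half_plane \<longleftrightarrow> Im z > 0"
  by (simp add: upper_half_plane_def)

lemma moebius_denom:
  assumes "a * d - b * c = 1" "Im z > 0"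
  shows "of_real c * z + of_real d \<noteq> 0"
proof
  assume "of_real c * z + of_real d = 0"
  then have "Re (of_real c * z + of_real d) = 0" "Im (of_real c * z + of_real d) = 0" by simp_all
  then have "c = 0" "d = 0" using assms(2) by auto
  then show False using assms(1) by simp
qed

lemma moebius_components:
  fixes a b c d :: real
  assumes det: "a * d - b * c = 1" and z: "Im z > 0"
  defines "n \<equiv> (cmod (of_real c * z + of_real d))\<^sup>2"
  shows "n > 0" "Im (moebius a b c d z) = Im z / n"
    "Re (moebius a b c d z) = (a * c * (cmod z)\<^sup>2 + (a * d + b * c) * Re z + b * d) / n"
proof -
  show n: "n > 0" using moebius_denom[OF det z] by (simp add: n_def)
  have n_eq: "n = (c * Re z + d)\<^sup>2 + (c * Im z)\<^sup>2"
    by (simp add: n_def cmod_power2)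
  have "Im (moebius a b c d z) = (a * Im z * (c * Re z + d) - (a * Re z + b) * (c * Im z)) / n"
    by (simp add: moebius_def Im_divide n_eq)
  also have "a * Im z * (c * Re z + d) - (a * Re z + b) * (c * Im z) = (a * d - b * c) * Im z"
    by (simp add: algebra_simps)
  finally show "Im (moebius a b c d z) = Im z / n" by (simp add: det)
  show "Re (moebius a b c d z) = (a * c * (cmod z)\<^sup>2 + (a * d + b * c) * Re z + b * d) / n"
    unfolding moebius_def Re_divide n_eq cmod_power2
    by (simp add: algebra_simps power2_eq_square)
qed

lemma moebius_in:
  assumes "a * d - b * c = 1" "Im z > 0"
  shows "Im (moebius a b c d z) > 0"
  using moebius_components[OF assms] assms(2) by simp

lemma moebius_holomorphic:
  assumes "a * d - b * c = 1"
  shows "moebius a b c d holomorphic_on upper_half_plane"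
  unfolding moebius_def using moebius_denom[OF assms] by (intro holomorphic_intros) auto

lemma moebius_compose:
  assumes "a * d - b * c = 1" "a' * d' - b' * c' = 1" "Im z > 0"
  shows "moebius a b c d (moebius a' b' c' d' z) =
    moebius (a * a' + b * c') (a * b' + b * d') (c * a' + d * c') (c * b' + d * d') z"
proof -
  let ?n = "of_real c' * z + of_real d'" and ?m = "of_real a' * z + of_real b' :: complex"
  have n: "?n \<noteq> 0" using moebius_denom[OF assms(2,3)] .
  have "moebius a b c d (?m / ?n) = ((of_real a * ?m + of_real b * ?n) / ?n) / ((of_real c * ?m + of_real d * ?n) / ?n)"
    using n by (simp add: moebius_def field_simps)
  also have "\<dots> = (of_real a * ?m + of_real b * ?n) / (of_real c * ?m + of_real d * ?n)"
    using n by simp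
  finally show ?thesis by (simp add: moebius_def algebra_simps)
qed

lemma moebius_compose_det:
  fixes a b c d :: real
  assumes "a * d - b * c = 1" "a' * d' - b' * c' = 1"
  shows "(a * a' + b * c') * (c * b' + d * d') - (a * b' + b * d') * (c * a' + d * c') = 1"
proof -
  have "(a * a' + b * c') * (c * b' + d * d') - (a * b' + b * d') * (c * a' + d * c')
     = (a * d - b * c) * (a' * d' - b' * c')" by (simp add: algebra_simps)
  then show ?thesis by (simp add: assms)
qed

lemma moebius_inverse:
  assumes "a * d - b * c = 1" "Im z > 0"
  shows "moebius d (- b) (- c) a (moebius a b c d z) = z"
proof -
  have "d * a - (- b) * (- c) = 1" using assms by (simp add: algebra_simps)
  from moebius_compose[OF this assms] show ?thesis
    using assms(1) by (simp add: algebra_simps moebius_def of_real_diff[symmetric] of_real_mult[symmetric] del: of_real_diff of_real_mult)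
qed

definition is_moebius :: "(complex \<Rightarrow> complex) \<Rightarrow> bool" where
  "is_moebius g \<longleftrightarrow> (\<exists>a b c d. a * d - b * c = 1 \<and> (\<forall>z\<in>upper_half_plane. g z = moebius a b c d z))"

lemma is_moebius_in: "is_moebius g \<Longrightarrow> Im z > 0 \<Longrightarrow> Im (g z) > 0"
  using moebius_in by (auto simp: is_moebius_def)

lemma is_moebius_compose:
  assumes "is_moebius g" "is_moebius h"
  shows "is_moebius (\<lambda>z. g (h z))"
proof -
  obtain a b c d where g: "a * d - b * c = 1" "\<forall>z\<in>upper_half_plane. g z = moebius a b c d z"
    using assms(1) by (auto simp: is_moebius_def)
  obtain a' b' c' d' where h: "a' * d' - b' * c' = 1" "\<forall>z\<in>upper_half_plane. h z = moebius a' b' c' d' z"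
    using assms(2) by (auto simp: is_moebius_def)
  have "g (h z) = moebius (a * a' + b * c') (a * b' + b * d') (c * a' + d * c') (c * b' + d * d') z"
    if "Im z > 0" for z
    using g h that moebius_in[OF h(1) that] moebius_compose[OF g(1) h(1) that] by simp
  then show ?thesis unfolding is_moebius_def
    using moebius_compose_det[OF g(1) h(1)]
    by (intro exI[of _ "a * a' + b * c'"] exI[of _ "a * b' + b * d'"] exI[of _ "c * a' + d * c'"]
        exI[of _ "c * b' + d * d'"]) simp
qed

lemma is_moebius_inverse:
  assumes "is_moebius g"
  shows "\<exists>h. is_moebius h \<and> (\<forall>z. Im z > 0 \<longrightarrow> h (g z) = z) \<and> (\<forall>z. Im z > 0 \<longrightarrow> g (h z) = z)"
proof -
  obtain a b c d where g: "a * d - b * c = 1" "\<forall>z\<in>upper_half_plane. g z = moebius a b c d z"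
    using assms by (auto simp: is_moebius_def)
  have det: "d * a - (- b) * (- c) = 1" using g(1) by (simp add: algebra_simps)
  show ?thesis
  proof (intro exI conjI allI impI)
    show "is_moebius (moebius d (- b) (- c) a)" using det unfolding is_moebius_def by blast
    show "moebius d (- b) (- c) a (g z) = z" if "Im z > 0" for z
      using moebius_inverse[OF g(1) that] g(2) that by simp
    show "g (moebius d (- b) (- c) a z) = z" if "Im z > 0" for z
      using moebius_inverse[OF det that] g(2) that moebius_in[OF det that] by simp
  qed
qed

lemma is_moebius_holomorphic:
  assumes "is_moebius g" shows "g holomorphic_on upper_half_plane"
proof -
  obtain a b c d where g: "a * d - b * c = 1" "\<forall>z\<in>upper_half_plane. g z = moebius a b c d z"
    using assms by (auto simp: is_moebius_def)
  then show ?thesis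
    by (intro holomorphic_transform[OF moebius_holomorphic[OF g(1)]]) auto
qed

subsection \<open>Hyperbolic distance\<close>

lemma cosh_hyp_dist:
  assumes "Im z > 0" "Im w > 0"
  shows "cosh (hyp_dist z w) = 1 + (dist z w)\<^sup>2 / (2 * Im z * Im w)"
  unfolding hyp_dist_def using assms by (intro cosh_arcosh_real) simp

lemma hyp_dist_nonneg: "Im z > 0 \<Longrightarrow> Im w > 0 \<Longrightarrow> hyp_dist z w \<ge> 0"
  unfolding hyp_dist_def by (intro arcosh_nonneg_real) simp

lemma hyp_dist_moebius:
  assumes g: "is_moebius g" and z: "Im z > 0" and w: "Im w > 0"
  shows "hyp_dist (g z) (g w) = hyp_dist z w"
proof -
  obtain a b c d where det: "a * d - b * c = 1" and g: "\<forall>z\<in>upper_half_plane. g z = moebius a b c d z"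
    using g by (auto simp: is_moebius_def)
  let ?p = "of_real c * z + of_real d" and ?q = "of_real c * w + of_real d"
  have p: "?p \<noteq> 0" and q: "?q \<noteq> 0" using moebius_denom[OF det z] moebius_denom[OF det w] by auto
  have "moebius a b c d z - moebius a b c d w =
      (of_real (a * d - b * c) * (z - w)) / (?p * ?q)"
    using p q unfolding moebius_def by (simp add: diff_frac_eq) (simp add: algebra_simps)
  then have d: "dist (g z) (g w) = dist z w / (cmod ?p * cmod ?q)"
    using g z w det by (simp add: dist_norm norm_divide norm_mult)
  have i: "Im (g z) = Im z / (cmod ?p)\<^sup>2" "Im (g w) = Im w / (cmod ?q)\<^sup>2"
    using moebius_components[OF det z] moebius_components[OF det w] g z w by simp_all
  have gen: "(e / (P * Q))\<^sup>2 / (2 * (x / P\<^sup>2) * (y / Q\<^sup>2)) = e\<^sup>2 / (2 * x * y)"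
    if "P \<noteq> 0" "Q \<noteq> 0" for e P Q x y :: real
    using that by (simp add: power_divide power_mult_distrib)
  have "cmod ?p \<noteq> 0" "cmod ?q \<noteq> 0" using p q by simp_all
  then show ?thesis unfolding hyp_dist_def d i by (subst gen) simp_all
qed

lemma hyp_dist_axis:
  assumes w: "Im w > 0"
  shows "cosh (hyp_dist w (\<i> * of_real (exp r))) = ((cmod w)\<^sup>2 + (exp r)\<^sup>2) / (2 * Im w * exp r)"
proof -
  have "(dist w (\<i> * of_real (exp r)))\<^sup>2 = (cmod w)\<^sup>2 + (exp r)\<^sup>2 - 2 * Im w * exp r"
    unfolding dist_norm cmod_power2 by (simp add: power2_eq_square algebra_simps)
  then show ?thesis
    using w by (subst cosh_hyp_dist) (auto simp: field_simps)
qed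

lemma hyp_dist_axis_points:
  "hyp_dist (\<i> * of_real (exp r)) (\<i> * of_real (exp t)) = \<bar>r - t\<bar>"
proof -
  have "cosh (hyp_dist (\<i> * of_real (exp r)) (\<i> * of_real (exp t))) = cosh (r - t)"
    by (subst hyp_dist_axis)
      (auto simp: cosh_def norm_mult exp_diff exp_minus power2_eq_square field_simps)
  then show ?thesis
    using hyp_dist_nonneg[of "\<i> * of_real (exp r)" "\<i> * of_real (exp t)"] by simp
qed

text \<open>The hyperbolic distances to two points of the imaginary axis give two linear equations
  for \<open>\<bar>w\<bar>\<^sup>2\<close> and \<open>Im w\<close>.\<close>

lemma axis_point_determined:
  assumes w: "Im w > 0" and rs: "r \<noteq> s"
    and r: "hyp_dist w (\<i> * of_real (exp r)) = \<bar>t - r\<bar>"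
    and s: "hyp_dist w (\<i> * of_real (exp s)) = \<bar>t - s\<bar>"
  shows "w = \<i> * of_real (exp t)"
proof -
  have *: "(cmod w)\<^sup>2 + (exp u)\<^sup>2 = Im w * (exp t + (exp u)\<^sup>2 / exp t)"
    if "hyp_dist w (\<i> * of_real (exp u)) = \<bar>t - u\<bar>" for u
  proof -
    have "((cmod w)\<^sup>2 + (exp u)\<^sup>2) / (2 * Im w * exp u) = cosh (t - u)"
      using hyp_dist_axis[OF w, of u] that by simp
    then have "(cmod w)\<^sup>2 + (exp u)\<^sup>2 = 2 * Im w * exp u * cosh (t - u)"
      using w by (simp add: field_simps)
    also have "\<dots> = Im w * (exp t + (exp u)\<^sup>2 / exp t)"
      by (simp add: cosh_def exp_diff exp_minus power2_eq_square field_simps)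
    finally show ?thesis .
  qed
  have eq: "(exp r)\<^sup>2 - (exp s)\<^sup>2 = Im w / exp t * ((exp r)\<^sup>2 - (exp s)\<^sup>2)"
    using *[OF r] *[OF s] by (simp add: field_simps)
  have "(exp r)\<^sup>2 - (exp s)\<^sup>2 \<noteq> 0" using rs by (simp add: power2_eq_iff_nonneg)
  then have "Im w / exp t = 1" using eq by (metis mult_cancel_right1)
  then have i: "Im w = exp t" by (simp add: field_simps)
  have "(cmod w)\<^sup>2 = (exp t)\<^sup>2" using *[OF r] by (simp add: i power2_eq_square field_simps)
  then have "Re w = 0" by (simp add: cmod_power2 i)
  with i show ?thesis by (simp add: complex_eq_iff)
qed

subsection \<open>Automorphisms of the half-plane\<close>

definition cayley :: "complex \<Rightarrow> complex" where
  "cayley z = (z - \<i>) / (z + \<i>)"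

definition cayley_inv :: "complex \<Rightarrow> complex" where
  "cayley_inv w = \<i> * (1 + w) / (1 - w)"

lemma cayley_denom: "Im z > 0 \<Longrightarrow> z + \<i> \<noteq> 0"
  by (auto simp: complex_eq_iff)

text \<open>The right side is a function of \<open>(dist z \<i>)\<^sup>2 / Im z\<close> and so of
  the hyperbolic distance from \<i>; \<open>moebius_i_pair\<close> exploits this.\<close>

lemma cmod_cayley:
  assumes "Im z > 0"
  shows "(cmod (cayley z))\<^sup>2 = (dist z \<i>)\<^sup>2 / ((dist z \<i>)\<^sup>2 + 4 * Im z)"
proof -
  have "(cmod (z + \<i>))\<^sup>2 = (dist z \<i>)\<^sup>2 + 4 * Im z"
    unfolding dist_norm cmod_power2 by (simp add: power2_eq_square algebra_simps)
  then show ?thesis by (simp add: cayley_def norm_divide power_divide dist_norm)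
qed

lemma cayley_in_disc:
  assumes "Im z > 0" shows "cmod (cayley z) < 1"
proof -
  have "(dist z \<i>)\<^sup>2 + 4 * Im z > 0" using assms by (intro add_nonneg_pos) auto
  then have "(cmod (cayley z))\<^sup>2 < 1" using assms by (simp add: cmod_cayley divide_less_eq)
  then show ?thesis by (simp add: power_less_one_iff abs_square_less_1)
qed

lemma cayley_inv_in:
  assumes "cmod w < 1" shows "Im (cayley_inv w) > 0"
proof -
  have ne: "1 - w \<noteq> 0" using assms by auto
  have "Im (cayley_inv w) = (1 - (cmod w)\<^sup>2) / (cmod (1 - w))\<^sup>2"
    unfolding cayley_inv_def Im_divide cmod_power2
    by (simp add: power2_eq_square algebra_simps)
  moreover have "(cmod w)\<^sup>2 < 1" using assms by (simp add: abs_square_less_1)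
  ultimately show ?thesis using ne by simp
qed

lemma cayley_inverse:
  assumes "Im z > 0"
  shows "cayley_inv (cayley z) = z"
proof -
  have ne: "z + \<i> \<noteq> 0" using cayley_denom[OF assms] .
  then have "1 + cayley z = 2 * z / (z + \<i>)" "1 - cayley z = 2 * \<i> / (z + \<i>)"
    by (simp_all add: cayley_def add_divide_eq_iff diff_divide_eq_iff eq_divide_eq divide_eq_eq)
  then show ?thesis using ne by (simp add: cayley_inv_def)
qed

lemma cayley_inverse':
  assumes "cmod w < 1"
  shows "cayley (cayley_inv w) = w"
proof -
  have ne: "1 - w \<noteq> 0" using assms by auto
  have "cayley_inv w - \<i> = (\<i> * (1 + w) - \<i> * (1 - w)) / (1 - w)"
    by (simp only: cayley_inv_def diff_divide_distrib nonzero_mult_div_cancel_right[OF ne])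
  also have "\<dots> = 2 * \<i> * w / (1 - w)" by (simp add: algebra_simps)
  finally have 1: "cayley_inv w - \<i> = 2 * \<i> * w / (1 - w)" .
  have "cayley_inv w + \<i> = (\<i> * (1 + w) + \<i> * (1 - w)) / (1 - w)"
    by (simp only: cayley_inv_def add_divide_distrib nonzero_mult_div_cancel_right[OF ne])
  also have "\<dots> = 2 * \<i> / (1 - w)" by (simp add: algebra_simps)
  finally show ?thesis using ne 1 by (simp add: cayley_def)
qed

lemma cayley_quotient:
  assumes "n \<noteq> 0"
  shows "cayley (m / n) = (m - \<i> * n) / (m + \<i> * n)"
proof -
  have "m / n - \<i> = (m - \<i> * n) / n" "m / n + \<i> = (m + \<i> * n) / n"
    using assms by (simp_all add: diff_divide_eq_iff add_divide_eq_iff diff_divide_distrib add_divide_distrib)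
  then show ?thesis using assms by (simp add: cayley_def)
qed

lemma cayley_inject: "Im z > 0 \<Longrightarrow> Im w > 0 \<Longrightarrow> cayley z = cayley w \<Longrightarrow> z = w"
  by (metis cayley_inverse)

text \<open>The rotation of the disc by \<open>2 * t\<close> corresponds to the rotation matrix of
  angle \<open>t\<close>: numerator and denominator of the Cayley transform are multiplied by
  \<open>cis t\<close> and \<open>cis (- t)\<close>.\<close>

lemma rotation_moebius:
  assumes "cmod \<alpha> = 1"
  obtains g where "is_moebius g" "\<And>z. Im z > 0 \<Longrightarrow> cayley (g z) = \<alpha> * cayley z"
proof -
  obtain t where t: "\<alpha> = cis (2 * t)"
  proof
    show "\<alpha> = cis (2 * (Arg \<alpha> / 2))" using rcis_cmod_Arg[of \<alpha>] assms by (simp add: rcis_def)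
  qed
  let ?g = "moebius (cos t) (sin t) (- sin t) (cos t)"
  have det: "cos t * cos t - sin t * (- sin t) = 1"
    by (simp add: power2_eq_square[symmetric])
  have "cayley (?g z) = \<alpha> * cayley z" if z: "Im z > 0" for z
  proof -
    let ?n = "of_real (- sin t) * z + of_real (cos t)" and ?m = "of_real (cos t) * z + of_real (sin t) :: complex"
    have n: "?n \<noteq> 0" using moebius_denom[OF det z] .
    have "cayley (?m / ?n) = (?m - \<i> * ?n) / (?m + \<i> * ?n)"
      by (rule cayley_quotient[OF n])
    also have "?m - \<i> * ?n = cis t * (z - \<i>)"
      by (simp add: complex_eq_iff cis.code algebra_simps)
    also have "?m + \<i> * ?n = cis (- t) * (z + \<i>)"
      by (simp add: complex_eq_iff cis.code algebra_simps)
    also have "cis t * (z - \<i>) / (cis (- t) * (z + \<i>)) = cis (2 * t) * cayley z"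
      by (simp add: cayley_def cis_divide times_divide_times_eq[symmetric])
    finally show ?thesis by (simp add: moebius_def t)
  qed
  moreover have "is_moebius ?g" unfolding is_moebius_def using det by blast
  ultimately show ?thesis using that by blast
qed

lemma moebius_to_i:
  assumes "Im u > 0"
  obtains g where "is_moebius g" "g u = \<i>"
proof -
  let ?v = "Im u"
  have det: "(1 / sqrt ?v) * sqrt ?v - (- Re u / sqrt ?v) * 0 = 1" using assms by simp
  have e: "of_real (1 / sqrt ?v) * u + of_real (- Re u / sqrt ?v) = (u - of_real (Re u)) / of_real (sqrt ?v)"
    by (simp add: diff_divide_distrib)
  have "moebius (1 / sqrt ?v) (- Re u / sqrt ?v) 0 (sqrt ?v) u = (u - of_real (Re u)) / of_real (sqrt ?v) / of_real (sqrt ?v)"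
    by (simp only: moebius_def e of_real_0 mult_zero_left add_0_left)
  also have "\<dots> = (u - of_real (Re u)) / of_real (sqrt ?v * sqrt ?v)"
    by (simp only: of_real_mult divide_divide_eq_left)
  also have "\<dots> = \<i>" using assms by (simp add: complex_eq_iff Re_divide Im_divide power2_eq_square)
  finally show ?thesis using that det unfolding is_moebius_def by blast
qed

text \<open>After \<open>u\<close> is moved to \<i>, the image of \<open>v\<close> and the point
  \<open>\<i> * of_real (exp s)\<close> have the same distance \<open>s\<close> from \<i>, hence
  Cayley images of equal modulus; a rotation about \<i> brings one to the other.\<close>

lemma moebius_i_pair:
  assumes u: "Im u > 0" and v: "Im v > 0" and s: "hyp_dist u v = s" "s > 0"
  obtains g where "is_moebius g" "g \<i> = u" "g (\<i> * of_real (exp s)) = v"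
proof -
  obtain f where f: "is_moebius f" "f u = \<i>" using moebius_to_i[OF u] .
  obtain f' where f': "is_moebius f'" "\<And>z. Im z > 0 \<Longrightarrow> f' (f z) = z" "\<And>z. Im z > 0 \<Longrightarrow> f (f' z) = z"
    using is_moebius_inverse[OF f(1)] by auto
  let ?v = "f v" and ?e = "\<i> * of_real (exp s)"
  have v': "Im ?v > 0" using is_moebius_in[OF f(1) v] .
  have "hyp_dist \<i> ?v = s" using hyp_dist_moebius[OF f(1) u v] f(2) s(1) by simp
  moreover have "hyp_dist \<i> ?e = s" using hyp_dist_axis_points[of 0 s] s(2) by simp
  ultimately have "cosh (hyp_dist \<i> ?v) = cosh (hyp_dist \<i> ?e)" by simp
  then have "(dist ?v \<i>)\<^sup>2 / Im ?v = (dist ?e \<i>)\<^sup>2 / Im ?e"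
    using v' by (simp add: cosh_hyp_dist dist_commute)
  moreover have "(cmod (cayley z))\<^sup>2 = (\<lambda>r. r / (r + 4)) ((dist z \<i>)\<^sup>2 / Im z)" if "Im z > 0" for z
  proof -
    have "(dist z \<i>)\<^sup>2 / Im z + 4 = ((dist z \<i>)\<^sup>2 + 4 * Im z) / Im z" using that by (simp add: field_simps)
    then show ?thesis using that by (simp add: cmod_cayley)
  qed
  from this[OF v'] this[of ?e] have "(cmod (cayley ?v))\<^sup>2 = (\<lambda>r. r / (r + 4)) ((dist ?v \<i>)\<^sup>2 / Im ?v)"
    "(cmod (cayley ?e))\<^sup>2 = (\<lambda>r. r / (r + 4)) ((dist ?e \<i>)\<^sup>2 / Im ?e)" by simp_all
  ultimately have "(cmod (cayley ?v))\<^sup>2 = (cmod (cayley ?e))\<^sup>2"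
    by metis
  then have eq: "cmod (cayley ?v) = cmod (cayley ?e)" by simp
  have ne: "cayley ?e \<noteq> 0"
  proof -
    have "?e \<noteq> \<i>" using s(2) by (auto simp: complex_eq_iff)
    then show ?thesis using cayley_denom[of ?e] by (simp add: cayley_def)
  qed
  have "cmod (cayley ?v / cayley ?e) = 1" using eq ne by (simp add: norm_divide)
  from rotation_moebius[OF this]
  obtain k where k: "is_moebius k" "\<And>z. Im z > 0 \<Longrightarrow> cayley (k z) = cayley ?v / cayley ?e * cayley z"
    by auto
  have "k ?e = ?v"
    by (rule cayley_inject[OF is_moebius_in[OF k(1)] v']) (use k(2)[of ?e] ne in simp_all)
  moreover have "k \<i> = \<i>"
    by (rule cayley_inject[OF is_moebius_in[OF k(1)]]) (use k(2)[of \<i>] in \<open>simp_all add: cayley_def\<close>)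
  ultimately show ?thesis
    using that[OF is_moebius_compose[OF f'(1) k(1)]] f'(2)[OF u] f'(2)[OF v] f(2) by simp
qed

text \<open>In the disc model, normalized to fix the centre, both the map and its inverse satisfy
  the Schwarz lemma. Equality therefore holds, here tested at the point 1/2, and the map is a
  rotation.\<close>

lemma half_plane_automorphism_moebius:
  assumes g: "g holomorphic_on upper_half_plane" "\<And>z. Im z > 0 \<Longrightarrow> Im (g z) > 0"
    and h: "h holomorphic_on upper_half_plane" "\<And>z. Im z > 0 \<Longrightarrow> Im (h z) > 0"
    and gh: "\<And>z. Im z > 0 \<Longrightarrow> h (g z) = z" "\<And>z. Im z > 0 \<Longrightarrow> g (h z) = z"
  shows "is_moebius g"
proof -
  obtain f where f: "is_moebius f" "f (g \<i>) = \<i>" using moebius_to_i[OF g(2)[of \<i>]] by auto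
  obtain f' where f': "is_moebius f'" "\<And>z. Im z > 0 \<Longrightarrow> f' (f z) = z" "\<And>z. Im z > 0 \<Longrightarrow> f (f' z) = z"
    using is_moebius_inverse[OF f(1)] by auto
  have hci: "cayley_inv holomorphic_on ball 0 1"
    unfolding cayley_inv_def by (intro holomorphic_intros) auto
  have hc: "cayley holomorphic_on upper_half_plane"
    unfolding cayley_def using cayley_denom by (intro holomorphic_intros) auto
  define F where "F w = cayley (f (g (cayley_inv w)))" for w
  define F' where "F' w = cayley (h (f' (cayley_inv w)))" for w
  have hol: "(\<lambda>w. cayley (k1 (k2 (cayley_inv w)))) holomorphic_on ball 0 1"
    if "k1 holomorphic_on upper_half_plane" "\<And>z. Im z > 0 \<Longrightarrow> Im (k1 z) > 0"
      "k2 holomorphic_on upper_half_plane" "\<And>z. Im z > 0 \<Longrightarrow> Im (k2 z) > 0" for k1 k2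
  proof -
    have "(k2 \<circ> cayley_inv) holomorphic_on ball 0 1"
      by (rule holomorphic_on_compose_gen[OF hci that(3)]) (auto intro: cayley_inv_in)
    then have "(k1 \<circ> (k2 \<circ> cayley_inv)) holomorphic_on ball 0 1"
      by (rule holomorphic_on_compose_gen[OF _ that(1)]) (auto intro!: cayley_inv_in that(2,4))
    then have "(cayley \<circ> (k1 \<circ> (k2 \<circ> cayley_inv))) holomorphic_on ball 0 1"
      by (rule holomorphic_on_compose_gen[OF _ hc]) (auto intro!: cayley_inv_in that(2,4))
    then show ?thesis by (simp add: o_def)
  qed
  have F_hol: "F holomorphic_on ball 0 1" unfolding F_def
    by (rule hol[OF is_moebius_holomorphic[OF f(1)] is_moebius_in[OF f(1)] g])
  have F'_hol: "F' holomorphic_on ball 0 1" unfolding F'_def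
    by (rule hol[OF h is_moebius_holomorphic[OF f'(1)] is_moebius_in[OF f'(1)]])
  have F_in: "cmod (F w) < 1" if "cmod w < 1" for w
    unfolding F_def using cayley_in_disc[OF is_moebius_in[OF f(1) g(2)[OF cayley_inv_in[OF that]]]] .
  have F'_in: "cmod (F' w) < 1" if "cmod w < 1" for w
    unfolding F'_def using cayley_in_disc[OF h(2)[OF is_moebius_in[OF f'(1) cayley_inv_in[OF that]]]] .
  have c0: "cayley_inv 0 = \<i>" "cayley \<i> = 0" by (simp_all add: cayley_inv_def cayley_def)
  have F0: "F 0 = 0" by (simp add: F_def c0 f)
  have F'F: "F' (F w) = w" if "cmod w < 1" for w
  proof -
    have 1: "Im (cayley_inv w) > 0" using cayley_inv_in[OF that] .
    have 2: "Im (g (cayley_inv w)) > 0" using g(2)[OF 1] .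
    have 3: "Im (f (g (cayley_inv w))) > 0" using is_moebius_in[OF f(1) 2] .
    show ?thesis unfolding F_def F'_def
      by (simp add: cayley_inverse[OF 3] f'(2)[OF 2] gh(1)[OF 1] cayley_inverse'[OF that])
  qed
  have F'0: "F' 0 = 0" using F'F[of 0] F0 by simp
  have n2: "cmod (1/2) < 1" by simp
  have "cmod (F (1/2)) \<le> cmod (1/2)" by (rule Schwarz_Lemma(1)[OF F_hol F0 F_in n2])
  moreover have "cmod (F' (F (1/2))) \<le> cmod (F (1/2))"
    by (rule Schwarz_Lemma(1)[OF F'_hol F'0 F'_in F_in[OF n2]])
  ultimately have "cmod (F (1/2)) = cmod (1/2)" using F'F[OF n2] by simp
  then have "\<exists>z. cmod z < 1 \<and> z \<noteq> 0 \<and> cmod (F z) = cmod z"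
    by (intro exI[of _ "1/2"]) simp
  then obtain \<alpha> where \<alpha>: "\<And>z. cmod z < 1 \<Longrightarrow> F z = \<alpha> * z" "cmod \<alpha> = 1"
    using Schwarz_Lemma(3)[OF F_hol F0 F_in n2] by blast
  obtain k where k: "is_moebius k" "\<And>z. Im z > 0 \<Longrightarrow> cayley (k z) = \<alpha> * cayley z"
    using rotation_moebius[OF \<alpha>(2)] by blast
  have "g z = f' (k z)" if z: "Im z > 0" for z
  proof -
    have "cayley (f (g z)) = F (cayley z)" by (simp add: F_def cayley_inverse[OF z])
    also have "\<dots> = cayley (k z)" using \<alpha>(1)[OF cayley_in_disc[OF z]] k(2)[OF z] by simp
    finally have "f (g z) = k z"
      by (rule cayley_inject[rotated 2]) (use z g f k is_moebius_in in auto)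
    then show ?thesis using f'(2)[OF g(2)[OF z]] by simp
  qed
  moreover have "is_moebius (\<lambda>z. f' (k z))" by (rule is_moebius_compose[OF f'(1) k(1)])
  ultimately show ?thesis unfolding is_moebius_def by auto
qed

text \<open>The fixed points are the roots of \<open>c z^2 + (d - a) z - b\<close>, whose
  discriminant \<open>(a + d)^2 - 4\<close> is negative; \<open>u\<close> and \<open>v\<close> are
  the real and imaginary part of the root in the upper half-plane.\<close>

lemma elliptic_fixpoint:
  assumes det: "a * d - b * c = 1" and tr: "\<bar>a + d\<bar> < 2"
  obtains z where "Im z > 0" "moebius a b c d z = z"
proof -
  have tr2: "(a + d)\<^sup>2 < 4" using power_strict_mono[OF tr, of 2] by simp
  have c: "c \<noteq> 0"
  proof
    assume "c = 0"
    then have "(a + d)\<^sup>2 = 4 + (a - d)\<^sup>2" using det by (simp add: power2_eq_square algebra_simps)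
    then show False using tr2 by (smt (verit) zero_le_power2)
  qed
  define u where "u = (a - d) / (2 * c)"
  define v where "v = sqrt (4 - (a + d)\<^sup>2) / (2 * \<bar>c\<bar>)"
  have v: "v > 0" using tr2 c by (simp add: v_def)
  have v2: "v\<^sup>2 = (4 - (a + d)\<^sup>2) / (4 * c\<^sup>2)" using tr2 by (simp add: v_def power_divide power_mult_distrib)
  have "c * u\<^sup>2 + c * v\<^sup>2 = c * (((a - d)\<^sup>2 + (4 - (a + d)\<^sup>2)) / (4 * c\<^sup>2))"
    by (simp add: v2 u_def power_divide power_mult_distrib add_divide_distrib distrib_left)
  also have "(a - d)\<^sup>2 + (4 - (a + d)\<^sup>2) = - 4 * (b * c)"
    using det by (simp add: power2_eq_square algebra_simps)
  also have "c * (- 4 * (b * c) / (4 * c\<^sup>2)) = - b" using c by (simp add: power2_eq_square)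
  finally have uv: "c * u\<^sup>2 + c * v\<^sup>2 = - b" .
  have dau: "d - a = - 2 * c * u" using c by (simp add: u_def)
  let ?z = "Complex u v"
  have "of_real a * ?z + of_real b = ?z * (of_real c * ?z + of_real d)"
  proof -
    have "a * u + b = u * (c * u + d) - v * (c * v)"
    proof -
      have "u * (c * u + d) - v * (c * v) - (a * u + b) = c * u\<^sup>2 - c * v\<^sup>2 + (d - a) * u - b"
        by (simp add: power2_eq_square algebra_simps)
      also have "\<dots> = - (c * u\<^sup>2 + c * v\<^sup>2) - b" unfolding dau by (simp add: power2_eq_square algebra_simps)
      finally show ?thesis using uv by simp
    qed
    moreover have "a * v = u * (c * v) + v * (c * u + d)"
    proof -
      have "u * (c * v) + v * (c * u + d) - a * v = v * (2 * c * u + (d - a))" by (simp add: algebra_simps)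
      then show ?thesis using dau by simp
    qed
    ultimately show ?thesis by (simp add: complex_eq_iff)
  qed
  then have "moebius a b c d ?z = ?z"
    using moebius_denom[OF det, of ?z] v by (simp add: moebius_def)
  then show ?thesis using that[of ?z] v by simp
qed

lemma moebius_identity_trace:
  assumes det: "a * d - b * c = 1" and id: "\<And>z. Im z > 0 \<Longrightarrow> moebius a b c d z = z"
  shows "\<bar>a + d\<bar> = 2"
proof -
  have *: "of_real a * z + of_real b = z * (of_real c * z + of_real d)" if "Im z > 0" for z
    using id[OF that] moebius_denom[OF det that] by (simp add: moebius_def divide_eq_eq)
  have "b = - c" "a = d" using *[of \<i>] by (simp_all add: complex_eq_iff)
  moreover have "b = - 4 * c" using *[of "2 * \<i>"] by (simp add: complex_eq_iff)
  ultimately have "a * a = 1" "a = d" using det by auto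
  then have "a = 1 \<or> a = -1" by (metis square_eq_1_iff)
  then show ?thesis using \<open>a = d\<close> by auto
qed

text \<open>The wedge is the neighbourhood of the imaginary axis of radius r with sinh r = \<kappa>.
  The axis and its image have distance D with cosh D = \<open>\<bar>a * d + b * c\<bar>\<close>, and
  the hypothesis on \<open>b * c\<close> says that D is at least 2 r, so the neighbourhoods of
  radius r cannot overlap. The proof is a direct computation with these hyperbolic
  functions.\<close>

lemma wedge_disjoint:
  fixes a b c d \<kappa> :: real
  assumes det: "a * d - b * c = 1" and \<kappa>: "\<kappa> > 0"
    and p: "b * c \<ge> \<kappa>\<^sup>2 \<or> b * c \<le> -1 - \<kappa>\<^sup>2"
    and z: "Im z > 0" "\<bar>Re z\<bar> < \<kappa> * Im z"
  shows "\<bar>Re (moebius a b c d z)\<bar> \<ge> \<kappa> * Im (moebius a b c d z)"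
proof (rule ccontr)
  assume neg: "\<not> ?thesis"
  define n where "n = (cmod (of_real c * z + of_real d))\<^sup>2"
  define x y R where "x = \<bar>Re z\<bar>" and "y = Im z" and "R = cmod z"
  define q where "q = b * c * (1 + b * c)"
  note comp = moebius_components[OF det z(1), folded n_def]
  have "\<bar>a * c * R\<^sup>2 + (a * d + b * c) * Re z + b * d\<bar> / n < \<kappa> * (y / n)"
    using neg comp by (simp add: R_def y_def)
  then have lt: "\<bar>a * c * R\<^sup>2 + (a * d + b * c) * Re z + b * d\<bar> < \<kappa> * y"
    using comp(1) by (simp add: divide_less_cancel)
  have R: "R \<ge> 0" "R\<^sup>2 = x\<^sup>2 + y\<^sup>2" "x \<le> R"
    using abs_Re_le_cmod[of z] by (auto simp: R_def x_def y_def cmod_power2)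
  have xy: "0 \<le> x" "x < \<kappa> * y" "y > 0" using z by (auto simp: x_def y_def)
  have q: "q \<ge> \<kappa>\<^sup>2 * (1 + \<kappa>\<^sup>2)"
    using p
  proof
    assume "b * c \<ge> \<kappa>\<^sup>2"
    then show ?thesis unfolding q_def using zero_le_power2[of \<kappa>] by (intro mult_mono) linarith+
  next
    assume "b * c \<le> -1 - \<kappa>\<^sup>2"
    then have "\<kappa>\<^sup>2 * (1 + \<kappa>\<^sup>2) \<le> (- 1 - b * c) * (- (b * c))"
      using zero_le_power2[of \<kappa>] by (intro mult_mono) linarith+
    then show ?thesis by (simp add: q_def algebra_simps)
  qed
  have q0: "q > 0"
    using q \<kappa> by (smt (verit) mult_pos_pos zero_less_power)
  have "1 + b * c = a * d" using det by simp
  then have qac: "q = (a * c) * (b * d)" by (simp add: q_def)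
  \<comment> \<open>With D the distance of the two axes and r the radius of the wedge,
    \<open>s\<close> and \<open>t\<close> are sinh and cosh of D; \<open>s0\<close> and
    \<open>t0\<close> are sinh and cosh of 2 r.\<close>
  define s t s0 t0 where "s = 2 * sqrt q" and "t = sqrt (1 + 4 * q)"
    and "s0 = 2 * \<kappa> * sqrt (1 + \<kappa>\<^sup>2)" and "t0 = 1 + 2 * \<kappa>\<^sup>2"
  have s2: "s\<^sup>2 = 4 * q" "t\<^sup>2 = 1 + 4 * q" using q0 by (simp_all add: s_def t_def power_mult_distrib)
  have s02: "s0\<^sup>2 = 4 * (\<kappa>\<^sup>2 * (1 + \<kappa>\<^sup>2))" "t0\<^sup>2 = 1 + s0\<^sup>2"
    by (simp_all add: s0_def t0_def power_mult_distrib power2_eq_square algebra_simps)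
  have pos: "s > 0" "t > 0" "s0 > 0" "t0 > 0" using q0 \<kappa>
    by (simp_all add: s_def t_def s0_def t0_def add_pos_nonneg)
  have ss0: "s0 \<le> s" by (rule power2_le_imp_le) (use s2(1) s02(1) q pos in auto)
  have "s \<le> t" by (rule power2_le_imp_le) (use s2 pos in auto)
  have "s0 \<le> t0" by (rule power2_le_imp_le) (use s02(2) pos in auto)
  \<comment> \<open>The inequality between arithmetic and geometric mean for
    \<open>a * c * R\<^sup>2\<close> and \<open>b * d\<close>, two numbers of equal sign.\<close>
  have 1: "s * R \<le> \<bar>a * c * R\<^sup>2 + b * d\<bar>"
  proof -
    have "(s * R)\<^sup>2 = 4 * ((a * c * R\<^sup>2) * (b * d))" by (simp add: power_mult_distrib s2 qac)
    also have "\<dots> \<le> (a * c * R\<^sup>2 + b * d)\<^sup>2"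
      using zero_le_power2[of "a * c * R\<^sup>2 - b * d"] by (simp add: power2_eq_square algebra_simps)
    finally show ?thesis by (metis abs_le_square_iff abs_of_nonneg R(1) pos(1) less_imp_le mult_nonneg_nonneg)
  qed
  have 2: "\<bar>(a * d + b * c) * Re z\<bar> = t * x"
  proof -
    have "a * d + b * c = 1 + 2 * (b * c)" using det by simp
    moreover have "(1 + 2 * (b * c))\<^sup>2 = 1 + 4 * q" by (simp add: q_def power2_eq_square algebra_simps)
    ultimately have "(a * d + b * c)\<^sup>2 = t\<^sup>2" by (simp only: s2)
    then have "\<bar>a * d + b * c\<bar> = t" using pos by (metis abs_of_pos power2_eq_iff abs_minus_cancel)
    then show ?thesis by (simp add: abs_mult x_def)
  qed
  have 3: "s * R < \<kappa> * y + t * x" using 1 2 lt by linarith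
  \<comment> \<open>On the hyperbola \<open>t^2 = 1 + s^2\<close> the slope is below 1, so
    \<open>t\<close> grows no faster than \<open>s\<close>. Since \<open>x\<close> is at most
    \<open>R\<close>, the strict inequality for the true distance persists for the critical
    one.\<close>
  have "(t - t0) * (t + t0) = (s - s0) * (s + s0)" using s2 s02 by (simp add: power2_eq_square algebra_simps)
  also have "\<dots> \<le> (s - s0) * (t + t0)" using ss0 \<open>s \<le> t\<close> \<open>s0 \<le> t0\<close> by (intro mult_left_mono) auto
  finally have "t - t0 \<le> s - s0" using pos by simp
  then have "(t - t0) * x \<le> (s - s0) * x" using xy by (intro mult_right_mono) auto
  also have "\<dots> \<le> (s - s0) * R" using R ss0 by (intro mult_left_mono) auto
  finally have 4: "s0 * R < \<kappa> * y + t0 * x" using 3 by (simp add: algebra_simps)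
  \<comment> \<open>At the critical distance the difference of squares has the factor
    \<open>\<kappa> * y - x\<close>, which is positive for points of the wedge.\<close>
  have "(\<kappa> * y + t0 * x)\<^sup>2 \<le> (s0 * R)\<^sup>2"
  proof -
    have "(s0 * R)\<^sup>2 - (\<kappa> * y + t0 * x)\<^sup>2
        = (s0\<^sup>2 - \<kappa>\<^sup>2) * y\<^sup>2 - 2 * \<kappa> * t0 * x * y + (s0\<^sup>2 - t0\<^sup>2) * x\<^sup>2"
      by (simp only: power_mult_distrib R(2)) (simp add: power2_eq_square algebra_simps)
    also have "\<dots> = (3 * \<kappa>\<^sup>2 + 4 * \<kappa>\<^sup>2 * \<kappa>\<^sup>2) * y\<^sup>2 - 2 * t0 * x * (\<kappa> * y) - x * x"
      unfolding s02 by (simp add: power2_eq_square algebra_simps)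
    also have "\<dots> = (\<kappa> * y - x) * (x + (2 * t0 + 1) * (\<kappa> * y))"
      by (simp add: t0_def power2_eq_square algebra_simps)
    also have "\<dots> \<ge> 0" using xy \<kappa> pos by (intro mult_nonneg_nonneg add_nonneg_nonneg) auto
    finally show ?thesis by simp
  qed
  then have "\<kappa> * y + t0 * x \<le> s0 * R" by (rule power2_le_imp_le) (use pos R in simp)
  then show False using 4 by simp
qed

lemma covering_space_precompose_homeomorphism:
  assumes cov: "covering_space C p S" and hom: "homeomorphism C' C m m'"
  shows "covering_space C' (p \<circ> m) S"
proof
  have p: "continuous_on C p" "p ` C = S"
    using cov by (auto simp: covering_space_def)
  have m: "continuous_on C' m" "m ` C' = C" "m' ` C = C'" "\<And>x. x \<in> C' \<Longrightarrow> m' (m x) = x" "\<And>x. x \<in> C \<Longrightarrow> m (m' x) = x"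
    using hom by (auto simp: homeomorphism_def)
  show "continuous_on C' (p \<circ> m)" using continuous_on_compose[OF m(1)] p(1) m(2) by simp
  show "(p \<circ> m) ` C' = S" using p(2) m(2) by (metis image_comp)
  fix y assume "y \<in> S"
  have "\<forall>x\<in>S. \<exists>T. x \<in> T \<and> openin (top_of_set S) T \<and> (\<exists>v. \<Union>v = C \<inter> p -` T \<and>
       (\<forall>u\<in>v. openin (top_of_set C) u) \<and> pairwise disjnt v \<and> (\<forall>u\<in>v. \<exists>q. homeomorphism u T p q))"
    using cov unfolding covering_space_def by (elim conjE)
  from bspec[OF this \<open>y \<in> S\<close>] obtain T where T0: "y \<in> T \<and> openin (top_of_set S) T \<and> (\<exists>v. \<Union>v = C \<inter> p -` T \<and>
       (\<forall>u\<in>v. openin (top_of_set C) u) \<and> pairwise disjnt v \<and> (\<forall>u\<in>v. \<exists>q. homeomorphism u T p q))"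
    by (rule exE)
  obtain v where v: "\<Union>v = C \<inter> p -` T \<and>
       (\<forall>u\<in>v. openin (top_of_set C) u) \<and> pairwise disjnt v \<and> (\<forall>u\<in>v. \<exists>q. homeomorphism u T p q)"
    using T0[THEN conjunct2, THEN conjunct2] by (rule exE)
  note T = T0[THEN conjunct1] T0[THEN conjunct2, THEN conjunct1] v[THEN conjunct1]
    v[THEN conjunct2, THEN conjunct1] v[THEN conjunct2, THEN conjunct2, THEN conjunct1]
    v[THEN conjunct2, THEN conjunct2, THEN conjunct2]
  have sub: "u \<subseteq> C" if "u \<in> v" for u using T(3) that by blast
  define v' where "v' = (\<lambda>u. m' ` u) ` v"
  have o3: "\<Union>v' = C' \<inter> (p \<circ> m) -` T"
  proof -
    have "\<Union>v' = m' ` (C \<inter> p -` T)" unfolding v'_def T(3)[symmetric] by blast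
    also have "\<dots> = C' \<inter> (p \<circ> m) -` T"
    proof (intro set_eqI iffI)
      fix x assume "x \<in> m' ` (C \<inter> p -` T)"
      then obtain z where "z \<in> C" "p z \<in> T" "x = m' z" by blast
      then show "x \<in> C' \<inter> (p \<circ> m) -` T" using m(3) m(5)[of z] by auto
    next
      fix x assume "x \<in> C' \<inter> (p \<circ> m) -` T"
      then have "x \<in> C'" "p (m x) \<in> T" by auto
      then show "x \<in> m' ` (C \<inter> p -` T)"
        using m(2) m(4)[of x] by (intro image_eqI[of _ _ "m x"]) auto
    qed
    finally show ?thesis .
  qed
  have o4: "openin (top_of_set C') u'" if u': "u' \<in> v'" for u'
  proof -
    obtain u where "u \<in> v" "u' = m' ` u" using u' by (auto simp: v'_def)
    then show ?thesis
      using homeomorphism_imp_open_map[OF homeomorphism_symD[OF hom]] T(4) by blast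
  qed
  have o5: "pairwise disjnt v'"
  proof (rule pairwiseI)
    fix a b assume ab: "a \<in> v'" "b \<in> v'" "a \<noteq> b"
    then obtain u w where u: "u \<in> v" "w \<in> v" "a = m' ` u" "b = m' ` w" "u \<noteq> w" by (auto simp: v'_def)
    then have "disjnt u w" using T(5) by (simp add: pairwise_def)
    moreover have "inj_on m' C" using m(5) by (rule inj_on_inverseI)
    ultimately show "disjnt a b" using sub u
      by (auto simp: disjnt_iff dest: inj_onD)
  qed
  have o6: "\<exists>q. homeomorphism u' T (p \<circ> m) q" if u': "u' \<in> v'" for u'
  proof -
    obtain u where u: "u \<in> v" "u' = m' ` u" using u' by (auto simp: v'_def)
    have "homeomorphism u u' m' m"
      by (rule homeomorphism_of_subsets[OF homeomorphism_symD[OF hom] sub[OF u(1)], of C']) (simp_all add: u)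
    then have 1: "homeomorphism u' u m m'" by (rule homeomorphism_symD)
    obtain q where "homeomorphism u T p q" using T(6) u(1) by blast
    from homeomorphism_compose[OF 1 this] show ?thesis by blast
  qed
  show "\<exists>T. y \<in> T \<and> openin (top_of_set S) T \<and> (\<exists>v. \<Union>v = C' \<inter> (p \<circ> m) -` T \<and>
      (\<forall>u\<in>v. openin (top_of_set C') u) \<and> pairwise disjnt v \<and> (\<forall>u\<in>v. \<exists>q. homeomorphism u T (p \<circ> m) q))"
    by (intro exI[of _ T] exI[of _ v'] conjI ballI T(1,2) o3 o4 o5 o6)
qed

lemma hyp_ball_small:
  assumes w: "Im w > 0" and d: "d > 0"
  obtains r where "r > 0" "\<And>z. Im z > 0 \<Longrightarrow> hyp_dist z w < r \<Longrightarrow> dist z w < d"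
proof -
  \<comment> \<open>Chosen so that \<open>c * (Im w + \<rho>)\<close> is at most
    \<open>\<rho>^2\<close> for every \<rho> that is at least \<open>d\<close>; a hyperbolically
    close \<open>z\<close> at such a Euclidean distance \<rho> would give the reverse strict
    inequality.\<close>
  define c where "c = min (d\<^sup>2 / (2 * Im w)) (d / 2)"
  have c: "c > 0" "c * Im w \<le> d\<^sup>2 / 2" "c \<le> d / 2"
  proof -
    show "c > 0" using w d by (simp add: c_def)
    have "c * Im w \<le> d\<^sup>2 / (2 * Im w) * Im w" using w by (intro mult_right_mono) (auto simp: c_def)
    then show "c * Im w \<le> d\<^sup>2 / 2" using w by simp
    show "c \<le> d / 2" by (simp add: c_def)
  qed
  define r where "r = arcosh (1 + c / (2 * Im w))"
  have r: "r > 0" "cosh r = 1 + c / (2 * Im w)" using c w by (auto simp: r_def)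
  have "dist z w < d" if z: "Im z > 0" "hyp_dist z w < r" for z
  proof (rule ccontr)
    define \<rho> where "\<rho> = dist z w"
    assume "\<not> dist z w < d"
    then have \<rho>: "\<rho> \<ge> d" by (simp add: \<rho>_def)
    have "cosh (hyp_dist z w) < cosh r"
      using hyp_dist_nonneg[OF z(1) w] z(2) r(1) by (simp add: cosh_real_nonneg_less_iff)
    then have "\<rho>\<^sup>2 / (2 * Im z * Im w) < c / (2 * Im w)"
      using cosh_hyp_dist[OF z(1) w] r by (simp add: \<rho>_def)
    then have "\<rho>\<^sup>2 < c * Im z" using z w by (simp add: field_simps)
    also have "Im z \<le> Im w + \<rho>"
      using abs_Im_le_cmod[of "z - w"] by (simp add: \<rho>_def dist_norm)
    then have "c * Im z \<le> c * (Im w + \<rho>)" using c by (intro mult_left_mono) auto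
    also have "\<dots> \<le> d\<^sup>2 / 2 + d / 2 * \<rho>" using c(2) mult_right_mono[OF c(3) order_trans[OF less_imp_le[OF d] \<rho>]] by (simp add: distrib_left)
    also have "\<dots> \<le> \<rho>\<^sup>2"
    proof -
      have "d * d \<le> \<rho> * \<rho>" "d * \<rho> \<le> \<rho> * \<rho>" using \<rho> d by (auto intro: mult_mono)
      then show ?thesis by (simp add: power2_eq_square)
    qed
    finally show False by simp
  qed
  then show ?thesis using that r(1) by blast
qed

section \<open>Deck transformations as isometries, distance on the surface, geodesics\<close>

context compact_hyperbolic_surface
begin

lemma deck_is_moebius:
  assumes g: "deck_transformation \<pi> g" shows "is_moebius g"
proof -
  obtain h where h: "deck_transformation \<pi> h" "\<And>z. z \<in> H \<Longrightarrow> h (g z) = z" "\<And>z. z \<in> H \<Longrightarrow> g (h z) = z"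
    using deck_inverse[OF g] by auto
  show ?thesis
    using deck_holo[OF g] deck_in[OF g] deck_holo[OF h(1)] deck_in[OF h(1)] h(2,3)
    by (intro half_plane_automorphism_moebius[of g h]) auto
qed

text \<open>An elliptic transformation has a fixed point in the half-plane, but a deck
  transformation with a fixed point is the identity, whose trace is 2 or -2.\<close>

lemma deck_trace:
  assumes g: "deck_transformation \<pi> g" and det: "a * d - b * c = 1"
    and eq: "\<And>z. Im z > 0 \<Longrightarrow> g z = moebius a b c d z"
  shows "\<bar>a + d\<bar> \<ge> 2"
proof (rule ccontr)
  assume neg: "\<not> ?thesis"
  then obtain z where z: "Im z > 0" "moebius a b c d z = z" using elliptic_fixpoint[OF det] by auto
  then have "g w = w" if "Im w > 0" for w
    using deck_fixpoint[OF g, of z w] eq that by simp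
  then have "\<bar>a + d\<bar> = 2" by (intro moebius_identity_trace[OF det]) (simp add: eq[symmetric])
  then show False using neg by simp
qed

text \<open>Near the limit \<open>w\<close> the covering map is injective, while all points of the
  orbit have the same image; late members of the sequence would coincide.\<close>

lemma deck_orbit_discrete:
  assumes h: "\<And>n::nat. deck_transformation \<pi> (h n)" and z: "Im z > 0" and w: "Im w > 0"
    and lim: "(\<lambda>n. h n z) \<longlonglongrightarrow> w" and ne: "\<And>n. h (Suc n) z \<noteq> h n z"
  shows False
proof -
  obtain e where e: "e > 0" "ball w e \<subseteq> H" "inj_on \<pi> (ball w e)" using local_inj[of w] w by auto
  have "eventually (\<lambda>n. dist (h n z) w < e) sequentially" using lim e(1) tendstoD by blast
  then obtain N where N: "\<And>n. n \<ge> N \<Longrightarrow> h n z \<in> ball w e" by (auto simp: eventually_sequentially dist_commute)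
  have "\<pi> (h (Suc N) z) = \<pi> (h N z)" using deck_pi[OF h] z by simp
  then have "h (Suc N) z = h N z" using e(3) N[of N] N[of "Suc N"] by (auto dest: inj_onD)
  then show False using ne by blast
qed

lemma surf_dist_bdd: "bdd_below {hyp_dist z w |z w. z \<in> H \<and> w \<in> H \<and> \<pi> z = p \<and> \<pi> w = q}"
  by (rule bdd_belowI[of _ 0]) (auto intro: hyp_dist_nonneg)

lemma surf_dist_le:
  assumes "z \<in> H" "w \<in> H" shows "surf_dist \<pi> (\<pi> z) (\<pi> w) \<le> hyp_dist z w"
  unfolding surf_dist_def by (rule cInf_lower[OF _ surf_dist_bdd]) (use assms in blast)

lemma surf_dist_nonneg:
  assumes "p \<in> S" "q \<in> S" shows "surf_dist \<pi> p q \<ge> 0"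
proof -
  obtain z w where "z \<in> H" "\<pi> z = p" "w \<in> H" "\<pi> w = q" using assms lift_cases by metis
  then show ?thesis unfolding surf_dist_def by (intro cInf_greatest) (auto intro: hyp_dist_nonneg)
qed

text \<open>The infimum runs over both lifts. Deck transformations are isometries, so the second
  lift can be moved to the prescribed \<open>w\<close>.\<close>

lemma surf_dist_less:
  assumes p: "p \<in> S" and w: "w \<in> H" and less: "surf_dist \<pi> p (\<pi> w) < r"
  obtains z where "z \<in> H" "\<pi> z = p" "hyp_dist z w < r"
proof -
  obtain z0 where "z0 \<in> H" "\<pi> z0 = p" using p lift_cases by metis
  then have "{hyp_dist z w' |z w'. z \<in> H \<and> w' \<in> H \<and> \<pi> z = p \<and> \<pi> w' = \<pi> w} \<noteq> {}" using w by blast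
  from cInf_lessD[OF this less[unfolded surf_dist_def]]
  obtain z w' where zw: "z \<in> H" "w' \<in> H" "\<pi> z = p" "\<pi> w' = \<pi> w" "hyp_dist z w' < r" by auto
  obtain g where g: "deck_transformation \<pi> g" "g w' = w" using deck_exists[OF zw(2) w zw(4)] .
  have "hyp_dist (g z) w = hyp_dist z w'"
    using hyp_dist_moebius[OF deck_is_moebius[OF g(1)], of z w'] zw g(2) by simp
  then show ?thesis using that[of "g z"] zw deck_in[OF g(1) zw(1)] deck_pi[OF g(1) zw(1)] by simp
qed

text \<open>A lift \<open>u'\<close> of \<open>\<pi> u\<close> closer to \<open>v\<close> than
  \<open>u\<close> would also be close in the Euclidean sense and lie in the disc on which
  \<open>\<pi>\<close> is injective, so it would be \<open>u\<close>.\<close>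

lemma surf_dist_local:
  assumes z: "z \<in> H"
  obtains e where "e > 0" "\<And>u v. u \<in> ball z e \<Longrightarrow> v \<in> ball z e \<Longrightarrow> surf_dist \<pi> (\<pi> u) (\<pi> v) = hyp_dist u v"
proof -
  obtain E where E: "E > 0" "ball z E \<subseteq> H" "inj_on \<pi> (ball z E)" using local_inj[OF z] .
  define y where "y = Im z"
  have y: "y > 0" using z by (simp add: y_def)
  \<comment> \<open>Factor 6: the point \<open>u'\<close> turns out to be within
    \<open>5 * e\<close> of \<open>v\<close>, which is within \<open>e\<close> of \<open>z\<close>.
    Factor 16: \<open>8 * e\<close> is at most \<open>y / 2\<close>, which absorbs a term of the
    quadratic inequality for \<rho>.\<close>
  define e where "e = min (E / 6) (y / 16)"
  have e: "e > 0" "6 * e \<le> E" "16 * e \<le> y" using E y by (auto simp: e_def)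
  have sub: "ball z e \<subseteq> ball z E" using e by (intro subset_ball) auto
  have "surf_dist \<pi> (\<pi> u) (\<pi> v) = hyp_dist u v" if u: "u \<in> ball z e" and v: "v \<in> ball z e" for u v
  proof (rule antisym)
    have uvH: "u \<in> H" "v \<in> H" using u v sub E(2) by blast+
    show "surf_dist \<pi> (\<pi> u) (\<pi> v) \<le> hyp_dist u v" using surf_dist_le uvH .
    show "hyp_dist u v \<le> surf_dist \<pi> (\<pi> u) (\<pi> v)"
    proof (rule ccontr)
      assume "\<not> ?thesis"
      then obtain u' where u': "u' \<in> H" "\<pi> u' = \<pi> u" "hyp_dist u' v < hyp_dist u v"
        using surf_dist_less[OF pi_in[OF uvH(1)] uvH(2), of "hyp_dist u v"] by auto
      define \<rho> where "\<rho> = dist u' v"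
      have Imu: "Im u \<ge> y / 2" "Im v \<le> 2 * y"
        using u v e abs_Im_le_cmod[of "u - z"] abs_Im_le_cmod[of "v - z"] y
        by (auto simp: dist_norm y_def norm_minus_commute)
      have pos: "Im u > 0" "Im v > 0" "Im u' > 0" using uvH u' by auto
      have duv: "dist u v < 2 * e" using u v by (metis dist_triangle_half_l mem_ball dist_commute mult_2 add_strict_mono order_le_less_trans dist_triangle)
      have "cosh (hyp_dist u' v) < cosh (hyp_dist u v)"
        using u'(3) hyp_dist_nonneg pos by (simp add: cosh_real_nonneg_less_iff)
      then have "\<rho>\<^sup>2 / (2 * Im u' * Im v) < (dist u v)\<^sup>2 / (2 * Im u * Im v)"
        using pos by (simp add: cosh_hyp_dist \<rho>_def)
      then have 1: "\<rho>\<^sup>2 * Im u < (dist u v)\<^sup>2 * Im u'" using pos by (simp add: field_simps)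
      have "\<rho>\<^sup>2 * (y / 2) \<le> \<rho>\<^sup>2 * Im u" using Imu by (intro mult_left_mono) auto
      also note 1
      also have "(dist u v)\<^sup>2 * Im u' \<le> (2 * e)\<^sup>2 * (2 * y + \<rho>)"
      proof (intro mult_mono power_mono)
        show "Im u' \<le> 2 * y + \<rho>"
          using abs_Im_le_cmod[of "u' - v"] Imu by (simp add: \<rho>_def dist_norm)
      qed (use duv e pos in auto)
      finally have "\<rho>\<^sup>2 * y < 16 * e\<^sup>2 * y + 8 * e * (e * \<rho>)"
        by (simp add: power2_eq_square algebra_simps)
      also have "8 * e * (e * \<rho>) \<le> (y / 2) * (e * \<rho>)"
        using e by (intro mult_right_mono) (auto simp: \<rho>_def)
      finally have "y * \<rho>\<^sup>2 < y * (16 * e\<^sup>2 + e * \<rho> / 2)" by (simp add: algebra_simps)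
      then have 2: "\<rho>\<^sup>2 < 16 * e\<^sup>2 + e * \<rho> / 2" using y by simp
      have "\<rho> < 5 * e"
      proof (rule ccontr)
        assume "\<not> ?thesis"
        then have r: "5 * e \<le> \<rho>" by simp
        have "(5 * e) * \<rho> \<le> \<rho> * \<rho>" "e * (5 * e) \<le> e * \<rho>"
          using r e by (intro mult_right_mono mult_left_mono; simp add: \<rho>_def)+
        moreover have "0 \<le> e * e" by simp
        ultimately have "16 * (e * e) + e * \<rho> / 2 \<le> \<rho> * \<rho>" by linarith
        then have "16 * e\<^sup>2 + e * \<rho> / 2 \<le> \<rho>\<^sup>2" by (simp add: power2_eq_square)
        then show False using 2 by simp
      qed
      then have "dist u' z < E"
        using dist_triangle[of u' z v] v e by (simp add: \<rho>_def dist_commute)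
      then have "u' \<in> ball z E" by (simp add: dist_commute)
      then have "u' = u" using inj_onD[OF E(3) u'(2)] subsetD[OF sub u] by blast
      then show False using u'(3) by simp
    qed
  qed
  then show ?thesis using that e(1) by blast
qed

text \<open>The topology of \<open>'a\<close> is not defined by \<open>surf_dist\<close>. A point of
  the surface at small distance from \<open>\<gamma> t\<close> has a lift near a given lift of
  \<open>\<gamma> t\<close>, and continuity of \<open>\<pi>\<close> does the rest.\<close>

lemma geodesic_continuous:
  assumes \<gamma>: "unit_speed_geodesic S \<pi> \<gamma>"
  shows "continuous_on UNIV \<gamma>"
proof (rule continuous_at_imp_continuous_on, rule ballI)
  fix t :: real
  have rng: "\<gamma> s \<in> S" for s using \<gamma> by (auto simp: unit_speed_geodesic_def)
  obtain e where e: "e > 0" "\<And>r s. r \<in> {t-e<..<t+e} \<Longrightarrow> s \<in> {t-e<..<t+e} \<Longrightarrow> surf_dist \<pi> (\<gamma> r) (\<gamma> s) = \<bar>r - s\<bar>"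
    using \<gamma> unfolding unit_speed_geodesic_def by metis
  obtain w where w: "w \<in> H" "\<pi> w = \<gamma> t" using rng lift_cases by metis
  show "isCont \<gamma> t"
    unfolding continuous_at_open
  proof (intro allI impI)
    fix V assume V: "open V \<and> \<gamma> t \<in> V"
    have "open (H \<inter> \<pi> -` V)"
      using continuous_open_preimage[OF pi_cont open_upper_half_plane] V by blast
    moreover have "w \<in> H \<inter> \<pi> -` V" using w V by simp
    ultimately obtain d where d: "d > 0" "ball w d \<subseteq> H \<inter> \<pi> -` V" using open_contains_ball by blast
    obtain r where r: "r > 0" "\<And>z. Im z > 0 \<Longrightarrow> hyp_dist z w < r \<Longrightarrow> dist z w < d"
      using hyp_ball_small[of w d] w(1) d(1) by auto
    have "\<gamma> s \<in> V" if s: "s \<in> ball t (min e r)" for s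
    proof -
      have "surf_dist \<pi> (\<gamma> s) (\<pi> w) = \<bar>s - t\<bar>"
        using e(2)[of s t] s e(1) w(2) by (auto simp: dist_real_def abs_less_iff)
      then have "surf_dist \<pi> (\<gamma> s) (\<pi> w) < r" using s by (simp add: dist_real_def abs_minus_commute)
      from surf_dist_less[OF rng w(1) this]
      obtain z where z: "z \<in> H" "\<pi> z = \<gamma> s" "hyp_dist z w < r" .
      then have "z \<in> ball w d" using r(2)[of z] by (simp add: dist_commute)
      then show ?thesis using d(2) z(2) by auto
    qed
    moreover have "open (ball t (min e r))" "t \<in> ball t (min e r)" using e(1) r(1) by auto
    ultimately show "\<exists>U. open U \<and> t \<in> U \<and> (\<forall>s\<in>U. \<gamma> s \<in> V)" by blast
  qed
qed

text \<open>After replacing the covering map by its composition with an isometry, the geodesic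
  is the image of the imaginary axis.\<close>

lemma geodesic_lift_axis:
  assumes \<gamma>: "unit_speed_geodesic S \<pi> \<gamma>"
  obtains m where "is_moebius m" "\<And>t. \<pi> (m (\<i> * of_real (exp t))) = \<gamma> t"
proof -
  have rng: "\<gamma> s \<in> S" for s using \<gamma> by (auto simp: unit_speed_geodesic_def)
  obtain w where w: "w \<in> H" "\<pi> w = \<gamma> 0" using rng lift_cases by metis
  obtain \<Gamma> where \<Gamma>: "continuous_on UNIV \<Gamma>" "\<Gamma> \<in> UNIV \<rightarrow> H" "\<Gamma> 0 = w" "\<And>t. t \<in> UNIV \<Longrightarrow> \<pi> (\<Gamma> t) = \<gamma> t"
  proof (rule compact_covering_space_lift[OF covering open_upper_half_plane compact w(1), of 0 UNIV \<gamma>])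
    show "simply_connected (UNIV :: real set)" by (simp add: convex_imp_simply_connected)
    show "locally path_connected (UNIV :: real set)" by (simp add: convex_imp_locally_path_connected)
  qed (use geodesic_continuous[OF \<gamma>] rng w in auto)
  have \<Gamma>H: "Im (\<Gamma> t) > 0" for t using \<Gamma>(2) by auto
  have loc: "\<exists>e>0. \<forall>r\<in>ball t e. \<forall>s\<in>ball t e. hyp_dist (\<Gamma> r) (\<Gamma> s) = \<bar>r - s\<bar>" for t
  proof -
    obtain e where e: "e > 0" "\<And>r s. r \<in> {t-e<..<t+e} \<Longrightarrow> s \<in> {t-e<..<t+e} \<Longrightarrow> surf_dist \<pi> (\<gamma> r) (\<gamma> s) = \<bar>r - s\<bar>"
      using \<gamma> unfolding unit_speed_geodesic_def by metis
    obtain d where d: "d > 0" "\<And>u v. u \<in> ball (\<Gamma> t) d \<Longrightarrow> v \<in> ball (\<Gamma> t) d \<Longrightarrow> surf_dist \<pi> (\<pi> u) (\<pi> v) = hyp_dist u v"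
      using surf_dist_local[of "\<Gamma> t"] \<Gamma>H by auto
    have "isCont \<Gamma> t" using \<Gamma>(1) by (simp add: continuous_on_eq_continuous_at)
    then obtain e' where e': "e' > 0" "\<And>s. dist s t < e' \<Longrightarrow> dist (\<Gamma> s) (\<Gamma> t) < d"
      using d(1) unfolding continuous_at_eps_delta by metis
    have "hyp_dist (\<Gamma> r) (\<Gamma> s) = \<bar>r - s\<bar>" if "r \<in> ball t (min e e')" "s \<in> ball t (min e e')" for r s
    proof -
      have "\<Gamma> r \<in> ball (\<Gamma> t) d" "\<Gamma> s \<in> ball (\<Gamma> t) d" using that e'(2)[of r] e'(2)[of s] by (auto simp: dist_commute)
      from d(2)[OF this] have "hyp_dist (\<Gamma> r) (\<Gamma> s) = surf_dist \<pi> (\<gamma> r) (\<gamma> s)" using \<Gamma>(4) by simp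
      also have "\<dots> = \<bar>r - s\<bar>" using that by (intro e(2)) (auto simp: dist_real_def abs_less_iff)
      finally show ?thesis .
    qed
    then show ?thesis using e(1) e'(1) by (intro exI[of _ "min e e'"]) auto
  qed
  obtain e where e: "e > 0" "\<And>r s. r \<in> ball 0 e \<Longrightarrow> s \<in> ball 0 e \<Longrightarrow> hyp_dist (\<Gamma> r) (\<Gamma> s) = \<bar>r - s\<bar>"
    using loc[of 0] by blast
  define s0 where "s0 = e / 2"
  have s0: "s0 > 0" "s0 \<in> ball 0 e" "0 \<in> ball 0 e" using e(1) by (auto simp: s0_def)
  have "hyp_dist (\<Gamma> 0) (\<Gamma> s0) = s0" using e(2)[OF s0(3,2)] s0(1) by simp
  from moebius_i_pair[OF \<Gamma>H \<Gamma>H this s0(1)]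
  obtain m where m: "is_moebius m" "m \<i> = \<Gamma> 0" "m (\<i> * of_real (exp s0)) = \<Gamma> s0" .
  obtain m' where m': "is_moebius m'" "\<And>z. Im z > 0 \<Longrightarrow> m' (m z) = z" "\<And>z. Im z > 0 \<Longrightarrow> m (m' z) = z"
    using is_moebius_inverse[OF m(1)] by auto
  define G where "G t = m' (\<Gamma> t)" for t
  have GH: "Im (G t) > 0" for t unfolding G_def using is_moebius_in[OF m'(1) \<Gamma>H] .
  have G0: "G 0 = \<i> * of_real (exp 0)" "G s0 = \<i> * of_real (exp s0)"
    using m'(2)[of \<i>] m'(2)[of "\<i> * of_real (exp s0)"] by (simp_all add: G_def m(2,3)[symmetric])
  have locG: "\<exists>e>0. \<forall>r\<in>ball t e. \<forall>s\<in>ball t e. hyp_dist (G r) (G s) = \<bar>r - s\<bar>" for t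
    using loc[of t] hyp_dist_moebius[OF m'(1) \<Gamma>H \<Gamma>H] by (simp add: G_def)
  \<comment> \<open>The times around which the lift runs along the axis. This set is nonempty, open
    and closed: on an interval where distances are realized, two points on the axis determine all
    others by \<open>axis_point_determined\<close>.\<close>
  define X where "X = {t. \<exists>d>0. \<forall>s\<in>ball t d. G s = \<i> * of_real (exp s)}"
  have "open X"
  proof (subst open_contains_ball, rule ballI)
    fix t assume "t \<in> X"
    then obtain d where d: "d > 0" "\<forall>s\<in>ball t d. G s = \<i> * of_real (exp s)" by (auto simp: X_def)
    have "t' \<in> X" if "t' \<in> ball t d" for t'
    proof -
      obtain d' where "d' > 0" "ball t' d' \<subseteq> ball t d" using \<open>t' \<in> ball t d\<close> open_ball open_contains_ball by blast
      then show ?thesis using d(2) by (auto simp: X_def)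
    qed
    then show "\<exists>e>0. ball t e \<subseteq> X" using d(1) by blast
  qed
  have nbh: "t \<in> X" if d: "d > 0" "\<And>r s. r \<in> ball t d \<Longrightarrow> s \<in> ball t d \<Longrightarrow> hyp_dist (G r) (G s) = \<bar>r - s\<bar>"
    and rs: "r \<in> ball t d" "s \<in> ball t d" "r \<noteq> s" "G r = \<i> * of_real (exp r)" "G s = \<i> * of_real (exp s)" for t d r s
  proof -
    have "G x = \<i> * of_real (exp x)" if "x \<in> ball t d" for x
      by (rule axis_point_determined[OF GH rs(3)])
        (use d(2)[OF that rs(1)] d(2)[OF that rs(2)] rs(4,5) in simp_all)
    then show ?thesis using d(1) by (auto simp: X_def)
  qed
  have "0 \<in> X"
  proof -
    have "hyp_dist (G r) (G s) = \<bar>r - s\<bar>" if "r \<in> ball 0 e" "s \<in> ball 0 e" for r s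
      using e(2)[OF that] hyp_dist_moebius[OF m'(1) \<Gamma>H \<Gamma>H] by (simp add: G_def)
    then show ?thesis using nbh[OF e(1) _ s0(3,2)] s0(1) G0 by simp
  qed
  have "closed X"
    unfolding closed_limpt
  proof (intro allI impI)
    fix t assume t: "t islimpt X"
    obtain d where d: "d > 0" "\<And>r s. r \<in> ball t d \<Longrightarrow> s \<in> ball t d \<Longrightarrow> hyp_dist (G r) (G s) = \<bar>r - s\<bar>"
      using locG[of t] by blast
    obtain x where x: "x \<in> X" "x \<in> ball t d"
      using t d(1) unfolding islimpt_approachable by (metis dist_commute mem_ball)
    then obtain d' where d': "d' > 0" "\<forall>s\<in>ball x d'. G s = \<i> * of_real (exp s)" by (auto simp: X_def)
    obtain d'' where d'': "d'' > 0" "ball x d'' \<subseteq> ball t d" using x(2) open_ball open_contains_ball by blast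
    define x' where "x' = x + min d' d'' / 2"
    have "x' \<in> ball x d'" "x' \<in> ball x d''" "x' \<noteq> x"
      using d'(1) d''(1) by (auto simp: x'_def dist_real_def)
    then show "t \<in> X" using nbh[OF d x(2), of x'] d' d'' by auto
  qed
  with \<open>open X\<close> \<open>0 \<in> X\<close> have "X = UNIV" using clopen by blast
  then have "G t = \<i> * of_real (exp t)" for t
  proof -
    have "t \<in> X" using \<open>X = UNIV\<close> by simp
    then show ?thesis by (auto simp: X_def)
  qed
  then have "\<pi> (m (\<i> * of_real (exp t))) = \<gamma> t" for t
    using m'(3)[OF \<Gamma>H, of t] \<Gamma>(4)[of t] by (simp add: G_def)
  then show ?thesis using that m(1) by blast
qed

lemma moebius_homeomorphism:
  assumes "is_moebius m"
  obtains m' where "is_moebius m'" "homeomorphism H H m m'" "\<And>z. Im z > 0 \<Longrightarrow> m' (m z) = z" "\<And>z. Im z > 0 \<Longrightarrow> m (m' z) = z"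
proof -
  obtain m' where m': "is_moebius m'" "\<And>z. Im z > 0 \<Longrightarrow> m' (m z) = z" "\<And>z. Im z > 0 \<Longrightarrow> m (m' z) = z"
    using is_moebius_inverse[OF assms] by auto
  have "homeomorphism H H m m'"
    by (rule homeomorphismI)
      (use assms m' is_moebius_in is_moebius_holomorphic holomorphic_on_imp_continuous_on in auto)
  then show ?thesis using that m' by blast
qed

text \<open>Lifts are relabelled by an isometry, so distances on the surface are unchanged; this
  permits the normalization of the geodesic.\<close>

lemma precompose_moebius:
  assumes m: "is_moebius m"
  shows "compact_hyperbolic_surface S A (\<pi> \<circ> m)" "surf_dist (\<pi> \<circ> m) = surf_dist \<pi>"
proof -
  obtain m' where m': "is_moebius m'" "homeomorphism H H m m'" "\<And>z. Im z > 0 \<Longrightarrow> m' (m z) = z" "\<And>z. Im z > 0 \<Longrightarrow> m (m' z) = z"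
    using moebius_homeomorphism[OF m] by auto
  have "(snd c \<circ> (\<pi> \<circ> m)) holomorphic_on (H \<inter> (\<pi> \<circ> m) -` fst c)" if "c \<in> A" for c
  proof -
    have "((snd c \<circ> \<pi>) \<circ> m) holomorphic_on (H \<inter> (\<pi> \<circ> m) -` fst c)"
      by (rule holomorphic_on_compose_gen[OF _ chart_lift_holomorphic[OF that]])
        (use is_moebius_holomorphic[OF m] is_moebius_in[OF m] in \<open>auto intro: holomorphic_on_subset\<close>)
    then show ?thesis by (simp add: o_assoc)
  qed
  then show "compact_hyperbolic_surface S A (\<pi> \<circ> m)"
    using surface compact covering_space_precompose_homeomorphism[OF covering m'(2)]
    by unfold_locales (auto simp: hyperbolic_riemann_surface_def)
  have "{hyp_dist z w |z w. z \<in> H \<and> w \<in> H \<and> (\<pi> \<circ> m) z = p \<and> (\<pi> \<circ> m) w = q}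
      = {hyp_dist z w |z w. z \<in> H \<and> w \<in> H \<and> \<pi> z = p \<and> \<pi> w = q}" for p q
  proof (intro set_eqI iffI)
    fix r assume "r \<in> {hyp_dist z w |z w. z \<in> H \<and> w \<in> H \<and> (\<pi> \<circ> m) z = p \<and> (\<pi> \<circ> m) w = q}"
    then obtain z w where zw: "r = hyp_dist z w" "Im z > 0" "Im w > 0" "\<pi> (m z) = p" "\<pi> (m w) = q" by auto
    show "r \<in> {hyp_dist z w |z w. z \<in> H \<and> w \<in> H \<and> \<pi> z = p \<and> \<pi> w = q}"
      by (intro CollectI exI[of _ "m z"] exI[of _ "m w"] conjI)
        (simp_all add: zw hyp_dist_moebius[OF m zw(2,3)] is_moebius_in[OF m])
  next
    fix r assume "r \<in> {hyp_dist z w |z w. z \<in> H \<and> w \<in> H \<and> \<pi> z = p \<and> \<pi> w = q}"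
    then obtain z w where zw: "r = hyp_dist z w" "Im z > 0" "Im w > 0" "\<pi> z = p" "\<pi> w = q" by auto
    show "r \<in> {hyp_dist z w |z w. z \<in> H \<and> w \<in> H \<and> (\<pi> \<circ> m) z = p \<and> (\<pi> \<circ> m) w = q}"
      by (intro CollectI exI[of _ "m' z"] exI[of _ "m' w"] conjI)
        (simp_all add: zw hyp_dist_moebius[OF m'(1) zw(2,3)] is_moebius_in[OF m'(1)] m'(4))
  qed
  then show "surf_dist (\<pi> \<circ> m) = surf_dist \<pi>" by (simp add: surf_dist_def fun_eq_iff)
qed

end

section \<open>The collar theorem\<close>

text \<open>The closed geodesic is normalized to be the image of the imaginary axis.\<close>

locale collar_surface = compact_hyperbolic_surface S A \<pi>
  for S :: "'a::t2_space set" and A :: "'a chart set" and \<pi> :: "complex \<Rightarrow> 'a" +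
  fixes L :: real
  assumes L_pos: "L > 0"
    and translation: "\<And>z. z \<in> upper_half_plane \<Longrightarrow> \<pi> (of_real (exp L) * z) = \<pi> z"
    and axis_simple: "\<And>s t. s > 0 \<Longrightarrow> t > 0 \<Longrightarrow> \<pi> (\<i> * of_real s) = \<pi> (\<i> * of_real t) \<Longrightarrow>
        \<exists>k::int. t = s * exp (of_int k * L)"
begin

definition shift :: "int \<Rightarrow> complex \<Rightarrow> complex" where
  "shift k z = of_real (exp (of_int k * L)) * z"

lemma Im_shift: "Im (shift k z) = exp (of_int k * L) * Im z"
  and Re_shift: "Re (shift k z) = exp (of_int k * L) * Re z"
  by (simp_all add: shift_def)

lemma shift_in_iff: "Im (shift k z) > 0 \<longleftrightarrow> Im z > 0"
  by (simp add: Im_shift zero_less_mult_iff)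

lemma pi_shift: "Im z > 0 \<Longrightarrow> \<pi> (shift k z) = \<pi> z"
proof -
  have nat: "\<pi> (shift (int n) z) = \<pi> z" if "Im z > 0" for n z
  proof (induction n)
    case (Suc n)
    have "shift (int (Suc n)) z = of_real (exp L) * shift (int n) z"
      by (simp add: shift_def distrib_right exp_add)
    then show ?case using translation[of "shift (int n) z"] Suc that by (simp add: shift_in_iff)
  qed (simp add: shift_def)
  assume z: "Im z > 0"
  show ?thesis
  proof (cases "k \<ge> 0")
    case True
    then show ?thesis using nat[OF z, of "nat k"] by simp
  next
    case False
    have "shift (int (nat (- k))) (shift k z) = z"
      using False by (simp add: shift_def mult.assoc[symmetric] of_real_mult[symmetric] exp_add[symmetric] del: of_real_mult)
    then show ?thesis using nat[of "shift k z" "nat (- k)"] z by (simp add: shift_in_iff)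
  qed
qed

lemma deck_shift: "deck_transformation \<pi> (shift k)"
  using pi_shift unfolding deck_transformation_def
  by (auto simp: shift_def[abs_def] intro!: holomorphic_intros)

text \<open>By simplicity of the geodesic the two axis points differ by a power of the translation,
  and deck transformations that agree at one point are equal.\<close>

lemma deck_axis:
  assumes g: "deck_transformation \<pi> g" and st: "s > 0" "t > 0" and eq: "g (\<i> * of_real s) = \<i> * of_real t"
  obtains k where "\<And>z. Im z > 0 \<Longrightarrow> g z = shift k z"
proof -
  have "\<pi> (\<i> * of_real s) = \<pi> (\<i> * of_real t)"
    using deck_pi[OF g, of "\<i> * of_real s"] st eq by simp
  then obtain k :: int where k: "t = s * exp (of_int k * L)" using axis_simple st by blast
  have "g z = shift k z" if "Im z > 0" for z
    by (rule deck_unique[OF g deck_shift, of "\<i> * of_real s"])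
      (use st that in \<open>simp_all add: eq k shift_def\<close>)
  then show ?thesis using that by blast
qed

text \<open>The orbit points are written as a function of \<open>exp (- (real n * L))\<close>, which
  tends to 0; the value at 0 is their limit. If it lies in the half-plane, discreteness of the orbit
  is violated. Injectivity keeps consecutive points distinct.\<close>

lemma deck_no_accumulation:
  assumes g: "deck_transformation \<pi> g"
    and F: "\<And>n. shift (j * int n) (g (shift (k * int n) \<i>)) = F (exp (- (real n * L)))"
    and cont: "isCont F 0" and pos: "Im (F 0) > 0" and inj: "inj_on F {0<..}"
  shows False
proof (rule deck_orbit_discrete[where h="\<lambda>n z. shift (j * int n) (g (shift (k * int n) z))" and z=\<i> and w="F 0"])
  show "deck_transformation \<pi> (\<lambda>z. shift (j * int n) (g (shift (k * int n) z)))" for n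
    by (rule deck_compose[OF deck_shift deck_compose[OF g deck_shift]])
  have "(\<lambda>n. exp (- (real n * L))) \<longlonglongrightarrow> 0"
  proof -
    have "(\<lambda>n. exp (- L) ^ n) \<longlonglongrightarrow> 0" using L_pos by (intro LIMSEQ_realpow_zero) auto
    then show ?thesis by (simp add: exp_of_nat_mult[symmetric])
  qed
  then show "(\<lambda>n. shift (j * int n) (g (shift (k * int n) \<i>))) \<longlonglongrightarrow> F 0"
    unfolding F by (rule isCont_tendsto_compose[OF cont])
  show "shift (j * int (Suc n)) (g (shift (k * int (Suc n)) \<i>)) \<noteq> shift (j * int n) (g (shift (k * int n) \<i>))" for n
  proof
    assume "shift (j * int (Suc n)) (g (shift (k * int (Suc n)) \<i>)) = shift (j * int n) (g (shift (k * int n) \<i>))"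
    then have "exp (- (real (Suc n) * L)) = exp (- (real n * L))"
      unfolding F using inj by (auto dest: inj_onD)
    then show False using L_pos by simp
  qed
qed (use pos in auto)

text \<open>Simplicity of the geodesic makes the translates of its axis disjoint; a common endpoint at
  infinity is excluded by the accumulation of an orbit.\<close>

lemma deck_disjoint_axes:
  assumes g: "deck_transformation \<pi> g" and det: "a * d - b * c = 1"
    and eq: "\<And>z. Im z > 0 \<Longrightarrow> g z = moebius a b c d z"
    and nt: "\<And>k. \<exists>z. Im z > 0 \<and> g z \<noteq> shift k z"
  shows "(b * c) * (1 + b * c) > 0"
proof -
  let ?P = "a * c" and ?Q = "b * d"
  \<comment> \<open>\<open>?P * s\<^sup>2 + ?Q\<close> is the numerator of the real part of
    \<open>g (\<i> * of_real s)\<close>; a zero means that the translated axis meets the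
    axis.\<close>
  have ne: "?P * s\<^sup>2 + ?Q \<noteq> 0" if s: "s > 0" for s
  proof
    assume "?P * s\<^sup>2 + ?Q = 0"
    then have "Re (g (\<i> * of_real s)) = 0"
      using moebius_components(3)[OF det, of "\<i> * of_real s"] s by (simp add: eq norm_mult)
    moreover have "Im (g (\<i> * of_real s)) > 0" using deck_in[OF g, of "\<i> * of_real s"] s by simp
    ultimately obtain k where "\<And>z. Im z > 0 \<Longrightarrow> g z = shift k z"
      using deck_axis[OF g s, of "Im (g (\<i> * of_real s))"] by (auto simp: complex_eq_iff)
    then show False using nt[of k] by auto
  qed
  have img: "shift (j * int n) (g (shift (k * int n) \<i>)) =
      of_real (exp (of_int j * (real n * L))) * (of_real (a * exp (of_int k * (real n * L))) * \<i> + of_real b)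
       / (of_real (c * exp (of_int k * (real n * L))) * \<i> + of_real d)" for j k n
    by (subst eq) (simp_all add: shift_in_iff, simp add: shift_def moebius_def mult.assoc)
  have ex: "exp (real n * L) * exp (- (real n * L)) = 1" for n by (simp add: exp_add[symmetric])
  have ad: "a * d = 1 + b * c" using det by simp
  \<comment> \<open>The image of the axis ends at \<open>a / c\<close> and \<open>b / d\<close>.
    Here the end \<open>a / c\<close> is infinity or 0, in the next claim the end
    \<open>b / d\<close> is 0 or infinity. In each of the four cases, powers of the translation on
    both sides of \<open>g\<close>, with signs according to the common end, produce orbit points
    that converge inside the half-plane.\<close>
  have "\<not> (?P = 0 \<and> ?Q \<noteq> 0)"
  proof
    assume *: "?P = 0 \<and> ?Q \<noteq> 0"
    then have "a = 0 \<or> c = 0" by simp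
    then show False
    proof
      assume c: "c = 0"
      then have ad: "a * d = 1" and d: "d \<noteq> 0" and b: "b \<noteq> 0" using det * by auto
      show False
      proof (rule deck_no_accumulation[OF g, of "-1" 1 "\<lambda>\<epsilon>. (of_real a * \<i> + of_real (b * \<epsilon>)) / of_real d"])
        fix n
        let ?e = "exp (- (real n * L))" and ?f = "exp (real n * L)"
        have "of_real ?e * (of_real (a * ?f) * \<i> + of_real b) = (of_real (a * (?f * ?e)) * \<i> + of_real (b * ?e) :: complex)"
          by (simp add: algebra_simps)
        then show "shift (- 1 * int n) (g (shift (1 * int n) \<i>)) = (of_real a * \<i> + of_real (b * ?e)) / of_real d"
          unfolding img by (simp add: c ex)
        show "isCont (\<lambda>\<epsilon>. (of_real a * \<i> + of_real (b * \<epsilon>)) / of_real d) 0"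
          using d by (intro continuous_intros) auto
        have "a * d > 0" using ad by simp
        then have "a / d > 0" by (simp add: zero_less_mult_iff zero_less_divide_iff)
        then show "Im ((of_real a * \<i> + of_real (b * 0)) / of_real d) > 0"
          by (simp add: Im_divide_of_real)
      qed (use b d in \<open>auto simp: inj_on_def\<close>)
    next
      assume a: "a = 0"
      then have bc: "b * c = - 1" and c: "c \<noteq> 0" and d: "d \<noteq> 0" "b \<noteq> 0" using det * by auto
      have den: "of_real c * \<i> + of_real x \<noteq> (0::complex)" for x using c by (auto simp: complex_eq_iff)
      show False
      proof (rule deck_no_accumulation[OF g, of 1 1 "\<lambda>\<epsilon>. of_real b / (of_real c * \<i> + of_real (d * \<epsilon>))"])
        fix n
        let ?e = "exp (- (real n * L))" and ?f = "exp (real n * L)"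
        have "of_real (c * ?f) * \<i> + of_real d = of_real ?f * (of_real c * \<i> + of_real (d * ?e) :: complex)"
          using ex[of n] by (simp add: algebra_simps flip: of_real_mult)
        then show "shift (1 * int n) (g (shift (1 * int n) \<i>)) = of_real b / (of_real c * \<i> + of_real (d * ?e))"
          unfolding img by (simp add: a)
        show "isCont (\<lambda>\<epsilon>. of_real b / (of_real c * \<i> + of_real (d * \<epsilon>))) 0"
          using den[of 0] by (intro continuous_intros) auto
        have "Im (of_real b / (of_real c * \<i> + of_real (d * 0))) = - (b * c) / (c * c)"
          using c by (simp add: Im_divide power2_eq_square)
        moreover have cc: "0 < c * c" using c by (metis not_real_square_gt_zero)
        ultimately show "Im (of_real b / (of_real c * \<i> + of_real (d * 0))) > 0"
          using bc cc by simp
      next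
        show "inj_on (\<lambda>\<epsilon>. of_real b / (of_real c * \<i> + of_real (d * \<epsilon>))) {0<..}"
        proof (rule inj_onI)
          fix x y assume "of_real b / (of_real c * \<i> + of_real (d * x)) = of_real b / (of_real c * \<i> + of_real (d * y))"
          then have "of_real c * \<i> + of_real (d * x) = of_real c * \<i> + of_real (d * y)"
            using den[of "d * x"] den[of "d * y"] d by (simp add: frac_eq_eq)
          then show "x = y" using d by (simp del: of_real_mult)
        qed
      qed
    qed
  qed
  moreover have "\<not> (?Q = 0 \<and> ?P \<noteq> 0)"
  proof
    assume *: "?Q = 0 \<and> ?P \<noteq> 0"
    then have "b = 0 \<or> d = 0" by simp
    then show False
    proof
      assume b: "b = 0"
      then have ad: "a * d = 1" and d: "d \<noteq> 0" and c: "c \<noteq> 0" "a \<noteq> 0" using det * by auto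
      have den: "of_real x * \<i> + of_real d \<noteq> (0::complex)" for x using d by (auto simp: complex_eq_iff)
      show False
      proof (rule deck_no_accumulation[OF g, of 1 "-1" "\<lambda>\<epsilon>. of_real a * \<i> / (of_real (c * \<epsilon>) * \<i> + of_real d)"])
        fix n
        let ?e = "exp (- (real n * L))" and ?f = "exp (real n * L)"
        have "of_real ?f * (of_real (a * ?e) * \<i>) = (of_real (a * (?f * ?e)) * \<i> :: complex)"
          by (simp add: algebra_simps)
        then show "shift (1 * int n) (g (shift (- 1 * int n) \<i>)) = of_real a * \<i> / (of_real (c * ?e) * \<i> + of_real d)"
          unfolding img by (simp add: b ex)
        show "isCont (\<lambda>\<epsilon>. of_real a * \<i> / (of_real (c * \<epsilon>) * \<i> + of_real d)) 0"
          using den[of 0] by (intro continuous_intros) auto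
        have "a * d > 0" using ad by simp
        then have "a / d > 0" by (simp add: zero_less_mult_iff zero_less_divide_iff)
        then show "Im (of_real a * \<i> / (of_real (c * 0) * \<i> + of_real d)) > 0"
          by (simp add: Im_divide_of_real)
      next
        show "inj_on (\<lambda>\<epsilon>. of_real a * \<i> / (of_real (c * \<epsilon>) * \<i> + of_real d)) {0<..}"
        proof (rule inj_onI)
          fix x y assume "of_real a * \<i> / (of_real (c * x) * \<i> + of_real d) = of_real a * \<i> / (of_real (c * y) * \<i> + of_real d)"
          then have "of_real (c * x) * \<i> + of_real d = of_real (c * y) * \<i> + of_real d"
            using den[of "c * x"] den[of "c * y"] c by (simp add: frac_eq_eq)
          then show "x = y" using c by (simp add: complex_eq_iff)
        qed
      qed
    next
      assume d: "d = 0"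
      then have bc: "b * c = - 1" and c: "c \<noteq> 0" "a \<noteq> 0" using det * by auto
      show False
      proof (rule deck_no_accumulation[OF g, of "-1" "-1" "\<lambda>\<epsilon>. (of_real (a * \<epsilon>) * \<i> + of_real b) / (of_real c * \<i>)"])
        fix n
        let ?e = "exp (- (real n * L))" and ?f = "exp (real n * L)"
        have "?e \<noteq> 0" by simp
        then have "of_real ?e * z / (of_real (c * ?e) * \<i>) = z / (of_real c * \<i>)" for z :: complex
          by simp
        then show "shift (- 1 * int n) (g (shift (- 1 * int n) \<i>)) = (of_real (a * ?e) * \<i> + of_real b) / (of_real c * \<i>)"
          unfolding img by (simp add: d)
        show "isCont (\<lambda>\<epsilon>. (of_real (a * \<epsilon>) * \<i> + of_real b) / (of_real c * \<i>)) 0"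
          using c by (intro continuous_intros) auto
        have "Im ((of_real (a * 0) * \<i> + of_real b) / (of_real c * \<i>)) = - (b * c) / (c * c)"
          using c by (simp add: Im_divide power2_eq_square)
        moreover have cc: "0 < c * c" using c by (metis not_real_square_gt_zero)
        ultimately show "Im ((of_real (a * 0) * \<i> + of_real b) / (of_real c * \<i>)) > 0"
          using bc cc by simp
      qed (use c in \<open>auto simp: inj_on_def\<close>)
    qed
  qed
  \<comment> \<open>Ends of opposite sign would make the image cross the axis, at the parameter
    \<open>sqrt (- ?Q / ?P)\<close> excluded by \<open>ne\<close>.\<close>
  moreover have "\<not> ?P * ?Q < 0"
  proof
    assume PQ: "?P * ?Q < 0"
    moreover have "- y / x > 0" if "x * y < 0" for x y :: real
      using that by (auto simp: mult_less_0_iff divide_less_0_iff)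
    ultimately have "- ?Q / ?P > 0" by blast
    moreover have "?P * (sqrt (- ?Q / ?P))\<^sup>2 + ?Q = 0" using PQ \<open>- ?Q / ?P > 0\<close> by auto
    ultimately show False using ne[of "sqrt (- ?Q / ?P)"] by (simp del: real_sqrt_pow2_iff)
  qed
  moreover have "?P + ?Q \<noteq> 0" using ne[of 1] by simp
  ultimately have "?P * ?Q > 0" by (metis add_0 linorder_neqE_linordered_idom mult_eq_0_iff)
  moreover have "?P * ?Q = (b * c) * (a * d)" by (simp add: algebra_simps)
  ultimately show ?thesis using ad by simp
qed

text \<open>The hyperbolic sine of \<open>collar_width L\<close>.\<close>

definition \<kappa> :: real where "\<kappa> = 1 / sinh (L / 2)"

lemma \<kappa>_pos: "\<kappa> > 0" using L_pos by (simp add: \<kappa>_def)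

text \<open>With T for \<open>shift 1\<close>, the traces of T g T g^-1 and T g T^-1 g^-1 are
  \<open>2 + 4 * (1 + p) * \<Sigma>\<close> and \<open>2 - 4 * p * \<Sigma>\<close>, where
  \<open>p = b * c\<close> and \<Sigma> is the inverse square of \<kappa>. Neither element is
  elliptic, so both traces have absolute value at least 2. Since \<open>p * (1 + p) > 0\<close> by
  the disjointness of the axes, one of them lies below 2 and must then be at most -2, which is the
  claim.\<close>

lemma deck_trace_dichotomy:
  assumes g: "deck_transformation \<pi> g" and det: "a * d - b * c = 1"
    and eq: "\<And>z. Im z > 0 \<Longrightarrow> g z = moebius a b c d z"
    and nt: "\<And>k. \<exists>z. Im z > 0 \<and> g z \<noteq> shift k z"
  shows "b * c \<ge> \<kappa>\<^sup>2 \<or> b * c \<le> -1 - \<kappa>\<^sup>2"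
proof -
  define e where "e = exp (L / 2)"
  have e: "e > 0" "e * e = exp L" by (simp_all add: e_def exp_add[symmetric])
  have ad: "a * d = 1 + b * c" using det by simp
  obtain h where h: "deck_transformation \<pi> h" "\<And>z. z \<in> H \<Longrightarrow> h (g z) = z" "\<And>z. z \<in> H \<Longrightarrow> g (h z) = z"
    using deck_inverse[OF g] by auto
  have det': "d * a - (- b) * (- c) = 1" using det by (simp add: algebra_simps)
  have h_eq: "h z = moebius d (- b) (- c) a z" if "Im z > 0" for z
  proof -
    have w: "Im (moebius d (- b) (- c) a z) > 0" using moebius_in[OF det' that] .
    have "g (moebius d (- b) (- c) a z) = z" using moebius_inverse[OF det' that] eq[OF w] by simp
    then show ?thesis using h(2)[of "moebius d (- b) (- c) a z"] w by simp
  qed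
  have shift_eq: "shift 1 z = moebius e 0 0 (1 / e) z" "shift (- 1) z = moebius (1 / e) 0 0 e z" for z
    using e by (simp_all add: shift_def moebius_def exp_minus e(2)[symmetric] field_simps)
  have dT: "e * (1 / e) - 0 * 0 = 1" "(1 / e) * e - 0 * 0 = 1" using e by auto
  define M1 where "M1 z = shift 1 (g (shift 1 (h z)))" for z
  define M2 where "M2 z = shift 1 (g (shift (- 1) (h z)))" for z
  have dk: "deck_transformation \<pi> M1" "deck_transformation \<pi> M2" unfolding M1_def M2_def
    by (intro deck_compose[OF deck_compose[OF deck_shift g] deck_compose[OF deck_shift h(1)]])+
  define A1 B1 C1 D1 where "A1 = e * a" "B1 = e * b" "C1 = c / e" "D1 = d / e"
  note m1 = this
  define A2 B2 C2 D2 where "A2 = e * d" "B2 = - (e * b)" "C2 = - (c / e)" "D2 = a / e"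
  note m2 = this
  define A3 B3 C3 D3 where "A3 = d / e" "B3 = - (b / e)" "C3 = - (c * e)" "D3 = a * e"
  note m3 = this
  have d1: "A1 * D1 - B1 * C1 = 1" and d2: "A2 * D2 - B2 * C2 = 1" and d3: "A3 * D3 - B3 * C3 = 1"
    using det e by (simp_all add: m1 m2 m3 mult.commute)
  have c1: "shift 1 (g z) = moebius A1 B1 C1 D1 z" if "Im z > 0" for z
    using moebius_compose[OF dT(1) det that] eq[OF that] by (simp add: shift_eq m1)
  have c2: "shift 1 (h z) = moebius A2 B2 C2 D2 z" if "Im z > 0" for z
    using moebius_compose[OF dT(1) det' that] h_eq[OF that] by (simp add: shift_eq m2)
  have c3: "shift (- 1) (h z) = moebius A3 B3 C3 D3 z" if "Im z > 0" for z
    using moebius_compose[OF dT(2) det' that] h_eq[OF that] by (simp add: shift_eq m3 mult.commute)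
  have M1: "M1 z = moebius (A1 * A2 + B1 * C2) (A1 * B2 + B1 * D2) (C1 * A2 + D1 * C2) (C1 * B2 + D1 * D2) z"
    if "Im z > 0" for z
    unfolding M1_def c2[OF that] using c1[OF moebius_in[OF d2 that]] moebius_compose[OF d1 d2 that] by simp
  have M2: "M2 z = moebius (A1 * A3 + B1 * C3) (A1 * B3 + B1 * D3) (C1 * A3 + D1 * C3) (C1 * B3 + D1 * D3) z"
    if "Im z > 0" for z
    unfolding M2_def c3[OF that] using c1[OF moebius_in[OF d3 that]] moebius_compose[OF d1 d3 that] by simp
  have t1: "\<bar>(A1 * A2 + B1 * C2) + (C1 * B2 + D1 * D2)\<bar> \<ge> 2"
    by (rule deck_trace[OF dk(1) moebius_compose_det[OF d1 d2] M1])
  have t2: "\<bar>(A1 * A3 + B1 * C3) + (C1 * B3 + D1 * D3)\<bar> \<ge> 2"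
    by (rule deck_trace[OF dk(2) moebius_compose_det[OF d1 d3] M2])
  define \<Sigma> where "\<Sigma> = (sinh (L / 2))\<^sup>2"
  have \<Sigma>: "\<Sigma> > 0" "\<kappa>\<^sup>2 = 1 / \<Sigma>" using L_pos by (simp_all add: \<Sigma>_def \<kappa>_def power_divide)
  have ee: "e * e + 1 / (e * e) = 2 + 4 * \<Sigma>"
  proof -
    have "sinh (L / 2) = (e - 1 / e) / 2" by (simp add: sinh_def e_def exp_minus field_simps)
    then have "\<Sigma> = ((e - 1 / e) / 2)\<^sup>2" by (simp only: \<Sigma>_def)
    then have "4 * \<Sigma> = (e - 1 / e) * (e - 1 / e)" by (simp add: power_divide power2_eq_square)
    also have "\<dots> = e * e - 2 + 1 / (e * e)" using e(1) by (simp add: field_simps)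
    finally show ?thesis by simp
  qed
  define p where "p = b * c"
  have "(A1 * A2 + B1 * C2) + (C1 * B2 + D1 * D2) = (a * d) * (e * e + 1 / (e * e)) - 2 * (b * c)"
    using e by (simp add: m1 m2 field_simps)
  also have "\<dots> = 2 + 4 * \<Sigma> + 4 * p * \<Sigma>" unfolding ee ad by (simp add: p_def algebra_simps)
  finally have t1': "\<bar>2 + 4 * (1 + p) * \<Sigma>\<bar> \<ge> 2" using t1 by (simp add: algebra_simps)
  have "(A1 * A3 + B1 * C3) + (C1 * B3 + D1 * D3) = 2 * (a * d) - (b * c) * (e * e + 1 / (e * e))"
    using e by (simp add: m1 m3 field_simps)
  also have "\<dots> = 2 - 4 * p * \<Sigma>" unfolding ee ad by (simp add: p_def algebra_simps)
  finally have t2': "\<bar>2 - 4 * p * \<Sigma>\<bar> \<ge> 2" using t2 by simp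
  have "p * (1 + p) > 0" using deck_disjoint_axes[OF assms] by (simp add: p_def)
  then consider "p > 0" | "1 + p < 0" by (auto simp: zero_less_mult_iff)
  then show ?thesis
  proof cases
    case 1
    then have "p * \<Sigma> > 0" using \<Sigma> by simp
    then have "p * \<Sigma> \<ge> 1" using t2' by linarith
    then have "p \<ge> \<kappa>\<^sup>2" using \<Sigma> by (simp add: divide_le_eq)
    then show ?thesis by (simp add: p_def)
  next
    case 2
    then have "(1 + p) * \<Sigma> < 0" using \<Sigma> by (simp add: mult_neg_pos)
    then have "(1 + p) * \<Sigma> \<le> - 1" using t1' by linarith
    then have "1 + p \<le> (- 1) / \<Sigma>" by (simp only: pos_le_divide_eq[OF \<Sigma>(1)])
    then have "1 + p \<le> - \<kappa>\<^sup>2" by (simp add: \<Sigma>(2))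
    then show ?thesis by (simp add: p_def)
  qed
qed

text \<open>The hyperbolic distance \<open>d\<close> of \<open>z\<close> from the imaginary axis satisfies
  \<open>sinh d = \<bar>Re z\<bar> / Im z\<close>.\<close>

definition wedge_set :: "complex set" where
  "wedge_set = {z. Im z > 0 \<and> \<bar>Re z\<bar> < \<kappa> * Im z}"

text \<open>The collar theorem: the wedge modulo powers of the translation embeds in the surface.
  Any other deck transformation moves the axis too far, by \<open>deck_trace_dichotomy\<close> and
  \<open>wedge_disjoint\<close>.\<close>

lemma collar_embedded:
  assumes g: "deck_transformation \<pi> g" and z: "z \<in> wedge_set" "g z \<in> wedge_set"
  obtains k where "\<And>w. Im w > 0 \<Longrightarrow> g w = shift k w"
proof (rule ccontr)
  assume "\<not> thesis"
  then have nt: "\<exists>z. Im z > 0 \<and> g z \<noteq> shift k z" for k using that by blast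
  obtain a b c d where det: "a * d - b * c = 1" and eq: "\<forall>z\<in>H. g z = moebius a b c d z"
    using deck_is_moebius[OF g] by (auto simp: is_moebius_def)
  have "b * c \<ge> \<kappa>\<^sup>2 \<or> b * c \<le> -1 - \<kappa>\<^sup>2"
    by (rule deck_trace_dichotomy[OF g det _ nt]) (use eq in auto)
  from wedge_disjoint[OF det \<kappa>_pos this, of z] show False
    using z eq by (auto simp: wedge_set_def)
qed

definition axis :: "complex set" where
  "axis = {\<i> * of_real s | s. s > 0}"

lemma axis_in_wedge: "axis \<subseteq> wedge_set"
  using \<kappa>_pos by (auto simp: axis_def wedge_set_def)

lemma wedge_subset: "wedge_set \<subseteq> H" by (auto simp: wedge_set_def)

lemma cosh_collar_width: "cosh (collar_width L) = sqrt (1 + \<kappa>\<^sup>2)"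
  by (simp add: collar_width_def cosh_arsinh_real \<kappa>_def add.commute)

lemma collar_width_pos: "collar_width L > 0"
  using \<kappa>_pos by (simp add: collar_width_def \<kappa>_def)

text \<open>The point of the axis nearest to \<open>z\<close> is
  \<open>\<i> * of_real (cmod z)\<close>, and the distance to it has hyperbolic cosine
  \<open>cmod z / Im z\<close>.\<close>

lemma wedge_iff_dist:
  assumes z: "Im z > 0"
  shows "z \<in> wedge_set \<longleftrightarrow> (\<exists>w\<in>axis. hyp_dist z w < collar_width L)"
proof -
  have zw: "z \<in> wedge_set \<longleftrightarrow> cmod z < Im z * cosh (collar_width L)"
  proof -
    have "z \<in> wedge_set \<longleftrightarrow> (Re z)\<^sup>2 < (\<kappa> * Im z)\<^sup>2"
      using z \<kappa>_pos abs_le_square_iff[of "\<kappa> * Im z" "Re z"]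
      by (simp add: wedge_set_def not_le[symmetric])
    also have "\<dots> \<longleftrightarrow> (cmod z)\<^sup>2 < (Im z * cosh (collar_width L))\<^sup>2"
      by (simp add: cosh_collar_width power_mult_distrib cmod_power2 algebra_simps)
    also have "\<dots> \<longleftrightarrow> cmod z < Im z * cosh (collar_width L)"
      using z abs_le_square_iff[of "Im z * cosh (collar_width L)" "cmod z"]
      by (simp add: not_le[symmetric])
    finally show ?thesis .
  qed
  have less: "hyp_dist z w < collar_width L \<longleftrightarrow> cosh (hyp_dist z w) < cosh (collar_width L)" if "Im w > 0" for w
    using hyp_dist_nonneg[OF z that] collar_width_pos by (simp add: cosh_real_nonneg_less_iff)
  have dist: "cosh (hyp_dist z (\<i> * of_real s)) = ((cmod z)\<^sup>2 + s\<^sup>2) / (2 * Im z * s)" if "s > 0" for s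
    using hyp_dist_axis[OF z, of "ln s"] that by simp
  show ?thesis
  proof
    assume "z \<in> wedge_set"
    then have "cmod z < Im z * cosh (collar_width L)" using zw by simp
    moreover have c: "cmod z > 0" using z by auto
    ultimately have "cosh (hyp_dist z (\<i> * of_real (cmod z))) < cosh (collar_width L)"
      using z by (simp add: dist power2_eq_square divide_less_eq mult.commute)
    then show "\<exists>w\<in>axis. hyp_dist z w < collar_width L"
      using less[of "\<i> * of_real (cmod z)"] c
      by (intro bexI[of _ "\<i> * of_real (cmod z)"]) (auto simp: axis_def)
  next
    assume "\<exists>w\<in>axis. hyp_dist z w < collar_width L"
    then obtain s where s: "s > 0" "hyp_dist z (\<i> * of_real s) < collar_width L" by (auto simp: axis_def)
    then have "((cmod z)\<^sup>2 + s\<^sup>2) / (2 * Im z * s) < cosh (collar_width L)"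
      using less[of "\<i> * of_real s"] dist by simp
    then have "(cmod z)\<^sup>2 + s\<^sup>2 < (2 * s) * (Im z * cosh (collar_width L))"
      using z s by (simp add: divide_less_eq algebra_simps)
    moreover have "2 * s * cmod z \<le> (cmod z)\<^sup>2 + s\<^sup>2"
      using sum_squares_bound[of s "cmod z"] by (simp add: add.commute)
    ultimately have "(2 * s) * cmod z < (2 * s) * (Im z * cosh (collar_width L))" by simp
    then show "z \<in> wedge_set" using zw s by simp
  qed
qed

text \<open>The strict inequality passes through both infima, the one over the geodesic and the one
  over the lifts.\<close>

lemma standard_collar_eq:
  assumes "range \<gamma> = \<pi> ` axis"
  shows "standard_collar S \<pi> \<gamma> L = \<pi> ` wedge_set"
proof -
  have axH: "axis \<subseteq> H" using axis_in_wedge wedge_subset by blast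
  have ne: "\<pi> ` axis \<noteq> {}" by (auto simp: axis_def intro: exI[of _ 1])
  have bdd: "bdd_below (surf_dist \<pi> p ` (\<pi> ` axis))" if "p \<in> S" for p
    by (rule bdd_belowI[of _ 0]) (use surf_dist_nonneg[OF that] pi_in axH in auto)
  have *: "surf_setdist \<pi> p (\<pi> ` axis) < collar_width L \<longleftrightarrow> p \<in> \<pi> ` wedge_set" if p: "p \<in> S" for p
  proof
    assume "surf_setdist \<pi> p (\<pi> ` axis) < collar_width L"
    then obtain w where w: "w \<in> axis" "surf_dist \<pi> p (\<pi> w) < collar_width L"
      unfolding surf_setdist_def using cINF_less_iff[OF ne bdd[OF p]] by auto
    have "w \<in> H" using w axH by auto
    from surf_dist_less[OF p this w(2)]
    obtain z where "z \<in> H" "\<pi> z = p" "hyp_dist z w < collar_width L" .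
    then show "p \<in> \<pi> ` wedge_set" using wedge_iff_dist[of z] w(1) by auto
  next
    assume "p \<in> \<pi> ` wedge_set"
    then obtain z where z: "z \<in> wedge_set" "p = \<pi> z" by blast
    then have "Im z > 0" by (simp add: wedge_set_def)
    then obtain w where w: "w \<in> axis" "hyp_dist z w < collar_width L" using wedge_iff_dist z by blast
    then have "surf_dist \<pi> p (\<pi> w) < collar_width L"
      using surf_dist_le[of z w] \<open>Im z > 0\<close> axH z(2) by auto
    then show "surf_setdist \<pi> p (\<pi> ` axis) < collar_width L"
      unfolding surf_setdist_def using cINF_less_iff[OF ne bdd[OF p]] w(1) by auto
  qed
  have "\<pi> ` wedge_set \<subseteq> S" using pi_in wedge_subset by blast
  then show ?thesis using * by (auto simp: standard_collar_def assms)
qed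

end

section \<open>Integration over the surface\<close>

text \<open>The injective image is a preimage under the holomorphic inverse.\<close>

lemma holomorphic_inj_image_borel:
  assumes "\<phi> holomorphic_on V" "open V" "inj_on \<phi> V" "X \<subseteq> V" "X \<in> sets borel"
  shows "\<phi> ` X \<in> sets borel"
proof -
  obtain g where g: "g holomorphic_on (\<phi> ` V)" "\<And>z. z \<in> V \<Longrightarrow> g (\<phi> z) = z"
    using holomorphic_has_inverse[OF assms(1-3)] by metis
  have o: "open (\<phi> ` V)" using open_mapping_thm3[OF assms(1-3)] .
  have "\<phi> ` X = \<phi> ` V \<inter> g -` X"
  proof (intro set_eqI iffI)
    fix w assume "w \<in> \<phi> ` V \<inter> g -` X"
    then obtain z where "z \<in> V" "w = \<phi> z" "g w \<in> X" by blast
    then show "w \<in> \<phi> ` X" using g(2)[of z] by auto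
  next
    fix w assume "w \<in> \<phi> ` X"
    then obtain z where "z \<in> X" "w = \<phi> z" by blast
    then show "w \<in> \<phi> ` V \<inter> g -` X" using g(2)[of z] assms(4) by auto
  qed
  moreover have "\<phi> ` V \<inter> g -` X \<in> sets borel"
  proof -
    have "g \<in> borel_measurable (restrict_space borel (\<phi> ` V))"
      using g(1) by (intro borel_measurable_continuous_on_restrict holomorphic_on_imp_continuous_on)
    from measurable_sets[OF this assms(5)] have "g -` X \<inter> \<phi> ` V \<in> sets (restrict_space borel (\<phi> ` V))"
      by (simp add: space_restrict_space)
    then show ?thesis using o by (auto simp: sets_restrict_space_iff Int_commute)
  qed
  ultimately show ?thesis by simp
qed

lemma set_integrable_continuous_relatively_compact:
  fixes k :: "complex \<Rightarrow> real"
  assumes k: "continuous_on V k" and K: "compact K" "K \<subseteq> V" and X: "X \<in> sets borel" "X \<subseteq> K"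
  shows "set_integrable lborel X k"
proof -
  have "set_integrable lborel K k"
    using borel_integrable_compact[OF K(1) continuous_on_subset[OF k K(2)]]
    by (simp add: set_integrable_def indicator_def if_distrib cong: if_cong)
  then show ?thesis by (rule set_integrable_subset) (use X in auto)
qed

context compact_hyperbolic_surface
begin

text \<open>The discs of radius \<open>rad i\<close> already cover the surface, while
  \<open>\<pi>\<close> stays injective on the discs of twice that radius; bump functions fade out in
  the room between.\<close>

lemma finite_sheets:
  obtains N :: nat and ctr rad where
    "\<And>i. i < N \<Longrightarrow> rad i > (0::real)" "\<And>i. i < N \<Longrightarrow> cball (ctr i) (2 * rad i) \<subseteq> H"
    "\<And>i. i < N \<Longrightarrow> inj_on \<pi> (ball (ctr i) (2 * rad i))" "S = (\<Union>i<N. \<pi> ` ball (ctr i) (rad i))"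
proof -
  have "\<exists>r>0. cball z (2 * r) \<subseteq> H \<and> inj_on \<pi> (ball z (2 * r))" if zH: "z \<in> H" for z
  proof -
    obtain e where e: "e > 0" "ball z e \<subseteq> H" "inj_on \<pi> (ball z e)" using local_inj[OF zH] .
    have "cball z (2 * (e / 3)) \<subseteq> ball z e" using e(1) by auto
    moreover have "ball z (2 * (e / 3)) \<subseteq> ball z e" using e(1) by auto
    ultimately show ?thesis using e by (intro exI[of _ "e / 3"]) (auto intro: inj_on_subset)
  qed
  then obtain r where r: "\<And>z. z \<in> H \<Longrightarrow> r z > 0 \<and> cball z (2 * r z) \<subseteq> H \<and> inj_on \<pi> (ball z (2 * r z))"
    by metis
  have "ball z (r z) \<subseteq> H" if "z \<in> H" for z
  proof -
    have "ball z (r z) \<subseteq> cball z (2 * r z)" using r[OF that] by auto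
    then show ?thesis using r[OF that] by blast
  qed
  then have "\<And>z. z \<in> H \<Longrightarrow> \<exists>W. open W \<and> \<pi> ` ball z (r z) = S \<inter> W"
    using pi_open_map[OF open_ball] by (simp add: openin_open)
  then obtain W where W: "\<And>z. z \<in> H \<Longrightarrow> open (W z) \<and> \<pi> ` ball z (r z) = S \<inter> W z" by metis
  have "S \<subseteq> (\<Union>z\<in>H. W z)"
  proof
    fix p assume "p \<in> S"
    then obtain z where "z \<in> H" "\<pi> z = p" by (rule lift_cases)
    moreover have "z \<in> ball z (r z)" using r[OF \<open>z \<in> H\<close>] by simp
    ultimately show "p \<in> (\<Union>z\<in>H. W z)" using W by blast
  qed
  then obtain P where P: "P \<subseteq> H" "finite P" "S \<subseteq> (\<Union>z\<in>P. W z)"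
    using compactE_image[OF compact, of H W] W by blast
  obtain ctr and N :: nat where ctr: "P = ctr ` {i. i < N}"
    using P(2) by (metis finite_imp_nat_seg_image_inj_on)
  have inH: "ctr i \<in> H" if "i < N" for i using P(1) ctr that by blast
  have "S = (\<Union>z\<in>P. S \<inter> W z)" using P(3) by blast
  also have "\<dots> = (\<Union>z\<in>P. \<pi> ` ball z (r z))"
    by (intro SUP_cong refl) (use W P(1) in \<open>metis subsetD\<close>)
  also have "\<dots> = (\<Union>i<N. \<pi> ` ball (ctr i) (r (ctr i)))" unfolding ctr by auto
  finally show ?thesis using that[of N "\<lambda>i. r (ctr i)" ctr] r inH by auto
qed

definition lift_set :: "'a set \<Rightarrow> complex set" where
  "lift_set D = H \<inter> \<pi> -` D"

lemma lift_set_open: "openin (top_of_set S) U \<Longrightarrow> open (lift_set U)"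
  unfolding lift_set_def by (rule pi_preimage_open)

lemma lift_set_iff: "z \<in> lift_set D \<longleftrightarrow> Im z > 0 \<and> \<pi> z \<in> D"
  by (simp add: lift_set_def)

text \<open>The coefficient of an invariant 2-form on the half-plane.\<close>

definition invariant_density :: "(complex \<Rightarrow> real) \<Rightarrow> bool" where
  "invariant_density k \<longleftrightarrow> continuous_on H k \<and>
     (\<forall>g z. deck_transformation \<pi> g \<longrightarrow> z \<in> H \<longrightarrow> (cmod (deriv g z))\<^sup>2 * k (g z) = k z)"

end

section \<open>A Borel fundamental set and integrals over the surface\<close>

locale sheeted_surface = compact_hyperbolic_surface S A \<pi>
  for S :: "'a::t2_space set" and A :: "'a chart set" and \<pi> :: "complex \<Rightarrow> 'a" +
  fixes N :: nat and ctr :: "nat \<Rightarrow> complex" and rad :: "nat \<Rightarrow> real"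
  assumes rad_pos: "\<And>i. i < N \<Longrightarrow> rad i > 0"
    and sheet_in: "\<And>i. i < N \<Longrightarrow> cball (ctr i) (2 * rad i) \<subseteq> upper_half_plane"
    and sheet_inj: "\<And>i. i < N \<Longrightarrow> inj_on \<pi> (ball (ctr i) (2 * rad i))"
    and sheets_cover: "S = (\<Union>i<N. \<pi> ` ball (ctr i) (rad i))"
begin

definition sheet :: "nat \<Rightarrow> complex set" where "sheet i = ball (ctr i) (2 * rad i)"
definition core :: "nat \<Rightarrow> complex set" where "core i = ball (ctr i) (rad i)"
definition cell :: "nat \<Rightarrow> 'a set" where "cell i = \<pi> ` core i - (\<Union>j<i. \<pi> ` core j)"
text \<open>Moves a point over sheet \<open>i\<close> along its fibre into the sheet; locally a deck
  transformation, see \<open>to_sheet_deriv\<close>.\<close>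

definition to_sheet :: "nat \<Rightarrow> complex \<Rightarrow> complex" where
  "to_sheet i z = the_inv_into (sheet i) \<pi> (\<pi> z)"
text \<open>A Borel set with exactly one lift of every point of the surface, by \<open>F_inj\<close>
  and \<open>F_image\<close>. It is put together from pieces of finitely many discs, so that
  continuous functions on the half-plane are integrable over it.\<close>

definition F :: "complex set" where "F = (\<Union>i<N. core i \<inter> lift_set (cell i))"

lemma sheet_H: "i < N \<Longrightarrow> sheet i \<subseteq> H"
  using sheet_in by (force simp: sheet_def)

lemma core_sheet: "i < N \<Longrightarrow> core i \<subseteq> sheet i"
  unfolding core_def sheet_def using rad_pos[of i] by (intro subset_ball) simp

lemma core_H: "i < N \<Longrightarrow> core i \<subseteq> H"
  using core_sheet sheet_H by blast

lemma inj_sheet: "i < N \<Longrightarrow> inj_on \<pi> (sheet i)"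
  using sheet_inj by (simp add: sheet_def)

lemma sheet_lift_open: "i < N \<Longrightarrow> open (lift_set (\<pi> ` sheet i))"
  by (intro lift_set_open pi_open_map sheet_H) (auto simp: sheet_def)

lemma to_sheet:
  assumes i: "i < N" and z: "z \<in> lift_set (\<pi> ` sheet i)"
  shows "to_sheet i z \<in> sheet i" "\<pi> (to_sheet i z) = \<pi> z"
proof -
  have z': "\<pi> z \<in> \<pi> ` sheet i" using z by (simp add: lift_set_iff)
  show "to_sheet i z \<in> sheet i" unfolding to_sheet_def
    by (rule the_inv_into_into[OF inj_sheet[OF i] z']) simp
  show "\<pi> (to_sheet i z) = \<pi> z" unfolding to_sheet_def
    by (rule f_the_inv_into_f[OF inj_sheet[OF i] z'])
qed

lemma to_sheet_unique:
  assumes i: "i < N" and w: "w \<in> sheet i" "\<pi> w = \<pi> z"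
  shows "to_sheet i z = w"
  unfolding to_sheet_def w(2)[symmetric] by (rule the_inv_into_f_f[OF inj_sheet[OF i] w(1)])

lemma to_sheet_holomorphic:
  assumes i: "i < N"
  shows "to_sheet i holomorphic_on lift_set (\<pi> ` sheet i)"
proof (rule lift_holomorphic)
  let ?O = "lift_set (\<pi> ` sheet i)"
  show "open ?O" using sheet_lift_open[OF i] .
  show "?O \<subseteq> H" by (auto simp: lift_set_def)
  show "to_sheet i \<in> ?O \<rightarrow> H" using to_sheet(1)[OF i] sheet_H[OF i] by blast
  show "\<pi> (to_sheet i z) = \<pi> z" if "z \<in> ?O" for z using to_sheet(2)[OF i that] .
  show "continuous_on ?O (to_sheet i)"
    unfolding continuous_on_open_vimage[OF sheet_lift_open[OF i]]
  proof (intro allI impI)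
    fix V :: "complex set" assume V: "open V"
    have "to_sheet i -` V \<inter> ?O = lift_set (\<pi> ` (sheet i \<inter> V))"
    proof (intro set_eqI iffI)
      fix z assume "z \<in> to_sheet i -` V \<inter> ?O"
      then have "to_sheet i z \<in> sheet i \<inter> V" "\<pi> (to_sheet i z) = \<pi> z" "Im z > 0"
        using to_sheet[OF i] by (auto simp: lift_set_iff)
      then show "z \<in> lift_set (\<pi> ` (sheet i \<inter> V))" unfolding lift_set_iff by (metis imageI)
    next
      fix z assume "z \<in> lift_set (\<pi> ` (sheet i \<inter> V))"
      then obtain w where "w \<in> sheet i" "w \<in> V" "\<pi> w = \<pi> z" "Im z > 0" by (force simp: lift_set_iff)
      then show "z \<in> to_sheet i -` V \<inter> ?O"
        using to_sheet_unique[OF i] by (auto simp: lift_set_iff) (metis imageI)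
    qed
    moreover have "open (lift_set (\<pi> ` (sheet i \<inter> V)))"
      by (intro lift_set_open pi_open_map) (use V sheet_H[OF i] in \<open>auto simp: sheet_def\<close>)
    ultimately show "open (to_sheet i -` V \<inter> ?O)" by simp
  qed
qed

text \<open>Both \<open>to_sheet i\<close> and the deck transformation with the same value at
  \<open>z\<close> lift \<open>\<pi>\<close>, so they agree near \<open>z\<close>.\<close>

lemma to_sheet_deriv:
  assumes i: "i < N" and z: "z \<in> lift_set (\<pi> ` sheet i)"
  obtains g where "deck_transformation \<pi> g" "to_sheet i z = g z" "deriv (to_sheet i) z = deriv g z"
    "eventually (\<lambda>w. to_sheet i w = g w) (nhds z)"
proof -
  let ?O = "lift_set (\<pi> ` sheet i)"
  have zH: "z \<in> H" using z by (simp add: lift_set_iff)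
  have tH: "to_sheet i z \<in> H" using to_sheet(1)[OF i z] sheet_H[OF i] by blast
  obtain g where g: "deck_transformation \<pi> g" "g z = to_sheet i z"
    using deck_exists[OF zH tH] to_sheet(2)[OF i z] by metis
  obtain e where e: "e > 0" "ball z e \<subseteq> ?O" using sheet_lift_open[OF i] z open_contains_ball by blast
  have sub: "ball z e \<subseteq> H" using e(2) by (auto simp: lift_set_def)
  have eq: "to_sheet i w = g w" if "w \<in> ball z e" for w
  proof (rule covering_space_lift_unique[OF covering, where f=\<pi> and T="ball z e" and a=z and ?g1.0="to_sheet i" and ?g2.0=g and x=w])
    show "continuous_on (ball z e) (to_sheet i)"
      using to_sheet_holomorphic[OF i] e(2) holomorphic_on_imp_continuous_on continuous_on_subset by blast
    show "continuous_on (ball z e) g"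
      using deck_holo[OF g(1)] sub holomorphic_on_imp_continuous_on continuous_on_subset by blast
    show "to_sheet i \<in> ball z e \<rightarrow> H" using to_sheet(1)[OF i] sheet_H[OF i] e(2) by blast
    show "g \<in> ball z e \<rightarrow> H" using deck_in[OF g(1)] sub by blast
    show "continuous_on (ball z e) \<pi>" using pi_cont sub continuous_on_subset by blast
    show "\<pi> \<in> ball z e \<rightarrow> S" using pi_in sub by blast
    show "\<pi> x = \<pi> (to_sheet i x)" if "x \<in> ball z e" for x using to_sheet(2)[OF i] e(2) that by auto
    show "\<pi> x = \<pi> (g x)" if "x \<in> ball z e" for x using deck_pi[OF g(1)] sub that by auto
  qed (use that e(1) g(2) in auto)
  have ev: "eventually (\<lambda>w. to_sheet i w = g w) (nhds z)"
    unfolding eventually_nhds using eq e(1) by (intro exI[of _ "ball z e"]) auto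
  show ?thesis
    using that[OF g(1) g(2)[symmetric] deriv_cong_ev[OF ev refl] ev] .
qed

lemma cell_lift_borel: "i < N \<Longrightarrow> lift_set (cell i) \<in> sets borel"
proof -
  assume i: "i < N"
  have "lift_set (cell i) = lift_set (\<pi> ` core i) - (\<Union>j<i. lift_set (\<pi> ` core j))"
    by (auto simp: lift_set_def cell_def)
  moreover have "open (lift_set (\<pi> ` core j))" if "j < N" for j
    by (intro lift_set_open pi_open_map core_H that) (simp add: core_def)
  ultimately show ?thesis using i by (auto intro!: sets.Diff sets.countable_UN)
qed

lemma cells_disjoint: "disjoint_family_on cell {..<N}"
  unfolding disjoint_family_on_def cell_def
proof (intro ballI impI)
  fix i j :: nat assume "i \<noteq> j"
  then show "(\<pi> ` core i - (\<Union>l<i. \<pi> ` core l)) \<inter> (\<pi> ` core j - (\<Union>l<j. \<pi> ` core l)) = {}"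
    by (cases i j rule: linorder_cases) blast+
qed

lemma cells_cover: "S = (\<Union>i<N. cell i)"
proof
  show "S \<subseteq> (\<Union>i<N. cell i)"
  proof
    fix p assume "p \<in> S"
    then have "\<exists>i. i < N \<and> p \<in> \<pi> ` core i" using sheets_cover by (auto simp: core_def)
    then obtain i where i: "i < N \<and> p \<in> \<pi> ` core i" "\<And>j. j < i \<Longrightarrow> \<not> (j < N \<and> p \<in> \<pi> ` core j)"
      using exists_least_iff[of "\<lambda>i. i < N \<and> p \<in> \<pi> ` core i"] by blast
    then have "p \<in> cell i" by (auto simp: cell_def)
    then show "p \<in> (\<Union>i<N. cell i)" using i by blast
  qed
  show "(\<Union>i<N. cell i) \<subseteq> S" using sheets_cover by (auto simp: cell_def core_def)
qed

lemma F_borel: "F \<in> sets borel"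
  unfolding F_def using cell_lift_borel by (intro sets.finite_UN sets.Int) (auto simp: core_def)

lemma F_H: "F \<subseteq> H" by (auto simp: F_def lift_set_def)

lemma F_inj: "inj_on \<pi> F"
proof (rule inj_onI)
  fix z w assume zw: "z \<in> F" "w \<in> F" "\<pi> z = \<pi> w"
  then obtain i j where ij: "i < N" "z \<in> core i" "\<pi> z \<in> cell i" "j < N" "w \<in> core j" "\<pi> w \<in> cell j"
    by (auto simp: F_def lift_set_def)
  then have "i = j" using cells_disjoint zw(3) by (auto simp: disjoint_family_on_def)
  then show "z = w" using ij zw(3) inj_sheet[OF ij(1)] core_sheet[OF ij(1)] by (auto dest: inj_onD)
qed

lemma F_image: "D \<subseteq> S \<Longrightarrow> \<pi> ` (F \<inter> lift_set D) = D"
proof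
  assume D: "D \<subseteq> S"
  show "D \<subseteq> \<pi> ` (F \<inter> lift_set D)"
  proof
    fix p assume p: "p \<in> D"
    then obtain i where i: "i < N" "p \<in> cell i" using D cells_cover by blast
    then obtain z where z: "z \<in> core i" "p = \<pi> z" by (auto simp: cell_def)
    moreover have "Im z > 0" using z core_H[OF i(1)] by auto
    ultimately have "z \<in> F \<inter> lift_set D" using i p by (auto simp: F_def lift_set_def)
    then show "p \<in> \<pi> ` (F \<inter> lift_set D)" using z(2) by blast
  qed
qed (auto simp: lift_set_def)

definition core_hull :: "complex set" where "core_hull = (\<Union>i<N. cball (ctr i) (rad i))"

lemma core_hull: "compact core_hull" "core_hull \<subseteq> H" "F \<subseteq> core_hull"
proof -
  show "compact core_hull" unfolding core_hull_def by (intro compact_UN) auto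
  have "cball (ctr i) (rad i) \<subseteq> cball (ctr i) (2 * rad i)" if "i < N" for i using rad_pos[OF that] by auto
  then show "core_hull \<subseteq> H" using sheet_in by (fastforce simp: core_hull_def)
  show "F \<subseteq> core_hull" by (auto simp: F_def core_hull_def core_def)
qed

lemma integrable_on_F:
  assumes "continuous_on H k" "X \<in> sets borel" "X \<subseteq> F"
  shows "set_integrable lborel X (k :: complex \<Rightarrow> real)"
  using set_integrable_continuous_relatively_compact[OF assms(1) core_hull(1,2) assms(2)] assms(3) core_hull(3) by blast

text \<open>Integrals do not depend on the set of representatives. The part of \<open>X\<close> over
  each cell is moved by \<open>to_sheet i\<close> onto the corresponding part of \<open>F\<close>;
  the invariance of \<open>k\<close> compensates the Jacobian.\<close>

lemma integral_representatives:
  assumes k: "invariant_density k" and X: "X \<in> sets borel" "X \<subseteq> H" "inj_on \<pi> X"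
    and bor: "lift_set (\<pi> ` X) \<in> sets borel"
  shows "set_integrable lborel X k"
    and "set_lebesgue_integral lborel X k = set_lebesgue_integral lborel (F \<inter> lift_set (\<pi> ` X)) k"
proof -
  have kc: "continuous_on H k" using k by (simp add: invariant_density_def)
  define X' where "X' i = X \<inter> lift_set (cell i)" for i
  define Y where "Y i = core i \<inter> lift_set (cell i) \<inter> lift_set (\<pi> ` X)" for i
  have XU: "X = (\<Union>i\<in>{..<N}. X' i)"
  proof -
    have "\<exists>i<N. z \<in> lift_set (cell i)" if "z \<in> X" for z
      using that X(2) pi_in[of z] cells_cover by (auto simp: lift_set_def subset_iff)
    then show ?thesis by (auto simp: X'_def)
  qed
  have YU: "F \<inter> lift_set (\<pi> ` X) = (\<Union>i\<in>{..<N}. Y i)" by (auto simp: F_def Y_def)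
  have dX: "disjoint_family_on X' {..<N}" and dY: "disjoint_family_on Y {..<N}"
    using cells_disjoint by (auto simp: disjoint_family_on_def X'_def Y_def lift_set_def)
  have bX: "X' i \<in> sets lborel" and bY: "Y i \<in> sets lborel" if "i \<in> {..<N}" for i
    using that X(1) bor cell_lift_borel by (auto simp: X'_def Y_def core_def)
  have step: "set_integrable lborel (X' i) k \<and> set_lebesgue_integral lborel (X' i) k = set_lebesgue_integral lborel (Y i) k"
    if iN: "i \<in> {..<N}" for i
  proof -
    have i: "i < N" using iN by simp
    let ?O = "lift_set (\<pi> ` sheet i)"
    have sub: "X' i \<subseteq> ?O" using core_sheet[OF i] by (auto simp: X'_def lift_set_def cell_def)
    have inj: "inj_on (to_sheet i) (X' i)"
    proof (rule inj_onI)
      fix z w assume zw: "z \<in> X' i" "w \<in> X' i" "to_sheet i z = to_sheet i w"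
      then have "\<pi> z = \<pi> w" using to_sheet(2)[OF i] sub by (metis subsetD)
      then show "z = w" using zw X(3) by (auto simp: X'_def dest: inj_onD)
    qed
    have im: "to_sheet i ` X' i = Y i"
    proof (intro set_eqI iffI)
      fix w assume "w \<in> to_sheet i ` X' i"
      then obtain z where z: "z \<in> X' i" "w = to_sheet i z" by blast
      have w: "w \<in> sheet i" "\<pi> w = \<pi> z" using to_sheet[OF i] sub z by auto
      have "\<pi> z \<in> cell i" using z(1) by (simp add: X'_def lift_set_def)
      then obtain w' where "w' \<in> core i" "\<pi> w' = \<pi> z" by (auto simp: cell_def)
      then have "w = w'" using w core_sheet[OF i] by (intro inj_onD[OF inj_sheet[OF i]]) auto
      then show "w \<in> Y i" using \<open>w' \<in> core i\<close> w z(1) core_H[OF i] by (auto simp: Y_def X'_def lift_set_def)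
    next
      fix w assume w: "w \<in> Y i"
      then obtain z where z: "z \<in> X" "\<pi> w = \<pi> z" by (auto simp: Y_def lift_set_def)
      then have "z \<in> X' i" using w X(2) by (auto simp: X'_def Y_def lift_set_def)
      moreover have "to_sheet i z = w"
        using to_sheet_unique[OF i _ z(2)] w core_sheet[OF i] by (auto simp: Y_def)
      ultimately show "w \<in> to_sheet i ` X' i" by blast
    qed
    have YH: "Y i \<subseteq> H" by (auto simp: Y_def lift_set_def)
    have intY: "set_integrable lborel (Y i) k"
      by (rule integrable_on_F[OF kc]) (use bY[OF iN] YU iN in auto)
    have dens: "(cmod (deriv (to_sheet i) z))\<^sup>2 * k (to_sheet i z) = k z" if zX: "z \<in> X' i" for z
    proof -
      have zO: "z \<in> ?O" using sub zX by blast
      obtain g where "deck_transformation \<pi> g" "to_sheet i z = g z" "deriv (to_sheet i) z = deriv g z"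
        using to_sheet_deriv[OF i zO] by metis
      then show ?thesis using k zX X(2) by (auto simp: invariant_density_def X'_def)
    qed
    have bX': "X' i \<in> sets borel" using bX[OF iN] by simp
    have imb: "to_sheet i ` X' i \<in> sets borel" unfolding im using bY[OF iN] by simp
    have imH: "to_sheet i ` X' i \<subseteq> H" unfolding im by (rule YH)
    note cv = holomorphic_change_of_variables[OF to_sheet_holomorphic[OF i] sheet_lift_open[OF i] sub bX' inj imb kc open_upper_half_plane imH]
    have "set_integrable lborel (X' i) (\<lambda>z. (cmod (deriv (to_sheet i) z))\<^sup>2 * k (to_sheet i z))"
      using cv(1) intY unfolding im by blast
    moreover have "set_integrable lborel (X' i) (\<lambda>z. (cmod (deriv (to_sheet i) z))\<^sup>2 * k (to_sheet i z)) \<longleftrightarrow> set_integrable lborel (X' i) k"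
      by (rule set_integrable_cong) (use dens in auto)
    moreover have "set_lebesgue_integral lborel (X' i) (\<lambda>z. (cmod (deriv (to_sheet i) z))\<^sup>2 * k (to_sheet i z)) = set_lebesgue_integral lborel (X' i) k"
      by (rule set_lebesgue_integral_cong) (use dens bX[OF iN] in auto)
    ultimately show ?thesis using cv(2) unfolding im by simp
  qed
  show "set_integrable lborel X k"
    unfolding XU by (rule set_integrable_UN) (use step bX in auto)
  have "set_lebesgue_integral lborel X k = (\<Sum>i<N. set_lebesgue_integral lborel (X' i) k)"
    unfolding XU by (rule set_integral_finite_Union[OF _ dX _ bX]) (use step in auto)
  also have "\<dots> = (\<Sum>i<N. set_lebesgue_integral lborel (Y i) k)"
    using step by (intro sum.cong) auto
  also have "\<dots> = set_lebesgue_integral lborel (F \<inter> lift_set (\<pi> ` X)) k"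
    unfolding YU
    by (rule set_integral_finite_Union[symmetric, OF _ dY _ bY])
      (use YU F_borel bY in \<open>auto intro!: integrable_on_F[OF kc]\<close>)
  finally show "set_lebesgue_integral lborel X k = set_lebesgue_integral lborel (F \<inter> lift_set (\<pi> ` X)) k" .
qed

text \<open>\<open>surface_integral\<close> is a definite description, so existence and uniqueness
  of the value are both due. Any admissible decomposition is evaluated on \<open>F\<close>, chart by
  chart, by a change of variables; existence uses a finite cover by chart domains, made
  disjoint.\<close>

lemma surface_integral_eq:
  assumes k: "continuous_on H k"
    and pull: "\<And>c z. c \<in> A \<Longrightarrow> z \<in> lift_set (fst c) \<Longrightarrow>
        (cmod (deriv (snd c \<circ> \<pi>) z))\<^sup>2 * \<eta> c ((snd c \<circ> \<pi>) z) 1 \<i> = k z"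
    and cont: "\<And>c. c \<in> A \<Longrightarrow> continuous_on (chart_range c) (\<lambda>w. \<eta> c w 1 \<i>)"
    and D: "D \<subseteq> S" "lift_set D \<in> sets borel"
  shows "surface_integral A \<eta> D = set_lebesgue_integral lborel (F \<inter> lift_set D) k"
proof -
  have piece: "set_integrable lborel (snd c ` B) (\<lambda>w. \<eta> c w 1 \<i>)"
    "set_lebesgue_integral lborel (snd c ` B) (\<lambda>w. \<eta> c w 1 \<i>) = set_lebesgue_integral lborel (F \<inter> lift_set B) k"
    if c: "c \<in> A" and B: "B \<subseteq> fst c" "snd c ` B \<in> sets borel" and bB: "lift_set B \<in> sets borel" for c B
  proof -
    let ?\<phi> = "snd c \<circ> \<pi>" and ?X = "F \<inter> lift_set B"
    have BS: "B \<subseteq> S" using B(1) chart_open[OF c] openin_imp_subset by blast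
    have im: "?\<phi> ` ?X = snd c ` B" using F_image[OF BS] by (metis image_comp)
    have sub: "?X \<subseteq> lift_set (fst c)" using B(1) by (auto simp: lift_set_def)
    have hol: "?\<phi> holomorphic_on lift_set (fst c)" using chart_lift_holomorphic[OF c] by (simp add: lift_set_def)
    have op: "open (lift_set (fst c))" using chart_open[OF c] by (rule lift_set_open)
    have bX: "?X \<in> sets borel" using F_borel bB by blast
    have inj: "inj_on ?\<phi> ?X"
    proof (rule comp_inj_on)
      show "inj_on \<pi> ?X" using F_inj by (rule inj_on_subset) simp
      show "inj_on (snd c) (\<pi> ` ?X)" using chart_inj[OF c] F_image[OF BS] B(1) inj_on_subset by metis
    qed
    have imb: "?\<phi> ` ?X \<in> sets borel" unfolding im by (rule B(2))
    have imr: "?\<phi> ` ?X \<subseteq> chart_range c" unfolding im using B(1) by (auto simp: chart_range_def)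
    note cv = holomorphic_change_of_variables[OF hol op sub bX inj imb cont[OF c] chart_range_open[OF c] imr]
    have "set_integrable lborel ?X (\<lambda>z. (cmod (deriv ?\<phi> z))\<^sup>2 * \<eta> c (?\<phi> z) 1 \<i>) \<longleftrightarrow> set_integrable lborel ?X k"
      by (rule set_integrable_cong) (use pull[OF c] sub in auto)
    moreover have "set_integrable lborel ?X k" by (rule integrable_on_F[OF k bX]) simp
    ultimately show "set_integrable lborel (snd c ` B) (\<lambda>w. \<eta> c w 1 \<i>)" using cv(1) unfolding im by blast
    have "set_lebesgue_integral lborel ?X (\<lambda>z. (cmod (deriv ?\<phi> z))\<^sup>2 * \<eta> c (?\<phi> z) 1 \<i>) = set_lebesgue_integral lborel ?X k"
      by (rule set_lebesgue_integral_cong) (use pull[OF c] sub bX in auto)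
    then show "set_lebesgue_integral lborel (snd c ` B) (\<lambda>w. \<eta> c w 1 \<i>) = set_lebesgue_integral lborel ?X k"
      using cv(2) unfolding im by simp
  qed
  \<comment> \<open>A decomposition provides Borel sets in the chart ranges; their lifts to the
    half-plane are preimages under a continuous map.\<close>
  have lift_bor: "lift_set B \<in> sets borel" if c: "c \<in> A" and B: "B \<subseteq> fst c" "snd c ` B \<in> sets borel" for c B
  proof -
    let ?\<phi> = "snd c \<circ> \<pi>"
    have "snd c p \<in> snd c ` B \<longleftrightarrow> p \<in> B" if "p \<in> fst c" for p
      using inj_on_image_mem_iff[OF chart_inj[OF c] that B(1)] .
    then have "lift_set B = lift_set (fst c) \<inter> ?\<phi> -` (snd c ` B)"
      using B(1) by (simp add: lift_set_def set_eq_iff subset_iff cong: conj_cong) blast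
    moreover have "?\<phi> \<in> borel_measurable (restrict_space borel (lift_set (fst c)))"
      using chart_lift_holomorphic[OF c]
      by (intro borel_measurable_continuous_on_restrict holomorphic_on_imp_continuous_on) (simp add: lift_set_def)
    from measurable_sets[OF this B(2)]
    have "?\<phi> -` (snd c ` B) \<inter> lift_set (fst c) \<in> sets (restrict_space borel (lift_set (fst c)))"
      by (simp add: space_restrict_space)
    ultimately show ?thesis
      using lift_set_open[OF chart_open[OF c]] by (auto simp: sets_restrict_space_iff Int_commute)
  qed
  let ?I = "set_lebesgue_integral lborel (F \<inter> lift_set D) k"
  have uniq: "I = ?I" if I: "has_surface_integral A \<eta> D I" for I
  proof -
    obtain n :: nat and c B where dec: "disjoint_family_on B {..<n}" "(\<Union>i<n. B i) = D"
      "\<And>i. i < n \<Longrightarrow> c i \<in> A \<and> B i \<subseteq> fst (c i) \<and> snd (c i) ` B i \<in> sets borel"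
      "I = (\<Sum>i<n. set_lebesgue_integral lborel (snd (c i) ` B i) (\<lambda>z. \<eta> (c i) z 1 \<i>))"
      using I unfolding has_surface_integral_def by blast
    have lb: "lift_set (B i) \<in> sets borel" if "i < n" for i using lift_bor dec(3)[OF that] by blast
    have "I = (\<Sum>i<n. set_lebesgue_integral lborel (F \<inter> lift_set (B i)) k)"
      unfolding dec(4) using piece(2) dec(3) lb by (intro sum.cong) auto
    also have "\<dots> = set_lebesgue_integral lborel (\<Union>i\<in>{..<n}. F \<inter> lift_set (B i)) k"
    proof (rule set_integral_finite_Union[symmetric])
      show "disjoint_family_on (\<lambda>i. F \<inter> lift_set (B i)) {..<n}"
        using dec(1) by (auto simp: disjoint_family_on_def lift_set_def)
    qed (use F_borel lb in \<open>auto intro!: integrable_on_F[OF k]\<close>)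
    also have "(\<Union>i\<in>{..<n}. F \<inter> lift_set (B i)) = F \<inter> lift_set D"
      using dec(2) by (auto simp: lift_set_def)
    finally show ?thesis .
  qed
  have ex: "\<exists>I. has_surface_integral A \<eta> D I"
  proof -
    have "\<And>c. c \<in> A \<Longrightarrow> \<exists>W. open W \<and> fst c = S \<inter> W" using chart_open by (simp add: openin_open)
    then obtain W where W: "\<And>c. c \<in> A \<Longrightarrow> open (W c) \<and> fst c = S \<inter> W c" by metis
    have "S \<subseteq> (\<Union>c\<in>A. W c)" using charts_cover W by blast
    then obtain P where P: "P \<subseteq> A" "finite P" "S \<subseteq> (\<Union>c\<in>P. W c)"
      using compactE_image[OF compact, of A W] W by blast
    obtain c and n :: nat where c: "P = c ` {i. i < n}"
      using P(2) by (metis finite_imp_nat_seg_image_inj_on)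
    have cA: "c i \<in> A" if "i < n" for i using P(1) c that by blast
    define B where "B i = D \<inter> fst (c i) - (\<Union>j<i. fst (c j))" for i
    have "disjoint_family_on B {..<n}"
      unfolding disjoint_family_on_def B_def
    proof (intro ballI impI)
      fix i j :: nat assume "i \<noteq> j"
      then show "(D \<inter> fst (c i) - (\<Union>l<i. fst (c l))) \<inter> (D \<inter> fst (c j) - (\<Union>l<j. fst (c l))) = {}"
        by (cases i j rule: linorder_cases) blast+
    qed
    moreover have "(\<Union>i<n. B i) = D"
    proof (intro set_eqI iffI)
      fix p assume p: "p \<in> D"
      then have "p \<in> S" using D(1) by blast
      then obtain d where "d \<in> P" "p \<in> W d" using P(3) by blast
      moreover from this obtain i where "i < n" "d = c i" using c by blast
      ultimately have "\<exists>i. i < n \<and> p \<in> fst (c i)" using \<open>p \<in> S\<close> W[OF cA] by blast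
      then obtain i where i: "i < n \<and> p \<in> fst (c i)" "\<And>j. j < i \<Longrightarrow> \<not> (j < n \<and> p \<in> fst (c j))"
        using exists_least_iff[of "\<lambda>i. i < n \<and> p \<in> fst (c i)"] by blast
      then have "p \<in> B i" using p by (auto simp: B_def)
      then show "p \<in> (\<Union>i<n. B i)" using i by blast
    qed (auto simp: B_def)
    moreover have "c i \<in> A \<and> B i \<subseteq> fst (c i) \<and> snd (c i) ` B i \<in> sets borel \<and>
        set_integrable lborel (snd (c i) ` B i) (\<lambda>z. \<eta> (c i) z 1 \<i>)" if i: "i < n" for i
    proof -
      have B: "B i \<subseteq> fst (c i)" by (auto simp: B_def)
      have BS: "B i \<subseteq> S" using D(1) by (auto simp: B_def)
      have "lift_set (B i) = lift_set D \<inter> lift_set (fst (c i)) - (\<Union>j<i. lift_set (fst (c j)))"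
        by (auto simp: B_def lift_set_def)
      moreover have "lift_set (fst (c j)) \<in> sets borel" if "j < n" for j
        using lift_set_open[OF chart_open[OF cA[OF that]]] by simp
      ultimately have lb: "lift_set (B i) \<in> sets borel" using D(2) i by (auto intro!: sets.Diff sets.Int sets.finite_UN)
      \<comment> \<open>The chart image is split over the cells because chart and
        \<open>\<pi>\<close> compose to an injective map on each core over the chart domain, but
        possibly not on a neighbourhood of \<open>F\<close>.\<close>
      have "snd (c i) ` B i = (\<Union>j<N. (snd (c i) \<circ> \<pi>) ` (core j \<inter> lift_set (cell j) \<inter> lift_set (B i)))"
      proof -
        have "F \<inter> lift_set (B i) = (\<Union>j<N. core j \<inter> lift_set (cell j) \<inter> lift_set (B i))" by (auto simp: F_def)
        then have "snd (c i) ` \<pi> ` (F \<inter> lift_set (B i)) = (\<Union>j<N. (snd (c i) \<circ> \<pi>) ` (core j \<inter> lift_set (cell j) \<inter> lift_set (B i)))"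
          by (simp only: image_UN image_comp)
        then show ?thesis using F_image[OF BS] by simp
      qed
      moreover have "(snd (c i) \<circ> \<pi>) ` (core j \<inter> lift_set (cell j) \<inter> lift_set (B i)) \<in> sets borel" if j: "j < N" for j
      proof (rule holomorphic_inj_image_borel)
        show "(snd (c i) \<circ> \<pi>) holomorphic_on (core j \<inter> lift_set (fst (c i)))"
          using chart_lift_holomorphic[OF cA[OF i]] by (rule holomorphic_on_subset) (auto simp: lift_set_def)
        show "open (core j \<inter> lift_set (fst (c i)))"
          using lift_set_open[OF chart_open[OF cA[OF i]]] by (auto simp: core_def)
        show "inj_on (snd (c i) \<circ> \<pi>) (core j \<inter> lift_set (fst (c i)))"
          using inj_sheet[OF j] core_sheet[OF j] chart_inj[OF cA[OF i]]
          by (intro comp_inj_on) (auto intro: inj_on_subset simp: lift_set_def)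
        show "core j \<inter> lift_set (cell j) \<inter> lift_set (B i) \<subseteq> core j \<inter> lift_set (fst (c i))"
          using B by (auto simp: lift_set_def)
        show "core j \<inter> lift_set (cell j) \<inter> lift_set (B i) \<in> sets borel"
          using cell_lift_borel[OF j] lb by (auto simp: core_def)
      qed
      ultimately have sb: "snd (c i) ` B i \<in> sets borel" by auto
      show ?thesis using cA[OF i] B sb piece(1)[OF cA[OF i] B sb lb] by blast
    qed
    ultimately show ?thesis unfolding has_surface_integral_def by blast
  qed
  show ?thesis unfolding surface_integral_def
    by (rule the_equality) (use ex uniq in blast)+
qed

end

section \<open>Gradients\<close>

text \<open>The gradient is a complex number, with respect to the real scalar product of the plane.
  For the real part of a holomorphic function it is the conjugate of the derivative, see
  \<open>has_grad_Re\<close>; thus the form \<open>Re (f dz)\<close> corresponds to the vector field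
  \<open>cnj f\<close>.\<close>

definition has_grad :: "(complex \<Rightarrow> real) \<Rightarrow> complex \<Rightarrow> complex \<Rightarrow> bool" where
  "has_grad u G z \<longleftrightarrow> (u has_derivative (\<lambda>v. G \<bullet> v)) (at z)"

lemma has_grad_unique:
  assumes "has_grad u G z" "has_grad u K z" shows "G = K"
proof -
  have "(\<lambda>v. G \<bullet> v) = (\<lambda>v. K \<bullet> v)"
    using assms unfolding has_grad_def by (rule has_derivative_unique)
  then show ?thesis using vector_eq_rdot[of G K] by (simp add: fun_eq_iff)
qed

lemma has_grad_const: "has_grad (\<lambda>z. c) 0 z"
  by (simp add: has_grad_def)

lemma has_grad_mult:
  assumes "has_grad u G z" "has_grad w K z"
  shows "has_grad (\<lambda>z. u z * w z) (u z *\<^sub>R K + w z *\<^sub>R G) z"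
  using has_derivative_mult[OF assms[unfolded has_grad_def]]
  by (simp add: has_grad_def inner_add_left mult.commute add.commute)

lemma has_grad_sum:
  assumes "\<And>i. i \<in> I \<Longrightarrow> has_grad (u i) (G i) z"
  shows "has_grad (\<lambda>z. \<Sum>i\<in>I. u i z) (\<Sum>i\<in>I. G i) z"
proof -
  have "((\<lambda>z. \<Sum>i\<in>I. u i z) has_derivative (\<lambda>v. \<Sum>i\<in>I. G i \<bullet> v)) (at z)"
    using assms unfolding has_grad_def by (intro has_derivative_sum) auto
  moreover have "(\<lambda>v. (\<Sum>i\<in>I. G i) \<bullet> v) = (\<lambda>v. \<Sum>i\<in>I. G i \<bullet> v)"
    by (simp add: inner_sum_left fun_eq_iff)
  ultimately show ?thesis by (simp only: has_grad_def)
qed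

lemma has_grad_divide:
  assumes "has_grad u G z" "has_grad w K z" "w z \<noteq> 0"
  shows "has_grad (\<lambda>z. u z / w z) ((1 / w z) *\<^sub>R G - (u z / (w z)\<^sup>2) *\<^sub>R K) z"
proof -
  have "((\<lambda>z. u z / w z) has_derivative
      (\<lambda>h. - u z * (inverse (w z) * (K \<bullet> h) * inverse (w z)) + (G \<bullet> h) / w z)) (at z)"
    using has_derivative_divide[OF assms(1,2)[unfolded has_grad_def] assms(3)] .
  moreover have "(\<lambda>h. - u z * (inverse (w z) * (K \<bullet> h) * inverse (w z)) + (G \<bullet> h) / w z)
     = (\<lambda>h. ((1 / w z) *\<^sub>R G - (u z / (w z)\<^sup>2) *\<^sub>R K) \<bullet> h)"
    by (simp add: fun_eq_iff inner_diff_left divide_inverse power2_eq_square algebra_simps)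
  ultimately show ?thesis by (simp add: has_grad_def)
qed

lemma inner_cnj_mult: "(cnj p * x) \<bullet> v = x \<bullet> (p * v)"
  by (simp add: inner_complex_def algebra_simps)

lemma has_grad_compose:
  assumes "(g has_field_derivative g') (at z)" "has_grad u G (g z)"
  shows "has_grad (\<lambda>z. u (g z)) (cnj g' * G) z"
proof -
  have "((\<lambda>z. u (g z)) has_derivative (\<lambda>v. G \<bullet> (g' * v))) (at z)"
    using has_derivative_compose[OF assms(1)[unfolded has_field_derivative_def] assms(2)[unfolded has_grad_def]] .
  then show ?thesis by (simp add: has_grad_def inner_cnj_mult)
qed

lemma has_grad_transform:
  assumes "has_grad u G z" "open V" "z \<in> V" "\<And>w. w \<in> V \<Longrightarrow> u w = u' w"
  shows "has_grad u' G z"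
  using has_derivative_transform_within_open[OF assms(1)[unfolded has_grad_def] assms(2,3)] assms(4)
  by (simp add: has_grad_def)

lemma has_grad_Re:
  assumes "(g has_field_derivative g') (at z)"
  shows "has_grad (\<lambda>z. Re (g z)) (cnj g') z"
proof -
  have "((\<lambda>z. Re (g z)) has_derivative (\<lambda>v. Re (g' * v))) (at z)"
    using assms unfolding has_field_derivative_def by (rule has_derivative_Re)
  then show ?thesis by (simp add: has_grad_def inner_complex_def)
qed

lemma has_grad_real_compose:
  assumes "(h has_real_derivative h') (at (u z))" "has_grad u G z"
  shows "has_grad (\<lambda>z. h (u z)) (h' *\<^sub>R G) z"
  using has_derivative_compose[OF assms(2)[unfolded has_grad_def] assms(1)[unfolded has_field_derivative_def]]
  by (simp add: has_grad_def)

lemma has_grad_continuous: "has_grad u G z \<Longrightarrow> isCont u z"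
  unfolding has_grad_def by (rule has_derivative_continuous)

text \<open>Squaring makes the positive part continuously differentiable; bumps and cut-offs are
  built from it.\<close>

lemma DERIV_positive_part_square: "((\<lambda>x. (max 0 x)\<^sup>2) has_real_derivative 2 * max 0 x) (at x)"
proof (cases x "0::real" rule: linorder_cases)
  case less
  have "((\<lambda>x. 0) has_real_derivative 0) (at x)" by simp
  then have "((\<lambda>x. (max 0 x)\<^sup>2) has_real_derivative 0) (at x)"
    by (rule has_field_derivative_transform_within_open[of _ _ _ "{..<0}"]) (use less in \<open>auto simp: max_def\<close>)
  then show ?thesis using less by simp
next
  case equal
  have "\<exists>g. (\<forall>z. (max 0 z)\<^sup>2 - (max 0 x)\<^sup>2 = g z * (z - x)) \<and> isCont g x \<and> g x = 2 * max 0 x"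
  proof (intro exI[of _ "\<lambda>z. max 0 z"] conjI)
    show "isCont (\<lambda>z. max 0 z) x" by (intro continuous_intros)
  qed (auto simp: equal power2_eq_square max_def)
  then show ?thesis unfolding CARAT_DERIV .
next
  case greater
  have "((\<lambda>x. x\<^sup>2) has_real_derivative 2 * x) (at x)" by (auto intro!: derivative_eq_intros)
  then have "((\<lambda>x. (max 0 x)\<^sup>2) has_real_derivative 2 * x) (at x)"
    by (rule has_field_derivative_transform_within_open[of _ _ _ "{0<..}"]) (use greater in \<open>auto simp: max_def\<close>)
  then show ?thesis using greater by simp
qed

definition bump :: "complex \<Rightarrow> real \<Rightarrow> complex \<Rightarrow> real" where
  "bump c r w = (max 0 (r\<^sup>2 - (dist w c)\<^sup>2))\<^sup>2"

definition bump_grad :: "complex \<Rightarrow> real \<Rightarrow> complex \<Rightarrow> complex" where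
  "bump_grad c r w = (- 4 * max 0 (r\<^sup>2 - (dist w c)\<^sup>2)) *\<^sub>R (w - c)"

lemma bump_has_grad: "has_grad (bump c r) (bump_grad c r w) w"
proof -
  have "((\<lambda>w. r\<^sup>2 - (w - c) \<bullet> (w - c)) has_derivative (\<lambda>v. (- 2 *\<^sub>R (w - c)) \<bullet> v)) (at w)"
    by (auto intro!: derivative_eq_intros simp: inner_commute)
  then have "has_grad (\<lambda>w. r\<^sup>2 - (dist w c)\<^sup>2) (- 2 *\<^sub>R (w - c)) w"
    by (simp add: has_grad_def dist_norm power2_norm_eq_inner)
  from has_grad_real_compose[OF DERIV_positive_part_square this]
  show ?thesis by (simp add: bump_def[abs_def] bump_grad_def)
qed

lemma bump_nonneg: "bump c r w \<ge> 0" by (simp add: bump_def)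

lemma bump_pos: "dist w c < r \<Longrightarrow> bump c r w > 0"
  using power_strict_mono[of "dist w c" r 2] by (simp add: bump_def)

lemma bump_zero: "dist w c \<ge> r \<Longrightarrow> r \<ge> 0 \<Longrightarrow> bump c r w = 0 \<and> bump_grad c r w = 0"
  using power_mono[of r "dist w c" 2] by (simp add: bump_def bump_grad_def)

lemma bump_grad_cont: "continuous_on X (bump_grad c r)"
  unfolding bump_grad_def[abs_def] by (intro continuous_intros)

section \<open>Harmonic forms on the universal cover\<close>

context compact_hyperbolic_surface
begin

lemma overlap_open:
  assumes "c \<in> A" "d \<in> A" shows "open (overlap c d)"
proof -
  obtain g where g: "homeomorphism (fst c) (chart_range c) (snd c) g" using chart_homeomorphism[OF assms(1)] .
  have "openin (top_of_set S) (fst c \<inter> fst d)" using chart_open assms by (intro openin_Int) auto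
  then have "openin (top_of_set (fst c)) (fst c \<inter> fst d)"
    by (rule openin_subset_trans) (use openin_imp_subset[OF chart_open[OF assms(1)]] in auto)
  from homeomorphism_imp_open_map[OF g this] show ?thesis
    using chart_range_open[OF assms(1)] openin_open_eq unfolding overlap_def by blast
qed

definition form_coeff :: "'a form1 \<Rightarrow> 'a chart \<Rightarrow> complex \<Rightarrow> complex" where
  "form_coeff \<sigma> c w = Complex (\<sigma> c w 1) (- \<sigma> c w \<i>)"

lemma form_coeff_Re:
  assumes "one_form A \<sigma>" "c \<in> A" "w \<in> chart_range c"
  shows "\<sigma> c w v = Re (form_coeff \<sigma> c w * v)"
proof -
  have lin: "linear (\<sigma> c w)" using assms by (simp add: one_form_def)
  have "v = Re v *\<^sub>R 1 + Im v *\<^sub>R \<i>" by (simp add: complex_eq_iff)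
  then have "\<sigma> c w v = Re v * \<sigma> c w 1 + Im v * \<sigma> c w \<i>"
    using linear_add[OF lin] linear_cmul[OF lin] by (metis real_scaleR_def)
  then show ?thesis by (simp add: form_coeff_def)
qed

lemma form_coeff_holomorphic:
  assumes \<sigma>: "harmonic_form A \<sigma>" and c: "c \<in> A"
  shows "form_coeff \<sigma> c holomorphic_on chart_range c"
  unfolding holomorphic_on_open[OF chart_range_open[OF c]]
proof
  fix w assume w: "w \<in> chart_range c"
  have one: "one_form A \<sigma>" using \<sigma> by (simp add: harmonic_form_def)
  let ?a = "\<lambda>x. \<sigma> c x 1" and ?b = "\<lambda>x. \<sigma> c x \<i>"
  let ?Da = "frechet_derivative ?a (at w)" and ?Db = "frechet_derivative ?b (at w)"
  have da: "(?a has_derivative ?Da) (at w)" and db: "(?b has_derivative ?Db) (at w)"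
    using \<sigma> c w unfolding harmonic_form_def closed_form_def by (auto simp: frechet_derivative_works[symmetric])
  have e1: "?Db 1 = ?Da \<i>"
    using \<sigma> c w unfolding harmonic_form_def closed_form_def ext_deriv_def by force
  \<comment> \<open>The coefficients of \<open>hodge_star \<sigma>\<close> are \<open>- ?b\<close>
    and \<open>?a\<close>; its closedness is the second Cauchy-Riemann equation for
    \<open>form_coeff\<close>, and \<open>e1\<close> is the first.\<close>
  have "(?a has_derivative frechet_derivative (\<lambda>x. hodge_star \<sigma> c x \<i>) (at w)) (at w)"
  proof (rule has_derivative_transform_within_open[OF _ chart_range_open[OF c] w])
    show "((\<lambda>x. hodge_star \<sigma> c x \<i>) has_derivative frechet_derivative (\<lambda>x. hodge_star \<sigma> c x \<i>) (at w)) (at w)"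
      using \<sigma> c w unfolding harmonic_form_def closed_form_def by (auto simp: frechet_derivative_works[symmetric])
    show "hodge_star \<sigma> c x \<i> = \<sigma> c x 1" if "x \<in> chart_range c" for x
      using form_coeff_Re[OF one c that] by (simp add: hodge_star_def)
  qed
  then have h1: "frechet_derivative (\<lambda>x. hodge_star \<sigma> c x \<i>) (at w) = ?Da"
    using da by (rule has_derivative_unique)
  have "((\<lambda>x. - ?b x) has_derivative frechet_derivative (\<lambda>x. hodge_star \<sigma> c x 1) (at w)) (at w)"
  proof (rule has_derivative_transform_within_open[OF _ chart_range_open[OF c] w])
    show "((\<lambda>x. hodge_star \<sigma> c x 1) has_derivative frechet_derivative (\<lambda>x. hodge_star \<sigma> c x 1) (at w)) (at w)"
      using \<sigma> c w unfolding harmonic_form_def closed_form_def by (auto simp: frechet_derivative_works[symmetric])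
  qed (simp add: hodge_star_def)
  then have h2: "frechet_derivative (\<lambda>x. hodge_star \<sigma> c x 1) (at w) = (\<lambda>v. - ?Db v)"
    using has_derivative_minus[OF db] by (rule has_derivative_unique)
  have "ext_deriv (hodge_star \<sigma>) c w 1 \<i> = 0"
    using \<sigma> c w unfolding harmonic_form_def closed_form_def by blast
  then have e2: "?Db \<i> = - ?Da 1" unfolding ext_deriv_def h1 h2 by simp
  have "((\<lambda>x. Complex (?a x) (- ?b x)) has_derivative (\<lambda>v. Complex (?Da v) (- ?Db v))) (at w)"
    unfolding Complex_eq by (intro derivative_intros da db)
  moreover have "(\<lambda>v. Complex (?Da v) (- ?Db v)) = (*) (Complex (?Da 1) (- ?Da \<i>))"
  proof
    fix v :: complex
    have v: "v = Re v *\<^sub>R 1 + Im v *\<^sub>R \<i>" by (simp add: complex_eq_iff)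
    have "?Da v = Re v * ?Da 1 + Im v * ?Da \<i>"
      using linear_add[OF has_derivative_linear[OF da]] linear_cmul[OF has_derivative_linear[OF da]] v by (metis real_scaleR_def)
    moreover have "?Db v = Re v * ?Db 1 + Im v * ?Db \<i>"
      using linear_add[OF has_derivative_linear[OF db]] linear_cmul[OF has_derivative_linear[OF db]] v by (metis real_scaleR_def)
    ultimately show "Complex (?Da v) (- ?Db v) = Complex (?Da 1) (- ?Da \<i>) * v"
      by (simp add: e1 e2 complex_eq_iff algebra_simps)
  qed
  ultimately show "\<exists>f'. (form_coeff \<sigma> c has_field_derivative f') (at w)"
    unfolding has_field_derivative_def form_coeff_def[abs_def] by auto
qed

lemma chart_lift_deriv:
  assumes "c \<in> A" "z \<in> lift_set (fst c)"
  shows "((snd c \<circ> \<pi>) has_field_derivative deriv (snd c \<circ> \<pi>) z) (at z)"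
  using holomorphic_derivI[OF chart_lift_holomorphic[OF assms(1)] chart_lift_open[OF assms(1)]] assms(2)
  by (simp add: lift_set_def)

text \<open>The transformation law of the real form, tested on the vectors 1 and \<i>, determines
  the complex coefficient; the chain rule for \<open>transition c d\<close> supplies the
  factor.\<close>

lemma form_coeff_transition:
  assumes one: "one_form A \<sigma>" and cd: "c \<in> A" "d \<in> A" and z: "z \<in> lift_set (fst c)" "z \<in> lift_set (fst d)"
  shows "form_coeff \<sigma> c ((snd c \<circ> \<pi>) z) * deriv (snd c \<circ> \<pi>) z = form_coeff \<sigma> d ((snd d \<circ> \<pi>) z) * deriv (snd d \<circ> \<pi>) z"
proof -
  let ?p = "snd c \<circ> \<pi>" and ?q = "snd d \<circ> \<pi>" and ?t = "transition c d"
  have t: "?t (?p w) = ?q w" if "w \<in> lift_set (fst c)" for w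
    using that inv_into_f_f[OF chart_inj[OF cd(1)], of "\<pi> w"] by (simp add: transition_def lift_set_def)
  have ov: "?p z \<in> overlap c d" using z by (auto simp: overlap_def lift_set_def)
  have r: "?p z \<in> chart_range c" "?q z \<in> chart_range d" using z by (auto simp: chart_range_def lift_set_def)
  have "?t holomorphic_on overlap c d" using surface cd by (simp add: riemann_surface_def)
  from holomorphic_derivI[OF this overlap_open[OF cd] ov]
  have "(?t has_field_derivative deriv ?t (?p z)) (at (?p z))" .
  from DERIV_chain2[OF this chart_lift_deriv[OF cd(1) z(1)]]
  have "((\<lambda>w. ?t (?p w)) has_field_derivative deriv ?t (?p z) * deriv ?p z) (at z)" .
  then have "(?q has_field_derivative deriv ?t (?p z) * deriv ?p z) (at z)"
    by (rule has_field_derivative_transform_within_open[OF _ lift_set_open[OF chart_open[OF cd(1)]] z(1)]) (rule t)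
  then have dq: "deriv ?q z = deriv ?t (?p z) * deriv ?p z" by (rule DERIV_imp_deriv)
  have "Re (form_coeff \<sigma> c (?p z) * (deriv ?p z * v)) = Re (form_coeff \<sigma> d (?q z) * (deriv ?q z * v))" for v
  proof -
    have "Re (form_coeff \<sigma> c (?p z) * (deriv ?p z * v)) = \<sigma> c (?p z) (deriv ?p z * v)"
      using form_coeff_Re[OF one cd(1) r(1)] by simp
    also have "\<dots> = \<sigma> d (?t (?p z)) (deriv ?t (?p z) * (deriv ?p z * v))"
      using one cd ov unfolding one_form_def by blast
    also have "\<dots> = Re (form_coeff \<sigma> d (?q z) * (deriv ?q z * v))"
      using form_coeff_Re[OF one cd(2) r(2)] t[OF z(1)] by (simp add: dq mult.assoc)
    finally show ?thesis .
  qed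
  from this[of 1] this[of \<i>] show ?thesis by (simp add: complex_eq_iff)
qed

text \<open>A chart is chosen at each point separately. By \<open>form_coeff_transition\<close> the
  choice does not matter, so one chart serves in a whole neighbourhood.\<close>

lemma harmonic_pullback:
  assumes \<sigma>: "harmonic_form A \<sigma>"
  obtains f where "f holomorphic_on H"
    "\<And>c z. c \<in> A \<Longrightarrow> z \<in> lift_set (fst c) \<Longrightarrow> f z = form_coeff \<sigma> c ((snd c \<circ> \<pi>) z) * deriv (snd c \<circ> \<pi>) z"
proof -
  have one: "one_form A \<sigma>" using \<sigma> by (simp add: harmonic_form_def)
  define ch where "ch z = (SOME c. c \<in> A \<and> z \<in> lift_set (fst c))" for z
  have ex: "\<exists>c. c \<in> A \<and> z \<in> lift_set (fst c)" if "z \<in> H" for z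
    using pi_in[OF that] charts_cover that by (auto simp: lift_set_def)
  then have ch: "ch z \<in> A \<and> z \<in> lift_set (fst (ch z))" if "z \<in> H" for z
    unfolding ch_def using someI_ex[OF ex[OF that]] by blast
  define f where "f z = form_coeff \<sigma> (ch z) ((snd (ch z) \<circ> \<pi>) z) * deriv (snd (ch z) \<circ> \<pi>) z" for z
  have f: "f z = form_coeff \<sigma> c ((snd c \<circ> \<pi>) z) * deriv (snd c \<circ> \<pi>) z" if "c \<in> A" "z \<in> lift_set (fst c)" for c z
    unfolding f_def using form_coeff_transition[OF one _ that(1) _ that(2)] ch[of z] that(2) by (simp add: lift_set_def)
  have "f holomorphic_on H"
    unfolding holomorphic_on_open[OF open_upper_half_plane]
  proof
    fix z assume "z \<in> H"
    then obtain c where c: "c \<in> A" "z \<in> lift_set (fst c)" using ex by blast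
    have op: "open (lift_set (fst c))" using lift_set_open chart_open c by blast
    have p: "(snd c \<circ> \<pi>) holomorphic_on lift_set (fst c)"
      using chart_lift_holomorphic[OF c(1)] by (simp add: lift_set_def)
    have "(\<lambda>z. form_coeff \<sigma> c ((snd c \<circ> \<pi>) z)) holomorphic_on lift_set (fst c)"
      using holomorphic_on_compose_gen[OF p form_coeff_holomorphic[OF \<sigma> c(1)]]
      by (auto simp: chart_range_def lift_set_def o_def)
    then have "(\<lambda>z. form_coeff \<sigma> c ((snd c \<circ> \<pi>) z) * deriv (snd c \<circ> \<pi>) z) holomorphic_on lift_set (fst c)"
      by (intro holomorphic_intros holomorphic_deriv[OF p op])
    then have "f holomorphic_on lift_set (fst c)"
      by (rule holomorphic_transform) (use f c in auto)
    then show "\<exists>f'. (f has_field_derivative f') (at z)" using holomorphic_on_open[OF op] c by blast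
  qed
  then show ?thesis using that f by blast
qed

lemma pullback_invariant:
  assumes f: "\<And>c z. c \<in> A \<Longrightarrow> z \<in> lift_set (fst c) \<Longrightarrow> f z = form_coeff \<sigma> c ((snd c \<circ> \<pi>) z) * deriv (snd c \<circ> \<pi>) z"
    and g: "deck_transformation \<pi> g" and z: "z \<in> H"
  shows "f (g z) * deriv g z = f z"
proof -
  obtain c where c: "c \<in> A" "z \<in> lift_set (fst c)" using pi_in[OF z] charts_cover z by (auto simp: lift_set_def)
  have gl: "g w \<in> lift_set (fst c)" if "w \<in> lift_set (fst c)" for w
    using that deck_in[OF g, of w] deck_pi[OF g, of w] by (auto simp: lift_set_def)
  let ?p = "snd c \<circ> \<pi>"
  have dg: "(g has_field_derivative deriv g z) (at z)"
    using holomorphic_derivI[OF deck_holo[OF g] open_upper_half_plane z] .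
  have "((\<lambda>w. ?p (g w)) has_field_derivative deriv ?p (g z) * deriv g z) (at z)"
    by (rule DERIV_chain2[OF chart_lift_deriv[OF c(1) gl[OF c(2)]] dg])
  then have "(?p has_field_derivative deriv ?p (g z) * deriv g z) (at z)"
    by (rule has_field_derivative_transform_within_open[OF _ lift_set_open[OF chart_open[OF c(1)]] c(2)])
      (use deck_pi[OF g] in \<open>auto simp: lift_set_def\<close>)
  then have "deriv ?p z = deriv ?p (g z) * deriv g z" by (rule DERIV_imp_deriv)
  moreover have "?p (g z) = ?p z" using deck_pi[OF g z] by simp
  ultimately show ?thesis using f[OF c] f[OF c(1) gl[OF c(2)]] by simp
qed

lemma grad_invariant:
  assumes u: "\<And>z. z \<in> H \<Longrightarrow> has_grad u (G z) z" and g: "deck_transformation \<pi> g"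
    and inv: "\<And>z. z \<in> H \<Longrightarrow> u (g z) = u z" and z: "z \<in> H"
  shows "cnj (deriv g z) * G (g z) = G z"
proof -
  have dg: "(g has_field_derivative deriv g z) (at z)"
    using holomorphic_derivI[OF deck_holo[OF g] open_upper_half_plane z] .
  have "has_grad (\<lambda>z. u (g z)) (cnj (deriv g z) * G (g z)) z"
    by (rule has_grad_compose[OF dg u[OF deck_in[OF g z]]])
  then have "has_grad u (cnj (deriv g z) * G (g z)) z"
    by (rule has_grad_transform[OF _ open_upper_half_plane z inv])
  then show ?thesis using u[OF z] has_grad_unique by blast
qed

text \<open>The gradient of an invariant function and \<open>cnj f\<close> both transform with the
  conjugate of \<open>deriv g\<close>, hence their scalar product with its squared modulus.\<close>

lemma invariant_density_inner:
  assumes f: "f holomorphic_on H" "\<And>g z. deck_transformation \<pi> g \<Longrightarrow> z \<in> H \<Longrightarrow> f (g z) * deriv g z = f z"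
    and u: "\<And>z. z \<in> H \<Longrightarrow> has_grad u (G z) z" "continuous_on H G"
    and inv: "\<And>g z. deck_transformation \<pi> g \<Longrightarrow> z \<in> H \<Longrightarrow> u (g z) = u z"
  shows "invariant_density (\<lambda>z. G z \<bullet> cnj (f z))"
  unfolding invariant_density_def
proof (intro conjI allI impI)
  show "continuous_on H (\<lambda>z. G z \<bullet> cnj (f z))"
    by (intro continuous_intros u(2) holomorphic_on_imp_continuous_on[OF f(1)])
  fix g z assume g: "deck_transformation \<pi> g" and z: "z \<in> H"
  have "G z \<bullet> cnj (f z) = (cnj (deriv g z) * G (g z)) \<bullet> cnj (f (g z) * deriv g z)"
    using grad_invariant[OF u(1) g inv[OF g] z] f(2)[OF g z] by simp
  also have "\<dots> = (cmod (deriv g z))\<^sup>2 * (G (g z) \<bullet> cnj (f (g z)))"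
    unfolding inner_cnj_mult cmod_power2 by (simp add: inner_complex_def power2_eq_square algebra_simps)
  finally show "(cmod (deriv g z))\<^sup>2 * (G (g z) \<bullet> cnj (f (g z))) = G z \<bullet> cnj (f z)" by simp
qed

lemma invariant_density_norm:
  assumes f: "f holomorphic_on H" "\<And>g z. deck_transformation \<pi> g \<Longrightarrow> z \<in> H \<Longrightarrow> f (g z) * deriv g z = f z"
  shows "invariant_density (\<lambda>z. (cmod (f z))\<^sup>2)"
  unfolding invariant_density_def
proof (intro conjI allI impI)
  show "continuous_on H (\<lambda>z. (cmod (f z))\<^sup>2)"
    by (intro continuous_intros holomorphic_on_imp_continuous_on[OF f(1)])
  fix g z assume g: "deck_transformation \<pi> g" and z: "z \<in> H"
  show "(cmod (deriv g z))\<^sup>2 * (cmod (f (g z)))\<^sup>2 = (cmod (f z))\<^sup>2"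
    using f(2)[OF g z, symmetric] by (simp add: norm_mult power_mult_distrib mult.commute)
qed

end

text \<open>The divergence of \<open>u\<close> times the conjugate of \<open>f\<close> is the scalar product below, because the
  conjugate of a holomorphic function is divergence free.\<close>

lemma integral_grad_compact_support:
  assumes V: "open V" and f: "f holomorphic_on V"
    and u: "\<And>z. z \<in> V \<Longrightarrow> has_grad u (G z) z" and G: "continuous_on V G"
    and K: "compact K" "K \<subseteq> V" "\<And>z. z \<in> V - K \<Longrightarrow> u z = 0"
  shows "set_lebesgue_integral lborel V (\<lambda>z. G z \<bullet> cnj (f z)) = 0"
proof -
  have opK: "open (- K)" using K(1) by (simp add: compact_imp_closed open_Compl)
  have G0: "G z = 0" if "z \<in> V - K" for z
  proof -
    have "has_grad u 0 z"
      by (rule has_grad_transform[OF has_grad_const, of "V \<inter> - K"]) (use that V opK K(3) in auto)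
    then show ?thesis using has_grad_unique u that by blast
  qed
  have df: "(f has_field_derivative deriv f z) (at z)" if "z \<in> V" for z
    using holomorphic_derivI[OF f V that] .
  have cf: "continuous_on V f" "continuous_on V (deriv f)"
    using f holomorphic_deriv[OF f V] holomorphic_on_imp_continuous_on by blast+
  have uc: "continuous_on V u" using u has_grad_continuous continuous_at_imp_continuous_on by blast
  have ext: "continuous_on UNIV (\<lambda>z. if z \<in> V then h z else 0)"
    if "continuous_on V h" "\<And>z. z \<in> V - K \<Longrightarrow> h z = 0" for h :: "complex \<Rightarrow> real"
  proof -
    have "continuous_on (V \<union> - K) (\<lambda>z. if z \<in> V then h z else 0)"
      by (rule continuous_on_cases_local_open) (use V opK that in \<open>auto intro: open_subset\<close>)
    moreover have "V \<union> - K = UNIV" using K(2) by auto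
    ultimately show ?thesis by simp
  qed
  have main: "integrable lborel (\<lambda>z. if z \<in> V then u z * (K' z \<bullet> e) + P z * (G z \<bullet> e) else 0)
      \<and> integral\<^sup>L lborel (\<lambda>z. if z \<in> V then u z * (K' z \<bullet> e) + P z * (G z \<bullet> e) else 0) = 0"
    if P: "\<And>z. z \<in> V \<Longrightarrow> has_grad P (K' z) z" "continuous_on V K'" for P K' e
  proof -
    define p where "p z = (if z \<in> V then u z * P z else 0)" for z
    define p' where "p' z v = (if z \<in> V then (u z *\<^sub>R K' z + P z *\<^sub>R G z) \<bullet> v else 0)" for z v
    have Pc: "continuous_on V P" using P(1) has_grad_continuous continuous_at_imp_continuous_on by blast
    have der: "(p has_derivative p' z) (at z)" for z
    proof (cases "z \<in> V")
      case True
      have "has_grad p (u z *\<^sub>R K' z + P z *\<^sub>R G z) z"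
        by (rule has_grad_transform[OF has_grad_mult[OF u[OF True] P(1)[OF True]] V True]) (simp add: p_def)
      moreover have "p' z = (\<lambda>v. (u z *\<^sub>R K' z + P z *\<^sub>R G z) \<bullet> v)" using True by (simp add: p'_def fun_eq_iff)
      ultimately show ?thesis by (simp add: has_grad_def)
    next
      case False
      have "has_grad p 0 z"
        by (rule has_grad_transform[OF has_grad_const opK]) (use False K in \<open>auto simp: p_def\<close>)
      moreover have "p' z = (\<lambda>v. 0 \<bullet> v)" using False by (simp add: p'_def fun_eq_iff)
      ultimately show ?thesis by (simp add: has_grad_def)
    qed
    have p'0: "(u z *\<^sub>R K' z + P z *\<^sub>R G z) \<bullet> e = 0" if "z \<in> V - K" for z using that K(3) G0 by simp
    have cont: "continuous_on UNIV (\<lambda>z. p' z e)"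
      unfolding p'_def by (rule ext) (use p'0 in \<open>auto intro!: continuous_intros uc P(2) Pc G\<close>)
    have z1: "p z = 0" if "z \<notin> K" for z using that K(3) by (simp add: p_def)
    have z2: "p' z e = 0" if "z \<notin> K" for z using that p'0 by (simp add: p'_def)
    have eq: "(\<lambda>z. p' z e) = (\<lambda>z. if z \<in> V then u z * (K' z \<bullet> e) + P z * (G z \<bullet> e) else 0)"
      by (simp add: p'_def fun_eq_iff inner_add_left)
    show ?thesis
      using integral_directional_derivative_eq_0[OF der cont K(1) z1 z2] unfolding eq by simp
  qed
  \<comment> \<open>\<open>main\<close> is applied to \<open>Re f\<close> in direction 1 and to
    \<open>- Im f\<close> in direction \<i>, the components of \<open>cnj f\<close>. In the sum the
    terms with \<open>deriv f\<close> cancel: together they are \<open>u\<close> times the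
    divergence of \<open>cnj f\<close>.\<close>
  have gRe: "has_grad (\<lambda>z. Re (f z)) (cnj (deriv f z)) z" if "z \<in> V" for z
    using has_grad_Re[OF df[OF that]] .
  have gIm: "has_grad (\<lambda>z. - Im (f z)) (cnj (\<i> * deriv f z)) z" if "z \<in> V" for z
  proof -
    have "((\<lambda>z. \<i> * f z) has_field_derivative \<i> * deriv f z) (at z)"
      using DERIV_cmult[OF df[OF that]] .
    from has_grad_Re[OF this] show ?thesis by simp
  qed
  note m1 = main[OF gRe, of 1] and m2 = main[OF gIm, of \<i>]
  have c1: "continuous_on V (\<lambda>z. cnj (deriv f z))" and c2: "continuous_on V (\<lambda>z. cnj (\<i> * deriv f z))"
    by (intro continuous_intros cf)+
  let ?A = "\<lambda>z. if z \<in> V then u z * (cnj (deriv f z) \<bullet> 1) + Re (f z) * (G z \<bullet> 1) else 0"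
  let ?B = "\<lambda>z. if z \<in> V then u z * (cnj (\<i> * deriv f z) \<bullet> \<i>) + - Im (f z) * (G z \<bullet> \<i>) else 0"
  have "(\<lambda>z. indicator V z *\<^sub>R (G z \<bullet> cnj (f z))) = (\<lambda>z. ?A z + ?B z)"
    by (auto simp: fun_eq_iff inner_complex_def indicator_def algebra_simps)
  then have "set_lebesgue_integral lborel V (\<lambda>z. G z \<bullet> cnj (f z)) = integral\<^sup>L lborel (\<lambda>z. ?A z + ?B z)"
    by (simp add: set_lebesgue_integral_def)
  also have "\<dots> = integral\<^sup>L lborel ?A + integral\<^sup>L lborel ?B"
    by (rule Bochner_Integration.integral_add) (use m1 m2 c1 c2 in blast)+
  finally show ?thesis using m1 m2 c1 c2 by simp
qed

section \<open>A partition of unity subordinate to the sheets\<close>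

context sheeted_surface
begin

text \<open>A bump on sheet \<open>i\<close>, spread over all translates of the sheet so that it is
  constant on fibres. Its radius lies strictly between those of core and sheet: it is positive on
  the core and zero near the boundary of the sheet.\<close>

definition pbump :: "nat \<Rightarrow> complex \<Rightarrow> real" where
  "pbump i z = (if z \<in> lift_set (\<pi> ` sheet i) then bump (ctr i) (3/2 * rad i) (to_sheet i z) else 0)"

definition pbump_grad :: "nat \<Rightarrow> complex \<Rightarrow> complex" where
  "pbump_grad i z = (if z \<in> lift_set (\<pi> ` sheet i)
     then cnj (deriv (to_sheet i) z) * bump_grad (ctr i) (3/2 * rad i) (to_sheet i z) else 0)"

definition supp :: "nat \<Rightarrow> complex set" where "supp i = cball (ctr i) (3/2 * rad i)"

lemma supp_sheet: "i < N \<Longrightarrow> supp i \<subseteq> sheet i"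
  using rad_pos[of i] by (auto simp: supp_def sheet_def)

lemma pbump_zero:
  assumes i: "i < N" and z: "z \<notin> lift_set (\<pi> ` supp i)"
  shows "pbump i z = 0 \<and> pbump_grad i z = 0"
proof (cases "z \<in> lift_set (\<pi> ` sheet i)")
  case True
  have "to_sheet i z \<notin> supp i" using z True to_sheet(2)[OF i True] by (auto simp: lift_set_def) (metis imageI)
  then have "dist (to_sheet i z) (ctr i) \<ge> 3/2 * rad i" by (simp add: supp_def dist_commute)
  then show ?thesis using bump_zero[of "3/2 * rad i" "to_sheet i z" "ctr i"] rad_pos[OF i] True
    by (simp add: pbump_def pbump_grad_def)
qed (simp add: pbump_def pbump_grad_def)

lemma supp_compl_open:
  assumes i: "i < N" shows "open (H - lift_set (\<pi> ` supp i))"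
proof -
  have "compact (\<pi> ` supp i)"
    by (rule compact_continuous_image[OF continuous_on_subset[OF pi_cont]])
      (use supp_sheet[OF i] sheet_H[OF i] in \<open>auto simp: supp_def\<close>)
  then have "open (- (\<pi> ` supp i))" by (simp add: compact_imp_closed open_Compl)
  from continuous_open_preimage[OF pi_cont open_upper_half_plane this]
  have "open (H \<inter> \<pi> -` (- (\<pi> ` supp i)))" .
  moreover have "H - lift_set (\<pi> ` supp i) = H \<inter> \<pi> -` (- (\<pi> ` supp i))" by (auto simp: lift_set_def)
  ultimately show ?thesis by simp
qed

lemma pbump_has_grad:
  assumes i: "i < N" and z: "z \<in> H"
  shows "has_grad (pbump i) (pbump_grad i z) z"
proof (cases "z \<in> lift_set (\<pi> ` sheet i)")
  case True
  have "(to_sheet i has_field_derivative deriv (to_sheet i) z) (at z)"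
    using holomorphic_derivI[OF to_sheet_holomorphic[OF i] sheet_lift_open[OF i] True] .
  from has_grad_compose[OF this bump_has_grad[of "ctr i" "3/2 * rad i"]]
  show ?thesis
    by (rule has_grad_transform[OF _ sheet_lift_open[OF i] True, where u'="pbump i", THEN back_subst[where P="\<lambda>G. has_grad (pbump i) G z"]])
      (use True in \<open>auto simp: pbump_def pbump_grad_def\<close>)
next
  case False
  then have "z \<in> H - lift_set (\<pi> ` supp i)" using z supp_sheet[OF i] by (auto simp: lift_set_def)
  then have "has_grad (pbump i) 0 z"
    by (rule has_grad_transform[OF has_grad_const supp_compl_open[OF i]]) (use pbump_zero[OF i] in auto)
  then show ?thesis using False by (simp add: pbump_grad_def)
qed

lemma pbump_grad_cont:
  assumes i: "i < N" shows "continuous_on H (pbump_grad i)"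
proof -
  let ?O = "lift_set (\<pi> ` sheet i)" and ?V = "H - lift_set (\<pi> ` supp i)"
  have U: "?O \<union> ?V = H" using supp_sheet[OF i] by (auto simp: lift_set_def)
  have t: "continuous_on ?O (to_sheet i)" "continuous_on ?O (deriv (to_sheet i))"
    using to_sheet_holomorphic[OF i] holomorphic_deriv[OF to_sheet_holomorphic[OF i] sheet_lift_open[OF i]]
      holomorphic_on_imp_continuous_on by blast+
  have "continuous_on ?O (\<lambda>z. cnj (deriv (to_sheet i) z) * bump_grad (ctr i) (3/2 * rad i) (to_sheet i z))"
    by (intro continuous_intros t continuous_on_compose2[OF bump_grad_cont t(1)]) auto
  then have c1: "continuous_on ?O (pbump_grad i)"
    by (rule continuous_on_eq) (simp add: pbump_grad_def)
  have c2: "continuous_on ?V (pbump_grad i)"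
    by (rule continuous_on_eq[of _ "\<lambda>z. 0"]) (use pbump_zero[OF i] in auto)
  have "continuous_on (?O \<union> ?V) (pbump_grad i)"
    by (rule continuous_on_open_Un[OF sheet_lift_open[OF i] supp_compl_open[OF i] c1 c2])
  then show ?thesis by (simp add: U)
qed

lemma pbump_nonneg: "pbump i z \<ge> 0"
  by (simp add: pbump_def bump_nonneg)

lemma pbump_invariant: "Im z > 0 \<Longrightarrow> Im w > 0 \<Longrightarrow> \<pi> z = \<pi> w \<Longrightarrow> pbump i z = pbump i w"
  by (simp add: pbump_def lift_set_def to_sheet_def)

lemma pbump_sum_pos:
  assumes z: "z \<in> H" shows "(\<Sum>i<N. pbump i z) > 0"
proof -
  obtain i where i: "i < N" "\<pi> z \<in> \<pi> ` core i" using pi_in[OF z] sheets_cover by (auto simp: core_def)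
  then obtain w where w: "w \<in> core i" "\<pi> w = \<pi> z" by force
  then have ws: "w \<in> sheet i" using core_sheet[OF i(1)] by blast
  then have "to_sheet i z = w" using to_sheet_unique[OF i(1) ws w(2)] by simp
  moreover have "z \<in> lift_set (\<pi> ` sheet i)" using z ws w(2) by (auto simp: lift_set_def) (metis imageI)
  moreover have "dist w (ctr i) < 3/2 * rad i" using w(1) rad_pos[OF i(1)] by (simp add: core_def dist_commute)
  ultimately have "pbump i z > 0" by (simp add: pbump_def bump_pos)
  then show ?thesis using i(1) pbump_nonneg by (intro sum_pos2[of _ i]) auto
qed

text \<open>The weak form of harmonicity on the closed surface, by a partition of unity on the sheets.\<close>

lemma weak_harmonic:
  assumes f: "f holomorphic_on H" "\<And>g z. deck_transformation \<pi> g \<Longrightarrow> z \<in> H \<Longrightarrow> f (g z) * deriv g z = f z"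
    and u: "\<And>z. z \<in> H \<Longrightarrow> has_grad u (G z) z" and G: "continuous_on H G"
    and inv: "\<And>g z. deck_transformation \<pi> g \<Longrightarrow> z \<in> H \<Longrightarrow> u (g z) = u z"
  shows "set_lebesgue_integral lborel F (\<lambda>z. G z \<bullet> cnj (f z)) = 0"
proof -
  define \<Psi> where "\<Psi> z = (\<Sum>i<N. pbump i z)" for z
  define \<Psi>' where "\<Psi>' z = (\<Sum>i<N. pbump_grad i z)" for z
  have \<Psi>: "has_grad \<Psi> (\<Psi>' z) z" if "z \<in> H" for z
    unfolding \<Psi>_def[abs_def] \<Psi>'_def by (rule has_grad_sum) (use pbump_has_grad that in auto)
  have \<Psi>_pos: "\<Psi> z > 0" if "z \<in> H" for z unfolding \<Psi>_def using pbump_sum_pos[OF that] .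
  have \<Psi>'_cont: "continuous_on H \<Psi>'" unfolding \<Psi>'_def[abs_def]
    by (intro continuous_intros pbump_grad_cont) auto
  \<comment> \<open>The part of \<open>u\<close> carried by sheet \<open>i\<close>; the bumps are
    normalized by their sum, which is positive because the cores cover the surface.\<close>
  define v where "v i z = pbump i z / \<Psi> z * u z" for i z
  define Gv where "Gv i z = (pbump i z / \<Psi> z) *\<^sub>R G z +
     u z *\<^sub>R ((1 / \<Psi> z) *\<^sub>R pbump_grad i z - (pbump i z / (\<Psi> z)\<^sup>2) *\<^sub>R \<Psi>' z)" for i z
  have v: "has_grad (v i) (Gv i z) z" if "i < N" "z \<in> H" for i z
    unfolding v_def[abs_def] Gv_def
    using has_grad_mult[OF has_grad_divide[OF pbump_has_grad[OF that] \<Psi>[OF that(2)]] u[OF that(2)]] \<Psi>_pos[OF that(2)] by simp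
  have cu: "continuous_on H u" using u has_grad_continuous continuous_at_imp_continuous_on by blast
  have cp: "continuous_on H (pbump i)" if "i < N" for i
    using pbump_has_grad[OF that] has_grad_continuous continuous_at_imp_continuous_on by blast
  have c\<Psi>: "continuous_on H \<Psi>" using \<Psi> has_grad_continuous continuous_at_imp_continuous_on by blast
  have Gv_cont: "continuous_on H (Gv i)" if "i < N" for i
    unfolding Gv_def[abs_def]
    by (intro continuous_intros cp[OF that] c\<Psi> G cu pbump_grad_cont[OF that] \<Psi>'_cont) (use \<Psi>_pos in force)+
  have pinv: "pbump i (g z) = pbump i z" "\<Psi> (g z) = \<Psi> z" if "deck_transformation \<pi> g" "z \<in> H" for i g z
  proof -
    have "pbump j (g z) = pbump j z" for j
      by (rule pbump_invariant) (use deck_in[OF that] deck_pi[OF that] that in auto)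
    then show "pbump i (g z) = pbump i z" "\<Psi> (g z) = \<Psi> z" by (simp_all add: \<Psi>_def)
  qed
  have v_inv: "v i (g z) = v i z" if "deck_transformation \<pi> g" "z \<in> H" for i g z
    using pinv[OF that] inv[OF that] by (simp add: v_def)
  have zero: "set_lebesgue_integral lborel F (\<lambda>z. Gv i z \<bullet> cnj (f z)) = 0" if i: "i < N" for i
  proof -
    let ?k = "\<lambda>z. Gv i z \<bullet> cnj (f z)"
    have inv_k: "invariant_density ?k"
      by (rule invariant_density_inner[where u="v i" and G="Gv i" and f=f, OF f v[OF i] Gv_cont[OF i]]) (assumption | (rule v_inv; assumption))+
    have v0: "v i z = 0" if "z \<in> H" "z \<notin> lift_set (\<pi> ` supp i)" for z
      using pbump_zero[OF i that(2)] by (simp add: v_def)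
    have Gv0: "Gv i z = 0" if "z \<in> H" "z \<notin> lift_set (\<pi> ` supp i)" for z
      using pbump_zero[OF i that(2)] by (simp add: Gv_def)
    have bs: "sheet i \<in> sets borel" by (simp add: sheet_def)
    have bl: "lift_set (\<pi> ` sheet i) \<in> sets borel" using sheet_lift_open[OF i] by simp
    \<comment> \<open>On the single disc \<open>sheet i\<close> the function \<open>v i\<close> has
      compact support; invariance of the density then transfers the vanishing integral to the part
      of \<open>F\<close> over the sheet.\<close>
    have "set_lebesgue_integral lborel (sheet i) ?k = 0"
    proof (rule integral_grad_compact_support[where K="supp i" and u="v i"])
      show "v i z = 0" if "z \<in> sheet i - supp i" for z
      proof (rule v0)
        show "z \<in> H" using that sheet_H[OF i] by blast
        show "z \<notin> lift_set (\<pi> ` supp i)"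
          using that supp_sheet[OF i] inj_sheet[OF i] by (auto simp: lift_set_def dest: inj_onD)
      qed
      show "f holomorphic_on sheet i" using f(1) sheet_H[OF i] holomorphic_on_subset by blast
      show "has_grad (v i) (Gv i z) z" if "z \<in> sheet i" for z using v[OF i] sheet_H[OF i] that by blast
      show "continuous_on (sheet i) (Gv i)" using Gv_cont[OF i] sheet_H[OF i] continuous_on_subset by blast
    qed (use supp_sheet[OF i] in \<open>auto simp: sheet_def supp_def\<close>)
    then have "set_lebesgue_integral lborel (F \<inter> lift_set (\<pi> ` sheet i)) ?k = 0"
      using integral_representatives(2)[OF inv_k bs sheet_H[OF i] inj_sheet[OF i] bl] by simp
    moreover have "indicator F z *\<^sub>R ?k z = indicator (F \<inter> lift_set (\<pi> ` sheet i)) z *\<^sub>R ?k z" for z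
    proof (cases "z \<in> F \<and> z \<notin> lift_set (\<pi> ` sheet i)")
      case True
      then have "z \<in> H" "z \<notin> lift_set (\<pi> ` supp i)" using F_H supp_sheet[OF i] by (auto simp: lift_set_def)
      then show ?thesis using Gv0 by simp
    qed (auto simp: indicator_def)
    ultimately show ?thesis unfolding set_lebesgue_integral_def by (simp only:)
  qed
  have sum: "G z = (\<Sum>i<N. Gv i z)" if z: "z \<in> H" for z
  proof -
    have "(\<Sum>i<N. v i w) = u w" if "w \<in> H" for w
    proof -
      have "(\<Sum>i<N. v i w) = (\<Sum>i<N. pbump i w) / \<Psi> w * u w"
        by (simp add: v_def sum_distrib_right sum_divide_distrib)
      then show ?thesis using \<Psi>_pos[OF that] by (simp add: \<Psi>_def)
    qed
    moreover have hs: "has_grad (\<lambda>z. \<Sum>i<N. v i z) (\<Sum>i<N. Gv i z) z"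
      by (rule has_grad_sum) (use v z in auto)
    ultimately have "has_grad u (\<Sum>i<N. Gv i z) z"
      using has_grad_transform[OF hs open_upper_half_plane z] by blast
    then show ?thesis using u[OF z] has_grad_unique by blast
  qed
  have "set_lebesgue_integral lborel F (\<lambda>z. G z \<bullet> cnj (f z)) = set_lebesgue_integral lborel F (\<lambda>z. \<Sum>i<N. Gv i z \<bullet> cnj (f z))"
    by (rule set_lebesgue_integral_cong) (use F_borel F_H sum in \<open>auto simp: inner_sum_left\<close>)
  also have "\<dots> = (\<Sum>i<N. set_lebesgue_integral lborel F (\<lambda>z. Gv i z \<bullet> cnj (f z)))"
  proof -
    have "set_integrable lborel F (\<lambda>z. Gv i z \<bullet> cnj (f z))" if "i < N" for i
      by (rule integrable_on_F[OF _ F_borel])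
        (intro continuous_intros Gv_cont[OF that] holomorphic_on_imp_continuous_on[OF f(1)], simp)
    then show ?thesis
      unfolding set_lebesgue_integral_def scaleR_sum_right set_integrable_def
      by (intro Bochner_Integration.integral_sum) auto
  qed
  also have "\<dots> = 0" using zero by simp
  finally show ?thesis .
qed

lemma energy_eq:
  assumes \<sigma>: "harmonic_form A \<sigma>" and f: "f holomorphic_on H"
    and pull: "\<And>c z. c \<in> A \<Longrightarrow> z \<in> lift_set (fst c) \<Longrightarrow> f z = form_coeff \<sigma> c ((snd c \<circ> \<pi>) z) * deriv (snd c \<circ> \<pi>) z"
    and D: "D \<subseteq> S" "lift_set D \<in> sets borel"
  shows "energy A D \<sigma> = set_lebesgue_integral lborel (F \<inter> lift_set D) (\<lambda>z. (cmod (f z))\<^sup>2)"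
proof -
  have one: "one_form A \<sigma>" using \<sigma> by (simp add: harmonic_form_def)
  \<comment> \<open>The star at \<i> evaluates \<sigma> at \<open>\<i> * \<i> = -1\<close>, so the
    density is the sum of the squares of both coefficients.\<close>
  have w: "wedge \<sigma> (hodge_star \<sigma>) c w 1 \<i> = (cmod (form_coeff \<sigma> c w))\<^sup>2" if "c \<in> A" "w \<in> chart_range c" for c w
    using form_coeff_Re[OF one that, of "-1"]
    by (simp add: wedge_def hodge_star_def form_coeff_def cmod_power2) (simp add: power2_eq_square)
  show ?thesis unfolding energy_def
  proof (rule surface_integral_eq[OF _ _ _ D])
    show "continuous_on H (\<lambda>z. (cmod (f z))\<^sup>2)"
      by (intro continuous_intros holomorphic_on_imp_continuous_on[OF f])
    fix c assume c: "c \<in> A"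
    show "continuous_on (chart_range c) (\<lambda>w. wedge \<sigma> (hodge_star \<sigma>) c w 1 \<i>)"
      by (rule continuous_on_eq[of _ "\<lambda>w. (cmod (form_coeff \<sigma> c w))\<^sup>2"])
        (use w[OF c] in \<open>auto intro!: continuous_intros holomorphic_on_imp_continuous_on form_coeff_holomorphic[OF \<sigma> c]\<close>)
    fix z assume z: "z \<in> lift_set (fst c)"
    then have "(snd c \<circ> \<pi>) z \<in> chart_range c" by (auto simp: chart_range_def lift_set_def)
    then show "(cmod (deriv (snd c \<circ> \<pi>) z))\<^sup>2 * wedge \<sigma> (hodge_star \<sigma>) c ((snd c \<circ> \<pi>) z) 1 \<i> = (cmod (f z))\<^sup>2"
      using w[OF c] pull[OF c z] by (simp add: norm_mult power_mult_distrib mult.commute)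
  qed
qed

end

section \<open>The two sides of the geodesic\<close>

text \<open>The image of \<open>V\<close> is open and also closed in the connected set
  \<open>T\<close>: if a disc over \<open>T\<close> has a translate that meets \<open>V\<close>, the
  whole translate lies in the component \<open>V\<close>.\<close>

lemma (in compact_hyperbolic_surface) component_lift_surjective:
  assumes T: "openin (top_of_set S) T" "connected T" and z0: "z0 \<in> lift_set T"
  defines "V \<equiv> connected_component_set (lift_set T) z0"
  shows "open V" "connected V" "z0 \<in> V" "V \<subseteq> lift_set T" "\<pi> ` V = T"
proof -
  have oT: "open (lift_set T)" using T(1) by (rule lift_set_open)
  show oV: "open V" unfolding V_def using oT by (rule open_connected_component)
  show cV: "connected V" unfolding V_def by simp
  show zV: "z0 \<in> V" unfolding V_def using z0 by (simp add: connected_component_refl_eq)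
  show sV: "V \<subseteq> lift_set T" unfolding V_def by (rule connected_component_subset)
  have VH: "V \<subseteq> H" using sV by (auto simp: lift_set_def)
  have oI: "openin (top_of_set T) (\<pi> ` V)"
  proof (rule openin_subset_trans[OF pi_open_map[OF oV VH]])
    show "\<pi> ` V \<subseteq> T" using sV by (auto simp: lift_set_def)
  qed (rule openin_imp_subset[OF T(1)])
  have "openin (top_of_set T) (T - \<pi> ` V)"
  proof (subst openin_subopen, rule ballI)
    fix p assume p: "p \<in> T - \<pi> ` V"
    then obtain z where z: "z \<in> H" "\<pi> z = p" using openin_imp_subset[OF T(1)] lift_cases by blast
    then have "z \<in> lift_set T" using p by (simp add: lift_set_def)
    then obtain e where e: "e > 0" "ball z e \<subseteq> lift_set T" using oT open_contains_ball by blast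
    then have bH: "ball z e \<subseteq> H" by (auto simp: lift_set_def)
    have "\<pi> ` ball z e \<inter> \<pi> ` V = {}"
    proof (rule ccontr)
      assume "\<pi> ` ball z e \<inter> \<pi> ` V \<noteq> {}"
      then obtain w w' where w: "w \<in> ball z e" "w' \<in> V" "\<pi> w = \<pi> w'" by force
      obtain g where g: "deck_transformation \<pi> g" "g w = w'"
        using deck_exists[of w w'] w bH VH by (metis subsetD)
      have "connected (g ` ball z e)"
        by (rule connected_continuous_image[OF continuous_on_subset[OF holomorphic_on_imp_continuous_on[OF deck_holo[OF g(1)]] bH]]) simp
      moreover have "g ` ball z e \<subseteq> lift_set T"
      proof
        fix y assume "y \<in> g ` ball z e"
        then obtain x where x: "x \<in> ball z e" "y = g x" by blast
        then have "x \<in> H" "\<pi> x \<in> T" using e(2) by (auto simp: lift_set_def)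
        then show "y \<in> lift_set T" using deck_in[OF g(1)] deck_pi[OF g(1)] x(2) by (auto simp: lift_set_def)
      qed
      moreover have "w' \<in> g ` ball z e" using w(1) g(2) by blast
      moreover have "connected_component_set (lift_set T) w' = V"
        using w(2) unfolding V_def by (metis connected_component_eq)
      ultimately have "g ` ball z e \<subseteq> V" by (metis connected_component_maximal)
      then have "g z \<in> V" using e(1) by auto
      then have "p \<in> \<pi> ` V" using deck_pi[OF g(1) z(1)] z(2) by (metis imageI)
      then show False using p by blast
    qed
    moreover have "openin (top_of_set T) (\<pi> ` ball z e)"
    proof (rule openin_subset_trans[OF pi_open_map[OF open_ball bH]])
      show "\<pi> ` ball z e \<subseteq> T" using e(2) by (auto simp: lift_set_def)
    qed (rule openin_imp_subset[OF T(1)])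
    moreover have "\<pi> ` ball z e \<subseteq> T" using e(2) by (auto simp: lift_set_def)
    moreover have "p \<in> \<pi> ` ball z e" using z(2) e(1) by force
    ultimately show "\<exists>U. openin (top_of_set T) U \<and> p \<in> U \<and> U \<subseteq> T - \<pi> ` V" by blast
  qed
  then have "closedin (top_of_set T) (\<pi> ` V)"
    using oI by (auto simp: closedin_def openin_imp_subset)
  then have "\<pi> ` V = {} \<or> \<pi> ` V = T" using T(2) oI by (auto simp: connected_clopen)
  then show "\<pi> ` V = T" using zV by auto
qed

text \<open>On the lifted curve the integrand is the derivative of \<open>Re P\<close> along
  \<open>q\<close>, so the sum over a subdivision telescopes. Polynomial curves have continuous
  velocity throughout; the subdivision comes from a Lebesgue number for the lifted chart
  domains.\<close>

lemma (in compact_hyperbolic_surface) line_integral_lift: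
  assumes \<sigma>: "harmonic_form A \<sigma>"
    and pull: "\<And>c z. c \<in> A \<Longrightarrow> z \<in> lift_set (fst c) \<Longrightarrow> f z = form_coeff \<sigma> c ((snd c \<circ> \<pi>) z) * deriv (snd c \<circ> \<pi>) z"
    and P: "\<And>z. z \<in> H \<Longrightarrow> (P has_field_derivative f z) (at z)"
    and q: "polynomial_function q" "path_image q \<subseteq> H"
  shows "has_line_integral A \<sigma> (\<pi> \<circ> q) (Re (P (pathfinish q)) - Re (P (pathstart q)))"
proof -
  have one: "one_form A \<sigma>" using \<sigma> by (simp add: harmonic_form_def)
  obtain q' where q': "polynomial_function q'" "\<And>x. (q has_vector_derivative q' x) (at x)"
    using has_vector_derivative_polynomial_function[OF q(1)] by metis
  have qH: "q s \<in> H" if "s \<in> {0..1}" for s using q(2) that unfolding path_image_def by blast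
  have qc: "continuous_on UNIV q" "continuous_on UNIV q'"
    using q(1) q'(1) continuous_on_polymonial_function by blast+
  have op: "open (q -` lift_set (fst c))" if "c \<in> A" for c
    using open_vimage[OF lift_set_open[OF chart_open[OF that]] qc(1)] .
  have cov: "{0..1} \<subseteq> \<Union>((\<lambda>c. q -` lift_set (fst c)) ` A)"
  proof
    fix s :: real assume "s \<in> {0..1}"
    then have "q s \<in> H" by (rule qH)
    then show "s \<in> \<Union>((\<lambda>c. q -` lift_set (fst c)) ` A)" using pi_in charts_cover by (auto simp: lift_set_def)
  qed
  obtain e where e: "e > 0" "\<And>x. x \<in> {0..1::real} \<Longrightarrow> \<exists>G\<in>(\<lambda>c. q -` lift_set (fst c)) ` A. ball x e \<subseteq> G"
    using Heine_Borel_lemma[OF compact_Icc cov] op by blast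
  obtain n :: nat where n: "n > 0" "1 / real n < e"
    using reals_Archimedean[OF e(1)] by (metis inverse_eq_divide zero_less_Suc)
  define t where "t i = real i / real n" for i
  have ti: "t i \<in> {0..1}" if "i \<le> n" for i using that n by (simp add: t_def field_simps)
  have tsuc: "t (Suc i) = t i + 1 / real n" for i using n by (simp add: t_def field_simps)
  have "\<exists>c\<in>A. ball (t i) e \<subseteq> q -` lift_set (fst c)" if "i < n" for i
    using e(2)[OF ti] that by auto
  then obtain c where c: "\<And>i. i < n \<Longrightarrow> c i \<in> A \<and> ball (t i) e \<subseteq> q -` lift_set (fst (c i))" by metis
  have seg: "q s \<in> lift_set (fst (c i))" if "i < n" "s \<in> {t i..t (Suc i)}" for i s
  proof -
    have "s \<in> ball (t i) e" using that(2) n tsuc[of i] by (auto simp: dist_real_def abs_le_iff)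
    then show ?thesis using c[OF that(1)] by blast
  qed
  define V where "V i s = deriv (snd (c i) \<circ> \<pi>) (q s) * q' s" for i s
  have qder: "(q has_vector_derivative q' s) (at s within X)" for s X
    using q'(2) has_vector_derivative_at_within by blast
  have int: "integral {t i..t (Suc i)} (\<lambda>s. \<sigma> (c i) (snd (c i) ((\<pi> \<circ> q) s)) (V i s)) = Re (P (q (t (Suc i)))) - Re (P (q (t i)))"
    if i: "i < n" for i
  proof -
    have eq: "\<sigma> (c i) (snd (c i) ((\<pi> \<circ> q) s)) (V i s) = Re (f (q s) * q' s)" if s: "s \<in> {t i..t (Suc i)}" for s
    proof -
      have "snd (c i) (\<pi> (q s)) \<in> chart_range (c i)" using seg[OF i s] by (auto simp: chart_range_def lift_set_def)
      from form_coeff_Re[OF one _ this] show ?thesis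
        using c[OF i] pull[OF _ seg[OF i s]] by (simp add: V_def mult.assoc)
    qed
    have "((\<lambda>s. Re (f (q s) * q' s)) has_integral (Re (P (q (t (Suc i)))) - Re (P (q (t i))))) {t i..t (Suc i)}"
    proof (rule fundamental_theorem_of_calculus)
      fix s assume s: "s \<in> {t i..t (Suc i)}"
      have "q s \<in> H" using seg[OF i s] by (auto simp: lift_set_def)
      from field_vector_diff_chain_within[OF qder has_field_derivative_at_within[OF P[OF this]]]
      have "((P \<circ> q) has_vector_derivative q' s * f (q s)) (at s within {t i..t (Suc i)})" .
      from bounded_linear.has_vector_derivative[OF bounded_linear_Re this]
      show "((\<lambda>s. Re (P (q s))) has_vector_derivative Re (f (q s) * q' s)) (at s within {t i..t (Suc i)})"
        by (simp add: o_def mult.commute)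
    qed (use n tsuc in simp)
    then show ?thesis using eq by (metis (no_types, lifting) integral_cong integral_unique)
  qed
  have "has_line_integral A \<sigma> (\<pi> \<circ> q) (\<Sum>i<n. integral {t i..t (Suc i)} (\<lambda>s. \<sigma> (c i) (snd (c i) ((\<pi> \<circ> q) s)) (V i s)))"
    unfolding has_line_integral_def
  proof (rule exI[of _ n], rule exI[of _ t], rule exI[of _ c], rule exI[of _ V], intro conjI allI impI ballI)
    show "t 0 = 0" "t n = 1" using n by (simp_all add: t_def)
    fix i assume i: "i < n"
    show "t i < t (Suc i)" using tsuc n by simp
    show cA: "c i \<in> A" using c[OF i] by simp
    show "(\<pi> \<circ> q) ` {t i..t (Suc i)} \<subseteq> fst (c i)" using seg[OF i] by (auto simp: lift_set_def)
    have hol: "(snd (c i) \<circ> \<pi>) holomorphic_on lift_set (fst (c i))"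
      using chart_lift_holomorphic[OF cA] by (simp add: lift_set_def)
    have "deriv (snd (c i) \<circ> \<pi>) holomorphic_on lift_set (fst (c i))"
      by (rule holomorphic_deriv[OF hol lift_set_open[OF chart_open[OF cA]]])
    then have cd: "continuous_on (lift_set (fst (c i))) (deriv (snd (c i) \<circ> \<pi>))"
      by (rule holomorphic_on_imp_continuous_on)
    have cq: "continuous_on {t i..t (Suc i)} q" "continuous_on {t i..t (Suc i)} q'"
      using continuous_on_subset[OF qc(1) subset_UNIV] continuous_on_subset[OF qc(2) subset_UNIV] by this+
    have qs: "q ` {t i..t (Suc i)} \<subseteq> lift_set (fst (c i))" by (rule image_subsetI) (rule seg[OF i])
    show "continuous_on {t i..t (Suc i)} (V i)"
      unfolding V_def by (rule continuous_on_mult[OF continuous_on_compose2[OF cd cq(1) qs] cq(2)])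
    fix s assume s: "s \<in> {t i..t (Suc i)}"
    from field_vector_diff_chain_within[OF qder has_field_derivative_at_within[OF chart_lift_deriv[OF cA seg[OF i s]]]]
    show "((snd (c i) \<circ> (\<pi> \<circ> q)) has_vector_derivative V i s) (at s within {t i..t (Suc i)})"
      by (simp only: V_def o_assoc mult.commute)
  qed simp
  also have "(\<Sum>i<n. integral {t i..t (Suc i)} (\<lambda>s. \<sigma> (c i) (snd (c i) ((\<pi> \<circ> q) s)) (V i s)))
      = (\<Sum>i<n. Re (P (q (t (Suc i)))) - Re (P (q (t i))))"
    by (rule sum.cong) (use int in auto)
  also have "\<dots> = Re (P (q (t n))) - Re (P (q (t 0)))" by (rule sum_lessThan_telescope)
  also have "\<dots> = Re (P (pathfinish q)) - Re (P (pathstart q))" using n by (simp add: t_def pathfinish_def pathstart_def)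
  finally show ?thesis .
qed

context collar_surface
begin

definition left_wedge :: "complex set" where "left_wedge = {z \<in> wedge_set. Re z < 0}"
definition right_wedge :: "complex set" where "right_wedge = {z \<in> wedge_set. Re z > 0}"

lemma wedge_split: "wedge_set = left_wedge \<union> axis \<union> right_wedge"
proof -
  have "z \<in> axis" if "Im z > 0" "Re z = 0" for z
    using that unfolding axis_def by (intro CollectI exI[of _ "Im z"]) (auto simp: complex_eq_iff)
  then show ?thesis using axis_in_wedge by (auto simp: left_wedge_def right_wedge_def wedge_set_def) (meson linorder_neqE_linordered_idom)
qed

lemma wedge_linear: "wedge_set = {z. Im z > 0} \<inter> {z. Re z < \<kappa> * Im z} \<inter> {z. Re z > - \<kappa> * Im z}"
  by (auto simp: wedge_set_def abs_less_iff)

lemma open_wedge: "open wedge_set"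
  unfolding wedge_linear by (intro open_Int open_Collect_less continuous_intros)

lemma convex_half_planes: "convex {z. Re z < m * Im z}" "convex {z. Re z > m * Im z}"
proof -
  have 1: "{z. Re z < m * Im z} = {z. Complex 1 (- m) \<bullet> z < 0}" by (auto simp: inner_complex_def)
  have 2: "{z. Re z > m * Im z} = {z. Complex 1 (- m) \<bullet> z > 0}" by (auto simp: inner_complex_def)
  show "convex {z. Re z < m * Im z}" unfolding 1 by (rule convex_halfspace_lt)
  show "convex {z. Re z > m * Im z}" unfolding 2 by (rule convex_halfspace_gt)
qed

lemma convex_wedge: "convex wedge_set"
  unfolding wedge_linear by (intro convex_Int convex_half_planes convex_halfspace_Im_gt)

lemma connected_sides: "connected left_wedge" "connected right_wedge"
proof -
  have 1: "left_wedge = wedge_set \<inter> {z. Re z < 0 * Im z}" by (auto simp: left_wedge_def)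
  have 2: "right_wedge = wedge_set \<inter> {z. Re z > 0 * Im z}" by (auto simp: right_wedge_def)
  show "connected left_wedge" unfolding 1 by (intro convex_connected convex_Int convex_wedge convex_half_planes)
  show "connected right_wedge" unfolding 2 by (intro convex_connected convex_Int convex_wedge convex_half_planes)
qed

lemma wedge_same_image:
  assumes "z \<in> wedge_set" "w \<in> wedge_set" "\<pi> z = \<pi> w"
  obtains k where "w = shift k z"
proof -
  have H: "z \<in> H" "w \<in> H" using assms wedge_subset by auto
  obtain g where g: "deck_transformation \<pi> g" "g z = w" using deck_exists[OF H assms(3)] .
  obtain k where "\<And>w. Im w > 0 \<Longrightarrow> g w = shift k w"
    using collar_embedded[OF g(1) assms(1)] g(2) assms(2) by auto
  then show ?thesis using that[of k] g(2) H by simp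
qed

lemma wedge_off_axis:
  assumes "z \<in> wedge_set" "\<pi> z \<in> \<pi> ` axis" shows "Re z = 0"
proof -
  obtain s where s: "s \<in> axis" "\<pi> z = \<pi> s" using assms(2) by blast
  then obtain k where "z = shift k s"
    using wedge_same_image[of s z] axis_in_wedge assms(1) by (metis subsetD)
  then show ?thesis using s(1) by (auto simp: axis_def Re_shift)
qed

text \<open>One period of the axis, a compact segment, already covers the geodesic.\<close>

lemma geodesic_closed: "closedin (top_of_set S) (\<pi> ` axis)"
proof -
  let ?K = "(\<lambda>s. \<i> * of_real s) ` {1..exp L}"
  have "\<pi> ` axis = \<pi> ` ?K"
  proof
    show "\<pi> ` ?K \<subseteq> \<pi> ` axis" by (auto simp: axis_def intro!: imageI)
    show "\<pi> ` axis \<subseteq> \<pi> ` ?K"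
    proof
      fix p assume "p \<in> \<pi> ` axis"
      then obtain s where s: "s > 0" "p = \<pi> (\<i> * of_real s)" by (auto simp: axis_def)
      define k where "k = - \<lfloor>ln s / L\<rfloor>"
      have "shift k (\<i> * of_real s) = \<i> * of_real (exp (of_int k * L + ln s))"
        using s(1) by (simp add: shift_def exp_add)
      moreover have "of_int k * L + ln s \<in> {0..L}"
      proof -
        have "of_int \<lfloor>ln s / L\<rfloor> * L \<le> ln s" "ln s \<le> (of_int \<lfloor>ln s / L\<rfloor> + 1) * L"
          using L_pos by (simp_all add: pos_le_divide_eq[symmetric] pos_divide_le_eq[symmetric] less_imp_le)
        then show ?thesis by (simp add: k_def algebra_simps)
      qed
      ultimately have "shift k (\<i> * of_real s) \<in> ?K" by auto
      moreover have "\<pi> (shift k (\<i> * of_real s)) = p" using pi_shift s by simp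
      ultimately show "p \<in> \<pi> ` ?K" by (metis imageI)
    qed
  qed
  moreover have "compact ?K" by (intro compact_continuous_image continuous_intros compact_Icc)
  moreover have "?K \<subseteq> H" by auto
  ultimately have "compact (\<pi> ` axis)" by (metis compact_continuous_image continuous_on_subset pi_cont)
  moreover have "\<pi> ` axis \<subseteq> S" using axis_in_wedge wedge_subset pi_in by blast
  ultimately show ?thesis by (simp add: closed_subset compact_imp_closed)
qed

end

locale separated_collar = collar_surface S A \<pi> L
  for S :: "'a::t2_space set" and A \<pi> L +
  fixes S1 S2 :: "'a set"
  assumes sep: "separates_into S (\<pi> ` axis) S1 S2"
begin

lemma parts: "S1 \<noteq> {}" "S2 \<noteq> {}" "connected S1" "connected S2" "S1 \<inter> S2 = {}"
  "S1 \<union> S2 = S - \<pi> ` axis" "S1 \<subseteq> S" "S2 \<subseteq> S"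
proof -
  have c: "components (S - \<pi> ` axis) = {S1, S2}" "S1 \<noteq> S2" using sep by (auto simp: separates_into_def)
  then have m: "S1 \<in> components (S - \<pi> ` axis)" "S2 \<in> components (S - \<pi> ` axis)" by auto
  show "S1 \<noteq> {}" "S2 \<noteq> {}" "connected S1" "connected S2"
    using m in_components_nonempty in_components_connected by blast+
  show "S1 \<inter> S2 = {}" using components_nonoverlap[OF m] c(2) by simp
  show U: "S1 \<union> S2 = S - \<pi> ` axis" using Union_components[of "S - \<pi> ` axis"] c(1) by simp
  then show "S1 \<subseteq> S" "S2 \<subseteq> S" by auto
qed

lemma parts_open: "openin (top_of_set S) S1" "openin (top_of_set S) S2"
proof -
  let ?X = "S - \<pi> ` axis"
  have oX: "openin (top_of_set S) ?X" using geodesic_closed by (simp add: openin_diff)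
  have c: "components ?X = {S1, S2}" using sep by (auto simp: separates_into_def)
  then have "closedin (top_of_set ?X) S1" "closedin (top_of_set ?X) S2" using closedin_component by blast+
  then have "openin (top_of_set ?X) (?X - S1)" "openin (top_of_set ?X) (?X - S2)" by (simp_all add: openin_diff)
  moreover have "?X - S1 = S2" "?X - S2 = S1" using parts by auto
  ultimately show "openin (top_of_set S) S1" "openin (top_of_set S) S2" using oX openin_trans by metis+
qed

lemma side_cases:
  assumes "X = left_wedge \<or> X = right_wedge" shows "\<pi> ` X \<subseteq> S1 \<or> \<pi> ` X \<subseteq> S2"
proof -
  have XW: "X \<subseteq> wedge_set" "connected X" using assms connected_sides by (auto simp: left_wedge_def right_wedge_def)
  have "\<pi> ` X \<subseteq> S1 \<union> S2"
  proof
    fix p assume "p \<in> \<pi> ` X"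
    then obtain z where z: "z \<in> X" "p = \<pi> z" by blast
    then have "p \<notin> \<pi> ` axis" using wedge_off_axis[of z] assms by (auto simp: left_wedge_def right_wedge_def)
    then show "p \<in> S1 \<union> S2" using parts(6) z XW wedge_subset pi_in by blast
  qed
  moreover have "connected (\<pi> ` X)"
    using XW wedge_subset by (intro connected_continuous_image continuous_on_subset[OF pi_cont]) auto
  moreover have "openin (top_of_set (\<pi> ` X)) (\<pi> ` X \<inter> S1)" "openin (top_of_set (\<pi> ` X)) (\<pi> ` X \<inter> S2)"
  proof -
    have "\<pi> ` X \<subseteq> S" using XW wedge_subset pi_in by blast
    then show "openin (top_of_set (\<pi> ` X)) (\<pi> ` X \<inter> S1)" "openin (top_of_set (\<pi> ` X)) (\<pi> ` X \<inter> S2)"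
      using parts_open by (metis inf.absorb_iff1 inf_assoc openin_open)+
  qed
  moreover have "(\<pi> ` X \<inter> S1) \<inter> (\<pi> ` X \<inter> S2) = {}" using parts(5) by blast
  moreover have "(\<pi> ` X \<inter> S1) \<union> (\<pi> ` X \<inter> S2) = \<pi> ` X" using calculation(1) by blast
  ultimately have "\<pi> ` X \<inter> S1 = {} \<or> \<pi> ` X \<inter> S2 = {}"
    unfolding connected_openin_eq by blast
  then show ?thesis using \<open>\<pi> ` X \<subseteq> S1 \<union> S2\<close> by blast
qed

lemma collar_open: "openin (top_of_set S) (\<pi> ` wedge_set)"
  by (rule pi_open_map[OF open_wedge wedge_subset])

text \<open>If both half-collars lay in the same part \<open>T\<close>, the union of
  \<open>T\<close> and the collar would be the complement of the other part, which would then be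
  closed as well as open in the connected surface.\<close>

lemma sides_differ:
  assumes T: "T = S1 \<or> T = S2" shows "\<not> (\<pi> ` left_wedge \<subseteq> T \<and> \<pi> ` right_wedge \<subseteq> T)"
proof
  assume *: "\<pi> ` left_wedge \<subseteq> T \<and> \<pi> ` right_wedge \<subseteq> T"
  define T' where "T' = (if T = S1 then S2 else S1)"
  have T': "T' \<noteq> {}" "T \<inter> T' = {}" "T \<union> T' = S - \<pi> ` axis" "openin (top_of_set S) T" "openin (top_of_set S) T'" "T' \<subseteq> S"
    using T parts parts_open by (auto simp: T'_def split: if_splits)
  have "\<pi> ` wedge_set \<subseteq> T \<union> \<pi> ` axis" using * by (subst wedge_split) blast
  then have "S - T' = T \<union> \<pi> ` wedge_set"
    using T'(2,3) axis_in_wedge pi_in wedge_subset by blast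
  then have "openin (top_of_set S) (S - T')" using T'(4) collar_open by (simp add: openin_Un)
  then have "closedin (top_of_set S) T'" using T'(6) by (simp add: closedin_def)
  moreover have "connected S" using surface by (simp add: riemann_surface_def)
  ultimately have "T' = S" using T'(1,5) connected_clopen by blast
  moreover have "\<pi> \<i> \<in> \<pi> ` axis" by (rule imageI) (auto simp: axis_def intro: exI[of _ 1])
  moreover have "\<pi> \<i> \<in> S" by (rule pi_in) simp
  ultimately show False using T'(2,3) by blast
qed

lemma some_side: "\<pi> ` left_wedge \<subseteq> S2 \<or> \<pi> ` right_wedge \<subseteq> S2"
  using sides_differ[of S1] side_cases[of left_wedge] side_cases[of right_wedge] by blast

end

section \<open>Cutting off in the collar\<close>

definition pps :: "real \<Rightarrow> real" where "pps x = (max 0 x)\<^sup>2"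

text \<open>A continuously differentiable transition from 0 at \<open>a\<close> to 1 at
  \<open>b\<close>; for \<open>a < b\<close> the two terms of the denominator never vanish
  together.\<close>

definition step :: "real \<Rightarrow> real \<Rightarrow> real \<Rightarrow> real" where
  "step a b y = pps (y - a) / (pps (y - a) + pps (b - y))"

definition step' :: "real \<Rightarrow> real \<Rightarrow> real \<Rightarrow> real" where
  "step' a b y = (2 * max 0 (y - a) * (pps (y - a) + pps (b - y))
     - pps (y - a) * (2 * max 0 (y - a) - 2 * max 0 (b - y))) / (pps (y - a) + pps (b - y))\<^sup>2"

lemma step_denom:
  assumes "a < b" shows "pps (y - a) + pps (b - y) > 0"
proof (cases "y > a")
  case True
  then show ?thesis by (intro add_pos_nonneg) (auto simp: pps_def)
next
  case False
  then show ?thesis using assms by (intro add_nonneg_pos) (auto simp: pps_def)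
qed

lemma step_deriv:
  assumes "a < b" shows "(step a b has_real_derivative step' a b y) (at y)"
proof -
  have 1: "((\<lambda>y. pps (y - a)) has_real_derivative 2 * max 0 (y - a)) (at y)"
  proof -
    have "((\<lambda>y. y - a) has_real_derivative 1) (at y)" by (auto intro!: derivative_eq_intros)
    from DERIV_chain2[OF DERIV_positive_part_square this] show ?thesis by (simp add: pps_def)
  qed
  have 2: "((\<lambda>y. pps (b - y)) has_real_derivative - 2 * max 0 (b - y)) (at y)"
  proof -
    have "((\<lambda>y. b - y) has_real_derivative - 1) (at y)" by (auto intro!: derivative_eq_intros)
    from DERIV_chain2[OF DERIV_positive_part_square this] show ?thesis by (simp add: pps_def)
  qed
  show ?thesis unfolding step_def[abs_def] step'_def
    using DERIV_divide[OF 1 DERIV_add[OF 1 2]] step_denom[OF assms, of y] by (simp add: power2_eq_square)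
qed

lemma step'_cont: "a < b \<Longrightarrow> continuous_on X (step' a b)"
  unfolding step'_def[abs_def] pps_def
  using step_denom[of a b] by (intro continuous_intros) (auto simp: pps_def less_le)

lemma step_values: "y \<le> a \<Longrightarrow> step a b y = 0" "y \<le> a \<Longrightarrow> step' a b y = 0"
  "a < b \<Longrightarrow> b \<le> y \<Longrightarrow> step a b y = 1" "a < b \<Longrightarrow> b \<le> y \<Longrightarrow> step' a b y = 0"
  by (auto simp: step_def step'_def pps_def)

text \<open>A function given on \<open>V\<close>, constant on fibres there and zero over
  \<open>Q\<close>, becomes an invariant function on the half-plane by extension with zero. At a
  point not over \<open>Q\<close>, a deck transformation carries a neighbourhood into
  \<open>V\<close> and transports the gradient back.\<close>

lemma (in compact_hyperbolic_surface) descend: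
  assumes V: "open V" "V \<subseteq> H"
    and w: "\<And>z. z \<in> V \<Longrightarrow> has_grad w (Gw z) z" "continuous_on V Gw"
    and compat: "\<And>z z'. z \<in> V \<Longrightarrow> z' \<in> V \<Longrightarrow> \<pi> z = \<pi> z' \<Longrightarrow> w z = w z'"
    and Q: "openin (top_of_set S) Q" "\<pi> ` V \<union> Q = S" "\<And>z. z \<in> V \<Longrightarrow> \<pi> z \<in> Q \<Longrightarrow> w z = 0"
  obtains u G where "\<And>z. z \<in> H \<Longrightarrow> has_grad u (G z) z" "continuous_on H G"
    "\<And>g z. deck_transformation \<pi> g \<Longrightarrow> z \<in> H \<Longrightarrow> u (g z) = u z"
    "\<And>z. z \<in> V \<Longrightarrow> G z = Gw z" "\<And>z. z \<in> H \<Longrightarrow> \<pi> z \<in> Q \<Longrightarrow> G z = 0"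
proof -
  define u where "u z = (if \<pi> z \<in> \<pi> ` V then w (SOME z'. z' \<in> V \<and> \<pi> z' = \<pi> z) else 0)" for z
  have u_eq: "u z = w z'" if "z' \<in> V" "\<pi> z' = \<pi> z" for z z'
  proof -
    have "\<exists>z'. z' \<in> V \<and> \<pi> z' = \<pi> z" using that by blast
    from someI_ex[OF this] have "(SOME z'. z' \<in> V \<and> \<pi> z' = \<pi> z) \<in> V" "\<pi> (SOME z'. z' \<in> V \<and> \<pi> z' = \<pi> z) = \<pi> z" by auto
    then have "w (SOME z'. z' \<in> V \<and> \<pi> z' = \<pi> z) = w z'" using compat that by metis
    moreover have "\<pi> z \<in> \<pi> ` V" using that by (metis imageI)
    ultimately show ?thesis by (simp add: u_def)
  qed
  have u_zero: "u z = 0" if "\<pi> z \<in> Q" for z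
  proof (cases "\<pi> z \<in> \<pi> ` V")
    case True
    then obtain z' where z': "z' \<in> V" "\<pi> z' = \<pi> z" by force
    then show ?thesis using u_eq[OF z'] Q(3)[OF z'(1)] that by simp
  qed (simp add: u_def)
  have oQ: "open (lift_set Q)" using lift_set_open Q(1) by blast
  have loc0: "has_grad u 0 z" if "z \<in> lift_set Q" for z
    by (rule has_grad_transform[OF has_grad_const oQ that]) (use u_zero in \<open>auto simp: lift_set_def\<close>)
  have loc: "\<exists>U K. open U \<and> z \<in> U \<and> U \<subseteq> H \<and> continuous_on U K \<and> (\<forall>y\<in>U. has_grad u (K y) y)" if z: "z \<in> H" for z
  proof (cases "\<pi> z \<in> Q")
    case True
    then have "z \<in> lift_set Q" "lift_set Q \<subseteq> H" using z by (auto simp: lift_set_def)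
    then show ?thesis using oQ loc0 by (intro exI[of _ "lift_set Q"] exI[of _ "\<lambda>_. 0"]) auto
  next
    case False
    then obtain z' where z': "z' \<in> V" "\<pi> z = \<pi> z'" using Q(2) pi_in[OF z] by blast
    obtain g where g: "deck_transformation \<pi> g" "g z = z'" using deck_exists[OF z _ z'(2)] z'(1) V(2) by blast
    define U where "U = H \<inter> g -` V"
    have gc: "continuous_on H g" using deck_holo[OF g(1)] by (rule holomorphic_on_imp_continuous_on)
    have U: "open U" "z \<in> U" "U \<subseteq> H"
      using continuous_open_preimage[OF gc open_upper_half_plane V(1)] z g(2) z'(1) by (auto simp: U_def)
    have dg: "(g has_field_derivative deriv g y) (at y)" if "y \<in> H" for y
      using holomorphic_derivI[OF deck_holo[OF g(1)] open_upper_half_plane that] .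
    have "has_grad u (cnj (deriv g y) * Gw (g y)) y" if y: "y \<in> U" for y
    proof (rule has_grad_transform[OF has_grad_compose[OF dg w(1)] U(1) y])
      show "y \<in> H" "g y \<in> V" using y by (auto simp: U_def)
      show "w (g x) = u x" if "x \<in> U" for x
        using u_eq[of "g x" x] deck_pi[OF g(1), of x] that by (auto simp: U_def)
    qed
    moreover have "continuous_on U (\<lambda>y. cnj (deriv g y) * Gw (g y))"
    proof (intro continuous_intros)
      show "continuous_on U (deriv g)"
        using holomorphic_deriv[OF deck_holo[OF g(1)] open_upper_half_plane] U(3)
        by (meson continuous_on_subset holomorphic_on_imp_continuous_on)
      show "continuous_on U (\<lambda>y. Gw (g y))"
        by (rule continuous_on_compose2[OF w(2) continuous_on_subset[OF gc U(3)]]) (auto simp: U_def)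
    qed
    ultimately show ?thesis using U by (intro exI[of _ U] exI[of _ "\<lambda>y. cnj (deriv g y) * Gw (g y)"]) auto
  qed
  define G where "G z = (THE K. has_grad u K z)" for z
  have G_eq: "G z = K" if "has_grad u K z" for z K
    unfolding G_def using that has_grad_unique by blast
  have 1: "has_grad u (G z) z" if "z \<in> H" for z
    using loc[OF that] G_eq by metis
  moreover have "continuous_on H G"
  proof (rule continuous_at_imp_continuous_on, rule ballI)
    fix z assume "z \<in> H"
    then obtain U K where U: "open U" "z \<in> U" "continuous_on U K" "\<forall>y\<in>U. has_grad u (K y) y" using loc by blast
    have "continuous_on U G" by (rule continuous_on_eq[OF U(3)]) (use U(4) G_eq in auto)
    then show "isCont G z" using U(1,2) continuous_on_eq_continuous_at by blast
  qed
  moreover have "u (g z) = u z" if "deck_transformation \<pi> g" "z \<in> H" for g z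
    using deck_pi[OF that] by (simp add: u_def)
  moreover have "G z = Gw z" if z: "z \<in> V" for z
    by (rule G_eq, rule has_grad_transform[OF w(1)[OF z] V(1) z]) (use u_eq in auto)
  moreover have "G z = 0" if "z \<in> H" "\<pi> z \<in> Q" for z
    by (rule G_eq, rule loc0) (use that in \<open>simp add: lift_set_def\<close>)
  ultimately show ?thesis using that by blast
qed

section \<open>Conformal coordinates on the collar\<close>

text \<open>Maps the strip of half-height \<open>pi / 2\<close> conformally onto the half-plane and
  the real line onto the imaginary axis. Translation by \<open>L\<close> becomes
  \<open>shift 1\<close>; positive \<open>Im \<zeta>\<close> lies to the left of the axis.\<close>

definition ex :: "complex \<Rightarrow> complex" where "ex \<zeta> = \<i> * exp \<zeta>"
definition lg :: "complex \<Rightarrow> complex" where "lg z = Ln (- \<i> * z)"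

lemma ex_lg: "Im z > 0 \<Longrightarrow> ex (lg z) = z"
proof -
  assume "Im z > 0"
  then have "- \<i> * z \<noteq> 0" by auto
  then show ?thesis by (simp add: ex_def lg_def)
qed

lemma lg_ex: "\<bar>Im \<zeta>\<bar> < pi \<Longrightarrow> lg (ex \<zeta>) = \<zeta>"
  unfolding ex_def lg_def by (simp add: mult.assoc[symmetric] abs_less_iff Ln_exp)

lemma ex_components: "Re (ex \<zeta>) = - exp (Re \<zeta>) * sin (Im \<zeta>)" "Im (ex \<zeta>) = exp (Re \<zeta>) * cos (Im \<zeta>)"
  by (simp_all add: ex_def Re_exp Im_exp)

lemma ex_deriv: "(ex has_field_derivative ex \<zeta>) (at \<zeta>)"
  unfolding ex_def[abs_def] by (auto intro!: derivative_eq_intros)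

lemma ex_holomorphic: "ex holomorphic_on X"
  unfolding ex_def[abs_def] by (intro holomorphic_intros)

lemma lg_deriv:
  assumes "Im z > 0" shows "(lg has_field_derivative 1 / z) (at z)"
proof -
  have "- \<i> * z \<notin> \<real>\<^sub>\<le>\<^sub>0" using assms by (auto simp: complex_nonpos_Reals_iff)
  moreover have "z \<noteq> 0" using assms by auto
  ultimately show ?thesis unfolding lg_def[abs_def]
    by (auto intro!: derivative_eq_intros simp: divide_inverse mult_ac)
qed

lemma Im_lg: assumes "Im z > 0" shows "\<bar>Im (lg z)\<bar> < pi / 2"
proof -
  have "- \<i> * z \<noteq> 0" "Re (- \<i> * z) > 0" using assms by auto
  then show ?thesis unfolding lg_def using Re_Ln_pos_lt by blast
qed

context collar_surface
begin

definition Y :: real where "Y = arctan \<kappa>"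

lemma Y_pos: "0 < Y" "Y < pi / 2"
  using \<kappa>_pos arctan_bounded[of \<kappa>] by (auto simp: Y_def)

lemma ex_in_H: "\<bar>Im \<zeta>\<bar> < Y \<Longrightarrow> Im (ex \<zeta>) > 0"
  using Y_pos cos_gt_zero_pi[of "Im \<zeta>"] by (simp add: ex_components)

text \<open>The ratio \<open>\<bar>Re z\<bar> / Im z\<close> at \<open>z = ex \<zeta>\<close> is
  \<open>\<bar>tan (Im \<zeta>)\<bar>\<close>, and \<open>Y\<close> is the arctangent of the bound
  \<kappa>.\<close>

lemma ex_wedge:
  assumes "\<bar>Im \<zeta>\<bar> < pi / 2" shows "ex \<zeta> \<in> wedge_set \<longleftrightarrow> \<bar>Im \<zeta>\<bar> < Y"
proof -
  let ?y = "Im \<zeta>"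
  have c: "cos ?y > 0" using assms by (intro cos_gt_zero_pi) auto
  have "ex \<zeta> \<in> wedge_set \<longleftrightarrow> exp (Re \<zeta>) * \<bar>sin ?y\<bar> < exp (Re \<zeta>) * (\<kappa> * cos ?y)"
    using c by (simp add: wedge_set_def ex_components abs_mult mult.left_commute)
  also have "\<dots> \<longleftrightarrow> \<bar>sin ?y\<bar> < \<kappa> * cos ?y" by (rule mult_less_cancel_left_pos) simp
  also have "\<dots> \<longleftrightarrow> \<bar>tan ?y\<bar> < \<kappa>" using c by (simp add: tan_def abs_divide divide_less_eq)
  also have "\<dots> \<longleftrightarrow> arctan \<bar>tan ?y\<bar> < Y" by (simp add: Y_def arctan_less_iff)
  also have "arctan \<bar>tan ?y\<bar> = \<bar>?y\<bar>"
  proof -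
    have "tan \<bar>?y\<bar> = \<bar>tan ?y\<bar>"
    proof (cases "?y \<ge> 0")
      case True
      then have "tan ?y \<ge> 0" using assms tan_gt_zero[of ?y] by (cases "?y = 0") auto
      then show ?thesis using True by simp
    next
      case False
      then have "tan ?y < 0" using assms tan_gt_zero[of "- ?y"] by simp
      then show ?thesis using False by simp
    qed
    then show ?thesis using arctan_tan[of "\<bar>?y\<bar>"] assms by (simp add: abs_less_iff)
  qed
  finally show ?thesis .
qed

lemma lg_wedge: "z \<in> wedge_set \<longleftrightarrow> Im z > 0 \<and> \<bar>Im (lg z)\<bar> < Y"
  using ex_wedge[of "lg z"] ex_lg[of z] Im_lg[of z] wedge_subset by auto

lemma lg_left: "z \<in> left_wedge \<longleftrightarrow> Im z > 0 \<and> 0 < Im (lg z) \<and> Im (lg z) < Y"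
proof (cases "Im z > 0")
  case True
  let ?y = "Im (lg z)"
  have "Re z = - exp (Re (lg z)) * sin ?y" using ex_components(1)[of "lg z"] ex_lg[OF True] by simp
  then have "Re z < 0 \<longleftrightarrow> sin ?y > 0" by (simp add: zero_less_mult_iff)
  also have "\<dots> \<longleftrightarrow> ?y > 0"
  proof -
    have b: "\<bar>?y\<bar> < pi" using Im_lg[OF True] pi_gt_zero by linarith
    show ?thesis
    proof (cases ?y "0::real" rule: linorder_cases)
      case less
      then have "sin (- ?y) > 0" using b by (intro sin_gt_zero) auto
      then show ?thesis using less by simp
    qed (use b sin_gt_zero[of ?y] in auto)
  qed
  finally show ?thesis using True lg_wedge[of z] Y_pos by (auto simp: left_wedge_def)
qed (auto simp: left_wedge_def wedge_set_def)

lemma shift_ex: "shift k (ex \<zeta>) = ex (\<zeta> + of_real (of_int k * L))"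
  by (simp only: shift_def ex_def exp_add exp_of_real mult_ac)

lemma Im_lg_shift:
  assumes "Im z > 0" shows "Im (lg (shift k z)) = Im (lg z)"
proof -
  have "shift k z = ex (lg z + of_real (of_int k * L))" using shift_ex[of k "lg z"] ex_lg[OF assms] by simp
  moreover have "\<bar>Im (lg z + of_real (of_int k * L))\<bar> < pi" using Im_lg[OF assms] pi_gt_zero by simp
  ultimately have "lg (shift k z) = lg z + of_real (of_int k * L)" by (simp only: lg_ex)
  then show ?thesis by simp
qed

text \<open>Half-open in the real direction, so that a rectangle holds one representative for each
  point of its annulus.\<close>

definition rect :: "real \<Rightarrow> real \<Rightarrow> complex set" where
  "rect b c = {\<zeta>. 0 \<le> Re \<zeta> \<and> Re \<zeta> < L \<and> b < Im \<zeta> \<and> Im \<zeta> < c}"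

lemma rect_borel: "rect b c \<in> sets borel"
proof -
  have "rect b c = {\<zeta>. 0 \<le> Re \<zeta>} \<inter> {\<zeta>. Re \<zeta> < L} \<inter> {\<zeta>. b < Im \<zeta>} \<inter> {\<zeta>. Im \<zeta> < c}" by (auto simp: rect_def)
  moreover have "closed {\<zeta>. 0 \<le> Re \<zeta>}" "open {\<zeta>. Re \<zeta> < L}" "open {\<zeta>. b < Im \<zeta>}" "open {\<zeta>. Im \<zeta> < c}"
    by (intro closed_Collect_le open_Collect_less continuous_intros)+
  ultimately show ?thesis by auto
qed

lemma strip_eq: "{\<zeta>. \<bar>Im \<zeta>\<bar> < Y} = {\<zeta>. - Y < Im \<zeta>} \<inter> {\<zeta>. Im \<zeta> < Y}" by auto

lemma open_strip: "open {\<zeta>. \<bar>Im \<zeta>\<bar> < Y}"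
  unfolding strip_eq by (intro open_Int open_Collect_less continuous_intros)

lemma ex_inj: "inj_on ex {\<zeta>. \<bar>Im \<zeta>\<bar> < Y}"
proof (rule inj_on_inverseI)
  fix \<zeta> :: complex assume "\<zeta> \<in> {\<zeta>. \<bar>Im \<zeta>\<bar> < Y}"
  then have "\<bar>Im \<zeta>\<bar> < pi" using Y_pos pi_gt_zero by simp
  then show "lg (ex \<zeta>) = \<zeta>" by (rule lg_ex)
qed

text \<open>By the collar theorem, two points of the strip with the same image differ by a multiple
  of \<open>L\<close>, and within a half-open period the multiple is 0. Conversely, the floor of
  \<open>Re (lg z) / L\<close> tells which power of the translation brings \<open>z\<close> into the
  rectangle.\<close>

lemma rect_image:
  assumes bc: "-Y \<le> b" "c \<le> Y"
  shows "ex ` rect b c \<in> sets borel" "ex ` rect b c \<subseteq> wedge_set" "inj_on \<pi> (ex ` rect b c)"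
    "\<pi> ` ex ` rect b c = \<pi> ` {z \<in> wedge_set. b < Im (lg z) \<and> Im (lg z) < c}"
proof -
  have sub: "rect b c \<subseteq> {\<zeta>. \<bar>Im \<zeta>\<bar> < Y}" using bc by (auto simp: rect_def)
  have lgx: "lg (ex \<zeta>) = \<zeta>" if "\<bar>Im \<zeta>\<bar> < Y" for \<zeta>
    using that Y_pos pi_gt_zero by (intro lg_ex) simp
  show "ex ` rect b c \<in> sets borel"
    by (rule holomorphic_inj_image_borel[OF ex_holomorphic open_strip ex_inj sub rect_borel])
  show W: "ex ` rect b c \<subseteq> wedge_set"
  proof
    fix z assume "z \<in> ex ` rect b c"
    then obtain \<zeta> where z: "\<zeta> \<in> rect b c" "z = ex \<zeta>" by blast
    then have "\<bar>Im \<zeta>\<bar> < Y" using sub by blast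
    moreover from this have "\<bar>Im \<zeta>\<bar> < pi / 2" using Y_pos by simp
    ultimately show "z \<in> wedge_set" using ex_wedge z(2) by blast
  qed
  show "inj_on \<pi> (ex ` rect b c)"
  proof (rule inj_onI)
    fix z w assume zw: "z \<in> ex ` rect b c" "w \<in> ex ` rect b c" "\<pi> z = \<pi> w"
    then obtain \<zeta> \<omega> where e: "\<zeta> \<in> rect b c" "z = ex \<zeta>" "\<omega> \<in> rect b c" "w = ex \<omega>" by blast
    obtain k where "w = shift k z" using wedge_same_image[of z w] zw W by blast
    then have "ex \<omega> = ex (\<zeta> + of_real (of_int k * L))" using e shift_ex by simp
    moreover have "\<bar>Im \<omega>\<bar> < Y" "\<bar>Im (\<zeta> + of_real (of_int k * L))\<bar> < Y" using e sub by auto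
    ultimately have eq: "\<omega> = \<zeta> + of_real (of_int k * L)" using lgx by metis
    then have "Re \<omega> = Re \<zeta> + of_int k * L" by simp
    then have "\<bar>of_int k * L\<bar> < L" using e(1,3) unfolding rect_def mem_Collect_eq abs_less_iff by linarith
    then have "\<bar>of_int k\<bar> < (1::real)" using L_pos by (simp add: abs_mult)
    then have "k = 0" by linarith
    then show "z = w" using eq e by simp
  qed
  show "\<pi> ` ex ` rect b c = \<pi> ` {z \<in> wedge_set. b < Im (lg z) \<and> Im (lg z) < c}"
  proof
    show "\<pi> ` ex ` rect b c \<subseteq> \<pi> ` {z \<in> wedge_set. b < Im (lg z) \<and> Im (lg z) < c}"
    proof (rule image_mono, rule subsetI)
      fix z assume z: "z \<in> ex ` rect b c"
      then obtain \<zeta> where e: "\<zeta> \<in> rect b c" "z = ex \<zeta>" by blast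
      then have "lg z = \<zeta>" using lgx sub by auto
      then show "z \<in> {z \<in> wedge_set. b < Im (lg z) \<and> Im (lg z) < c}" using z W e by (auto simp: rect_def)
    qed
    show "\<pi> ` {z \<in> wedge_set. b < Im (lg z) \<and> Im (lg z) < c} \<subseteq> \<pi> ` ex ` rect b c"
    proof
      fix p assume "p \<in> \<pi> ` {z \<in> wedge_set. b < Im (lg z) \<and> Im (lg z) < c}"
      then obtain z where z: "z \<in> wedge_set" "b < Im (lg z)" "Im (lg z) < c" "p = \<pi> z" by blast
      have zH: "Im z > 0" using z(1) wedge_subset by auto
      define k where "k = - \<lfloor>Re (lg z) / L\<rfloor>"
      have "of_int \<lfloor>Re (lg z) / L\<rfloor> * L \<le> Re (lg z)" "Re (lg z) < (of_int \<lfloor>Re (lg z) / L\<rfloor> + 1) * L"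
        using L_pos by (simp_all add: pos_le_divide_eq[symmetric] pos_divide_less_eq[symmetric])
      then have "lg z + of_real (of_int k * L) \<in> rect b c"
        using z by (auto simp: rect_def k_def algebra_simps)
      moreover have "shift k z = ex (lg z + of_real (of_int k * L))" using shift_ex[of k "lg z"] ex_lg[OF zH] by simp
      ultimately have "shift k z \<in> ex ` rect b c" by blast
      then have "\<pi> (shift k z) \<in> \<pi> ` ex ` rect b c" by (rule imageI)
      then show "p \<in> \<pi> ` ex ` rect b c" by (simp only: pi_shift[OF zH] z(4))
    qed
  qed
qed

lemma wedge_band: "{z \<in> wedge_set. -Y < Im (lg z) \<and> Im (lg z) < Y} = wedge_set"
  using lg_wedge by auto

lemma band_compact:
  assumes b: "0 \<le> b" "b < Y"
  shows "compact (\<pi> ` {z \<in> wedge_set. \<bar>Im (lg z)\<bar> \<le> b})"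
proof -
  let ?R = "{\<zeta>. 0 \<le> Re \<zeta> \<and> Re \<zeta> \<le> L \<and> \<bar>Im \<zeta>\<bar> \<le> b}"
  have R: "?R = cbox (Complex 0 (- b)) (Complex L b)"
    by (auto simp: cbox_def Basis_complex_def abs_le_iff)
  have "\<pi> ` {z \<in> wedge_set. \<bar>Im (lg z)\<bar> \<le> b} = \<pi> ` ex ` ?R"
  proof
    show "\<pi> ` ex ` ?R \<subseteq> \<pi> ` {z \<in> wedge_set. \<bar>Im (lg z)\<bar> \<le> b}"
    proof (rule image_mono, rule subsetI)
      fix z assume "z \<in> ex ` ?R"
      then obtain \<zeta> where e: "\<zeta> \<in> ?R" "z = ex \<zeta>" by blast
      then have "\<bar>Im \<zeta>\<bar> < Y" "\<bar>Im \<zeta>\<bar> < pi" "\<bar>Im \<zeta>\<bar> < pi / 2" using b Y_pos pi_gt_zero by auto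
      then have "z \<in> wedge_set" "lg z = \<zeta>" using e(2) ex_wedge[of \<zeta>] lg_ex[of \<zeta>] by auto
      then show "z \<in> {z \<in> wedge_set. \<bar>Im (lg z)\<bar> \<le> b}" using e(1) by simp
    qed
    show "\<pi> ` {z \<in> wedge_set. \<bar>Im (lg z)\<bar> \<le> b} \<subseteq> \<pi> ` ex ` ?R"
    proof
      fix p assume "p \<in> \<pi> ` {z \<in> wedge_set. \<bar>Im (lg z)\<bar> \<le> b}"
      then obtain z where z: "z \<in> wedge_set" "\<bar>Im (lg z)\<bar> \<le> b" "p = \<pi> z" by blast
      have zH: "Im z > 0" using z(1) wedge_subset by auto
      define k where "k = - \<lfloor>Re (lg z) / L\<rfloor>"
      have "of_int \<lfloor>Re (lg z) / L\<rfloor> * L \<le> Re (lg z)" "Re (lg z) < (of_int \<lfloor>Re (lg z) / L\<rfloor> + 1) * L"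
        using L_pos by (simp_all add: pos_le_divide_eq[symmetric] pos_divide_less_eq[symmetric])
      then have "0 \<le> Re (lg z) + of_int k * L" "Re (lg z) + of_int k * L \<le> L"
        by (simp_all add: k_def algebra_simps)
      then have "lg z + of_real (of_int k * L) \<in> ?R" using z(2) by simp
      moreover have "shift k z = ex (lg z + of_real (of_int k * L))" using shift_ex[of k "lg z"] ex_lg[OF zH] by simp
      ultimately have "shift k z \<in> ex ` ?R" by blast
      then have "\<pi> (shift k z) \<in> \<pi> ` ex ` ?R" by (rule imageI)
      then show "p \<in> \<pi> ` ex ` ?R" by (simp only: pi_shift[OF zH] z(3))
    qed
  qed
  moreover have c: "compact (ex ` ?R)"
    unfolding R by (intro compact_continuous_image compact_cbox holomorphic_on_imp_continuous_on[OF ex_holomorphic])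
  moreover have sub: "ex ` ?R \<subseteq> H"
  proof
    fix z assume "z \<in> ex ` ?R"
    then obtain \<zeta> where "\<zeta> \<in> ?R" "z = ex \<zeta>" by blast
    then show "z \<in> H" using ex_in_H[of \<zeta>] b by auto
  qed
  moreover have "compact (\<pi> ` ex ` ?R)"
    by (rule compact_continuous_image[OF continuous_on_subset[OF pi_cont sub] c])
  ultimately show ?thesis by simp
qed

lemma ang_grad:
  assumes "Im z > 0" shows "has_grad (\<lambda>z. Im (lg z)) (cnj (- \<i> / z)) z"
proof -
  have "((\<lambda>z. - \<i> * lg z) has_field_derivative - \<i> * (1 / z)) (at z)"
    by (rule DERIV_cmult[OF lg_deriv[OF assms]])
  from has_grad_Re[OF this] show ?thesis by simp
qed

lemma rect_Fubini:
  assumes q: "set_integrable lborel (rect b c) (q :: complex \<Rightarrow> real)"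
  shows "set_integrable lborel {b<..<c} (\<lambda>y. set_lebesgue_integral lborel {0..<L} (\<lambda>x. q (Complex x y)))"
    and "set_lebesgue_integral lborel (rect b c) q
      = set_lebesgue_integral lborel {b<..<c} (\<lambda>y. set_lebesgue_integral lborel {0..<L} (\<lambda>x. q (Complex x y)))"
proof -
  let ?g = "\<lambda>z. indicator (rect b c) z *\<^sub>R q z"
  have m: "(\<lambda>(x, y). Complex x y) \<in> borel_measurable (lborel \<Otimes>\<^sub>M lborel)"
    unfolding Complex_eq by measurable
  have gm: "?g \<in> borel_measurable borel" using q unfolding set_integrable_def by simp
  have gi: "integrable lborel ?g" using q by (simp add: set_integrable_def)
  then have "integrable (distr (lborel \<Otimes>\<^sub>M lborel) borel (\<lambda>(x, y). Complex x y)) ?g"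
    using lborel_complex_pair by simp
  then have i: "integrable (lborel \<Otimes>\<^sub>M lborel) (\<lambda>p. ?g (case p of (x, y) \<Rightarrow> Complex x y))"
    using integrable_distr_eq[OF m gm] by simp
  then have i': "integrable (lborel \<Otimes>\<^sub>M lborel) (\<lambda>(x, y). ?g (Complex x y))"
    by (simp add: case_prod_beta')
  have "integral\<^sup>L lborel ?g = integral\<^sup>L (distr (lborel \<Otimes>\<^sub>M lborel) borel (\<lambda>(x, y). Complex x y)) ?g"
    using lborel_complex_pair by simp
  also have "\<dots> = integral\<^sup>L (lborel \<Otimes>\<^sub>M lborel) (\<lambda>p. ?g (case p of (x, y) \<Rightarrow> Complex x y))"
    by (rule integral_distr[OF m gm])
  also have "\<dots> = integral\<^sup>L (lborel \<Otimes>\<^sub>M lborel) (\<lambda>(x, y). ?g (Complex x y))"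
    by (simp add: case_prod_beta')
  also have "\<dots> = (LINT y|lborel. LINT x|lborel. ?g (Complex x y))"
    by (rule lborel_pair.integral_snd[OF i', symmetric])
  finally have eq: "integral\<^sup>L lborel ?g = (LINT y|lborel. LINT x|lborel. ?g (Complex x y))" .
  have inner: "(LINT x|lborel. ?g (Complex x y)) = indicator {b<..<c} y *\<^sub>R set_lebesgue_integral lborel {0..<L} (\<lambda>x. q (Complex x y))" for y
  proof -
    have "?g (Complex x y) = indicator {b<..<c} y * (indicator {0..<L} x *\<^sub>R q (Complex x y))" for x
      by (auto simp: rect_def indicator_def)
    then have "(LINT x|lborel. ?g (Complex x y)) = (LINT x|lborel. indicator {b<..<c} y * (indicator {0..<L} x *\<^sub>R q (Complex x y)))"
      by (simp only:)
    then show ?thesis by (simp add: set_lebesgue_integral_def)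
  qed
  show "set_lebesgue_integral lborel (rect b c) q
      = set_lebesgue_integral lborel {b<..<c} (\<lambda>y. set_lebesgue_integral lborel {0..<L} (\<lambda>x. q (Complex x y)))"
    using eq unfolding inner by (simp add: set_lebesgue_integral_def)
  have "integrable lborel (\<lambda>y. LINT x|lborel. ?g (Complex x y))"
    using lborel_pair.integrable_snd[OF i'] .
  then show "set_integrable lborel {b<..<c} (\<lambda>y. set_lebesgue_integral lborel {0..<L} (\<lambda>x. q (Complex x y)))"
    unfolding inner by (simp add: set_integrable_def)
qed

lemma period_integral:
  assumes "continuous_on {0..L} (h :: real \<Rightarrow> real)"
  shows "set_lebesgue_integral lborel {0..<L} h = integral {0..L} h"
proof -
  have "set_integrable lborel {0..L} h" by (rule borel_integrable_atLeastAtMost'[OF assms])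
  then have "set_integrable lborel {0..<L} h" by (rule set_integrable_subset) auto
  then have "set_lebesgue_integral lborel {0..<L} h = integral {0..<L} h"
    by (rule set_borel_integral_eq_integral(2))
  also have "\<dots> = integral {0..L} h"
    by (rule integral_spike_set) (auto intro: negligible_subset[of "{L}"])
  finally show ?thesis .
qed

end

section \<open>Energy decay across the collar\<close>

locale exact_collar = separated_collar S A \<pi> L S1 S2 + sheeted_surface S A \<pi> N ctr rad
  for S :: "'a::t2_space set" and A :: "'a chart set" and \<pi> :: "complex \<Rightarrow> 'a" and L :: real
    and S1 S2 :: "'a set" and N :: nat and ctr :: "nat \<Rightarrow> complex" and rad :: "nat \<Rightarrow> real" +
  fixes \<sigma> :: "'a form1" and f P :: "complex \<Rightarrow> complex"
  assumes harmonic: "harmonic_form A \<sigma>"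
    and f_hol: "f holomorphic_on upper_half_plane"
    and pull: "\<And>c z. c \<in> A \<Longrightarrow> z \<in> lift_set (fst c) \<Longrightarrow> f z = form_coeff \<sigma> c ((snd c \<circ> \<pi>) z) * deriv (snd c \<circ> \<pi>) z"
    and P_deriv: "\<And>z. z \<in> upper_half_plane \<Longrightarrow> (P has_field_derivative f z) (at z)"
    and van: "vanishing_periods_in A \<sigma> S2"
    and left_in: "\<pi> ` left_wedge \<subseteq> S2"
begin

lemma f_inv: "deck_transformation \<pi> g \<Longrightarrow> z \<in> H \<Longrightarrow> f (g z) * deriv g z = f z"
  by (rule pullback_invariant[OF pull])

lemma f_cont: "continuous_on H f"
  using f_hol by (rule holomorphic_on_imp_continuous_on)

lemma right_in: "\<pi> ` right_wedge \<subseteq> S1"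
  using side_cases[of right_wedge] sides_differ[of S2] left_in by blast

lemma wedge_S2: assumes "z \<in> wedge_set" "\<pi> z \<in> S2" shows "z \<in> left_wedge"
proof -
  have "z \<notin> right_wedge" using assms(2) right_in parts(5) by blast
  moreover have "z \<notin> axis" using assms(2) parts(6) by blast
  ultimately show ?thesis using assms(1) wedge_split by blast
qed

definition z0 :: complex where "z0 = ex (Complex 0 (Y / 2))"
text \<open>One component over \<open>S2\<close>. \<open>P\<close> lives on the whole half-plane,
  but over another component its real part may differ by a constant; on \<open>V2\<close> it depends
  on the image in the surface alone, see \<open>period_zero\<close>.\<close>

definition V2 :: "complex set" where "V2 = connected_component_set (lift_set S2) z0"

lemma z0_left: "z0 \<in> left_wedge"
proof -
  have "\<bar>Im (Complex 0 (Y / 2))\<bar> < Y" "\<bar>Im (Complex 0 (Y / 2))\<bar> < pi" using Y_pos pi_gt_zero by simp_all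
  then show ?thesis using ex_in_H[of "Complex 0 (Y / 2)"] lg_ex[of "Complex 0 (Y / 2)"] Y_pos
    by (simp add: lg_left z0_def)
qed

lemma left_H: "left_wedge \<subseteq> H" using wedge_subset by (auto simp: left_wedge_def)

lemma left_lift: "left_wedge \<subseteq> lift_set S2"
  using left_in left_H by (auto simp: lift_set_def)

lemma V2: "open V2" "connected V2" "z0 \<in> V2" "V2 \<subseteq> lift_set S2" "\<pi> ` V2 = S2"
  unfolding V2_def
  using component_lift_surjective[OF parts_open(2) parts(4), of z0] left_lift z0_left by blast+

lemma V2_H: "V2 \<subseteq> H" using V2(4) by (auto simp: lift_set_def)

lemma left_V2: "left_wedge \<subseteq> V2"
  unfolding V2_def using connected_component_maximal[OF z0_left connected_sides(1) left_lift] .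

text \<open>A curve in \<open>V2\<close> from \<open>z\<close> to \<open>w\<close> projects to a
  closed curve in \<open>S2\<close>, and the increment of \<open>Re P\<close> along it is a
  period.\<close>

lemma period_zero:
  assumes "z \<in> V2" "w \<in> V2" "\<pi> z = \<pi> w" shows "Re (P z) = Re (P w)"
proof -
  obtain q where q: "polynomial_function q" "path_image q \<subseteq> V2" "pathstart q = z" "pathfinish q = w"
    using connected_open_polynomial_connected[OF V2(1,2) assms(1,2)] by metis
  have "has_line_integral A \<sigma> (\<pi> \<circ> q) (Re (P w) - Re (P z))"
    by (rule line_integral_lift[where f = f and P = P and q = q, OF harmonic pull P_deriv q(1), unfolded q(3,4)])
      ((assumption)+, use q(2) V2_H in blast)
  moreover have "(\<pi> \<circ> q) ` {0..1} \<subseteq> S2" using q(2) V2(5) by (auto simp: path_image_def)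
  moreover have "(\<pi> \<circ> q) 0 = (\<pi> \<circ> q) 1" using q(3,4) assms(3) by (simp add: pathstart_def pathfinish_def)
  ultimately have "Re (P w) - Re (P z) = 0" using van unfolding vanishing_periods_in_def by blast
  then show ?thesis by simp
qed

lemma shift_deriv: "(shift k has_field_derivative of_real (exp (of_int k * L))) (at z)"
  unfolding shift_def[abs_def] by (auto intro!: derivative_eq_intros)

text \<open>The increment of \<open>P\<close> under the translation is a constant, the complex
  period along the geodesic traversed \<open>k\<close> times. Its real part vanishes because the
  curve can be pushed to angle \<open>Y / 2\<close>, inside \<open>S2\<close>. The imaginary part is
  dealt with in \<open>Ph_periodic\<close>.\<close>

lemma P_shift: obtains c where "\<And>z. z \<in> H \<Longrightarrow> P (shift k z) = P z + c" "Re c = 0"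
proof -
  have "((\<lambda>z. P (shift k z) - P z) has_field_derivative 0) (at z)" if z: "z \<in> H" for z
  proof -
    have zs: "shift k z \<in> H" using z by (simp add: shift_in_iff)
    have "((\<lambda>z. P (shift k z) - P z) has_field_derivative f (shift k z) * of_real (exp (of_int k * L)) - f z) (at z)"
      by (intro DERIV_diff DERIV_chain2[OF P_deriv[OF zs] shift_deriv] P_deriv z)
    moreover have "deriv (shift k) z = of_real (exp (of_int k * L))" by (rule DERIV_imp_deriv[OF shift_deriv])
    ultimately show ?thesis using f_inv[OF deck_shift z, of k] by simp
  qed
  then have "\<exists>c. \<forall>z\<in>H. P (shift k z) - P z = c"
    by (intro has_field_derivative_zero_constant[OF convex_upper_half_plane]) (blast intro: has_field_derivative_at_within)
  then obtain c where c: "\<And>z. z \<in> H \<Longrightarrow> P (shift k z) - P z = c" by blast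
  have zH: "z0 \<in> H" using z0_left left_H by blast
  have "shift k z0 \<in> left_wedge"
    using z0_left zH by (simp add: lg_left shift_in_iff Im_lg_shift)
  then have "Re (P z0) = Re (P (shift k z0))"
    using left_V2 z0_left zH by (intro period_zero) (auto simp: pi_shift)
  then have "Re c = 0" using c[OF zH] by auto
  moreover have "P (shift k z) = P z + c" if "z \<in> H" for z using c[OF that] by (simp add: algebra_simps)
  ultimately show ?thesis using that by blast
qed

text \<open>Two points of the wedge over the same point differ by a power of the translation.
  Otherwise the common image lies in \<open>S2\<close>, and both points are in \<open>V2\<close>,
  since the wedge meets the lift of \<open>S2\<close> in its left half.\<close>

lemma compat_ReP:
  assumes "z \<in> wedge_set \<union> V2" "w \<in> wedge_set \<union> V2" "\<pi> z = \<pi> w"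
  shows "Re (P z) = Re (P w)"
proof (cases "z \<in> wedge_set \<and> w \<in> wedge_set")
  case True
  then obtain k where k: "w = shift k z" using wedge_same_image[of z w] assms(3) by blast
  obtain c where "\<And>z. z \<in> H \<Longrightarrow> P (shift k z) = P z + c" "Re c = 0" using P_shift[of k] by blast
  then show ?thesis using True wedge_subset k by auto
next
  case False
  then have "\<pi> z \<in> S2" "\<pi> w \<in> S2" using assms V2(4) by (auto simp: lift_set_def)
  then have "z \<in> V2" "w \<in> V2" using assms(1,2) wedge_S2 left_V2 by blast+
  then show ?thesis using assms(3) by (rule period_zero)
qed

abbreviation "coll \<equiv> \<pi> ` wedge_set"

lemma lift_coll_open: "open (lift_set coll)"
  using collar_open by (rule lift_set_open)

lemma lift_borel: "lift_set coll \<in> sets borel" "lift_set S1 \<in> sets borel" "lift_set S2 \<in> sets borel"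
  "lift_set (S2 - coll) \<in> sets borel" "lift_set (S1 - coll) \<in> sets borel"
proof -
  show 1: "lift_set coll \<in> sets borel" "lift_set S1 \<in> sets borel" "lift_set S2 \<in> sets borel"
    using lift_coll_open lift_set_open parts_open by auto
  have "lift_set (S2 - coll) = lift_set S2 - lift_set coll" "lift_set (S1 - coll) = lift_set S1 - lift_set coll"
    by (auto simp: lift_set_def)
  then show "lift_set (S2 - coll) \<in> sets borel" "lift_set (S1 - coll) \<in> sets borel"
    using 1 sets.Diff by metis+
qed

lemma coll_S: "coll \<subseteq> S" using wedge_subset pi_in by blast

lemma S_split: "S = (S2 - coll) \<union> (coll \<union> (S1 - coll))"
  using parts(6-8) axis_in_wedge coll_S by blast

text \<open>The scalar product of the gradient of \<open>step a b (Im (lg z)) * Q z\<close> with the conjugate of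
  \<open>f\<close>. The cut-off factor is \<open>0\<close> towards \<open>S1\<close> and \<open>1\<close> towards \<open>S2\<close>, so the product descends
  to the surface although \<open>Q\<close>, say the primitive of the form, is defined over \<open>S2\<close> and the collar
  only.\<close>

definition collar_density :: "real \<Rightarrow> real \<Rightarrow> (complex \<Rightarrow> real) \<Rightarrow> (complex \<Rightarrow> complex) \<Rightarrow> complex \<Rightarrow> real" where
  "collar_density a b Q GQ z =
     (step a b (Im (lg z)) *\<^sub>R GQ z + (Q z * step' a b (Im (lg z))) *\<^sub>R cnj (- \<i> / z)) \<bullet> cnj (f z)"

lemma lg_cont: "continuous_on H lg"
  using lg_deriv by (meson DERIV_isCont continuous_at_imp_continuous_on in_upper_half_plane)

lemma collar_density_cont:
  assumes "a < b" "continuous_on H Q" "continuous_on H GQ"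
  shows "continuous_on H (collar_density a b Q GQ)"
proof -
  have s: "continuous_on UNIV (step a b)" using step_deriv[OF assms(1)] by (meson DERIV_isCont continuous_at_imp_continuous_on)
  show ?thesis
    unfolding collar_density_def[abs_def]
    by (intro continuous_intros assms f_cont lg_cont continuous_on_compose2[OF s] continuous_on_compose2[OF step'_cont[OF assms(1), of UNIV]]) auto
qed

text \<open>The function that is the cut-off times \<open>Q\<close> on the wedge and
  \<open>Q\<close> on the rest of \<open>V2\<close> descends to the surface, is zero towards
  \<open>S1\<close>, and falls under \<open>weak_harmonic\<close>. The integral splits into
  \<open>S2\<close> outside the collar, where the density is that of \<open>Q\<close>, the collar,
  represented by a rectangle, and \<open>S1\<close> outside the collar, which contributes
  nothing.\<close>

lemma cutoff_identity:
  assumes ab: "-Y < a" "a < b" "b < Y"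
    and Q: "\<And>z. z \<in> H \<Longrightarrow> has_grad Q (GQ z) z" "continuous_on H GQ"
    and compat: "\<And>z w. z \<in> wedge_set \<union> V2 \<Longrightarrow> w \<in> wedge_set \<union> V2 \<Longrightarrow> \<pi> z = \<pi> w \<Longrightarrow> Q z = Q w"
    and inv: "invariant_density (\<lambda>z. GQ z \<bullet> cnj (f z))"
  shows "set_integrable lborel (ex ` rect (-Y) Y) (collar_density a b Q GQ)"
    and "set_lebesgue_integral lborel (F \<inter> lift_set (S2 - coll)) (\<lambda>z. GQ z \<bullet> cnj (f z))
       + set_lebesgue_integral lborel (ex ` rect (-Y) Y) (collar_density a b Q GQ) = 0"
proof -
  \<comment> \<open>The cut-off varies within the band \<open>\<bar>Im (lg z)\<bar> \<le> b0\<close>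
    alone. Its image \<open>K\<close> is compact, so removing it leaves open parts of the surface on
    which the glued function is \<open>Q\<close> or 0.\<close>
  define b0 where "b0 = max \<bar>a\<bar> \<bar>b\<bar>"
  have b0: "0 \<le> b0" "b0 < Y" using ab by (auto simp: b0_def)
  define K where "K = \<pi> ` {z \<in> wedge_set. \<bar>Im (lg z)\<bar> \<le> b0}"
  have Kc: "K \<subseteq> coll" by (auto simp: K_def)
  have cK: "compact K" unfolding K_def by (rule band_compact[OF b0])
  have oK: "openin (top_of_set S) (S - K)"
    using cK Kc coll_S by (intro openin_diff) (auto intro!: closed_subset compact_imp_closed)
  have Kin: "z \<in> wedge_set \<Longrightarrow> \<pi> z \<notin> K \<Longrightarrow> \<bar>Im (lg z)\<bar> > b0" for z by (force simp: K_def)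
  define V' where "V' = V2 \<inter> lift_set (S - K)"
  have oV': "open V'" unfolding V'_def using V2(1) lift_set_open[OF oK] by blast
  define V where "V = wedge_set \<union> V'"
  define X where "X z = (if z \<in> V' then 1 else step a b (Im (lg z)))" for z
  define w where "w z = X z * Q z" for z
  define GW where "GW z = step a b (Im (lg z)) *\<^sub>R GQ z + (Q z * step' a b (Im (lg z))) *\<^sub>R cnj (- \<i> / z)" for z
  define Gw where "Gw z = (if z \<in> V' then GQ z else GW z)" for z
  have WV': "step a b (Im (lg z)) = 1 \<and> step' a b (Im (lg z)) = 0" if z: "z \<in> wedge_set" "\<pi> z \<in> S2" "\<pi> z \<notin> K" for z
  proof -
    have "Im (lg z) > 0" using wedge_S2[OF z(1,2)] by (simp add: lg_left)
    then have "b \<le> Im (lg z)" using Kin[OF z(1,3)] unfolding b0_def by linarith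
    then show ?thesis using step_values[OF _] step_values(3,4)[OF ab(2)] by simp
  qed
  have V'K: "\<pi> z \<in> S2" "\<pi> z \<notin> K" if "z \<in> V'" for z using that V2(5) by (auto simp: V'_def lift_set_def)
  have XW: "X z = step a b (Im (lg z))" if "z \<in> wedge_set" for z
    using WV'[OF that V'K] by (simp add: X_def)
  have GwW: "Gw z = GW z" if "z \<in> wedge_set" for z
    using WV'[OF that V'K] by (simp add: Gw_def GW_def)
  have VH: "V \<subseteq> H" using wedge_subset V2_H by (auto simp: V_def V'_def)
  have oV: "open V" using open_wedge oV' by (auto simp: V_def)
  have Qc: "continuous_on H Q" using Q(1) has_grad_continuous continuous_at_imp_continuous_on by blast
  have gradw: "has_grad w (Gw z) z" if z: "z \<in> V" for z
  proof (cases "z \<in> V'")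
    case True
    then have "has_grad w (GQ z) z"
      using VH z by (intro has_grad_transform[OF Q(1) oV' True]) (auto simp: w_def X_def)
    then show ?thesis using True by (simp add: Gw_def)
  next
    case False
    then have zW: "z \<in> wedge_set" using z by (simp add: V_def)
    have zH: "Im z > 0" using zW by (simp add: wedge_set_def)
    have "has_grad (\<lambda>z. step a b (Im (lg z))) (step' a b (Im (lg z)) *\<^sub>R cnj (- \<i> / z)) z"
      by (rule has_grad_real_compose[OF step_deriv[OF ab(2)] ang_grad[OF zH]])
    from has_grad_mult[OF this Q(1)] zH
    have "has_grad (\<lambda>z. step a b (Im (lg z)) * Q z) (GW z) z" by (simp add: GW_def)
    then have "has_grad w (GW z) z"
      by (rule has_grad_transform[OF _ open_wedge zW]) (simp add: w_def XW)
    then show ?thesis using GwW[OF zW] by simp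
  qed
  have GWc: "continuous_on H GW"
  proof -
    have s: "continuous_on UNIV (step a b)" using step_deriv[OF ab(2)] by (meson DERIV_isCont continuous_at_imp_continuous_on)
    show ?thesis unfolding GW_def[abs_def]
      by (intro continuous_intros Q(2) Qc lg_cont continuous_on_compose2[OF s] continuous_on_compose2[OF step'_cont[OF ab(2), of UNIV]]) auto
  qed
  have contGw: "continuous_on V Gw"
    unfolding V_def
  proof (rule continuous_on_open_Un[OF open_wedge oV'])
    show "continuous_on wedge_set Gw"
      by (rule continuous_on_eq[OF continuous_on_subset[OF GWc wedge_subset]]) (simp add: GwW)
    have "V' \<subseteq> H" using VH by (simp add: V_def)
    show "continuous_on V' Gw"
      by (rule continuous_on_eq[OF continuous_on_subset[OF Q(2) \<open>V' \<subseteq> H\<close>]]) (simp add: Gw_def)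
  qed
  have compw: "w z = w z'" if z: "z \<in> V" "z' \<in> V" "\<pi> z = \<pi> z'" for z z'
  proof -
    have "Q z = Q z'" using z by (intro compat) (auto simp: V_def V'_def)
    moreover have "X z = X z'"
    proof (cases "\<pi> z \<in> S2 \<and> \<pi> z \<notin> K")
      case True
      have "X y = 1" if "y \<in> V" "\<pi> y = \<pi> z" for y
        using that True WV'[of y] by (auto simp: V_def X_def)
      then show ?thesis using z by metis
    next
      case False
      then have "z \<notin> V'" "z' \<notin> V'" using V'K[of z] V'K[of z'] z(3) False by auto
      then have W: "z \<in> wedge_set" "z' \<in> wedge_set" using z by (auto simp: V_def)
      then obtain k where "z' = shift k z" using wedge_same_image z(3) by blast
      then show ?thesis using W Im_lg_shift[of z k] wedge_subset XW by auto
    qed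
    ultimately show ?thesis by (simp add: w_def)
  qed
  define O1 where "O1 = S1 - K"
  have oO1: "openin (top_of_set S) O1"
  proof -
    have "O1 = S1 \<inter> (S - K)" using parts(7) by (auto simp: O1_def)
    then show ?thesis using parts_open(1) oK by (simp add: openin_Int)
  qed
  have cover: "\<pi> ` V \<union> O1 = S"
  proof
    have "\<pi> ` V \<subseteq> S" using VH pi_in by blast
    then show "\<pi> ` V \<union> O1 \<subseteq> S" using parts(7) by (auto simp: O1_def)
    show "S \<subseteq> \<pi> ` V \<union> O1"
    proof
      fix p assume p: "p \<in> S"
      consider "p \<in> coll" | "p \<in> S2" "p \<notin> coll" | "p \<in> S1" "p \<notin> coll" using p S_split by blast
      then show "p \<in> \<pi> ` V \<union> O1"
      proof cases
        case 1 then show ?thesis by (auto simp: V_def)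
      next
        case 2
        then obtain z where "z \<in> V2" "p = \<pi> z" using V2(5) by blast
        then have "z \<in> V'" using 2 Kc p V2_H by (auto simp: V'_def lift_set_def)
        then show ?thesis using \<open>p = \<pi> z\<close> by (auto simp: V_def)
      next
        case 3 then show ?thesis using Kc by (auto simp: O1_def)
      qed
    qed
  qed
  have zero: "w z = 0" if z: "z \<in> V" "\<pi> z \<in> O1" for z
  proof -
    have "\<pi> z \<notin> S2" using z(2) parts(5) by (auto simp: O1_def)
    then have zW: "z \<in> wedge_set" using z(1) V'K by (auto simp: V_def)
    have "z \<notin> left_wedge" using \<open>\<pi> z \<notin> S2\<close> left_in by blast
    then have "Im (lg z) \<le> 0" using zW lg_left[of z] lg_wedge[of z] by auto
    then have "Im (lg z) \<le> a" using Kin[OF zW] z(2) by (auto simp: O1_def b0_def)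
    then show ?thesis using XW[OF zW] step_values(1) by (simp add: w_def)
  qed
  obtain u G where u: "\<And>z. z \<in> H \<Longrightarrow> has_grad u (G z) z" "continuous_on H G"
    "\<And>g z. deck_transformation \<pi> g \<Longrightarrow> z \<in> H \<Longrightarrow> u (g z) = u z"
    and GV: "\<And>z. z \<in> V \<Longrightarrow> G z = Gw z" and G0: "\<And>z. z \<in> H \<Longrightarrow> \<pi> z \<in> O1 \<Longrightarrow> G z = 0"
    apply (rule descend[OF oV VH gradw contGw compw oO1 cover zero])
         apply assumption+
    subgoal premises p for u G by (rule that[of u G]) (fact p)+
    done
  let ?k = "\<lambda>z. G z \<bullet> cnj (f z)"
  have inv_k: "invariant_density ?k" by (rule invariant_density_inner[where f = f and u = u and G = G]) (assumption | rule f_hol f_inv u)+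
  have kc: "continuous_on H ?k" using inv_k by (simp add: invariant_density_def)
  have total: "set_lebesgue_integral lborel F ?k = 0" by (rule weak_harmonic[where f = f and u = u and G = G]) (assumption | rule f_hol f_inv u)+
  let ?A = "F \<inter> lift_set (S2 - coll)" and ?B = "F \<inter> lift_set coll" and ?C = "F \<inter> lift_set (S1 - coll)"
  have FU: "F = ?A \<union> (?B \<union> ?C)"
  proof
    show "F \<subseteq> ?A \<union> (?B \<union> ?C)"
    proof
      fix z assume "z \<in> F"
      then have "z \<in> H" using F_H by blast
      then have "\<pi> z \<in> (S2 - coll) \<union> (coll \<union> (S1 - coll))" using pi_in S_split by blast
      then show "z \<in> ?A \<union> (?B \<union> ?C)" using \<open>z \<in> F\<close> \<open>z \<in> H\<close> by (auto simp: lift_set_def)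
    qed
  qed blast
  have bor: "?A \<in> sets borel" "?B \<in> sets borel" "?C \<in> sets borel" using F_borel lift_borel by auto
  have int: "set_integrable lborel ?A ?k" "set_integrable lborel ?B ?k" "set_integrable lborel ?C ?k"
    using bor by (auto intro!: integrable_on_F[OF kc])
  have dis: "?B \<inter> ?C = {}" "?A \<inter> (?B \<union> ?C) = {}" using parts(5) by (auto simp: lift_set_def)
  have "set_lebesgue_integral lborel F ?k = set_lebesgue_integral lborel (?A \<union> (?B \<union> ?C)) ?k" using FU by simp
  also have "\<dots> = set_lebesgue_integral lborel ?A ?k + set_lebesgue_integral lborel (?B \<union> ?C) ?k"
    by (rule set_integral_Un[OF dis(2) int(1)]) (use int bor in \<open>auto intro!: set_integrable_Un\<close>)
  also have "set_lebesgue_integral lborel (?B \<union> ?C) ?k = set_lebesgue_integral lborel ?B ?k + set_lebesgue_integral lborel ?C ?k"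
    by (rule set_integral_Un[OF dis(1) int(2,3)])
  also have "set_lebesgue_integral lborel ?C ?k = 0"
  proof -
    have "set_lebesgue_integral lborel ?C ?k = set_lebesgue_integral lborel ?C (\<lambda>z. 0)"
    proof (rule set_lebesgue_integral_cong)
      show "\<forall>z. z \<in> ?C \<longrightarrow> ?k z = 0"
      proof (intro allI impI)
        fix z assume "z \<in> ?C"
        then have "z \<in> H" "\<pi> z \<in> O1" using Kc unfolding lift_set_def O1_def by blast+
        then show "?k z = 0" using G0[of z] by simp
      qed
    qed (use bor in simp)
    then show ?thesis by (simp add: set_lebesgue_integral_def)
  qed
  finally have sum0: "set_lebesgue_integral lborel ?A ?k + set_lebesgue_integral lborel ?B ?k = 0" using total by simp
  \<comment> \<open>Points of \<open>F\<close> over \<open>S2\<close> may lie outside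
    \<open>V2\<close>; a deck transformation moves them there, and both densities are
    invariant.\<close>
  have A_eq: "set_lebesgue_integral lborel ?A ?k = set_lebesgue_integral lborel ?A (\<lambda>z. GQ z \<bullet> cnj (f z))"
  proof (rule set_lebesgue_integral_cong)
    show "\<forall>z. z \<in> ?A \<longrightarrow> ?k z = GQ z \<bullet> cnj (f z)"
    proof (intro allI impI)
      fix z assume "z \<in> ?A"
      then have z: "z \<in> H" "\<pi> z \<in> S2" "\<pi> z \<notin> coll" by (auto simp: lift_set_def)
      then obtain z' where z': "z' \<in> V2" "\<pi> z = \<pi> z'" using V2(5) by blast
      have "z' \<in> V'" using z' z V2_H pi_in Kc by (auto simp: V'_def lift_set_def)
      obtain g where g: "deck_transformation \<pi> g" "g z = z'" using deck_exists[OF z(1) _ z'(2)] z'(1) V2_H by blast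
      have "?k z = (cmod (deriv g z))\<^sup>2 * ?k z'" using inv_k g z(1) by (auto simp: invariant_density_def)
      also have "G z' = GQ z'" using GV[of z'] \<open>z' \<in> V'\<close> by (simp add: V_def Gw_def)
      also have "(cmod (deriv g z))\<^sup>2 * (GQ z' \<bullet> cnj (f z')) = GQ z \<bullet> cnj (f z)"
        using inv g z(1) by (auto simp: invariant_density_def)
      finally show "?k z = GQ z \<bullet> cnj (f z)" .
    qed
  qed (use bor in simp)
  let ?R = "ex ` rect (-Y) Y"
  have R: "?R \<in> sets borel" "?R \<subseteq> wedge_set" "inj_on \<pi> ?R" "\<pi> ` ?R = coll"
    using rect_image[of "-Y" Y] wedge_band by auto
  have RH: "?R \<subseteq> H" using R(2) wedge_subset by blast
  have kR: "?k z = collar_density a b Q GQ z" if "z \<in> ?R" for z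
  proof -
    have "z \<in> wedge_set" using that R(2) by blast
    then show ?thesis using GV[of z] GwW[of z] by (simp add: V_def collar_density_def GW_def)
  qed
  have bc: "lift_set (\<pi> ` ?R) \<in> sets borel" unfolding R(4) by (rule lift_borel(1))
  note rep = integral_representatives[OF inv_k R(1) RH R(3) bc]
  show "set_integrable lborel ?R (collar_density a b Q GQ)"
    using rep(1) kR set_integrable_cong[OF refl refl, of ?R ?k "collar_density a b Q GQ" lborel] by simp
  have "set_lebesgue_integral lborel ?R (collar_density a b Q GQ) = set_lebesgue_integral lborel ?R ?k"
    by (rule set_lebesgue_integral_cong) (use R(1) kR in auto)
  also have "\<dots> = set_lebesgue_integral lborel ?B ?k" using rep(2) unfolding R(4) .
  finally show "set_lebesgue_integral lborel ?A (\<lambda>z. GQ z \<bullet> cnj (f z))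
       + set_lebesgue_integral lborel ?R (collar_density a b Q GQ) = 0"
    using sum0 A_eq by simp
qed

text \<open>The form \<open>f dz\<close> becomes \<open>fh d\<zeta>\<close>, as \<open>ex\<close> is
  its own derivative.\<close>

definition fh :: "complex \<Rightarrow> complex" where "fh \<zeta> = f (ex \<zeta>) * ex \<zeta>"
definition Ph :: "complex \<Rightarrow> complex" where "Ph \<zeta> = P (ex \<zeta>)"

lemma rect_sub: "-Y \<le> b \<Longrightarrow> c \<le> Y \<Longrightarrow> rect b c \<subseteq> {\<zeta>. \<bar>Im \<zeta>\<bar> < Y}"
  by (auto simp: rect_def)

lemma rect_change_of_variables:
  assumes h: "continuous_on H h" and bc: "-Y \<le> b" "c \<le> Y"
  shows "set_integrable lborel (ex ` rect b c) h \<longleftrightarrow> set_integrable lborel (rect b c) (\<lambda>\<zeta>. (cmod (ex \<zeta>))\<^sup>2 * h (ex \<zeta>))"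
    and "set_lebesgue_integral lborel (ex ` rect b c) h = set_lebesgue_integral lborel (rect b c) (\<lambda>\<zeta>. (cmod (ex \<zeta>))\<^sup>2 * h (ex \<zeta>))"
proof -
  have d: "deriv ex \<zeta> = ex \<zeta>" for \<zeta> by (rule DERIV_imp_deriv[OF ex_deriv])
  have inj: "inj_on ex (rect b c)" using ex_inj rect_sub[OF bc] by (rule inj_on_subset)
  have im: "ex ` rect b c \<subseteq> H" using rect_image(2)[OF bc] wedge_subset by blast
  note cv = holomorphic_change_of_variables[OF ex_holomorphic open_UNIV subset_UNIV rect_borel inj rect_image(1)[OF bc] h open_upper_half_plane im, unfolded d]
  show "set_integrable lborel (ex ` rect b c) h \<longleftrightarrow> set_integrable lborel (rect b c) (\<lambda>\<zeta>. (cmod (ex \<zeta>))\<^sup>2 * h (ex \<zeta>))"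
    by (rule cv(1))
  show "set_lebesgue_integral lborel (ex ` rect b c) h = set_lebesgue_integral lborel (rect b c) (\<lambda>\<zeta>. (cmod (ex \<zeta>))\<^sup>2 * h (ex \<zeta>))"
    by (rule cv(2))
qed

text \<open>The scalar product is conformally invariant. In the strip the height
  \<open>Im \<zeta>\<close> has gradient \<i>, whose scalar product with
  \<open>cnj (fh \<zeta>)\<close> is \<open>- Im (fh \<zeta>)\<close>.\<close>

lemma collar_density_strip:
  assumes \<zeta>: "\<bar>Im \<zeta>\<bar> < Y"
  shows "(cmod (ex \<zeta>))\<^sup>2 * collar_density a b Q GQ (ex \<zeta>)
    = step a b (Im \<zeta>) * ((cnj (ex \<zeta>) * GQ (ex \<zeta>)) \<bullet> cnj (fh \<zeta>)) - step' a b (Im \<zeta>) * (Q (ex \<zeta>) * Im (fh \<zeta>))"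
proof -
  have lg: "lg (ex \<zeta>) = \<zeta>" using \<zeta> Y_pos pi_gt_zero by (intro lg_ex) simp
  have e: "ex \<zeta> \<noteq> 0" by (simp add: ex_def)
  have conf: "(cmod p)\<^sup>2 * (x \<bullet> cnj y) = (cnj p * x) \<bullet> cnj (y * p)" for p x y
    unfolding cmod_power2 by (simp add: inner_complex_def power2_eq_square algebra_simps)
  have i: "cnj (ex \<zeta>) * cnj (- \<i> / ex \<zeta>) = \<i>"
    using e by (simp flip: complex_cnj_mult)
  have "(cmod (ex \<zeta>))\<^sup>2 * collar_density a b Q GQ (ex \<zeta>) =
     (cnj (ex \<zeta>) * (step a b (Im \<zeta>) *\<^sub>R GQ (ex \<zeta>) + (Q (ex \<zeta>) * step' a b (Im \<zeta>)) *\<^sub>R cnj (- \<i> / ex \<zeta>))) \<bullet> cnj (fh \<zeta>)"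
    unfolding collar_density_def lg conf fh_def ..
  also have "cnj (ex \<zeta>) * (step a b (Im \<zeta>) *\<^sub>R GQ (ex \<zeta>) + (Q (ex \<zeta>) * step' a b (Im \<zeta>)) *\<^sub>R cnj (- \<i> / ex \<zeta>))
     = step a b (Im \<zeta>) *\<^sub>R (cnj (ex \<zeta>) * GQ (ex \<zeta>)) + (Q (ex \<zeta>) * step' a b (Im \<zeta>)) *\<^sub>R \<i>"
    using i by (simp only: distrib_left mult_scaleR_right)
  finally show ?thesis by (simp add: inner_add_left inner_complex_def algebra_simps)
qed

lemma fh_hol: "fh holomorphic_on {\<zeta>. \<bar>Im \<zeta>\<bar> < Y}"
proof -
  have "(f \<circ> ex) holomorphic_on {\<zeta>. \<bar>Im \<zeta>\<bar> < Y}"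
    by (rule holomorphic_on_compose_gen[OF ex_holomorphic f_hol]) (use ex_in_H in auto)
  then show ?thesis unfolding fh_def[abs_def] o_def by (intro holomorphic_intros ex_holomorphic)
qed

lemma Ph_deriv: "\<bar>Im \<zeta>\<bar> < Y \<Longrightarrow> (Ph has_field_derivative fh \<zeta>) (at \<zeta>)"
  unfolding Ph_def[abs_def] fh_def using DERIV_chain2[OF P_deriv ex_deriv] ex_in_H by simp

lemma strip_line:
  assumes "continuous_on {\<zeta>. \<bar>Im \<zeta>\<bar> < Y} h" "\<bar>y\<bar> < Y"
  shows "continuous_on X (\<lambda>x. h (Complex x y))"
  by (rule continuous_on_compose2[OF assms(1)]) (use assms(2) in \<open>auto simp: Complex_eq intro!: continuous_intros\<close>)

lemma fh_cont: "continuous_on {\<zeta>. \<bar>Im \<zeta>\<bar> < Y} fh"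
  using fh_hol by (rule holomorphic_on_imp_continuous_on)

lemma Ph_cont: "continuous_on {\<zeta>. \<bar>Im \<zeta>\<bar> < Y} Ph"
  using Ph_deriv by (metis DERIV_isCont continuous_at_imp_continuous_on mem_Collect_eq)

text \<open>What remains is the imaginary period, that of the conjugate form along the geodesic. The
  conjugate form is closed and the geodesic bounds \<open>S2\<close>: in
  \<open>cutoff_identity\<close> with \<open>Q = 1\<close> the term over \<open>S2\<close> is zero,
  and the collar term is, up to sign, the imaginary period times the integral of
  \<open>step'\<close>, which is 1.\<close>

lemma Ph_periodic:
  assumes \<zeta>: "\<bar>Im \<zeta>\<bar> < Y" shows "Ph (\<zeta> + of_real L) = Ph \<zeta>"
proof -
  obtain c where c: "\<And>z. z \<in> H \<Longrightarrow> P (shift 1 z) = P z + c" "Re c = 0" using P_shift[of 1] by metis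
  have per: "Ph (\<zeta> + of_real L) = Ph \<zeta> + c" if "\<bar>Im \<zeta>\<bar> < Y" for \<zeta>
    using c(1)[of "ex \<zeta>"] ex_in_H[OF that] shift_ex[of 1 \<zeta>] by (simp add: Ph_def)
  let ?a = "- Y / 2" and ?b = "Y / 2"
  have ab: "- Y < ?a" "?a < ?b" "?b < Y" using Y_pos by auto
  let ?one = "\<lambda>z::complex. 1::real" and ?nul = "\<lambda>z::complex. 0::complex"
  have d0: "invariant_density (\<lambda>z. ?nul z \<bullet> cnj (f z))" by (simp add: invariant_density_def)
  note ci = cutoff_identity[OF ab has_grad_const _ _ d0, of 1]
  have z: "set_lebesgue_integral lborel (ex ` rect (-Y) Y) (collar_density ?a ?b ?one ?nul) = 0"
    using ci(2) by (simp add: set_lebesgue_integral_def)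
  have cd: "continuous_on H (collar_density ?a ?b ?one ?nul)"
    by (rule collar_density_cont[OF ab(2)]) (intro continuous_intros)+
  note cv = rect_change_of_variables[OF cd order_refl order_refl]
  let ?q = "\<lambda>\<zeta>. (cmod (ex \<zeta>))\<^sup>2 * collar_density ?a ?b ?one ?nul (ex \<zeta>)"
  have si: "set_integrable lborel (rect (-Y) Y) ?q" using cv(1) ci(1) by simp
  have "0 = set_lebesgue_integral lborel (rect (-Y) Y) ?q" using cv(2) z by simp
  also have "\<dots> = set_lebesgue_integral lborel {-Y<..<Y} (\<lambda>y. set_lebesgue_integral lborel {0..<L} (\<lambda>x. ?q (Complex x y)))"
    by (rule rect_Fubini(2)[OF si])
  also have "\<dots> = set_lebesgue_integral lborel {-Y<..<Y} (\<lambda>y. step' ?a ?b y * (- Im c))"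
  proof (rule set_lebesgue_integral_cong, simp, intro allI impI)
    fix y assume "y \<in> {-Y<..<Y}"
    then have y: "\<bar>y\<bar> < Y" by auto
    have "?q (Complex x y) = step' ?a ?b y * (- Im (fh (Complex x y)))" for x
      using collar_density_strip[of "Complex x y" ?a ?b ?one ?nul] y by simp
    then have "set_lebesgue_integral lborel {0..<L} (\<lambda>x. ?q (Complex x y))
        = set_lebesgue_integral lborel {0..<L} (\<lambda>x. step' ?a ?b y * (- Im (fh (Complex x y))))" by simp
    also have "\<dots> = integral {0..L} (\<lambda>x. step' ?a ?b y * (- Im (fh (Complex x y))))"
      by (rule period_integral) (intro continuous_intros strip_line[OF fh_cont y])
    also have "\<dots> = step' ?a ?b y * (- Im c)"
    proof -
      have "((\<lambda>x. Im (fh (Complex x y))) has_integral (Im (Ph (Complex L y)) - Im (Ph (Complex 0 y)))) {0..L}"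
      proof (rule fundamental_theorem_of_calculus)
        fix x assume "x \<in> {0..L}"
        have "((\<lambda>x. Complex x y) has_vector_derivative 1) (at x within {0..L})"
          unfolding Complex_eq by (auto intro!: derivative_eq_intros)
        from field_vector_diff_chain_within[OF this has_field_derivative_at_within[OF Ph_deriv]] y
        have "((\<lambda>x. Ph (Complex x y)) has_vector_derivative fh (Complex x y)) (at x within {0..L})" by (simp add: o_def)
        from bounded_linear.has_vector_derivative[OF bounded_linear_Im this]
        show "((\<lambda>x. Im (Ph (Complex x y))) has_vector_derivative Im (fh (Complex x y))) (at x within {0..L})" .
      qed (use L_pos in simp)
      moreover have "Complex L y = Complex 0 y + of_real L" by (simp add: complex_eq_iff)
      then have "Im (Ph (Complex L y)) - Im (Ph (Complex 0 y)) = Im c" using per[of "Complex 0 y"] y by simp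
      ultimately have "((\<lambda>x. step' ?a ?b y * (- Im (fh (Complex x y)))) has_integral step' ?a ?b y * (- Im c)) {0..L}"
        by (intro has_integral_mult_right has_integral_neg) simp
      then show ?thesis by (rule integral_unique)
    qed
    finally show "set_lebesgue_integral lborel {0..<L} (\<lambda>x. ?q (Complex x y)) = step' ?a ?b y * (- Im c)" .
  qed
  also have "\<dots> = integral {-Y..Y} (\<lambda>y. step' ?a ?b y * (- Im c))"
  proof -
    have "set_integrable lborel {-Y..Y} (\<lambda>y. step' ?a ?b y * (- Im c))"
      by (rule borel_integrable_atLeastAtMost') (intro continuous_intros step'_cont ab)
    then have "set_integrable lborel {-Y<..<Y} (\<lambda>y. step' ?a ?b y * (- Im c))" by (rule set_integrable_subset) auto
    from set_borel_integral_eq_integral(2)[OF this] show ?thesis by (simp add: integral_open_interval_real)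
  qed
  also have "\<dots> = (step ?a ?b Y - step ?a ?b (-Y)) * (- Im c)"
  proof (rule integral_unique, rule has_integral_mult_left, rule fundamental_theorem_of_calculus)
    show "(step ?a ?b has_vector_derivative step' ?a ?b y) (at y within {-Y..Y})" for y
      using step_deriv[OF ab(2), of y] has_field_derivative_at_within
      by (simp add: has_real_derivative_iff_has_vector_derivative[symmetric])
  qed (use Y_pos in simp)
  also have "\<dots> = - Im c" using step_values(1)[of "-Y" ?a ?b] step_values(3)[of ?a ?b Y] ab by simp
  finally have "c = 0" using c(2) by (simp add: complex_eq_iff)
  then show ?thesis using per[OF \<zeta>] by simp
qed

end

sublocale exact_collar \<subseteq> cyl: cylinder L Y fh Ph
  using L_pos Y_pos fh_hol Ph_deriv Ph_periodic by unfold_locales auto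

context exact_collar
begin

definition lift_energy :: "'a set \<Rightarrow> real" where
  "lift_energy D = set_lebesgue_integral lborel (F \<inter> lift_set D) (\<lambda>z. (cmod (f z))\<^sup>2)"

lemma norm_density: "invariant_density (\<lambda>z. (cmod (f z))\<^sup>2)"
  by (rule invariant_density_norm[where f = f]) (assumption | rule f_hol f_inv)+

lemma norm_integrable:
  assumes "lift_set D \<in> sets borel"
  shows "set_integrable lborel (F \<inter> lift_set D) (\<lambda>z. (cmod (f z))\<^sup>2)"
proof (rule integrable_on_F)
  show "continuous_on H (\<lambda>z. (cmod (f z))\<^sup>2)" using norm_density by (simp add: invariant_density_def)
  show "F \<inter> lift_set D \<in> sets borel" using F_borel assms by blast
qed blast

lemma lift_energy_nonneg: "lift_energy D \<ge> 0"
  unfolding lift_energy_def set_lebesgue_integral_def by (rule Bochner_Integration.integral_nonneg) simp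

lemma lift_energy_Un:
  assumes "D \<inter> D' = {}" "lift_set D \<in> sets borel" "lift_set D' \<in> sets borel"
  shows "lift_energy (D \<union> D') = lift_energy D + lift_energy D'"
proof -
  have "F \<inter> lift_set (D \<union> D') = (F \<inter> lift_set D) \<union> (F \<inter> lift_set D')" by (auto simp: lift_set_def)
  moreover have "(F \<inter> lift_set D) \<inter> (F \<inter> lift_set D') = {}" using assms(1) by (auto simp: lift_set_def)
  ultimately show ?thesis
    unfolding lift_energy_def using set_integral_Un norm_integrable assms(2,3) by metis
qed

lemma lift_energy_mono:
  assumes "D \<subseteq> D'" "lift_set D \<in> sets borel" "lift_set D' \<in> sets borel"
  shows "lift_energy D \<le> lift_energy D'"
proof -
  have "lift_set (D' - D) = lift_set D' - lift_set D" by (auto simp: lift_set_def)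
  then have "lift_set (D' - D) \<in> sets borel" using assms by auto
  then have "lift_energy (D \<union> (D' - D)) = lift_energy D + lift_energy (D' - D)"
    using assms(2) by (intro lift_energy_Un) auto
  moreover have "D \<union> (D' - D) = D'" using assms(1) by blast
  ultimately show ?thesis using lift_energy_nonneg[of "D' - D"] by simp
qed

definition upper_part :: "real \<Rightarrow> complex set" where
  "upper_part b = {z \<in> wedge_set. b < Im (lg z)}"

lemma upper_part_borel: "lift_set (\<pi> ` upper_part b) \<in> sets borel"
proof -
  have "continuous_on wedge_set (\<lambda>z. Im (lg z))"
    by (intro continuous_intros continuous_on_subset[OF lg_cont wedge_subset])
  from continuous_open_preimage[OF this open_wedge open_greaterThan[of b]]
  have "open (upper_part b)" by (simp add: upper_part_def vimage_def Int_def)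
  moreover have "upper_part b \<subseteq> H" using wedge_subset by (auto simp: upper_part_def)
  ultimately have "open (lift_set (\<pi> ` upper_part b))" by (intro lift_set_open pi_open_map)
  then show ?thesis by simp
qed

lemma slice_from_strip:
  assumes "\<bar>y\<bar> < Y"
  shows "set_lebesgue_integral lborel {0..<L} (\<lambda>x. (cmod (fh (Complex x y)))\<^sup>2) = cyl.slice_energy y"
  unfolding cyl.slice_energy_def
  by (rule period_integral) (intro continuous_intros strip_line[OF fh_cont assms])

text \<open>Energy is conformally invariant, so Fubini's theorem in the strip expresses it by the
  energies of the circles.\<close>

lemma upper_part_energy:
  assumes b: "-Y \<le> b"
  shows "set_integrable lborel {b<..<Y} cyl.slice_energy"
    and "lift_energy (\<pi> ` upper_part b) = set_lebesgue_integral lborel {b<..<Y} cyl.slice_energy"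
proof -
  let ?X = "ex ` rect b Y" and ?k = "\<lambda>z. (cmod (f z))\<^sup>2" and ?q = "\<lambda>\<zeta>. (cmod (fh \<zeta>))\<^sup>2"
  have band: "{z \<in> wedge_set. b < Im (lg z) \<and> Im (lg z) < Y} = upper_part b"
    using lg_wedge by (auto simp: upper_part_def)
  note R = rect_image[OF b order_refl, unfolded band]
  have XH: "?X \<subseteq> H" using R(2) wedge_subset by blast
  have bor: "lift_set (\<pi> ` ?X) \<in> sets borel" unfolding R(4) by (rule upper_part_borel)
  note rep = integral_representatives[OF norm_density R(1) XH R(3) bor]
  have kc: "continuous_on H ?k" using norm_density by (simp add: invariant_density_def)
  have q: "(cmod (ex \<zeta>))\<^sup>2 * ?k (ex \<zeta>) = ?q \<zeta>" for \<zeta>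
    by (simp add: fh_def norm_mult power_mult_distrib mult.commute)
  note cv = rect_change_of_variables[OF kc b order_refl, unfolded q]
  have qi: "set_integrable lborel (rect b Y) ?q" using cv(1) rep(1) by simp
  have s: "\<forall>y. y \<in> {b<..<Y} \<longrightarrow> set_lebesgue_integral lborel {0..<L} (\<lambda>x. ?q (Complex x y)) = cyl.slice_energy y"
    using b slice_from_strip by auto
  have "set_integrable lborel {b<..<Y} (\<lambda>y. set_lebesgue_integral lborel {0..<L} (\<lambda>x. ?q (Complex x y)))"
    by (rule rect_Fubini(1)[OF qi])
  then show "set_integrable lborel {b<..<Y} cyl.slice_energy"
    using s by (subst (asm) set_integrable_cong[OF refl refl]) auto
  have "lift_energy (\<pi> ` upper_part b) = set_lebesgue_integral lborel ?X ?k"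
    unfolding lift_energy_def using rep(2) unfolding R(4) by simp
  also have "\<dots> = set_lebesgue_integral lborel (rect b Y) ?q" by (rule cv(2))
  also have "\<dots> = set_lebesgue_integral lborel {b<..<Y} (\<lambda>y. set_lebesgue_integral lborel {0..<L} (\<lambda>x. ?q (Complex x y)))"
    by (rule rect_Fubini(2)[OF qi])
  also have "\<dots> = set_lebesgue_integral lborel {b<..<Y} cyl.slice_energy"
    by (rule set_lebesgue_integral_cong) (use s in simp_all)
  finally show "lift_energy (\<pi> ` upper_part b) = set_lebesgue_integral lborel {b<..<Y} cyl.slice_energy" .
qed

text \<open>Green's formula, from \<open>cutoff_identity\<close> with \<open>Q = Re P\<close>.
  Integrated over circles, the collar density is \<open>step * slice_energy - step' * flux\<close>.
  Below \<open>a\<close> this is zero and above \<open>b\<close> the slice energy; on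
  \<open>{a..b}\<close> it is the derivative of \<open>- step * flux\<close>, because
  \<open>flux\<close> has derivative \<open>- slice_energy\<close>, and contributes
  \<open>- flux b\<close>.\<close>

lemma flux_eq:
  assumes b: "\<bar>b\<bar> < Y"
  shows "cyl.flux b = lift_energy (S2 - coll) + lift_energy (\<pi> ` upper_part b)"
proof -
  \<comment> \<open>The midpoint between \<open>- Y\<close> and \<open>b\<close>; the result does
    not depend on where the cut-off begins.\<close>
  define a where "a = (b - Y) / 2"
  have ab: "-Y < a" "a < b" "b < Y" using b by (auto simp: a_def)
  let ?Q = "\<lambda>z. Re (P z)" and ?GQ = "\<lambda>z. cnj (f z)"
  have g: "has_grad ?Q (?GQ z) z" if "z \<in> H" for z by (rule has_grad_Re[OF P_deriv[OF that]])
  have gc: "continuous_on H ?GQ" by (intro continuous_intros f_cont)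
  have nn: "cnj w \<bullet> cnj w = (cmod w)\<^sup>2" for w by (simp add: dot_square_norm)
  have inv: "invariant_density (\<lambda>z. ?GQ z \<bullet> cnj (f z))" unfolding nn by (rule norm_density)
  have ci: "set_integrable lborel (ex ` rect (-Y) Y) (collar_density a b ?Q ?GQ)"
    "lift_energy (S2 - coll) + set_lebesgue_integral lborel (ex ` rect (-Y) Y) (collar_density a b ?Q ?GQ) = 0"
    using cutoff_identity[where Q = ?Q and GQ = ?GQ, OF ab g gc compat_ReP inv]
    unfolding nn lift_energy_def by blast+
  have Qc: "continuous_on H ?Q"
    using g has_grad_continuous continuous_at_imp_continuous_on by blast
  have cd: "continuous_on H (collar_density a b ?Q ?GQ)"
    by (rule collar_density_cont[OF ab(2) Qc gc])
  note cv = rect_change_of_variables[OF cd order_refl order_refl]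
  let ?q = "\<lambda>\<zeta>. (cmod (ex \<zeta>))\<^sup>2 * collar_density a b ?Q ?GQ (ex \<zeta>)"
  let ?t = "\<lambda>y. step a b y * cyl.slice_energy y - step' a b y * cyl.flux y"
  have si: "set_integrable lborel (rect (-Y) Y) ?q" using cv(1) ci(1) by simp
  have t: "set_lebesgue_integral lborel {0..<L} (\<lambda>x. ?q (Complex x y)) = ?t y" if y: "\<bar>y\<bar> < Y" for y
  proof -
    have "?q (Complex x y) = step a b y * (cmod (fh (Complex x y)))\<^sup>2
       - step' a b y * (Re (Ph (Complex x y)) * Im (fh (Complex x y)))" for x
    proof -
      have "cnj (ex \<zeta>) * cnj (f (ex \<zeta>)) = cnj (fh \<zeta>)" for \<zeta> by (simp add: fh_def)
      then show ?thesis
        using collar_density_strip[of "Complex x y" a b ?Q ?GQ] y nn by (simp add: Ph_def)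
    qed
    then have "set_lebesgue_integral lborel {0..<L} (\<lambda>x. ?q (Complex x y))
      = set_lebesgue_integral lborel {0..<L} (\<lambda>x. step a b y * (cmod (fh (Complex x y)))\<^sup>2
       - step' a b y * (Re (Ph (Complex x y)) * Im (fh (Complex x y))))" by simp
    also have "\<dots> = integral {0..L} (\<lambda>x. step a b y * (cmod (fh (Complex x y)))\<^sup>2
       - step' a b y * (Re (Ph (Complex x y)) * Im (fh (Complex x y))))"
      by (rule period_integral) (intro continuous_intros strip_line[OF fh_cont y] strip_line[OF Ph_cont y])
    also have "\<dots> = ?t y"
      unfolding cyl.slice_energy_def cyl.flux_def
      by (subst Henstock_Kurzweil_Integration.integral_diff)
        (auto intro!: integrable_continuous_real continuous_intros strip_line[OF fh_cont y] strip_line[OF Ph_cont y])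
    finally show ?thesis .
  qed
  have ti: "set_integrable lborel {-Y<..<Y} ?t"
    using rect_Fubini(1)[OF si] t by (subst (asm) set_integrable_cong[OF refl refl, of _ _ ?t]) auto
  have "lift_energy (S2 - coll) + set_lebesgue_integral lborel (rect (-Y) Y) ?q = 0"
    using ci(2) cv(2) by simp
  also have "set_lebesgue_integral lborel (rect (-Y) Y) ?q
     = set_lebesgue_integral lborel {-Y<..<Y} (\<lambda>y. set_lebesgue_integral lborel {0..<L} (\<lambda>x. ?q (Complex x y)))"
    by (rule rect_Fubini(2)[OF si])
  also have "\<dots> = set_lebesgue_integral lborel {-Y<..<Y} ?t"
    by (rule set_lebesgue_integral_cong) (use t in auto)
  also have "{-Y<..<Y} = {-Y<..<a} \<union> ({a..b} \<union> {b<..<Y})" using ab by auto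
  also have "set_lebesgue_integral lborel ({-Y<..<a} \<union> ({a..b} \<union> {b<..<Y})) ?t
     = set_lebesgue_integral lborel {-Y<..<a} ?t + set_lebesgue_integral lborel ({a..b} \<union> {b<..<Y}) ?t"
    by (rule set_integral_Un) (use ab in \<open>auto intro!: set_integrable_subset[OF ti]\<close>)
  also have "set_lebesgue_integral lborel ({a..b} \<union> {b<..<Y}) ?t
     = set_lebesgue_integral lborel {a..b} ?t + set_lebesgue_integral lborel {b<..<Y} ?t"
    by (rule set_integral_Un) (use ab in \<open>auto intro!: set_integrable_subset[OF ti]\<close>)
  also have "set_lebesgue_integral lborel {-Y<..<a} ?t = set_lebesgue_integral lborel {-Y<..<a} (\<lambda>y. 0)"
    by (rule set_lebesgue_integral_cong) (auto simp: step_values)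
  also have "\<dots> = 0" by (simp add: set_lebesgue_integral_def)
  also have "set_lebesgue_integral lborel {b<..<Y} ?t = set_lebesgue_integral lborel {b<..<Y} cyl.slice_energy"
    by (rule set_lebesgue_integral_cong) (use ab in \<open>auto simp: step_values\<close>)
  also have "\<dots> = lift_energy (\<pi> ` upper_part b)" using upper_part_energy(2)[of b] ab by simp
  also have "set_lebesgue_integral lborel {a..b} ?t = - cyl.flux b"
  proof -
    have "set_integrable lborel {a..b} ?t" by (rule set_integrable_subset[OF ti]) (use ab in auto)
    then have "set_lebesgue_integral lborel {a..b} ?t = integral {a..b} ?t"
      by (rule set_borel_integral_eq_integral(2))
    moreover have "(?t has_integral (- (step a b b * cyl.flux b) - - (step a b a * cyl.flux a))) {a..b}"
    proof (rule fundamental_theorem_of_calculus)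
      fix y assume "y \<in> {a..b}"
      then have y: "\<bar>y\<bar> < Y" using ab by auto
      have "((\<lambda>y. - (step a b y * cyl.flux y)) has_real_derivative
          - (step' a b y * cyl.flux y + - cyl.slice_energy y * step a b y)) (at y within {a..b})"
        by (intro DERIV_minus DERIV_mult has_field_derivative_at_within[OF step_deriv[OF ab(2)]]
            has_field_derivative_at_within[OF cyl.flux_deriv[OF y]])
      then show "((\<lambda>y. - (step a b y * cyl.flux y)) has_vector_derivative ?t y) (at y within {a..b})"
        by (simp add: has_real_derivative_iff_has_vector_derivative[symmetric] mult.commute)
    qed (use ab in simp)
    ultimately show ?thesis using step_values(1)[of a a b] step_values(3)[OF ab(2) order_refl]
      by (simp add: integral_unique)
  qed
  finally show ?thesis by simp
qed

lemma upper_part_0: "upper_part 0 = left_wedge"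
  using lg_left lg_wedge by (auto simp: upper_part_def)

lemma energy_S2_flux: "lift_energy S2 = cyl.flux 0"
proof -
  have "S2 = (S2 - coll) \<union> \<pi> ` upper_part 0"
  proof
    show "S2 \<subseteq> (S2 - coll) \<union> \<pi> ` upper_part 0" using wedge_S2 unfolding upper_part_0 by blast
    show "(S2 - coll) \<union> \<pi> ` upper_part 0 \<subseteq> S2" using left_in unfolding upper_part_0 by blast
  qed
  moreover have "(S2 - coll) \<inter> \<pi> ` upper_part 0 = {}" by (auto simp: upper_part_def)
  ultimately have "lift_energy S2 = lift_energy (S2 - coll) + lift_energy (\<pi> ` upper_part 0)"
    using lift_energy_Un lift_borel(4) upper_part_borel by metis
  then show ?thesis using flux_eq[of 0] Y_pos by simp
qed

lemma flux_bounds: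
  assumes "\<bar>b\<bar> < Y"
  shows "lift_energy (S2 - coll) \<le> cyl.flux b" "cyl.flux b \<le> lift_energy (S2 - coll) + lift_energy coll"
    "lift_energy (S2 - coll) + lift_energy coll \<le> lift_energy S"
proof -
  show "lift_energy (S2 - coll) \<le> cyl.flux b"
    using flux_eq[OF assms] lift_energy_nonneg by simp
  have "lift_energy (\<pi> ` upper_part b) \<le> lift_energy coll"
    using upper_part_borel lift_borel(1) by (intro lift_energy_mono) (auto simp: upper_part_def)
  then show "cyl.flux b \<le> lift_energy (S2 - coll) + lift_energy coll" using flux_eq[OF assms] by simp
  have "lift_energy (S2 - coll) + lift_energy coll = lift_energy ((S2 - coll) \<union> coll)"
    by (rule lift_energy_Un[symmetric]) (use lift_borel in auto)
  also have "\<dots> \<le> lift_energy S"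
  proof (rule lift_energy_mono)
    show "(S2 - coll) \<union> coll \<subseteq> S" using parts(8) coll_S by blast
    have "lift_set ((S2 - coll) \<union> coll) = lift_set (S2 - coll) \<union> lift_set coll" by (auto simp: lift_set_def)
    then show "lift_set ((S2 - coll) \<union> coll) \<in> sets borel" using sets.Un[OF lift_borel(4) lift_borel(1)] by (rule ssubst)
    have "openin (top_of_set S) S" by simp
    then show "lift_set S \<in> sets borel" by (intro borel_open lift_set_open)
  qed
  finally show "lift_energy (S2 - coll) + lift_energy coll \<le> lift_energy S" .
qed

text \<open>The flux is controlled on the open strip, so decay is proved up to every height below
  \<open>Y\<close> and extended to \<open>Y\<close> by continuity.\<close>

lemma limit_bound:
  assumes "\<And>t. 0 < t \<Longrightarrow> t < Y \<Longrightarrow> x \<le> exp (- (k * t)) * c"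
  shows "x \<le> exp (- (k * Y)) * c"
proof (rule tendsto_lowerbound)
  show "((\<lambda>t. exp (- (k * t)) * c) \<longlongrightarrow> exp (- (k * Y)) * c) (at_left Y)"
    by (intro tendsto_intros)
  show "\<forall>\<^sub>F t in at_left Y. x \<le> exp (- (k * t)) * c"
    using eventually_at_left_real[OF Y_pos(1)] by eventually_elim (use assms in auto)
qed simp

text \<open>Decay from height \<open>- t\<close> to the geodesic at height 0, where the flux is the
  energy of \<open>S2\<close>; the flux at \<open>- t\<close> is at most the total energy.\<close>

lemma energy_decay_half: "lift_energy S2 \<le> exp (- (4 * pi / L * Y)) * lift_energy S"
proof (rule limit_bound)
  fix t assume t: "0 < t" "t < Y"
  have "cyl.flux 0 \<le> exp (- (4 * pi / L) * (0 - - t)) * cyl.flux (- t)"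
    using t Y_pos by (intro cyl.flux_decay) auto
  also have "\<dots> \<le> exp (- (4 * pi / L) * (0 - - t)) * lift_energy S"
    using flux_bounds[of "- t"] t by (intro mult_left_mono) auto
  finally show "lift_energy S2 \<le> exp (- (4 * pi / L * t)) * lift_energy S" by (simp add: energy_S2_flux)
qed

text \<open>Decay over the height \<open>2 * t\<close>, from one end of the collar to the other. The
  flux at the lower end includes the energy of \<open>S2\<close> outside the collar, which therefore
  reappears on the right.\<close>

lemma energy_decay_full:
  "lift_energy (S2 - coll) \<le> exp (- (8 * pi / L * Y)) * (lift_energy (S2 - coll) + lift_energy coll)"
proof (rule limit_bound)
  fix t assume t: "0 < t" "t < Y"
  have "lift_energy (S2 - coll) \<le> cyl.flux t" using flux_bounds[of t] t by simp
  also have "\<dots> \<le> exp (- (4 * pi / L) * (t - - t)) * cyl.flux (- t)"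
    using t Y_pos by (intro cyl.flux_decay) auto
  also have "\<dots> \<le> exp (- (4 * pi / L) * (t - - t)) * (lift_energy (S2 - coll) + lift_energy coll)"
    using flux_bounds[of "- t"] t by (intro mult_left_mono) auto
  finally show "lift_energy (S2 - coll) \<le> exp (- (8 * pi / L * t)) * (lift_energy (S2 - coll) + lift_energy coll)"
    by (simp add: mult.assoc)
qed

end

section \<open>The constants, and the normalization of the geodesic\<close>

lemma (in collar_surface) Y_ge: "Y \<ge> pi / 2 - L / 2"
proof -
  have "Y = pi / 2 - arctan (sinh (L / 2))"
    using arctan_inverse[of "sinh (L / 2)"] L_pos by (simp add: Y_def \<kappa>_def sgn_if inverse_eq_divide)
  then show ?thesis using arctan_sinh_le[of "L / 2"] L_pos by simp
qed

text \<open>The bound for \<open>Y\<close> turns the exponent into at most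
  \<open>2 * pi - 2 * pi^2 / L\<close>. The constant allows \<open>pi^2\<close> in place of
  \<open>2 * pi\<close>, which is larger because pi is at least 2.\<close>

lemma collar_constant_half:
  assumes "0 < L" "pi / 2 - L / 2 \<le> Y"
  shows "exp (- (4 * pi / L * Y)) \<le> exp (- 2 * pi\<^sup>2 * (1 / L - 1 / 2))"
proof -
  have "4 * pi / L * (pi / 2 - L / 2) \<le> 4 * pi / L * Y" using assms by (intro mult_left_mono) auto
  moreover have "4 * pi / L * (pi / 2 - L / 2) = 2 * pi\<^sup>2 / L - 2 * pi"
    using assms by (simp add: field_simps power2_eq_square)
  moreover have "2 * pi \<le> pi\<^sup>2" using pi_ge_two by (simp add: power2_eq_square)
  moreover have "- 2 * pi\<^sup>2 * (1 / L - 1 / 2) = - (2 * pi\<^sup>2 / L) + pi\<^sup>2" by (simp add: field_simps)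
  ultimately show ?thesis by simp
qed

text \<open>Here \<open>m\<close> is the energy of \<open>S2\<close> outside the collar and
  \<open>c\<close> that of the collar. As \<open>?q\<close> is at most 1/2, the \<open>m\<close> on
  the right is absorbed, leaving \<open>2 * ?q * c\<close>. The factor 2 is below e, and
  \<open>4 * pi + 1\<close> is below \<open>2 * pi^2\<close>, which leaves room for it in the
  squared constant.\<close>

lemma collar_constant_full:
  assumes L: "0 < L" "L \<le> 1 / 2" and Y: "pi / 2 - L / 2 \<le> Y"
    and m: "m \<le> exp (- (8 * pi / L * Y)) * (m + c)" "0 \<le> m" "0 \<le> c"
  shows "m \<le> (exp (- 2 * pi\<^sup>2 * (1 / L - 1 / 2)))\<^sup>2 * c"
proof -
  let ?q = "exp (- (8 * pi / L * Y))" and ?\<mu> = "exp (- 2 * pi\<^sup>2 * (1 / L - 1 / 2))"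
  have e1: "exp (- 1 :: real) \<le> 1 / 2"
    using exp_ge_add_one_self[of 1] by (simp add: exp_minus inverse_eq_divide field_simps)
  have "8 * pi / L * (pi / 2 - L / 2) \<le> 8 * pi / L * Y" using L Y by (intro mult_left_mono) auto
  moreover have "8 * pi / L * (pi / 2 - L / 2) = 4 * pi\<^sup>2 / L - 4 * pi"
    using L by (simp add: field_simps power2_eq_square)
  ultimately have Yb: "4 * pi\<^sup>2 / L - 4 * pi \<le> 8 * pi / L * Y" by simp
  have p: "3 * pi \<le> pi\<^sup>2" "3 < pi" using pi_gt3 by (auto simp: power2_eq_square)
  \<comment> \<open>From the bound 1/2 on \<open>L\<close>; it pushes the exponent of
    \<open>?q\<close> below -1.\<close>
  have "8 * pi\<^sup>2 \<le> 4 * pi\<^sup>2 / L"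
    using L mult_left_mono[of "2 * L" 1 "4 * pi\<^sup>2"] by (simp add: field_simps)
  then have "?q \<le> exp (- 1)" using Yb p unfolding exp_le_cancel_iff by linarith
  then have q: "?q \<le> 1 / 2" using e1 by linarith
  have "?\<mu>\<^sup>2 = exp (2 * (- 2 * pi\<^sup>2 * (1 / L - 1 / 2)))" by (simp only: exp_double)
  also have "2 * (- 2 * pi\<^sup>2 * (1 / L - 1 / 2)) = - (4 * pi\<^sup>2 / L) + 2 * pi\<^sup>2" by (simp add: field_simps)
  finally have \<mu>: "?\<mu>\<^sup>2 = exp (- (4 * pi\<^sup>2 / L) + 2 * pi\<^sup>2)" .
  have "?q \<le> exp (- (4 * pi\<^sup>2 / L) + 2 * pi\<^sup>2 + - 1)"
    using Yb p unfolding exp_le_cancel_iff by linarith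
  also have "\<dots> = ?\<mu>\<^sup>2 * exp (- 1)" unfolding \<mu> exp_add ..
  also have "\<dots> \<le> ?\<mu>\<^sup>2 * (1 / 2)" using e1 by (intro mult_left_mono) auto
  finally have q\<mu>: "2 * ?q \<le> ?\<mu>\<^sup>2" by simp
  have "?q * m \<le> 1 / 2 * m" using q m(2) by (rule mult_right_mono)
  then have "m \<le> 2 * ?q * c" using m(1) by (simp add: distrib_left)
  also have "\<dots> \<le> ?\<mu>\<^sup>2 * c" using q\<mu> m(3) by (rule mult_right_mono)
  finally show ?thesis .
qed

lemma moebius_axis_translation:
  assumes g: "is_moebius g" and eq: "\<And>t. g (\<i> * of_real (exp t)) = \<i> * of_real (exp (t + l))"
    and z: "Im z > 0"
  shows "g z = of_real (exp l) * z"
proof -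
  obtain a b c d where det: "a * d - b * c = 1" and gm: "\<And>z. Im z > 0 \<Longrightarrow> g z = moebius a b c d z"
    using g by (auto simp: is_moebius_def)
  have rel: "b = - c * exp l * x\<^sup>2 \<and> a = d * exp l" if x: "x > 0" for x
  proof -
    let ?z = "\<i> * of_real x"
    have "moebius a b c d ?z = \<i> * of_real (x * exp l)"
      using eq[of "ln x"] gm[of ?z] x by (simp add: exp_add)
    moreover have "of_real c * ?z + of_real d \<noteq> 0" using moebius_denom[OF det, of ?z] x by simp
    ultimately have "of_real a * ?z + of_real b = \<i> * of_real (x * exp l) * (of_real c * ?z + of_real d)"
      by (simp add: moebius_def divide_eq_eq)
    then have "b = - c * exp l * x\<^sup>2" "a * x = d * exp l * x"
      by (simp_all add: complex_eq_iff power2_eq_square algebra_simps)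
    then show ?thesis using x by simp
  qed
  \<comment> \<open>Two values of \<open>x\<close> force \<open>c = 0\<close>, because
    \<open>b\<close> does not depend on \<open>x\<close>.\<close>
  have "c = 0" "b = 0" using rel[of 1] rel[of 2] by auto
  moreover have "a = d * exp l" using rel[of 1] by simp
  moreover have "d \<noteq> 0" using det \<open>b = 0\<close> by auto
  ultimately show ?thesis using gm[OF z] by (simp add: moebius_def)
qed

lemma inj_on_periodic:
  fixes \<gamma> :: "real \<Rightarrow> 'a"
  assumes L: "L > 0" and per: "\<And>t. \<gamma> (t + L) = \<gamma> t" and inj: "inj_on \<gamma> {0..<L}" and eq: "\<gamma> x = \<gamma> y"
  obtains k :: int where "y = x + of_int k * L"
proof -
  have n: "\<gamma> (t + of_nat n * L) = \<gamma> t" for t and n :: nat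
  proof (induction n)
    case (Suc n)
    then show ?case using per[of "t + of_nat n * L"] by (simp add: algebra_simps)
  qed simp
  have k: "\<gamma> (t + of_int k * L) = \<gamma> t" for t and k :: int
  proof (cases "k \<ge> 0")
    case True
    then show ?thesis using n[of t "nat k"] by simp
  next
    case False
    then show ?thesis using n[of "t + of_int k * L" "nat (- k)"] by simp
  qed
  define r where "r t = t + of_int (- \<lfloor>t / L\<rfloor>) * L" for t
  have r: "r t \<in> {0..<L}" for t
  proof -
    have "of_int \<lfloor>t / L\<rfloor> * L \<le> t" "t < (of_int \<lfloor>t / L\<rfloor> + 1) * L"
      unfolding pos_le_divide_eq[OF L, symmetric] pos_divide_less_eq[OF L, symmetric] by linarith+
    then show ?thesis by (simp add: r_def algebra_simps)
  qed
  have "\<gamma> (r x) = \<gamma> (r y)" unfolding r_def k by (rule eq)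
  then have "r x = r y" using inj r by (auto dest: inj_onD)
  then have "y = x + of_int (\<lfloor>y / L\<rfloor> - \<lfloor>x / L\<rfloor>) * L" by (simp add: r_def algebra_simps)
  then show ?thesis by (rule that)
qed

lemma (in compact_hyperbolic_surface) geodesic_collar_surface:
  assumes \<gamma>: "simple_closed_geodesic S \<pi> \<gamma> L"
  obtains m where "is_moebius m" "collar_surface S A (\<pi> \<circ> m) L" "range \<gamma> = (\<pi> \<circ> m) ` collar_surface.axis"
proof -
  have L: "L > 0" and per: "\<And>t. \<gamma> (t + L) = \<gamma> t" and inj: "inj_on \<gamma> {0..<L}" and geo: "unit_speed_geodesic S \<pi> \<gamma>"
    using \<gamma> by (auto simp: simple_closed_geodesic_def)
  obtain m where m: "is_moebius m" "\<And>t. \<pi> (m (\<i> * of_real (exp t))) = \<gamma> t"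
    using geodesic_lift_axis[OF geo] by blast
  define p where "p = \<pi> \<circ> m"
  interpret p: compact_hyperbolic_surface S A p
    unfolding p_def by (rule precompose_moebius(1)[OF m(1)])
  have pc: "p (\<i> * of_real (exp t)) = \<gamma> t" for t using m(2) by (simp add: p_def)
  let ?c = "\<lambda>t. \<i> * complex_of_real (exp t)"
  have "p (?c 0) = p (?c L)" using per[of 0] unfolding pc by simp
  then obtain g where g: "deck_transformation p g" "g (?c 0) = ?c L"
    using p.deck_exists[of "?c 0" "?c L"] by auto
  \<comment> \<open>Both sides lift the geodesic and agree at 0. Thus \<open>g\<close> translates
    the axis by \<open>L\<close>, and a Moebius transformation that does so is multiplication by
    \<open>exp L\<close>.\<close>
  have tr: "g (?c t) = ?c (t + L)" for t
  proof (rule covering_space_lift_unique[OF p.covering, where f = \<gamma> and T = UNIV and a = 0 and x = t and ?g1.0 = "\<lambda>t. g (?c t)" and ?g2.0 = "\<lambda>t. ?c (t + L)"])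
    show "continuous_on UNIV \<gamma>" by (rule geodesic_continuous[OF geo])
    show "\<gamma> \<in> UNIV \<rightarrow> S" using geo by (auto simp: unit_speed_geodesic_def)
    show "continuous_on UNIV (\<lambda>t. g (?c t))"
      by (rule continuous_on_compose2[OF holomorphic_on_imp_continuous_on[OF p.deck_holo[OF g(1)]]])
        (auto intro!: continuous_intros)
    show "(\<lambda>t. g (?c t)) \<in> UNIV \<rightarrow> H" using p.deck_in[OF g(1)] by auto
    show "\<gamma> t = p (g (?c t))" for t using p.deck_pi[OF g(1), of "?c t"] pc by simp
    show "\<gamma> t = p (?c (t + L))" for t unfolding pc using per by simp
  qed (use g(2) in \<open>auto intro!: continuous_intros\<close>)
  have "is_moebius g" by (rule p.deck_is_moebius[OF g(1)])
  then have gz: "g z = of_real (exp L) * z" if "Im z > 0" for z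
    using moebius_axis_translation tr that by blast
  have collar: "collar_surface S A p L"
  proof
    show "L > 0" by (rule L)
    show "p (of_real (exp L) * z) = p z" if "z \<in> H" for z
      using p.deck_pi[OF g(1) that] gz that by simp
    fix s t :: real assume st: "s > 0" "t > 0" "p (\<i> * of_real s) = p (\<i> * of_real t)"
    then have "\<gamma> (ln s) = \<gamma> (ln t)" using pc[of "ln s"] pc[of "ln t"] by simp
    then obtain k :: int where k: "ln t = ln s + of_int k * L"
      using inj_on_periodic[of L \<gamma> "ln s" "ln t"] L per inj by metis
    have "t = exp (ln t)" using st by simp
    then have "t = exp (ln s + of_int k * L)" unfolding k .
    then show "\<exists>k::int. t = s * exp (of_int k * L)" using st by (auto simp: exp_add)
  qed
  have "range \<gamma> = p ` collar_surface.axis"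
  proof
    show "range \<gamma> \<subseteq> p ` collar_surface.axis"
    proof
      fix q assume "q \<in> range \<gamma>"
      then obtain t where "q = p (?c t)" using pc by auto
      then show "q \<in> p ` collar_surface.axis" using exp_gt_zero[of t] unfolding collar_surface.axis_def[OF collar] by blast
    qed
    show "p ` collar_surface.axis \<subseteq> range \<gamma>"
    proof
      fix q assume "q \<in> p ` collar_surface.axis"
      then obtain s where s: "s > 0" "q = p (\<i> * of_real s)" by (auto simp: collar_surface.axis_def[OF collar])
      then show "q \<in> range \<gamma>" using pc[of "ln s"] by auto
    qed
  qed
  then show ?thesis using that[OF m(1)] collar by (simp add: p_def)
qed

text \<open>The half-turn about \<i> reverses the axis and exchanges its two sides, which lets the
  left half of the collar be placed in \<open>S2\<close>.\<close>

lemma (in collar_surface) half_turn: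
  shows "is_moebius (\<lambda>z. - 1 / z)" "collar_surface S A (\<pi> \<circ> (\<lambda>z. - 1 / z)) L"
    and "(\<pi> \<circ> (\<lambda>z. - 1 / z)) ` axis = \<pi> ` axis" "(\<pi> \<circ> (\<lambda>z. - 1 / z)) ` left_wedge \<subseteq> \<pi> ` right_wedge"
proof -
  let ?n = "\<lambda>z::complex. - 1 / z"
  show mn: "is_moebius ?n"
    unfolding is_moebius_def by (intro exI[of _ 0] exI[of _ "-1"] exI[of _ 1]) (simp add: moebius_def)
  have H: "?n z \<in> H" if "z \<in> H" for z using is_moebius_in[OF mn] that by simp
  have ni: "?n (\<i> * of_real s) = \<i> * of_real (1 / s)" for s by (simp add: divide_inverse)
  show "collar_surface S A (\<pi> \<circ> ?n) L"
  proof (intro collar_surface.intro collar_surface_axioms.intro)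
    show "compact_hyperbolic_surface S A (\<pi> \<circ> ?n)" by (rule precompose_moebius(1)[OF mn])
    show "L > 0" by (rule L_pos)
    show "(\<pi> \<circ> ?n) (of_real (exp L) * z) = (\<pi> \<circ> ?n) z" if z: "z \<in> H" for z
    proof -
      have "?n (of_real (exp L) * z) \<in> H" using z by (intro H) simp
      from translation[OF this] show ?thesis by simp
    qed
    fix s t :: real assume st: "s > 0" "t > 0" "(\<pi> \<circ> ?n) (\<i> * of_real s) = (\<pi> \<circ> ?n) (\<i> * of_real t)"
    then have "\<pi> (\<i> * of_real (1 / t)) = \<pi> (\<i> * of_real (1 / s))" unfolding o_def ni by simp
    then obtain k :: int where "1 / s = 1 / t * exp (of_int k * L)"
      using axis_simple[of "1 / t" "1 / s"] st by auto
    then show "\<exists>k::int. t = s * exp (of_int k * L)" using st by (auto simp: field_simps)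
  qed
  show "(\<pi> \<circ> ?n) ` axis = \<pi> ` axis"
  proof -
    have "?n ` axis = axis"
    proof
      show "?n ` axis \<subseteq> axis"
      proof
        fix w assume "w \<in> ?n ` axis"
        then obtain s where "s > 0" "w = ?n (\<i> * of_real s)" by (auto simp: axis_def)
        then have "1 / s > 0" "w = \<i> * of_real (1 / s)" unfolding ni by auto
        then show "w \<in> axis" unfolding axis_def by blast
      qed
      show "axis \<subseteq> ?n ` axis"
      proof
        fix w assume "w \<in> axis"
        then obtain s where s: "s > 0" "w = \<i> * of_real s" by (auto simp: axis_def)
        then have "1 / s > 0" "w = ?n (\<i> * of_real (1 / s))" unfolding ni by auto
        then show "w \<in> ?n ` axis" unfolding axis_def by blast
      qed
    qed
    then show ?thesis by (metis image_comp)
  qed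
  have "?n z \<in> right_wedge" if z: "z \<in> left_wedge" for z
  proof -
    have zW: "Im z > 0" "\<bar>Re z\<bar> < \<kappa> * Im z" "Re z < 0" using z by (auto simp: left_wedge_def wedge_set_def)
    define D where "D = (Re z)\<^sup>2 + (Im z)\<^sup>2"
    have D: "D > 0" using zW by (simp add: D_def add_nonneg_pos)
    have c: "Re (?n z) = - Re z / D" "Im (?n z) = Im z / D" by (simp_all add: Re_divide Im_divide D_def)
    have "\<bar>- Re z / D\<bar> = \<bar>Re z\<bar> / D" using D by (simp add: abs_divide)
    then have "\<bar>- Re z / D\<bar> < \<kappa> * (Im z / D)" using divide_strict_right_mono[OF zW(2) D] by (simp only: times_divide_eq_right)
    moreover have "Im z / D > 0" "- Re z / D > 0" using zW D divide_pos_pos[of "- Re z" D] by simp_all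
    ultimately show ?thesis unfolding right_wedge_def wedge_set_def mem_Collect_eq c by blast
  qed
  then show "(\<pi> \<circ> ?n) ` left_wedge \<subseteq> \<pi> ` right_wedge" by auto
qed

lemma (in compact_hyperbolic_surface) geodesic_separated_collar:
  assumes \<gamma>: "simple_closed_geodesic S \<pi> \<gamma> L" and sep: "separates_into S (range \<gamma>) S1 S2"
  obtains m where "is_moebius m" "separated_collar S A (\<pi> \<circ> m) L S1 S2"
    "range \<gamma> = (\<pi> \<circ> m) ` collar_surface.axis" "(\<pi> \<circ> m) ` collar_surface.left_wedge L \<subseteq> S2"
proof -
  obtain m where m: "is_moebius m" "collar_surface S A (\<pi> \<circ> m) L" "range \<gamma> = (\<pi> \<circ> m) ` collar_surface.axis"
    using geodesic_collar_surface[OF \<gamma>] by blast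
  interpret p: separated_collar S A "\<pi> \<circ> m" L S1 S2
    by (intro separated_collar.intro separated_collar_axioms.intro m(2)) (use sep m(3) in simp)
  show ?thesis
  proof (cases "(\<pi> \<circ> m) ` p.left_wedge \<subseteq> S2")
    case True
    then show ?thesis using that m(1,3) p.separated_collar_axioms by blast
  next
    case False
    then have right: "(\<pi> \<circ> m) ` p.right_wedge \<subseteq> S2" using p.some_side by blast
    let ?m = "\<lambda>z. m (- 1 / z)"
    have eq: "\<pi> \<circ> m \<circ> (\<lambda>z. - 1 / z) = \<pi> \<circ> ?m" by (simp add: fun_eq_iff)
    note ht = p.half_turn[unfolded eq]
    have rng: "range \<gamma> = (\<pi> \<circ> ?m) ` p.axis" using m(3) ht(3) by simp
    have "is_moebius ?m" by (rule is_moebius_compose[OF m(1) ht(1)])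
    moreover have "separated_collar S A (\<pi> \<circ> ?m) L S1 S2"
      by (intro separated_collar.intro separated_collar_axioms.intro ht(2)) (use sep rng in \<open>simp only:\<close>)
    moreover note rng
    moreover have "(\<pi> \<circ> ?m) ` p.left_wedge \<subseteq> S2" using ht(4) right by blast
    ultimately show ?thesis by (rule that[of ?m])
  qed
qed

theorem theorem1p1:
  fixes S S1 S2 :: "'a::t2_space set"
    and A :: "'a chart set"
    and \<pi> :: "complex \<Rightarrow> 'a"
    and \<gamma> :: "real \<Rightarrow> 'a"
    and L \<mu> :: real
    and \<sigma> :: "'a form1"
  assumes "hyperbolic_riemann_surface S A \<pi>"
    and "compact S"
    and "simple_closed_geodesic S \<pi> \<gamma> L"
    and "L \<le> 1 / 2"
    and "separates_into S (range \<gamma>) S1 S2"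
    and "\<mu> = exp (- 2 * pi\<^sup>2 * (1 / L - 1 / 2))"
    and "harmonic_form A \<sigma>"
    and "nontrivial_form A \<sigma>"
    and "vanishing_periods_in A \<sigma> S2"
  shows "energy A S2 \<sigma> \<le> \<mu> * energy A S \<sigma> \<and>
    energy A (S2 - standard_collar S \<pi> \<gamma> L) \<sigma>
      \<le> \<mu>\<^sup>2 * energy A (standard_collar S \<pi> \<gamma> L) \<sigma>"
proof -
  interpret s: compact_hyperbolic_surface S A \<pi> by unfold_locales (use assms(1,2) in simp_all)
  obtain m where m: "is_moebius m" "separated_collar S A (\<pi> \<circ> m) L S1 S2"
    "range \<gamma> = (\<pi> \<circ> m) ` collar_surface.axis" "(\<pi> \<circ> m) ` collar_surface.left_wedge L \<subseteq> S2"
    using s.geodesic_separated_collar[OF assms(3,5)] by blast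
  define p where "p = \<pi> \<circ> m"
  interpret c: separated_collar S A p L S1 S2 unfolding p_def by (rule m(2))
  \<comment> \<open>The collar is defined by distances on the surface, which precomposition with an
    isometry leaves unchanged.\<close>
  have std: "standard_collar S \<pi> \<gamma> L = p ` c.wedge_set"
  proof -
    have "standard_collar S \<pi> \<gamma> L = standard_collar S p \<gamma> L"
      using s.precompose_moebius(2)[OF m(1)] by (simp add: standard_collar_def surf_setdist_def p_def)
    then show ?thesis using c.standard_collar_eq[of \<gamma>] m(3) by (simp add: p_def)
  qed
  obtain N :: nat and ctr rad where sheets:
    "\<And>i. i < N \<Longrightarrow> rad i > (0::real)" "\<And>i. i < N \<Longrightarrow> cball (ctr i) (2 * rad i) \<subseteq> upper_half_plane"
    "\<And>i. i < N \<Longrightarrow> inj_on p (ball (ctr i) (2 * rad i))" "S = (\<Union>i<N. p ` ball (ctr i) (rad i))"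
    apply (rule c.finite_sheets)
    subgoal premises h for N ctr rad by (rule that[of N rad ctr]) (fact h)+
    done
  interpret t: sheeted_surface S A p N ctr rad by unfold_locales (fact sheets)+
  obtain f where f: "f holomorphic_on upper_half_plane"
    "\<And>c z. c \<in> A \<Longrightarrow> z \<in> c.lift_set (fst c) \<Longrightarrow> f z = c.form_coeff \<sigma> c ((snd c \<circ> p) z) * deriv (snd c \<circ> p) z"
    using c.harmonic_pullback[OF assms(7)] by blast
  obtain P where "\<And>z. z \<in> upper_half_plane \<Longrightarrow> (P has_field_derivative f z) (at z within upper_half_plane)"
    using holomorphic_convex_primitive'[OF convex_upper_half_plane open_upper_half_plane f(1)] by blast
  then have P: "\<And>z. z \<in> upper_half_plane \<Longrightarrow> (P has_field_derivative f z) (at z)"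
    using at_within_open[OF _ open_upper_half_plane] by metis
  interpret e: exact_collar S A p L S1 S2 N ctr rad \<sigma> f P
    by (intro exact_collar.intro exact_collar_axioms.intro c.separated_collar_axioms t.sheeted_surface_axioms assms(7,9) f(1))
      (assumption | rule f(2) P m(4)[folded p_def])+
  have en: "energy A D \<sigma> = e.lift_energy D" if "D \<subseteq> S" "c.lift_set D \<in> sets borel" for D
    unfolding e.lift_energy_def by (rule t.energy_eq[OF assms(7) f that])
  have "openin (top_of_set S) S" by simp
  then have bS: "c.lift_set S \<in> sets borel" by (intro borel_open c.lift_set_open)
  have S2S: "S2 \<subseteq> S" by (rule c.parts(8))
  have "energy A S2 \<sigma> \<le> \<mu> * energy A S \<sigma>"
  proof -
    have "e.lift_energy S2 \<le> exp (- (4 * pi / L * c.Y)) * e.lift_energy S" by (rule e.energy_decay_half)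
    also have "\<dots> \<le> \<mu> * e.lift_energy S"
      using collar_constant_half[OF c.L_pos c.Y_ge] e.lift_energy_nonneg unfolding assms(6) by (intro mult_right_mono)
    finally show ?thesis using en S2S bS e.lift_borel(3) by simp
  qed
  moreover have "energy A (S2 - p ` c.wedge_set) \<sigma> \<le> \<mu>\<^sup>2 * energy A (p ` c.wedge_set) \<sigma>"
  proof -
    have "e.lift_energy (S2 - p ` c.wedge_set) \<le> \<mu>\<^sup>2 * e.lift_energy (p ` c.wedge_set)"
      unfolding assms(6)
      by (rule collar_constant_full[OF c.L_pos assms(4) c.Y_ge e.energy_decay_full e.lift_energy_nonneg e.lift_energy_nonneg])
    moreover have "S2 - p ` c.wedge_set \<subseteq> S" using S2S by blast
    ultimately show ?thesis using en[OF _ e.lift_borel(4)] en[OF e.coll_S e.lift_borel(1)] by simp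
  qed
  ultimately show ?thesis unfolding std by blast
qed

end
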